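(* Let $\lambda_1(\mu)=1-\mu$. The Kuramoto--Sivashinsky equation $u_t=-\mu u_{xxxx}-u_{xx}+(u^2)_x$ with odd, $2\pi$-periodic boundary conditions, regarded as a family with parameter $\nu=\lambda_1(\mu)$, undergoes a pitchfork bifurcation on the interval $[\lambda_1(1.01),\lambda_1(0.99)]$ (that is, for the parameter $\mu$ in the range $[0.99,1.01]$).
   Context: With $u(t,x)=-u(t,-x)=u(t,x+2\pi)$ and $u(t,x)=\sum_{k\ge1}-2a_k(t)\sin(kx)$ the equation becomes the ladder $$\dot a_k=k^2(1-\mu k^2)a_k-k\sum_{i=1}^{k-1}a_ia_{k-i}+2k\sum_{i=1}^\infty a_ia_{k+i},\quad k=1,2,\dots,$$ in $H=\ell^2$. "A pitchfork bifurcation occurs in the equation" means that it occurs, in the sense defined below, for the system obtained from this ladder by a normal-form type change of variables: a composition of finitely many substitutions, each replacing a single coordinate $a_k$ by a new coordinate $b_k$ through $a_k=b_k+p(b)$, with $p$ a polynomial in finitely many coordinates without constant or linear terms and with coefficients depending on $\mu$, used near the origin where it is invertible and analytic. All sets below are in the coordinates $b$. Local semiflow: a continuous partial map $\varphi$ from $[0,\infty)\times H$ to $H$ such that $\varphi(\cdot,z)$ exists only on $[0,t_{\max}(z))$, $t_{\max}(z)\in[0,\infty]$, $\varphi(0,z)=z$, and $\varphi(t,\varphi(s,z))=\varphi(t+s,z)$ for $s,t>0$, $s+t<t_{\max}(z)$. The local semiflow $\varphi_\nu$ of a family $u'=F_\nu(u)$ is the one given by its solutions. Isolating cuboid: let $X_n\subset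 H$ be an $n$-dimensional subspace ($n\ge0$), $Y_n=X_n^\perp$, $P_n,P_n^\perp$ the orthogonal projections, $c_u:X_n\to\mathbb R^n$ a homeomorphism, $T\subset Y_n$ nonempty compact, $N=c_u^{-1}(\overline B(0,1))\oplus T$, $N^\varepsilon=c_u^{-1}(\overline B(0,1+\varepsilon))\oplus T$. $N$ is an $\varepsilon$-isolating cuboid for $\varphi$ if there is $t(\varepsilon)>0$ such that for every $s\in(0,t(\varepsilon)]$: (I0) if $z\in N^\varepsilon$ and $t_{\max}(z)<\infty$ then $\varphi(t,z)\notin N^\varepsilon$ for some $t>0$; (I1) $\varphi(s,N)\subset N^\varepsilon$; (I2) $\varphi(s,N^\varepsilon\setminus N)\cap N=\emptyset$. Trajectory in $N$ through $\bar z$: $z:I\to N$, $I\ni0$ an interval, $z(0)=\bar z$, $\varphi(s,z(t))=z(t+s)$ for $s\ge 0$, $t,t+s\in I$. It is full if $I=\mathbb R$. Hyperbolic fixed point: let $N$ be a product of compact nondegenerate coordinate intervals containing $z_0$ in the product of their interiors, $X_n$ ($0\le n<\infty$) a span of coordinate directions, $\mathcal Q(z)=\|P_nz\|^2-\|P_n^\perp z\|^2$, $z_0+Q^+=\{z\in N:\mathcal Q(z-z_0)>0\}$, $z_0+Q^-=\{z\in N:\mathcal Q(z-z_0)\le0\}$. A set $S\subset N$ is forward- (backward-) invariant relative to $N$ if for each trajectory $z$ in $N$ with $z(0)\in S$ and each $t>0$ ($t<0$) with $z([0,t])\subset N$ ($z([t,0])\subset N$), this piece lies in $S$. The fixed point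 $z_0$ is hyperbolic (with respect to $N$, $\mathcal Q$) if the sets $z_0+Q^+$ (when $n\geq 1$) and $z_0+Q^-$ are nonempty, $z_0+Q^{+}$ and $z_0+Q^-$ are respectively forward- and backward-invariant relative to $N$, and for some $A,B,\omega>0$: $\|P_n(\varphi(t,z)-z_0)\|\ge Ae^{\omega t}\|P_n(z-z_0)\|$ if $z\in z_0+Q^+$ and $\varphi([0,t],z)\subset N$; $\|P_n^\perp(\varphi(t,z)-z_0)\|\le Be^{-\omega t}\|P_n^\perp(z-z_0)\|$ if $\varphi([0,t],z)\subset z_0+Q^-$. "Hyperbolic" means hyperbolic for some such $N$, $n$. Maximal invariant set in $S$: the set $I\subset S$ such that $\bar z\in S$ belongs to $I$ iff there is a full trajectory in $S$ through $\bar z$ and every such full trajectory stays in $I$. A heteroclinic connection from $u$ to $v$ is a full trajectory tending to $u$ as $t\to-\infty$ and to $v$ as $t\to+\infty$. Pitchfork bifurcation: $u'=F_\nu(u)$ undergoes a pitchfork bifurcation on $[\nu_-,\nu_+]$, $\nu_-<0<\nu_+$, if there is a set $R$ that is an $\varepsilon$-isolating cuboid for $\varphi_\nu$ for each $\nu\in[\nu_-,\nu_+]$ such that: (P1) some $u_0\in R$ is a fixed point for all $\nu\in[\nu_-,\nu_+]$ and is hyperbolic for $\nu\ne0$; (P2) for $\nu\in[\nu_-,0]$, $\{u_0\}$ is the maximal invariant set in $R$; (P3) for $\nu\in(0,\nu_+]$ there are hyperbolic fixed points $u_-^\nu,u_+^\nu\in R$ different from $u_0$ and heteroclinic connections from $u_0$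 to $u_-^\nu$ and to $u_+^\nu$ such that the set consisting of $u_0$, $u_\pm^\nu$ and the points of these connections is the maximal invariant set in $R$. *)

theory Defs
  imports "HOL-Analysis.Analysis"
begin

text \<open>
  Square-summable real sequences indexed by \<open>k = 1, 2, \<dots>\<close>. The index 0 is a dummy: every
  sequence is extended by \<open>a\<^sub>0 = 0\<close>, so that the indices below are literally those of the
  Fourier modes.
\<close>

typedef ell2 = "{f :: nat \<Rightarrow> real. f 0 = 0 \<and> summable (\<lambda>k. (f k)\<^sup>2)}"
  morphisms coord Abs_ell2
  by (rule exI[of _ "\<lambda>_. 0"]) simp

lemma coord_0 [simp]: "coord a 0 = 0"
  and summable_coord_square: "summable (\<lambda>k. (coord a k)\<^sup>2)"
  using coord[of a] by auto

lemma ell2_eqI: "(\<And>k. coord a k = coord b k) \<Longrightarrow> a = b"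
  by (metis coord_inject ext)

lemma summable_mult_squares:
  fixes f g :: "nat \<Rightarrow> real"
  assumes "summable (\<lambda>k. (f k)\<^sup>2)" "summable (\<lambda>k. (g k)\<^sup>2)"
  shows "summable (\<lambda>k. f k * g k)"
proof (rule summable_comparison_test')
  show "summable (\<lambda>k. (f k)\<^sup>2 + (g k)\<^sup>2)"
    using assms by (rule summable_add)
  show "norm (f k * g k) \<le> (f k)\<^sup>2 + (g k)\<^sup>2" for k
  proof -
    have "0 \<le> (\<bar>f k\<bar> - \<bar>g k\<bar>)\<^sup>2" by simp
    then have "2 * (\<bar>f k\<bar> * \<bar>g k\<bar>) \<le> (f k)\<^sup>2 + (g k)\<^sup>2"
      by (simp add: power2_diff)
    moreover have "0 \<le> \<bar>f k\<bar> * \<bar>g k\<bar>" by simp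
    ultimately show ?thesis
      unfolding real_norm_def abs_mult by linarith
  qed
qed

lemmas summable_coord_mult = summable_mult_squares[OF summable_coord_square summable_coord_square]

instantiation ell2 :: real_vector
begin

definition "0 = Abs_ell2 (\<lambda>_. 0)"
definition "a + b = Abs_ell2 (\<lambda>k. coord a k + coord b k)"
definition "a - b = Abs_ell2 (\<lambda>k. coord a k - coord b k)"
definition "- a = Abs_ell2 (\<lambda>k. - coord a k)"
definition "r *\<^sub>R a = Abs_ell2 (\<lambda>k. r * coord a k)"

lemma coord_zero [simp]: "coord 0 k = 0"
  unfolding zero_ell2_def by (subst Abs_ell2_inverse) auto

lemma coord_add [simp]: "coord (a + b) k = coord a k + coord b k"
proof -
  have "summable (\<lambda>k. (coord a k)\<^sup>2 + (coord b k)\<^sup>2 + 2 * (coord a k * coord b k))"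
    by (intro summable_add summable_mult summable_coord_square summable_coord_mult)
  then have "summable (\<lambda>k. (coord a k + coord b k)\<^sup>2)"
    by (simp add: power2_sum mult.assoc)
  then show ?thesis
    unfolding plus_ell2_def by (subst Abs_ell2_inverse) auto
qed

lemma coord_scaleR [simp]: "coord (r *\<^sub>R a) k = r * coord a k"
  unfolding scaleR_ell2_def
  by (subst Abs_ell2_inverse) (auto simp: power_mult_distrib intro!: summable_mult summable_coord_square)

lemma coord_uminus [simp]: "coord (- a) k = - coord a k"
  unfolding uminus_ell2_def
  by (subst Abs_ell2_inverse) (auto intro!: summable_coord_square)

lemma coord_minus [simp]: "coord (a - b) k = coord a k - coord b k"
proof -
  have "a - b = a + (- b)"
    unfolding minus_ell2_def plus_ell2_def by simp
  then show ?thesis by simp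
qed

instance
  by standard (auto intro!: ell2_eqI simp: algebra_simps)

end

instantiation ell2 :: real_inner
begin

definition "inner a b = (\<Sum>k. coord a k * coord b k)"
definition "norm (a :: ell2) = sqrt (inner a a)"
definition "dist (a :: ell2) b = norm (a - b)"
definition "sgn (a :: ell2) = a /\<^sub>R norm a"
definition "uniformity = (INF e\<in>{0<..}. principal {(a :: ell2, b). dist a b < e})"
definition "open (S :: ell2 set) \<longleftrightarrow>
  (\<forall>a\<in>S. \<forall>\<^sub>F (a', b) in uniformity. a' = a \<longrightarrow> b \<in> S)"

instance
proof
  fix a b c :: ell2 and r :: real
  show "inner a b = inner b a"
    by (simp add: inner_ell2_def mult.commute)
  show "inner (a + b) c = inner a c + inner b c"
    unfolding inner_ell2_def by (simp add: distrib_right suminf_add summable_coord_mult)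
  show "inner (r *\<^sub>R a) b = r * inner a b"
    unfolding inner_ell2_def by (simp add: mult.assoc suminf_mult summable_coord_mult)
  show "0 \<le> inner a a"
    unfolding inner_ell2_def by (simp add: suminf_nonneg summable_coord_mult)
  show "inner a a = 0 \<longleftrightarrow> a = 0"
    unfolding inner_ell2_def
    by (auto simp: suminf_eq_zero_iff summable_coord_mult intro: ell2_eqI)
qed (simp_all add: norm_ell2_def dist_ell2_def sgn_ell2_def uniformity_ell2_def open_ell2_def)

end

definition unit :: "nat \<Rightarrow> ell2" where
  "unit k = Abs_ell2 (\<lambda>i. if i = k \<and> 1 \<le> k then 1 else 0)"

lemma coord_unit: "coord (unit k) i = (if i = k \<and> 1 \<le> k then 1 else 0)"
proof -
  have "summable (\<lambda>i. (if i = k \<and> 1 \<le> k then 1 else 0 :: real)\<^sup>2)"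
    by (rule summable_finite[of "{k}"]) auto
  then show ?thesis
    unfolding unit_def by (subst Abs_ell2_inverse) auto
qed

definition proj :: "ell2 set \<Rightarrow> ell2 \<Rightarrow> ell2" where
  "proj X z = (THE x. x \<in> X \<and> z - x \<in> X\<^sup>\<bottom>)"

text \<open>\<open>dim\<close> is avoided here because it also assigns 0 to infinite-dimensional subspaces.\<close>

definition subspace_of_dim :: "nat \<Rightarrow> ell2 set \<Rightarrow> bool" where
  "subspace_of_dim n X \<longleftrightarrow> (\<exists>B. finite B \<and> card B = n \<and> independent B \<and> X = span B)"

text \<open>
  A partial map is a pair of a total function \<open>\<phi>\<close> and an existence time \<open>\<tau>\<close>; the value
  \<open>\<phi> t z\<close> is meaningful only for \<open>0 \<le> t < \<tau> z\<close>. In particular \<open>\<tau> z = 0\<close> means that no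
  solution starts at \<open>z\<close>.
\<close>

definition local_semiflow :: "(real \<Rightarrow> ell2 \<Rightarrow> ell2) \<Rightarrow> (ell2 \<Rightarrow> ereal) \<Rightarrow> bool" where
  "local_semiflow \<phi> \<tau> \<longleftrightarrow>
     (\<forall>z. 0 \<le> \<tau> z) \<and>
     continuous_on {(t, z). 0 \<le> t \<and> ereal t < \<tau> z} (\<lambda>(t, z). \<phi> t z) \<and>
     (\<forall>z. 0 < \<tau> z \<longrightarrow> \<phi> 0 z = z) \<and>
     (\<forall>z s t. 0 < s \<and> 0 < t \<and> ereal (s + t) < \<tau> z \<longrightarrow>
        ereal t < \<tau> (\<phi> s z) \<and> \<phi> t (\<phi> s z) = \<phi> (t + s) z)"

text \<open>
  An evolution equation is given by its solutions: \<open>Sol T u\<close> says that the restriction of \<open>u\<close> to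
  \<open>[0, T)\<close> solves it. The second conjunct says that the solution starting at \<open>z\<close> is unique, and
  that \<open>\<tau> z\<close> is its maximal time of existence.
\<close>

definition generates ::
    "(ereal \<Rightarrow> (real \<Rightarrow> ell2) \<Rightarrow> bool) \<Rightarrow> (real \<Rightarrow> ell2 \<Rightarrow> ell2) \<Rightarrow> (ell2 \<Rightarrow> ereal) \<Rightarrow> bool" where
  "generates Sol \<phi> \<tau> \<longleftrightarrow>
     local_semiflow \<phi> \<tau> \<and>
     (\<forall>z u T. 0 < T \<longrightarrow>
        (Sol T u \<and> u 0 = z \<longleftrightarrow> T \<le> \<tau> z \<and> (\<forall>t. 0 \<le> t \<and> ereal t < T \<longrightarrow> u t = \<phi> t z)))"

definition fixed_point :: "(real \<Rightarrow> ell2 \<Rightarrow> ell2) \<Rightarrow> (ell2 \<Rightarrow> ereal) \<Rightarrow> ell2 \<Rightarrow> bool" where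
  "fixed_point \<phi> \<tau> z \<longleftrightarrow> \<tau> z = \<infinity> \<and> (\<forall>t\<ge>0. \<phi> t z = z)"

definition trajectory_in ::
    "(real \<Rightarrow> ell2 \<Rightarrow> ell2) \<Rightarrow> (ell2 \<Rightarrow> ereal) \<Rightarrow> ell2 set \<Rightarrow> real set \<Rightarrow> (real \<Rightarrow> ell2) \<Rightarrow> bool" where
  "trajectory_in \<phi> \<tau> N I z \<longleftrightarrow>
     is_interval I \<and> 0 \<in> I \<and> z ` I \<subseteq> N \<and>
     (\<forall>t s. 0 \<le> s \<and> t \<in> I \<and> t + s \<in> I \<longrightarrow> ereal s < \<tau> (z t) \<and> \<phi> s (z t) = z (t + s))"

abbreviation full_trajectory_in ::
    "(real \<Rightarrow> ell2 \<Rightarrow> ell2) \<Rightarrow> (ell2 \<Rightarrow> ereal) \<Rightarrow> ell2 set \<Rightarrow> (real \<Rightarrow> ell2) \<Rightarrow> bool" where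
  "full_trajectory_in \<phi> \<tau> N z \<equiv> trajectory_in \<phi> \<tau> N UNIV z"

definition heteroclinic ::
    "(real \<Rightarrow> ell2 \<Rightarrow> ell2) \<Rightarrow> (ell2 \<Rightarrow> ereal) \<Rightarrow> ell2 \<Rightarrow> ell2 \<Rightarrow> (real \<Rightarrow> ell2) \<Rightarrow> bool" where
  "heteroclinic \<phi> \<tau> u v z \<longleftrightarrow>
     full_trajectory_in \<phi> \<tau> UNIV z \<and> (z \<longlongrightarrow> u) at_bot \<and> (z \<longlongrightarrow> v) at_top"

text \<open>
  The membership condition alone does not determine the set (the empty set always satisfies it),
  so maximality is required explicitly.
\<close>

definition invariant_part ::
    "(real \<Rightarrow> ell2 \<Rightarrow> ell2) \<Rightarrow> (ell2 \<Rightarrow> ereal) \<Rightarrow> ell2 set \<Rightarrow> ell2 set \<Rightarrow> bool" where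
  "invariant_part \<phi> \<tau> S J \<longleftrightarrow>
     J \<subseteq> S \<and>
     (\<forall>p\<in>S. p \<in> J \<longleftrightarrow>
        (\<exists>z. full_trajectory_in \<phi> \<tau> S z \<and> z 0 = p) \<and>
        (\<forall>z. full_trajectory_in \<phi> \<tau> S z \<and> z 0 = p \<longrightarrow> range z \<subseteq> J))"

definition maximal_invariant_set ::
    "(real \<Rightarrow> ell2 \<Rightarrow> ell2) \<Rightarrow> (ell2 \<Rightarrow> ereal) \<Rightarrow> ell2 set \<Rightarrow> ell2 set \<Rightarrow> bool" where
  "maximal_invariant_set \<phi> \<tau> S J \<longleftrightarrow>
     invariant_part \<phi> \<tau> S J \<and> (\<forall>J'. invariant_part \<phi> \<tau> S J' \<longrightarrow> J' \<subseteq> J)"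

text \<open>\<open>cuboid n X c T r\<close> is the direct sum of the preimage under \<open>c\<close> of the closed
  Euclidean ball of radius \<open>r\<close> and \<open>T\<close>.\<close>

definition cuboid_data :: "nat \<Rightarrow> ell2 set \<Rightarrow> (ell2 \<Rightarrow> nat \<Rightarrow> real) \<Rightarrow> ell2 set \<Rightarrow> bool" where
  "cuboid_data n X c T \<longleftrightarrow>
     subspace_of_dim n X \<and> homeomorphic_map (top_of_set X) (Euclidean_space n) c \<and>
     T \<subseteq> X\<^sup>\<bottom> \<and> T \<noteq> {} \<and> compact T"

definition cuboid ::
    "nat \<Rightarrow> ell2 set \<Rightarrow> (ell2 \<Rightarrow> nat \<Rightarrow> real) \<Rightarrow> ell2 set \<Rightarrow> real \<Rightarrow> ell2 set" where
  "cuboid n X c T r = {x + y | x y. x \<in> X \<and> L2_set (c x) {..<n} \<le> r \<and> y \<in> T}"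

definition flow_image ::
    "(real \<Rightarrow> ell2 \<Rightarrow> ell2) \<Rightarrow> (ell2 \<Rightarrow> ereal) \<Rightarrow> real \<Rightarrow> ell2 set \<Rightarrow> ell2 set" where
  "flow_image \<phi> \<tau> s S = \<phi> s ` {z \<in> S. ereal s < \<tau> z}"

definition isolating_cuboid ::
    "(real \<Rightarrow> ell2 \<Rightarrow> ell2) \<Rightarrow> (ell2 \<Rightarrow> ereal) \<Rightarrow> real \<Rightarrow>
     nat \<Rightarrow> ell2 set \<Rightarrow> (ell2 \<Rightarrow> nat \<Rightarrow> real) \<Rightarrow> ell2 set \<Rightarrow> bool" where
  "isolating_cuboid \<phi> \<tau> \<epsilon> n X c T \<longleftrightarrow>
     cuboid_data n X c T \<and> 0 < \<epsilon> \<and>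
     (let N = cuboid n X c T 1; N\<epsilon> = cuboid n X c T (1 + \<epsilon>) in
      (\<forall>z\<in>N\<epsilon>. \<tau> z < \<infinity> \<longrightarrow> (\<exists>t>0. ereal t < \<tau> z \<and> \<phi> t z \<notin> N\<epsilon>)) \<and>
      (\<exists>t\<epsilon>>0. \<forall>s\<in>{0<..t\<epsilon>}.
         flow_image \<phi> \<tau> s N \<subseteq> N\<epsilon> \<and>
         flow_image \<phi> \<tau> s (N\<epsilon> - N) \<inter> N = {}))"

definition quad_form :: "ell2 set \<Rightarrow> ell2 \<Rightarrow> real" where
  "quad_form X z = (norm (proj X z))\<^sup>2 - (norm (z - proj X z))\<^sup>2"

definition pos_cone :: "ell2 set \<Rightarrow> ell2 set \<Rightarrow> ell2 \<Rightarrow> ell2 set" where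
  "pos_cone X N z\<^sub>0 = {z \<in> N. quad_form X (z - z\<^sub>0) > 0}"

definition neg_cone :: "ell2 set \<Rightarrow> ell2 set \<Rightarrow> ell2 \<Rightarrow> ell2 set" where
  "neg_cone X N z\<^sub>0 = {z \<in> N. quad_form X (z - z\<^sub>0) \<le> 0}"

definition forward_invariant ::
    "(real \<Rightarrow> ell2 \<Rightarrow> ell2) \<Rightarrow> (ell2 \<Rightarrow> ereal) \<Rightarrow> ell2 set \<Rightarrow> ell2 set \<Rightarrow> bool" where
  "forward_invariant \<phi> \<tau> N S \<longleftrightarrow>
     (\<forall>I z t. trajectory_in \<phi> \<tau> N I z \<and> z 0 \<in> S \<and> 0 < t \<and> {0..t} \<subseteq> I \<longrightarrow> z ` {0..t} \<subseteq> S)"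

definition backward_invariant ::
    "(real \<Rightarrow> ell2 \<Rightarrow> ell2) \<Rightarrow> (ell2 \<Rightarrow> ereal) \<Rightarrow> ell2 set \<Rightarrow> ell2 set \<Rightarrow> bool" where
  "backward_invariant \<phi> \<tau> N S \<longleftrightarrow>
     (\<forall>I z t. trajectory_in \<phi> \<tau> N I z \<and> z 0 \<in> S \<and> t < 0 \<and> {t..0} \<subseteq> I \<longrightarrow> z ` {t..0} \<subseteq> S)"

definition hyperbolic_wrt ::
    "(real \<Rightarrow> ell2 \<Rightarrow> ell2) \<Rightarrow> (ell2 \<Rightarrow> ereal) \<Rightarrow> nat \<Rightarrow> ell2 set \<Rightarrow> ell2 set \<Rightarrow> ell2 \<Rightarrow> bool" where
  "hyperbolic_wrt \<phi> \<tau> n X N z\<^sub>0 \<longleftrightarrow>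
     (1 \<le> n \<longrightarrow> pos_cone X N z\<^sub>0 \<noteq> {}) \<and> neg_cone X N z\<^sub>0 \<noteq> {} \<and>
     forward_invariant \<phi> \<tau> N (pos_cone X N z\<^sub>0) \<and>
     backward_invariant \<phi> \<tau> N (neg_cone X N z\<^sub>0) \<and>
     (\<exists>A B \<omega>. 0 < A \<and> 0 < B \<and> 0 < \<omega> \<and>
        (\<forall>z\<in>pos_cone X N z\<^sub>0. \<forall>t\<ge>0.
           ereal t < \<tau> z \<and> (\<forall>s\<in>{0..t}. \<phi> s z \<in> N) \<longrightarrow>
           norm (proj X (\<phi> t z - z\<^sub>0)) \<ge> A * exp (\<omega> * t) * norm (proj X (z - z\<^sub>0))) \<and>
        (\<forall>z. \<forall>t\<ge>0.
           ereal t < \<tau> z \<and> (\<forall>s\<in>{0..t}. \<phi> s z \<in> neg_cone X N z\<^sub>0) \<longrightarrow>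
           norm (\<phi> t z - z\<^sub>0 - proj X (\<phi> t z - z\<^sub>0))
             \<le> B * exp (- \<omega> * t) * norm (z - z\<^sub>0 - proj X (z - z\<^sub>0))))"

text \<open>
  The endpoints \<open>l\<close>, \<open>u\<close> of the coordinate intervals are themselves square-summable, because the
  product of the intervals has to be a subset of \<open>\<ell>\<^sup>2\<close>.
\<close>

definition hyperbolic_fixed_point ::
    "(real \<Rightarrow> ell2 \<Rightarrow> ell2) \<Rightarrow> (ell2 \<Rightarrow> ereal) \<Rightarrow> ell2 \<Rightarrow> bool" where
  "hyperbolic_fixed_point \<phi> \<tau> z\<^sub>0 \<longleftrightarrow>
     fixed_point \<phi> \<tau> z\<^sub>0 \<and>
     (\<exists>l u K.
        (\<forall>k\<ge>1. coord l k < coord z\<^sub>0 k \<and> coord z\<^sub>0 k < coord u k) \<and>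
        finite K \<and> K \<subseteq> {1..} \<and>
        hyperbolic_wrt \<phi> \<tau> (card K) (span (unit ` K))
          {z. \<forall>k\<ge>1. coord l k \<le> coord z k \<and> coord z k \<le> coord u k} z\<^sub>0)"

definition pitchfork_bifurcation ::
    "(real \<Rightarrow> ereal \<Rightarrow> (real \<Rightarrow> ell2) \<Rightarrow> bool) \<Rightarrow> real \<Rightarrow> real \<Rightarrow> bool" where
  "pitchfork_bifurcation Sol \<nu>\<^sub>m \<nu>\<^sub>p \<longleftrightarrow>
     \<nu>\<^sub>m < 0 \<and> 0 < \<nu>\<^sub>p \<and>
     (\<exists>\<phi> \<tau>. (\<forall>\<nu>\<in>{\<nu>\<^sub>m..\<nu>\<^sub>p}. generates (Sol \<nu>) (\<phi> \<nu>) (\<tau> \<nu>)) \<and>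
     (\<exists>\<epsilon> n X c T R u\<^sub>0.
        R = cuboid n X c T 1 \<and>
        (\<forall>\<nu>\<in>{\<nu>\<^sub>m..\<nu>\<^sub>p}. isolating_cuboid (\<phi> \<nu>) (\<tau> \<nu>) \<epsilon> n X c T) \<and>
        u\<^sub>0 \<in> R \<and>
        (\<forall>\<nu>\<in>{\<nu>\<^sub>m..\<nu>\<^sub>p}. fixed_point (\<phi> \<nu>) (\<tau> \<nu>) u\<^sub>0 \<and>
           (\<nu> \<noteq> 0 \<longrightarrow> hyperbolic_fixed_point (\<phi> \<nu>) (\<tau> \<nu>) u\<^sub>0)) \<and>
        (\<forall>\<nu>\<in>{\<nu>\<^sub>m..0}. maximal_invariant_set (\<phi> \<nu>) (\<tau> \<nu>) R {u\<^sub>0}) \<and>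
        (\<forall>\<nu>\<in>{0<..\<nu>\<^sub>p}. \<exists>u\<^sub>1 u\<^sub>2 w\<^sub>1 w\<^sub>2.
           u\<^sub>1 \<in> R \<and> u\<^sub>2 \<in> R \<and> u\<^sub>1 \<noteq> u\<^sub>0 \<and> u\<^sub>2 \<noteq> u\<^sub>0 \<and> u\<^sub>1 \<noteq> u\<^sub>2 \<and>
           hyperbolic_fixed_point (\<phi> \<nu>) (\<tau> \<nu>) u\<^sub>1 \<and>
           hyperbolic_fixed_point (\<phi> \<nu>) (\<tau> \<nu>) u\<^sub>2 \<and>
           heteroclinic (\<phi> \<nu>) (\<tau> \<nu>) u\<^sub>0 u\<^sub>1 w\<^sub>1 \<and>
           heteroclinic (\<phi> \<nu>) (\<tau> \<nu>) u\<^sub>0 u\<^sub>2 w\<^sub>2 \<and>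
           maximal_invariant_set (\<phi> \<nu>) (\<tau> \<nu>) R
             ({u\<^sub>0, u\<^sub>1, u\<^sub>2} \<union> range w\<^sub>1 \<union> range w\<^sub>2))))"

definition ks_ladder :: "real \<Rightarrow> ell2 \<Rightarrow> nat \<Rightarrow> real" where
  "ks_ladder \<mu> a k =
     real k ^ 2 * (1 - \<mu> * real k ^ 2) * coord a k
     - real k * (\<Sum>i = 1..k - 1. coord a i * coord a (k - i))
     + 2 * real k * (\<Sum>i. coord a (Suc i) * coord a (k + Suc i))"

text \<open>
  The linear part of the ladder is unbounded, so a solution is a continuous curve in \<open>\<ell>\<^sup>2\<close> whose
  coordinates satisfy the equations of the ladder; the series converges on all of \<open>\<ell>\<^sup>2\<close>.
\<close>

definition ks_solution :: "real \<Rightarrow> ereal \<Rightarrow> (real \<Rightarrow> ell2) \<Rightarrow> bool" where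
  "ks_solution \<mu> T a \<longleftrightarrow>
     continuous_on {t. 0 \<le> t \<and> ereal t < T} a \<and>
     (\<forall>k\<ge>1. \<forall>t. 0 \<le> t \<and> ereal t < T \<longrightarrow>
        ((\<lambda>s. coord (a s) k) has_real_derivative ks_ladder \<mu> (a t) k)
          (at t within {t. 0 \<le> t \<and> ereal t < T}))"

definition lambda1 :: "real \<Rightarrow> real" where
  "lambda1 \<mu> = 1 - \<mu>"

text \<open>
  A monomial is the multiset of the indices of its factors, so its degree is the size of the
  multiset.
\<close>

definition normal_form_poly :: "(real \<Rightarrow> ell2 \<Rightarrow> real) \<Rightarrow> bool" where
  "normal_form_poly p \<longleftrightarrow>
     (\<exists>M c. finite M \<and> (\<forall>m\<in>M. 2 \<le> size m) \<and>
        p = (\<lambda>\<mu> b. \<Sum>m\<in>M. c m \<mu> * (\<Prod>i\<in>#m. coord b i)))"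

text \<open>\<open>\<Phi> \<mu>\<close> expresses the old coordinates \<open>a\<close> by the new coordinates \<open>b\<close>.\<close>

inductive normal_form_change :: "(real \<Rightarrow> ell2 \<Rightarrow> ell2) \<Rightarrow> bool" where
  identity: "normal_form_change (\<lambda>\<mu> b. b)"
| substitute: "\<lbrakk>normal_form_change \<Phi>; 1 \<le> k; normal_form_poly p\<rbrakk> \<Longrightarrow>
    normal_form_change (\<lambda>\<mu> b. \<Phi> \<mu> (b + p \<mu> b *\<^sub>R unit k))"

text \<open>Only the arguments with index below \<open>n\<close> matter.\<close>

definition bounded_multilinear :: "nat \<Rightarrow> ((nat \<Rightarrow> ell2) \<Rightarrow> ell2) \<Rightarrow> bool" where
  "bounded_multilinear n A \<longleftrightarrow>
     (\<forall>v w. (\<forall>i<n. v i = w i) \<longrightarrow> A v = A w) \<and>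
     (\<forall>i<n. \<forall>v. linear (\<lambda>h. A (v(i := h)))) \<and>
     (\<exists>C. \<forall>v. norm (A v) \<le> C * (\<Prod>i<n. norm (v i)))"

definition real_analytic_on :: "(ell2 \<Rightarrow> ell2) \<Rightarrow> ell2 set \<Rightarrow> bool" where
  "real_analytic_on f S \<longleftrightarrow>
     (\<forall>x\<in>S. \<exists>r>0. \<exists>A. (\<forall>n. bounded_multilinear n (A n)) \<and>
        (\<forall>h. norm h < r \<longrightarrow> (\<lambda>n. A n (\<lambda>_. h)) sums f (x + h)))"

definition analytic_change_on :: "(ell2 \<Rightarrow> ell2) \<Rightarrow> ell2 set \<Rightarrow> bool" where
  "analytic_change_on f U \<longleftrightarrow>
     open U \<and> 0 \<in> U \<and> inj_on f U \<and> open (f ` U) \<and>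
     real_analytic_on f U \<and> real_analytic_on (inv_into U f) (f ` U)"

text \<open>
  Solutions of the ladder written in new coordinates \<open>b\<close> with \<open>a = \<Phi> b\<close>, used on \<open>U\<close>. Since
  \<open>\<Phi>\<close> alters only finitely many coordinates and is a diffeomorphism onto its image, these are the
  solutions in \<open>U\<close> of the transformed system of coordinate equations.
\<close>

definition ks_solution_in_coords ::
    "real \<Rightarrow> (ell2 \<Rightarrow> ell2) \<Rightarrow> ell2 set \<Rightarrow> ereal \<Rightarrow> (real \<Rightarrow> ell2) \<Rightarrow> bool" where
  "ks_solution_in_coords \<mu> \<Phi> U T b \<longleftrightarrow>
     continuous_on {t. 0 \<le> t \<and> ereal t < T} b \<and>
     (\<forall>t. 0 \<le> t \<and> ereal t < T \<longrightarrow> b t \<in> U) \<and>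
     ks_solution \<mu> T (\<lambda>t. \<Phi> (b t))"

end

theory Submission
  imports Defs
begin

text \<open>
  No change of coordinates is needed. For \<open>\<mu>\<close> near 1 the set \<open>trap\<close> of all \<open>a\<close> with \<open>\<bar>a\<^sub>1\<bar> \<le> 1/5\<close>,
  \<open>-1/5 \<le> a\<^sub>2 / a\<^sub>1\<^sup>2 \<le> -1/7\<close> and \<open>\<bar>a\<^sub>k\<bar> \<le> 5\<^sup>-\<^sup>k a\<^sub>1\<^sup>2\<close> for \<open>k \<ge> 3\<close> is compact and forward invariant. It is pinched at
  the origin, contains a neighbourhood of 0 in the centre manifold, and is an isolating cuboid with \<open>n = 0\<close>.
  On it \<open>a\<^sub>1' = (1 - \<mu>) a\<^sub>1 + 2 a\<^sub>1 a\<^sub>2 + \<dots>\<close> is a cubically damped scalar equation up to small errors. In a chart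
  using \<open>ln a\<^sub>1\<close> and the quotients of the other modes by powers of \<open>a\<^sub>1\<close>, two solutions with \<open>a\<^sub>1\<close> bounded away
  from 0 approach each other exponentially, which gives the nontrivial equilibrium and its stability. A cone condition
  in the same chart shows that two orbits bounded for all negative times coincide as soon as their first
  modes agree at one time, so the connecting orbit is unique up to a time shift. The translation of \<open>x\<close> by \<open>\<pi>\<close>
  maps \<open>a\<^sub>k\<close> to \<open>(-1)\<^sup>k a\<^sub>k\<close> and gives the branch with \<open>a\<^sub>1 < 0\<close>.
\<close>

section \<open>The sequence space\<close>

text \<open>Near \<mu> = 1 the linear rate of a_1 is at most 1/100 in modulus and changes sign, so
  no linear estimate separates the orbits. The saturation comes from the product 2 a_1 a_2 and is
  visible only once a_2 is tied to a_1^2. A normal form does this by substitutions; here the pinched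
  region does it, because its faces a_2 = - a_1^2/5 and a_2 = - a_1^2/7 enclose the parabola of
  quasi-stationary values and move slowly compared with the damping of the other modes. The
  contraction rate in the chart is proportional to a_1^2 and is lost at the origin, where ln a_1
  also runs to infinity. Contraction is therefore used only above a fixed amplitude. Below it the
  cone condition takes over: its quadratic form would grow exponentially backward in time, although
  it is bounded above uniformly up to the origin. The quadratic terms are not globally Lipschitz and
  lose a power of k. The semiflow is obtained from cut-off nonlinearities that agree with the true
  one along the solutions in question.\<close>

lemma norm_ell2_square: "(norm (a :: ell2))\<^sup>2 = (\<Sum>k. (coord a k)\<^sup>2)"
proof -
  have "0 \<le> inner a a" by simp
  then show ?thesis
    by (simp add: norm_ell2_def inner_ell2_def power2_eq_square)
qed

lemma coord_Abs:
  assumes "f 0 = 0" "summable (\<lambda>k. (f k)\<^sup>2)"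
  shows "coord (Abs_ell2 f) = f"
  using assms by (simp add: Abs_ell2_inverse)

lemma norm_sum_squares_le:
  fixes a :: ell2
  assumes "summable w" "\<And>k. (coord a k)\<^sup>2 \<le> w k" "suminf w \<le> C\<^sup>2" "0 \<le> C"
  shows "norm a \<le> C"
proof -
  have "(norm a)\<^sup>2 \<le> suminf w"
    unfolding norm_ell2_square by (intro suminf_le assms summable_coord_square)
  also note assms(3)
  finally show ?thesis
    using assms(4) by (simp add: power2_le_iff_abs_le)
qed

lemma norm_coord_mono:
  assumes "\<And>k. 1 \<le> k \<Longrightarrow> \<bar>coord a k\<bar> \<le> \<bar>coord b k\<bar>"
  shows "norm a \<le> norm b"
proof (rule norm_sum_squares_le)
  show "summable (\<lambda>k. (coord b k)\<^sup>2)" by (rule summable_coord_square)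
  fix k
  have "\<bar>coord a k\<bar> \<le> \<bar>coord b k\<bar>" using assms[of k] by (cases "k = 0") auto
  then show "(coord a k)\<^sup>2 \<le> (coord b k)\<^sup>2" by (simp add: abs_le_square_iff)
qed (simp_all add: norm_ell2_square)

lemma abs_coord_le_norm: "\<bar>coord a k\<bar> \<le> norm a"
proof -
  have "(coord a k)\<^sup>2 = (\<Sum>i\<in>{k}. (coord a i)\<^sup>2)" by simp
  also have "\<dots> \<le> (\<Sum>i. (coord a i)\<^sup>2)"
    by (intro sum_le_suminf summable_coord_square) auto
  also have "\<dots> = (norm a)\<^sup>2" by (simp add: norm_ell2_square)
  finally show ?thesis by (simp add: abs_le_square_iff[symmetric])
qed

text \<open>Majorants are assembled in the space itself, from \<open>abs_ell2\<close>,
  \<open>recip\<close> and \<open>geom\<close>; \<open>norm_coord_mono\<close> then turns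
  coordinatewise bounds into norm bounds through the triangle inequality.\<close>

definition abs_ell2 :: "ell2 \<Rightarrow> ell2" where
  "abs_ell2 a = Abs_ell2 (\<lambda>k. \<bar>coord a k\<bar>)"

lemma coord_abs_ell2 [simp]: "coord (abs_ell2 a) k = \<bar>coord a k\<bar>"
  unfolding abs_ell2_def by (subst coord_Abs) (simp_all add: summable_coord_square)

lemma norm_abs_ell2 [simp]: "norm (abs_ell2 a) = norm a"
  by (intro antisym norm_coord_mono) simp_all

lemma ell2_dominated:
  fixes f :: "nat \<Rightarrow> real"
  assumes "f 0 = 0" "\<And>k. 1 \<le> k \<Longrightarrow> \<bar>f k\<bar> \<le> coord b k"
  shows "coord (Abs_ell2 f) = f" "norm (Abs_ell2 f) \<le> norm b"
proof -
  have le: "\<bar>f k\<bar> \<le> coord b k" for k using assms by (cases "k = 0") auto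
  have sm: "summable (\<lambda>k. (f k)\<^sup>2)"
  proof (rule summable_comparison_test'[OF summable_coord_square[of b]])
    fix k
    show "norm ((f k)\<^sup>2) \<le> (coord b k)\<^sup>2"
      using power_mono[OF le[of k], of 2] by simp
  qed
  show *: "coord (Abs_ell2 f) = f" by (rule coord_Abs[OF assms(1) sm])
  show "norm (Abs_ell2 f) \<le> norm b"
    by (rule norm_coord_mono) (simp add: * order_trans[OF le abs_ge_self])
qed

text \<open>The nonlinearity costs a factor k and the gap in the linear damping gains at least k^2,
  so the Duhamel estimate of mode k decays like 1/k; this is its square-summable majorant.\<close>

definition recip :: ell2 where "recip = Abs_ell2 (\<lambda>k. 1 / real k)"

lemma coord_recip [simp]: "coord recip k = 1 / real k"
proof -
  have "summable (\<lambda>k. (1 / real k)\<^sup>2)"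
    using inverse_power_summable[of 2, where ?'a = real] by (simp add: power_divide inverse_eq_divide)
  then show ?thesis unfolding recip_def by (subst coord_Abs) auto
qed

text \<open>The decay of the high modes in the trapping region, and the shape of the boxes used for
  hyperbolicity.\<close>

definition geom :: ell2 where "geom = Abs_ell2 (\<lambda>k. if k = 0 then 0 else (1/5)^k)"

lemma coord_geom: "coord geom k = (if k = 0 then 0 else (1/5)^k)"
proof -
  have "summable (\<lambda>k. (1/25::real)^k)" by (rule summable_geometric) simp
  then have "summable (\<lambda>k. (if k = 0 then 0 else (1/5::real)^k)\<^sup>2)"
    by (rule summable_comparison_test'[where N = 0]) (auto simp: power_mult[symmetric] power_even_eq power2_eq_square power_mult_distrib[symmetric])
  then show ?thesis unfolding geom_def by (subst coord_Abs) auto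
qed

lemma coord_sum: "coord (sum f A) k = (\<Sum>i\<in>A. coord (f i) k)"
  by (induction A rule: infinite_finite_induct) auto

lemma continuous_coord [continuous_intros]:
  assumes "continuous_on S f" shows "continuous_on S (\<lambda>x. coord (f x) k)"
proof -
  have "norm (coord a k - coord b k) \<le> norm (a - b)" for a b
    using abs_coord_le_norm[of "a - b" k] by simp
  then have "continuous_on UNIV (\<lambda>a. coord a k)"
    unfolding continuous_on_iff dist_norm by (meson le_less_trans)
  from continuous_on_compose2[OF this assms] show ?thesis by simp
qed

lemma tendsto_coord [tendsto_intros]:
  assumes "(f \<longlongrightarrow> l) F" shows "((\<lambda>x. coord (f x) k) \<longlongrightarrow> coord l k) F"
proof -
  have "isCont (\<lambda>a. coord a k) l"
    using continuous_coord[OF continuous_on_id, of UNIV k]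
    by (simp add: continuous_on_eq_continuous_at)
  from isCont_tendsto_compose[OF this assms] show ?thesis .
qed

definition truncate :: "nat \<Rightarrow> ell2 \<Rightarrow> ell2" where
  "truncate n a = (\<Sum>k<n. coord a k *\<^sub>R unit k)"

lemma coord_truncate: "coord (truncate n a) k = (if k < n then coord a k else 0)"
proof -
  have "coord (truncate n a) k = (\<Sum>i<n. coord a i * coord (unit i) k)"
    by (simp add: truncate_def coord_sum)
  also have "\<dots> = (\<Sum>i<n. if i = k then coord a k else 0)"
    by (intro sum.cong refl) (use coord_0[of a] in \<open>auto simp: coord_unit not_less_eq_eq\<close>)
  finally show ?thesis by simp
qed

lemma continuous_on_truncate:
  assumes "\<And>k. continuous_on S (\<lambda>x. coord (f x) k)"
  shows "continuous_on S (\<lambda>x. truncate n (f x))"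
  unfolding truncate_def by (intro continuous_intros assms)

lemma norm_tail_tendsto_0: "(\<lambda>n. norm (b - truncate n b)) \<longlonglongrightarrow> 0"
proof -
  have sq: "(norm (b - truncate n b))\<^sup>2 = (\<Sum>k. (coord b (k + n))\<^sup>2)" for n
  proof -
    have "(norm (b - truncate n b))\<^sup>2 = (\<Sum>k. (coord (b - truncate n b) k)\<^sup>2)"
      by (rule norm_ell2_square)
    also have "\<dots> = (\<Sum>k. (coord (b - truncate n b) (k + n))\<^sup>2) + (\<Sum>k<n. (coord (b - truncate n b) k)\<^sup>2)"
      by (rule suminf_split_initial_segment[OF summable_coord_square])
    also have "\<dots> = (\<Sum>k. (coord b (k + n))\<^sup>2)" by (simp add: coord_truncate)
    finally show ?thesis .
  qed
  have "(\<lambda>n. (norm (b - truncate n b))\<^sup>2) \<longlonglongrightarrow> 0"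
    unfolding sq by (rule suminf_exist_split2[OF summable_coord_square])
  then have "(\<lambda>n. sqrt ((norm (b - truncate n b))\<^sup>2)) \<longlonglongrightarrow> sqrt 0"
    by (rule tendsto_real_sqrt)
  then show ?thesis by simp
qed

text \<open>The common majorant \<open>b\<close> makes the truncations converge uniformly on
  \<open>S\<close>, so continuity of each coordinate suffices.\<close>

lemma continuous_on_ell2I:
  assumes "\<And>k. continuous_on S (\<lambda>x. coord (f x) k)"
    and "\<And>x k. x \<in> S \<Longrightarrow> 1 \<le> k \<Longrightarrow> \<bar>coord (f x) k\<bar> \<le> coord b k"
  shows "continuous_on S f"
proof (rule uniform_limit_theorem)
  show "\<forall>\<^sub>F n in sequentially. continuous_on S (\<lambda>x. truncate n (f x))"
    by (intro always_eventually allI continuous_on_truncate assms)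
  show "uniform_limit S (\<lambda>n x. truncate n (f x)) f sequentially"
  proof (rule uniform_limitI)
    fix e :: real assume "e > 0"
    with norm_tail_tendsto_0[of b] have "\<forall>\<^sub>F n in sequentially. norm (b - truncate n b) < e"
      by (auto dest: order_tendstoD)
    then show "\<forall>\<^sub>F n in sequentially. \<forall>x\<in>S. dist (truncate n (f x)) (f x) < e"
    proof eventually_elim
      case (elim n)
      have "norm (f x - truncate n (f x)) \<le> norm (b - truncate n b)" if "x \<in> S" for x
        by (intro norm_coord_mono) (auto simp: coord_truncate intro!: order_trans[OF assms(2)[OF that] abs_ge_self])
      with elim show ?case
        by (metis dist_commute dist_norm le_less_trans)
    qed
  qed
qed simp

text \<open>Completeness serves the Banach fixed point theorem for the Duhamel operator and the
  limit that yields the nontrivial equilibrium.\<close>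

instance ell2 :: complete_space
proof
  fix X :: "nat \<Rightarrow> ell2" assume C: "Cauchy X"
  have "Cauchy (\<lambda>n. coord (X n) k)" for k
  proof (rule metric_CauchyI)
    fix e :: real assume "e > 0"
    with C obtain M where M: "\<And>m n. m \<ge> M \<Longrightarrow> n \<ge> M \<Longrightarrow> dist (X m) (X n) < e"
      unfolding Cauchy_def by blast
    have "dist (coord (X m) k) (coord (X n) k) \<le> dist (X m) (X n)" for m n
      using abs_coord_le_norm[of "X m - X n" k] by (simp add: dist_norm)
    with M show "\<exists>M. \<forall>m\<ge>M. \<forall>n\<ge>M. dist (coord (X m) k) (coord (X n) k) < e"
      by (meson le_less_trans)
  qed
  then have "\<exists>l. (\<lambda>n. coord (X n) k) \<longlonglongrightarrow> l" for k
    by (simp add: Cauchy_convergent_iff convergent_def)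
  then obtain l where l: "\<And>k. (\<lambda>n. coord (X n) k) \<longlonglongrightarrow> l k" by metis
  \<comment> \<open>The Cauchy bound on finite sums of squares passes to the coordinatewise limit in
    \<open>m\<close>, uniformly in \<open>K\<close>.\<close>
  have tail: "\<exists>M. \<forall>n\<ge>M. \<forall>K. (\<Sum>k<K. (coord (X n) k - l k)\<^sup>2) \<le> e\<^sup>2" if "e > 0" for e
  proof -
    from C that obtain M where M: "\<And>m n. m \<ge> M \<Longrightarrow> n \<ge> M \<Longrightarrow> dist (X m) (X n) < e"
      unfolding Cauchy_def by blast
    have "(\<Sum>k<K. (coord (X n) k - l k)\<^sup>2) \<le> e\<^sup>2" if "n \<ge> M" for n K
    proof (rule LIMSEQ_le_const2)
      show "(\<lambda>m. \<Sum>k<K. (coord (X n) k - coord (X m) k)\<^sup>2) \<longlonglongrightarrow> (\<Sum>k<K. (coord (X n) k - l k)\<^sup>2)"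
        by (intro tendsto_intros l)
      have "(\<Sum>k<K. (coord (X n) k - coord (X m) k)\<^sup>2) \<le> e\<^sup>2" if "m \<ge> M" for m
      proof -
        have "(\<Sum>k<K. (coord (X n) k - coord (X m) k)\<^sup>2) = (\<Sum>k<K. (coord (X n - X m) k)\<^sup>2)" by simp
        also have "\<dots> \<le> (norm (X n - X m))\<^sup>2"
          unfolding norm_ell2_square by (intro sum_le_suminf summable_coord_square) auto
        also have "\<dots> \<le> e\<^sup>2"
          using M[OF \<open>n \<ge> M\<close> \<open>m \<ge> M\<close>] by (intro power_mono) (auto simp: dist_norm)
        finally show ?thesis .
      qed
      then show "\<exists>N. \<forall>m\<ge>N. (\<Sum>k<K. (coord (X n) k - coord (X m) k)\<^sup>2) \<le> e\<^sup>2" by blast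
    qed
    then show ?thesis by blast
  qed
  have l0: "l 0 = 0" using l[of 0] by (simp add: LIMSEQ_const_iff)
  obtain M where M: "\<And>K. (\<Sum>k<K. (coord (X M) k - l k)\<^sup>2) \<le> 1\<^sup>2"
    using tail[of 1] by auto
  have "summable (\<lambda>k. (coord (X M) k - l k)\<^sup>2)"
    by (rule bounded_imp_summable[where B = 1]) (use M[of "Suc _"] in \<open>auto simp: lessThan_Suc_atMost\<close>)
  then have co: "coord (Abs_ell2 (\<lambda>k. coord (X M) k - l k)) = (\<lambda>k. coord (X M) k - l k)"
    by (intro coord_Abs) (auto simp: l0)
  define L where "L = X M - Abs_ell2 (\<lambda>k. coord (X M) k - l k)"
  have L: "coord L k = l k" for k unfolding L_def by (simp add: co)
  have "X \<longlonglongrightarrow> L"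
  proof (rule metric_LIMSEQ_I)
    fix e :: real assume "e > 0"
    then have "0 < e / 2" by simp
    from tail[OF this] obtain M where M: "\<And>n K. n \<ge> M \<Longrightarrow> (\<Sum>k<K. (coord (X n) k - l k)\<^sup>2) \<le> (e/2)\<^sup>2" by blast
    have "dist (X n) L < e" if "n \<ge> M" for n
    proof -
      have "(norm (X n - L))\<^sup>2 \<le> (e/2)\<^sup>2"
        unfolding norm_ell2_square
        by (rule suminf_le_const[OF summable_coord_square]) (use M[OF that] L in auto)
      then have "norm (X n - L) \<le> e / 2"
        using \<open>e > 0\<close> by (simp add: power2_le_iff_abs_le)
      with \<open>e > 0\<close> show ?thesis by (simp add: dist_norm)
    qed
    then show "\<exists>M. \<forall>n\<ge>M. dist (X n) L < e" by blast
  qed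
  then show "convergent X" by (auto simp: convergent_def)
qed

text \<open>The Hilbert cube: Tychonoff makes the product of the coordinate intervals compact, and
  the common majorant makes its map into the sequence space continuous for the norm.\<close>

lemma compact_ell2_box:
  "compact {a. \<forall>k\<ge>1. \<bar>coord a k\<bar> \<le> coord b k}" (is "compact ?B")
proof (cases "\<forall>k\<ge>1. 0 \<le> coord b k")
  case False
  then obtain k where "1 \<le> k" "coord b k < 0" by (auto simp: not_le)
  then have "\<not> \<bar>x\<bar> \<le> coord b k" for x :: real by linarith
  with \<open>1 \<le> k\<close> have "?B = {}" by blast
  then show ?thesis by (simp only: compact_empty)
next
  case True
  define P where "P = (\<Pi>\<^sub>E k\<in>UNIV. {- coord b k..coord b k})"
  have "compactin (product_topology (\<lambda>k. euclidean) UNIV) P"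
    unfolding P_def compactin_PiE by simp
  then have "compact P" by (simp add: euclidean_product_topology)
  have P: "x \<in> P \<longleftrightarrow> (\<forall>k. \<bar>x k\<bar> \<le> coord b k)" for x
    by (auto simp: P_def abs_le_iff minus_le_iff)
  have co: "coord (Abs_ell2 x) = x" if "x \<in> P" for x
    using that P[of x] by (intro ell2_dominated(1)[of _ b]) (auto dest: spec[of _ 0])
  have "continuous_on P Abs_ell2"
  proof (rule continuous_on_ell2I)
    show "continuous_on P (\<lambda>x. coord (Abs_ell2 x) k)" for k
      by (subst continuous_on_cong[OF refl, of _ _ "\<lambda>x. x k"])
        (auto simp: co intro: continuous_on_subset[OF continuous_on_product_coordinates])
  qed (use P co in auto)
  from compact_continuous_image[OF this \<open>compact P\<close>] have "compact (Abs_ell2 ` P)" .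
  moreover have "Abs_ell2 ` P = ?B"
  proof safe
    fix a assume "\<forall>k\<ge>1. \<bar>coord a k\<bar> \<le> coord b k"
    then have "\<bar>coord a k\<bar> \<le> coord b k" for k by (cases "k = 0") auto
    then have "coord a \<in> P" by (simp add: P)
    then show "a \<in> Abs_ell2 ` P" by (metis coord_inverse imageI)
  qed (use P co in auto)
  ultimately show ?thesis by simp
qed

section \<open>Scalar differential inequalities\<close>

lemma has_real_derivative_nonneg_imp_le:
  fixes f :: "real \<Rightarrow> real"
  assumes "a \<le> b"
    and "\<And>t. t \<in> {a..b} \<Longrightarrow> (f has_real_derivative f' t) (at t within {a..b})"
    and "\<And>t. t \<in> {a..b} \<Longrightarrow> 0 \<le> f' t"
  shows "f a \<le> f b"
proof -
  have "\<exists>x\<in>{a..b}. f b - f a = (\<lambda>h. f' x * h) (b - a)"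
    using assms(1,2) by (intro mvt_very_simple) (auto simp: has_field_derivative_def)
  then obtain x where "x \<in> {a..b}" "f b - f a = f' x * (b - a)" by blast
  with assms(1) assms(3)[of x] have "0 \<le> f b - f a" by simp
  then show ?thesis by simp
qed

text \<open>Gronwall's inequality by an integrating factor. Neither \<open>f\<close> nor
  \<open>c\<close> has a prescribed sign, so lower bounds follow by applying it to a negated
  function.\<close>

lemma differential_inequality:
  fixes f :: "real \<Rightarrow> real"
  assumes "a \<le> b"
    and d: "\<And>t. t \<in> {a..b} \<Longrightarrow> (f has_real_derivative f' t) (at t within {a..b})"
    and le: "\<And>t. t \<in> {a..b} \<Longrightarrow> f' t \<le> c * f t"
  shows "f b \<le> exp (c * (b - a)) * f a"
proof -
  have "- (exp (- c * a) * f a) \<le> - (exp (- c * b) * f b)"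
  proof (rule has_real_derivative_nonneg_imp_le[OF \<open>a \<le> b\<close>])
    fix t assume t: "t \<in> {a..b}"
    show "((\<lambda>t. - (exp (- c * t) * f t)) has_real_derivative exp (- c * t) * (c * f t - f' t)) (at t within {a..b})"
      by (auto intro!: derivative_eq_intros d[OF t] simp: algebra_simps)
    show "0 \<le> exp (- c * t) * (c * f t - f' t)" using le[OF t] by simp
  qed
  then have "exp (c * b) * (exp (- c * b) * f b) \<le> exp (c * b) * (exp (- c * a) * f a)"
    by (intro mult_left_mono) auto
  then show ?thesis
    by (simp add: mult.assoc[symmetric] exp_add[symmetric] right_diff_distrib)
qed

text \<open>At the last time of nonnegativity \<open>f\<close> would vanish, yet its positive
  derivative makes it increase. Only the zeros of \<open>f\<close> are inspected, that is, one face
  of a region.\<close>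

lemma barrier:
  fixes f :: "real \<Rightarrow> real"
  assumes "a \<le> b" "0 \<le> f a"
    and d: "\<And>t. t \<in> {a..b} \<Longrightarrow> (f has_real_derivative f' t) (at t within {a..b})"
    and pos: "\<And>t. t \<in> {a..b} \<Longrightarrow> f t = 0 \<Longrightarrow> 0 < f' t"
  shows "0 \<le> f b"
proof (rule ccontr)
  assume neg: "\<not> 0 \<le> f b"
  have cont: "continuous_on {a..b} f"
    using d by (meson DERIV_continuous continuous_on_eq_continuous_within)
  define A where "A = {a..b} \<inter> f -` {0..}"
  have "closed A" unfolding A_def by (intro continuous_closed_preimage cont) auto
  moreover have "A \<noteq> {}" "bdd_above A" using assms(1,2) by (auto simp: A_def)
  ultimately have s: "Sup A \<in> A" by (intro closed_contains_Sup)
  define s where "s = Sup A"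
  have sab: "s \<in> {a..b}" "0 \<le> f s" using s by (auto simp: A_def s_def)
  have after: "f t < 0" if "s < t" "t \<le> b" for t
  proof (rule ccontr)
    assume "\<not> f t < 0"
    with that sab have "t \<in> A" by (auto simp: A_def)
    then have "t \<le> s" unfolding s_def by (rule cSup_upper) (auto simp: A_def)
    with that show False by simp
  qed
  have sb: "s < b" using sab neg by (cases "s = b") auto
  have "f s = 0"
  proof (rule ccontr)
    assume "f s \<noteq> 0"
    with sab have "0 < f s" by simp
    have "\<exists>x\<ge>s. x \<le> b \<and> f x = 0"
      by (rule IVT2') (use neg \<open>0 < f s\<close> sab continuous_on_subset[OF cont] in auto)
    then obtain x where "x \<ge> s" "x \<le> b" "f x = 0" by blast
    with after[of x] \<open>0 < f s\<close> show False by (cases "x = s") auto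
  qed
  from has_real_derivative_pos_inc_right[OF d[OF sab(1)] pos[OF sab(1) this]]
  obtain e where e: "e > 0" "\<And>h. h > 0 \<Longrightarrow> s + h \<in> {a..b} \<Longrightarrow> h < e \<Longrightarrow> f s < f (s + h)" by blast
  define h where "h = min (e / 2) (b - s)"
  have "0 < h" "h < e" "s + h \<le> b" using e sb by (auto simp: h_def min_def)
  with e(2)[of h] after[of "s + h"] sab show False by auto
qed

lemma barrier_backward:
  fixes f :: "real \<Rightarrow> real"
  assumes "a \<le> b" "0 \<le> f b"
    and d: "\<And>t. t \<in> {a..b} \<Longrightarrow> (f has_real_derivative f' t) (at t within {a..b})"
    and neg: "\<And>t. t \<in> {a..b} \<Longrightarrow> f t = 0 \<Longrightarrow> f' t < 0"
  shows "0 \<le> f a"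
proof -
  have im: "uminus ` {- b..- a} = {a..b}" by (simp add: image_uminus_atLeastAtMost)
  have "0 \<le> (f \<circ> uminus) (- a)"
  proof (rule barrier[where f = "f \<circ> uminus" and a = "- b" and b = "- a" and f' = "\<lambda>t. - f' (- t)"])
    fix t assume t: "t \<in> {- b..- a}"
    have "(f has_real_derivative f' (- t)) (at (- t) within uminus ` {- b..- a})"
      using t im d by auto
    from DERIV_image_chain[OF this DERIV_minus[OF DERIV_ident]]
    show "((f \<circ> uminus) has_real_derivative - f' (- t)) (at t within {- b..- a})"
      by simp
    show "0 < - f' (- t)" if "(f \<circ> uminus) t = 0" using neg[of "- t"] that t by auto
  qed (use assms in auto)
  then show ?thesis by simp
qed

text \<open>Variation of constants, by comparison with the particular solution
  \<open>K / (r - l) * exp (r * t)\<close> for the forcing \<open>K * exp (r * t)\<close>.\<close>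

lemma linear_ode_bound:
  fixes y g :: "real \<Rightarrow> real"
  assumes "0 \<le> T" "l < r"
    and d: "\<And>t. t \<in> {0..T} \<Longrightarrow> (y has_real_derivative l * y t + g t) (at t within {0..T})"
    and g: "\<And>t. t \<in> {0..T} \<Longrightarrow> \<bar>g t\<bar> \<le> K * exp (r * t)"
  shows "\<bar>y T\<bar> \<le> exp (r * T) * (\<bar>y 0\<bar> + K / (r - l))"
proof -
  have K: "0 \<le> K" using g[of 0] assms(1) by (auto intro: order_trans[OF abs_ge_zero])
  \<comment> \<open>The sign \<open>s\<close> stands for the two halves of the absolute
    value.\<close>
  have *: "s * y T \<le> exp (r * T) * (\<bar>y 0\<bar> + K / (r - l))" if s: "\<bar>s\<bar> = 1" for s
  proof -
    define q where "q = K / (r - l)"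
    have Kq: "K = q * (r - l)" using \<open>l < r\<close> by (simp add: q_def)
    have "q * exp ((r - l) * 0) - s * (exp (- l * 0) * y 0)
        \<le> q * exp ((r - l) * T) - s * (exp (- l * T) * y T)"
    proof (rule has_real_derivative_nonneg_imp_le[OF \<open>0 \<le> T\<close>])
      fix t assume t: "t \<in> {0..T}"
      show "((\<lambda>t. q * exp ((r - l) * t) - s * (exp (- l * t) * y t)) has_real_derivative
          exp (- l * t) * (K * exp (r * t) - s * g t)) (at t within {0..T})"
        by (auto intro!: derivative_eq_intros d[OF t] simp: Kq algebra_simps mult_exp_exp)
      have "s * g t \<le> \<bar>g t\<bar>"
        using abs_ge_self[of "s * g t"] s by (simp add: abs_mult)
      with g[OF t] show "0 \<le> exp (- l * t) * (K * exp (r * t) - s * g t)" by simp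
    qed
    then have "exp (l * T) * (s * (exp (- l * T) * y T))
        \<le> exp (l * T) * (q * exp ((r - l) * T) + s * y 0 - q)"
      by (intro mult_left_mono) (simp_all add: algebra_simps)
    then have "s * y T \<le> q * exp (r * T) + exp (l * T) * (s * y 0) - exp (l * T) * q"
      by (simp add: algebra_simps mult_exp_exp)
    also have "\<dots> \<le> q * exp (r * T) + exp (l * T) * (s * y 0)"
      using K \<open>l < r\<close> by (simp add: q_def)
    also have "exp (l * T) * (s * y 0) \<le> exp (r * T) * \<bar>y 0\<bar>"
    proof -
      have "s * y 0 \<le> \<bar>y 0\<bar>"
        using abs_ge_self[of "s * y 0"] s by (simp add: abs_mult)
      then have "exp (l * T) * (s * y 0) \<le> exp (l * T) * \<bar>y 0\<bar>" by simp
      also have "\<dots> \<le> exp (r * T) * \<bar>y 0\<bar>"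
        using assms(1,2) by (intro mult_right_mono) (simp_all add: mult_right_mono)
      finally show ?thesis .
    qed
    finally show ?thesis by (simp add: q_def algebra_simps)
  qed
  show ?thesis using *[of 1] *[of "-1"] by (simp add: abs_le_iff)
qed

lemma at_within_atLeast_eq:
  fixes t :: real
  assumes "t < T" shows "at t within {a..} = at t within {a..T}"
  by (rule at_within_nhd[of t "{..<T}"]) (use assms in auto)

section \<open>Semilinear systems with a globally Lipschitz nonlinearity\<close>

text \<open>\<open>F\<close> yields one number per mode instead of a point of the space, because the
  nonlinearity loses a power of k and its values need not be square-summable. Derivatives are taken
  within \<open>S\<close>, so endpoints carry one-sided derivatives.\<close>

definition solves :: "(nat \<Rightarrow> real) \<Rightarrow> (ell2 \<Rightarrow> nat \<Rightarrow> real) \<Rightarrow> real set \<Rightarrow> (real \<Rightarrow> ell2) \<Rightarrow> bool" where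
  "solves l F S u \<longleftrightarrow> continuous_on S u \<and>
     (\<forall>k\<ge>1. \<forall>t\<in>S. ((\<lambda>s. coord (u s) k) has_real_derivative l k * coord (u t) k + F (u t) k) (at t within S))"

lemma solvesD:
  assumes "solves l F S u"
  shows "continuous_on S u"
    and "1 \<le> k \<Longrightarrow> t \<in> S \<Longrightarrow>
      ((\<lambda>s. coord (u s) k) has_real_derivative l k * coord (u t) k + F (u t) k) (at t within S)"
  using assms by (auto simp: solves_def)

lemma solves_subset: "solves l F S u \<Longrightarrow> T \<subseteq> S \<Longrightarrow> solves l F T u"
  unfolding solves_def by (meson DERIV_subset continuous_on_subset subset_iff)

lemma solves_cong:
  assumes "\<And>t. t \<in> S \<Longrightarrow> u t = v t" "solves l F S u" shows "solves l F S v"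
  unfolding solves_def
proof (intro conjI allI impI ballI)
  show "continuous_on S v"
    using assms by (simp add: solves_def cong: continuous_on_cong)
  fix k :: nat and t assume "1 \<le> k" "t \<in> S"
  from solvesD(2)[OF assms(2) this]
  show "((\<lambda>s. coord (v s) k) has_real_derivative l k * coord (v t) k + F (v t) k) (at t within S)"
    unfolding assms(1)[OF \<open>t \<in> S\<close>]
    by (rule has_field_derivative_transform_within[OF _ zero_less_one \<open>t \<in> S\<close>]) (simp add: assms(1))
qed

lemma solves_shift:
  assumes "solves l F ((+) c ` S) u" shows "solves l F S (\<lambda>t. u (c + t))"
  unfolding solves_def
proof (intro conjI allI impI ballI)
  show "continuous_on S (\<lambda>t. u (c + t))"
    by (rule continuous_on_compose2[OF solvesD(1)[OF assms]]) (auto intro!: continuous_intros)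
  fix k :: nat and t assume "1 \<le> k" "t \<in> S"
  then have "((\<lambda>s. coord (u s) k) has_real_derivative l k * coord (u (c + t)) k + F (u (c + t)) k)
      (at (c + t) within (+) c ` S)"
    by (intro solvesD(2)[OF assms]) auto
  from DERIV_image_chain[OF this DERIV_add[OF DERIV_const DERIV_ident]]
  show "((\<lambda>s. coord (u (c + s)) k) has_real_derivative l k * coord (u (c + t)) k + F (u (c + t)) k) (at t within S)"
    by (simp add: o_def)
qed

text \<open>Only the values of the nonlinearity along the curve enter; this is how the cut-offs are
  removed.\<close>

lemma solves_change_F:
  assumes "\<And>t k. t \<in> S \<Longrightarrow> F (u t) k = G (u t) k" "solves l F S u" shows "solves l G S u"
  using assms by (simp add: solves_def)

text \<open>Fourth-order damping against a Lipschitz nonlinearity that loses one power of k.\<close>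

locale semilinear =
  fixes lam :: "nat \<Rightarrow> real" and F :: "ell2 \<Rightarrow> nat \<Rightarrow> real" and L :: real
  assumes lam_le: "1 \<le> k \<Longrightarrow> lam k \<le> 1 - real k ^ 4 / 2"
    and L_pos: "0 < L"
    and F_lipschitz: "1 \<le> k \<Longrightarrow> \<bar>F a k - F b k\<bar> \<le> L * real k * norm (a - b)"
    and F_zero: "F 0 k = 0"
begin

text \<open>In the norm \<open>sup\<^sub>t exp (- rate * t) * norm (u t)\<close> the Duhamel operator contracts by the factor 1/2.\<close>

definition rate :: real where "rate = 1 + 2 * (L * norm recip)\<^sup>2"

lemma norm_recip_ge_1: "1 \<le> norm recip"
  using abs_coord_le_norm[of recip 1] by simp

text \<open>Completing a square bounds \<open>2 * p * (real k)\<^sup>2\<close> by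
  \<open>2 * p\<^sup>2 + real k ^ 4 / 2\<close>, hence by the gap \<open>rate - lam k\<close>. The
  prefactor \<open>1 / (2 * norm recip)\<close> scales the sequence 1/k to norm 1/2, the contraction
  constant.\<close>

lemma rate_gap:
  assumes "1 \<le> k"
  shows "lam k < rate" "L * real k / (rate - lam k) \<le> 1 / (2 * norm recip) * (1 / real k)"
proof -
  define p where "p = L * norm recip"
  have p: "0 < p" using L_pos norm_recip_ge_1 unfolding p_def by (intro mult_pos_pos) auto
  have "0 \<le> (2 * p - (real k)\<^sup>2)\<^sup>2" by simp
  then have "2 * p * (real k)\<^sup>2 \<le> 2 * p\<^sup>2 + real k ^ 4 / 2"
    by (simp add: power2_diff power_mult[symmetric] power_mult_distrib algebra_simps)
  also have "\<dots> \<le> rate - lam k"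
    using lam_le[OF assms] by (simp add: rate_def p_def)
  finally have gap: "2 * p * (real k)\<^sup>2 \<le> rate - lam k" .
  moreover have "0 < 2 * p * (real k)\<^sup>2" using p assms by simp
  ultimately show "lam k < rate" by linarith
  have "L * real k / (rate - lam k) \<le> L * real k / (2 * p * (real k)\<^sup>2)"
    using gap \<open>0 < 2 * p * (real k)\<^sup>2\<close> L_pos by (intro divide_left_mono) (auto intro: mult_pos_pos)
  also have "\<dots> = 1 / (2 * norm recip) * (1 / real k)"
    using L_pos assms by (simp add: p_def power2_eq_square divide_simps)
  finally show "L * real k / (rate - lam k) \<le> 1 / (2 * norm recip) * (1 / real k)" .
qed

lemma F_bound: "1 \<le> k \<Longrightarrow> \<bar>F a k\<bar> \<le> L * real k * norm a"
  using F_lipschitz[of k a 0] by (simp add: F_zero)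

lemma continuous_F:
  assumes "continuous_on S u" "1 \<le> k" shows "continuous_on S (\<lambda>t. F (u t) k)"
proof -
  have "(L * real k)-lipschitz_on UNIV (\<lambda>a. F a k)"
    using F_lipschitz[OF \<open>1 \<le> k\<close>] L_pos by (intro lipschitz_onI) (auto simp: dist_norm)
  from continuous_on_compose2[OF lipschitz_on_continuous_on[OF this] assms(1)] show ?thesis by simp
qed

lemma mode_bound:
  assumes "0 \<le> T" "1 \<le> k" "0 \<le> D"
    and "\<And>t. t \<in> {0..T} \<Longrightarrow> (y has_real_derivative lam k * y t + g t) (at t within {0..T})"
    and "\<And>t. t \<in> {0..T} \<Longrightarrow> \<bar>g t\<bar> \<le> L * real k * (D * exp (rate * t))"
  shows "\<bar>y T\<bar> \<le> exp (rate * T) * (\<bar>y 0\<bar> + D / (2 * norm recip) * (1 / real k))"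
proof -
  have "\<bar>y T\<bar> \<le> exp (rate * T) * (\<bar>y 0\<bar> + L * real k * D / (rate - lam k))"
    using assms rate_gap(1)[of k] by (intro linear_ode_bound[where g = g]) (auto simp: mult.assoc)
  also have "L * real k * D / (rate - lam k) = L * real k / (rate - lam k) * D" by simp
  also have "\<dots> \<le> 1 / (2 * norm recip) * (1 / real k) * D"
    using rate_gap(2)[of k] assms by (intro mult_right_mono) auto
  finally show ?thesis by (simp add: algebra_simps)
qed

lemma norm_le_mode_bound:
  assumes "\<And>k. 1 \<le> k \<Longrightarrow> \<bar>coord a k\<bar> \<le> C * (\<bar>coord b k\<bar> + D / (2 * norm recip) * (1 / real k))"
    and "0 \<le> C" "0 \<le> D"
  shows "norm a \<le> C * (norm b + D / 2)"
proof -
  have "norm a \<le> norm (C *\<^sub>R (abs_ell2 b + (D / (2 * norm recip)) *\<^sub>R recip))"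
    using assms by (intro norm_coord_mono) (auto simp: abs_mult abs_of_nonneg intro: order_trans)
  also have "\<dots> = C * norm (abs_ell2 b + (D / (2 * norm recip)) *\<^sub>R recip)"
    using assms by simp
  also have "\<dots> \<le> C * (norm (abs_ell2 b) + norm ((D / (2 * norm recip)) *\<^sub>R recip))"
    using assms by (intro mult_left_mono norm_triangle_ineq)
  also have "norm ((D / (2 * norm recip)) *\<^sub>R recip) = D / 2"
  proof -
    have "recip \<noteq> 0" using norm_recip_ge_1 by auto
    then show ?thesis using assms by simp
  qed
  finally show ?thesis by simp
qed

text \<open>The weighted distance \<open>exp (- rate * t) * norm (u t - v t)\<close> attains its
  maximum \<open>g s\<close>. The mode bounds at \<open>s\<close> give the initial distance plus
  \<open>g s / 2\<close>; absorbing the half produces the factor 2.\<close>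

lemma solutions_close:
  assumes "solves lam F {0..T} u" "solves lam F {0..T} v" "t \<in> {0..T}"
  shows "norm (u t - v t) \<le> 2 * exp (rate * t) * norm (u 0 - v 0)"
proof -
  define g where "g t = exp (- rate * t) * norm (u t - v t)" for t
  have "continuous_on {0..T} g"
    unfolding g_def by (intro continuous_intros solvesD(1)[OF assms(1)] solvesD(1)[OF assms(2)])
  with assms(3) obtain s where s: "s \<in> {0..T}" "\<And>t. t \<in> {0..T} \<Longrightarrow> g t \<le> g s"
    using continuous_attains_sup[of "{0..T}" g] by auto
  have g: "norm (u r - v r) = g r * exp (rate * r)" for r
    by (simp add: g_def mult_exp_exp mult.commute mult.left_commute)
  have "norm (u s - v s) \<le> exp (rate * s) * (norm (u 0 - v 0) + g s / 2)"
  proof (rule norm_le_mode_bound)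
    fix k :: nat assume k: "1 \<le> k"
    show "\<bar>coord (u s - v s) k\<bar> \<le> exp (rate * s) * (\<bar>coord (u 0 - v 0) k\<bar> + g s / (2 * norm recip) * (1 / real k))"
    proof (rule mode_bound[where y = "\<lambda>s. coord (u s - v s) k" and g = "\<lambda>t. F (u t) k - F (v t) k"])
      fix t assume t: "t \<in> {0..s}"
      then have tT: "t \<in> {0..T}" using s by auto
      have sub: "{0..s} \<subseteq> {0..T}" using s by auto
      show "((\<lambda>s. coord (u s - v s) k) has_real_derivative
          lam k * coord (u t - v t) k + (F (u t) k - F (v t) k)) (at t within {0..s})"
        by (auto intro!: derivative_eq_intros DERIV_subset[OF _ sub] solvesD(2)[OF assms(1) k tT]
          solvesD(2)[OF assms(2) k tT] simp: algebra_simps)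
      have "\<bar>F (u t) k - F (v t) k\<bar> \<le> L * real k * (g t * exp (rate * t))"
        using F_lipschitz[OF k] by (simp only: g[symmetric])
      also have "\<dots> \<le> L * real k * (g s * exp (rate * t))"
        using s(2)[OF tT] L_pos by (intro mult_left_mono mult_right_mono) auto
      finally show "\<bar>F (u t) k - F (v t) k\<bar> \<le> L * real k * (g s * exp (rate * t))" .
    qed (use s k in \<open>auto simp: g_def\<close>)
  qed (auto simp: g_def)
  then have "exp (rate * s) * g s \<le> exp (rate * s) * (norm (u 0 - v 0) + g s / 2)"
    by (simp add: g mult.commute)
  then have "g s \<le> norm (u 0 - v 0) + g s / 2"
    by (simp only: mult_le_cancel_left_pos exp_gt_zero)
  then have "g t \<le> 2 * norm (u 0 - v 0)" using s(2)[OF assms(3)] by simp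
  from mult_right_mono[OF this, of "exp (rate * t)"] show ?thesis by (simp add: g mult_ac)
qed

section \<open>Existence of solutions by a contraction\<close>

definition duhamel :: "ell2 \<Rightarrow> (real \<Rightarrow> ell2) \<Rightarrow> nat \<Rightarrow> real \<Rightarrow> real" where
  "duhamel z u k t = exp (lam k * t) * (coord z k + integral {0..t} (\<lambda>s. exp (- lam k * s) * F (u s) k))"

lemma duhamel_0 [simp]: "duhamel z u k 0 = coord z k"
  by (simp add: duhamel_def)

lemma duhamel_deriv:
  assumes u: "continuous_on {0..T} u" and k: "1 \<le> k" and t: "t \<in> {0..T}"
  shows "(duhamel z u k has_real_derivative lam k * duhamel z u k t + F (u t) k) (at t within {0..T})"
proof -
  let ?f = "\<lambda>s. exp (- lam k * s) * F (u s) k"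
  have "((\<lambda>t. integral {0..t} ?f) has_real_derivative ?f t) (at t within {0..T})"
    by (intro integral_has_real_derivative continuous_intros continuous_F u k t)
  from this have I: "((\<lambda>t. coord z k + integral {0..t} ?f) has_real_derivative 0 + ?f t) (at t within {0..T})"
    by (rule DERIV_add[OF DERIV_const])
  have "((\<lambda>t. exp (lam k * t)) has_real_derivative exp (lam k * t) * lam k) (at t within {0..T})"
    by (auto intro!: derivative_eq_intros)
  from DERIV_mult[OF this I]
  have "(duhamel z u k has_real_derivative
      exp (lam k * t) * lam k * (coord z k + integral {0..t} ?f) + (0 + ?f t) * exp (lam k * t)) (at t within {0..T})"
    unfolding duhamel_def .
  moreover have "exp (lam k * t) * lam k * (coord z k + integral {0..t} ?f) + (0 + ?f t) * exp (lam k * t)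
      = lam k * duhamel z u k t + F (u t) k"
    by (simp add: duhamel_def algebra_simps mult_exp_exp)
  ultimately show ?thesis by simp
qed

lemma duhamel_deriv_atLeast:
  assumes "continuous_on {0..} u" "1 \<le> k" "0 \<le> t"
  shows "(duhamel z u k has_real_derivative lam k * duhamel z u k t + F (u t) k) (at t within {0..})"
  unfolding at_within_atLeast_eq[of t "t + 1" 0, simplified]
  by (rule duhamel_deriv) (use assms in \<open>auto intro: continuous_on_subset\<close>)

text \<open>The unknown is a bounded continuous function \<open>v\<close>; its supremum norm plays
  the part of the weighted norm of the curve \<open>grown v\<close>.\<close>

definition grown :: "(real \<Rightarrow>\<^sub>C ell2) \<Rightarrow> real \<Rightarrow> ell2" where
  "grown v t = exp (rate * t) *\<^sub>R apply_bcontfun v t"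

lemma continuous_grown: "continuous_on S (grown v)"
  unfolding grown_def
  by (intro continuous_intros continuous_on_subset[OF continuous_on_apply_bcontfun[of UNIV]]) auto

lemma duhamel_bound:
  assumes "1 \<le> k" "0 \<le> t"
  shows "\<bar>duhamel z (grown v) k t\<bar> \<le> exp (rate * t) * (\<bar>coord z k\<bar> + norm v / (2 * norm recip) * (1 / real k))"
proof -
  have "\<bar>duhamel z (grown v) k t\<bar>
      \<le> exp (rate * t) * (\<bar>duhamel z (grown v) k 0\<bar> + norm v / (2 * norm recip) * (1 / real k))"
  proof (rule mode_bound[where g = "\<lambda>s. F (grown v s) k"])
    fix s assume "s \<in> {0..t}"
    then show "(duhamel z (grown v) k has_real_derivative lam k * duhamel z (grown v) k s + F (grown v s) k) (at s within {0..t})"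
      by (intro duhamel_deriv continuous_grown assms)
    have "norm (grown v s) \<le> norm v * exp (rate * s)"
      using norm_bounded[of v s] by (simp add: grown_def mult.commute)
    then have "L * real k * norm (grown v s) \<le> L * real k * (norm v * exp (rate * s))"
      using L_pos by (intro mult_left_mono) auto
    with F_bound[OF assms(1)] show "\<bar>F (grown v s) k\<bar> \<le> L * real k * (norm v * exp (rate * s))"
      by (rule order_trans)
  qed (use assms in auto)
  then show ?thesis by simp
qed

lemma duhamel_diff_bound:
  assumes "1 \<le> k" "0 \<le> t"
  shows "\<bar>duhamel z (grown v) k t - duhamel z (grown w) k t\<bar> \<le> exp (rate * t) * (norm (v - w) / (2 * norm recip) * (1 / real k))"
proof -
  let ?d = "\<lambda>t. duhamel z (grown v) k t - duhamel z (grown w) k t"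
  have "\<bar>?d t\<bar> \<le> exp (rate * t) * (\<bar>?d 0\<bar> + norm (v - w) / (2 * norm recip) * (1 / real k))"
  proof (rule mode_bound[where y = ?d and g = "\<lambda>s. F (grown v s) k - F (grown w s) k"])
    fix s assume s: "s \<in> {0..t}"
    show "(?d has_real_derivative lam k * ?d s + (F (grown v s) k - F (grown w s) k)) (at s within {0..t})"
      by (auto intro!: derivative_eq_intros duhamel_deriv continuous_grown assms s simp: algebra_simps)
    have "norm (grown v s - grown w s) \<le> norm (v - w) * exp (rate * s)"
      using norm_bounded[of "v - w" s] by (simp add: grown_def mult.commute scaleR_diff_right[symmetric])
    then have "L * real k * norm (grown v s - grown w s) \<le> L * real k * (norm (v - w) * exp (rate * s))"
      using L_pos by (intro mult_left_mono) auto
    with F_lipschitz[OF assms(1)]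
    show "\<bar>F (grown v s) k - F (grown w s) k\<bar> \<le> L * real k * (norm (v - w) * exp (rate * s))"
      by (rule order_trans)
  qed (use assms in auto)
  then show ?thesis by simp
qed

text \<open>The type of bounded continuous functions has the whole line as its domain;
  \<open>max 0 t\<close> continues the curve to negative times by its initial value.\<close>

definition picard :: "ell2 \<Rightarrow> (real \<Rightarrow>\<^sub>C ell2) \<Rightarrow> real \<Rightarrow> ell2" where
  "picard z v t = Abs_ell2 (\<lambda>k. if k = 0 then 0 else exp (- rate * max 0 t) * duhamel z (grown v) k (max 0 t))"

lemma coord_picard:
  shows "coord (picard z v t) k = (if k = 0 then 0 else exp (- rate * max 0 t) * duhamel z (grown v) k (max 0 t))"
    and "\<bar>coord (picard z v t) k\<bar> \<le> coord (abs_ell2 z + (norm v / (2 * norm recip)) *\<^sub>R recip) k"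
proof -
  let ?b = "abs_ell2 z + (norm v / (2 * norm recip)) *\<^sub>R recip"
  have le: "\<bar>if k = 0 then 0 else exp (- rate * max 0 t) * duhamel z (grown v) k (max 0 t)\<bar> \<le> coord ?b k" for k
  proof (cases "k = 0")
    case False
    then have "exp (- rate * max 0 t) * \<bar>duhamel z (grown v) k (max 0 t)\<bar>
      \<le> exp (- rate * max 0 t) * (exp (rate * max 0 t) * (\<bar>coord z k\<bar> + norm v / (2 * norm recip) * (1 / real k)))"
      by (intro mult_left_mono duhamel_bound) auto
    also have "\<dots> = \<bar>coord z k\<bar> + norm v / (2 * norm recip) * (1 / real k)"
      by (simp add: mult.assoc[symmetric] mult_exp_exp)
    finally show ?thesis using False by (simp add: abs_mult)
  qed simp
  have "coord (picard z v t) = (\<lambda>k. if k = 0 then 0 else exp (- rate * max 0 t) * duhamel z (grown v) k (max 0 t))"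
    unfolding picard_def by (rule ell2_dominated(1)[of _ ?b]) (simp, rule le)
  then show co: "coord (picard z v t) k = (if k = 0 then 0 else exp (- rate * max 0 t) * duhamel z (grown v) k (max 0 t))"
    by simp
  show "\<bar>coord (picard z v t) k\<bar> \<le> coord ?b k"
    unfolding co by (rule le)
qed

lemma picard_bcontfun: "picard z v \<in> bcontfun"
proof (rule bcontfun_normI)
  show "norm (picard z v t) \<le> norm (abs_ell2 z + (norm v / (2 * norm recip)) *\<^sub>R recip)" for t
    by (rule norm_coord_mono) (rule order_trans[OF coord_picard(2) abs_ge_self])
  show "continuous_on UNIV (picard z v)"
  proof (rule continuous_on_ell2I)
    fix k
    show "continuous_on UNIV (\<lambda>t. coord (picard z v t) k)"
    proof (cases "k = 0")
      case False
      have "continuous_on {0..} (duhamel z (grown v) k)"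
        using duhamel_deriv_atLeast[OF continuous_grown, of k] False
        by (intro continuous_at_imp_continuous_on DERIV_continuous_on) auto
      then have "continuous_on UNIV (\<lambda>t. duhamel z (grown v) k (max 0 t))"
        by (rule continuous_on_compose2) (auto intro!: continuous_intros)
      then show ?thesis using False by (auto simp: coord_picard(1) intro!: continuous_intros)
    qed simp
  qed (rule coord_picard(2))
qed

lemma solution_exists: "\<exists>u. solves lam F {0..} u \<and> u 0 = z"
proof -
  define P where "P v = Bcontfun (picard z v)" for v
  have P: "apply_bcontfun (P v) = picard z v" for v
    unfolding P_def by (rule Bcontfun_inverse[OF picard_bcontfun])
  have "\<exists>!v. P v = v"
  proof (rule banach_fix_type)
    show "\<forall>v w. dist (P v) (P w) \<le> 1/2 * dist v w"
    proof (intro allI dist_bound)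
      fix v w t
      \<comment> \<open>Both images start at \<open>z\<close>, so the initial term of the mode bound
        is the zero vector and only half the distance remains.\<close>
      have "norm (picard z v t - picard z w t) \<le> 1 * (norm (0 :: ell2) + norm (v - w) / 2)"
      proof (rule norm_le_mode_bound)
        fix k :: nat assume k: "1 \<le> k"
        have "exp (- rate * max 0 t) * \<bar>duhamel z (grown v) k (max 0 t) - duhamel z (grown w) k (max 0 t)\<bar>
          \<le> exp (- rate * max 0 t) * (exp (rate * max 0 t) * (norm (v - w) / (2 * norm recip) * (1 / real k)))"
          using k by (intro mult_left_mono duhamel_diff_bound) auto
        also have "\<dots> = norm (v - w) / (2 * norm recip) * (1 / real k)"
          by (simp add: mult.assoc[symmetric] mult_exp_exp)
        finally show "\<bar>coord (picard z v t - picard z w t) k\<bar>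
          \<le> 1 * (\<bar>coord 0 k\<bar> + norm (v - w) / (2 * norm recip) * (1 / real k))"
          using k by (simp add: coord_picard(1) right_diff_distrib[symmetric] abs_mult)
      qed auto
      then show "dist (P v t) (P w t) \<le> 1/2 * dist v w"
        by (simp add: P dist_norm)
    qed
  qed auto
  then obtain v where v: "P v = v" by blast
  define u where "u = grown v"
  have u: "coord (u t) k = duhamel z u k t" if "0 \<le> t" "1 \<le> k" for t k
  proof -
    have "coord (u t) k = exp (rate * t) * coord (picard z v t) k"
      using P[of v] by (simp add: u_def grown_def v)
    also have "\<dots> = duhamel z u k t"
      using that by (simp add: coord_picard(1) u_def mult.assoc[symmetric] mult_exp_exp)
    finally show ?thesis .
  qed
  have "solves lam F {0..} u"
    unfolding solves_def
  proof (intro conjI allI impI ballI)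
    show "continuous_on {0..} u" unfolding u_def by (rule continuous_grown)
    fix k :: nat and t :: real assume kt: "1 \<le> k" "t \<in> {0..}"
    have "(duhamel z u k has_real_derivative lam k * duhamel z u k t + F (u t) k) (at t within {0..})"
      using kt by (intro duhamel_deriv_atLeast) (auto simp: u_def continuous_grown)
    then show "((\<lambda>s. coord (u s) k) has_real_derivative lam k * coord (u t) k + F (u t) k) (at t within {0..})"
      using kt by (subst u) (auto simp: u intro: has_field_derivative_transform_within[OF _ zero_less_one])
  qed
  moreover have "u 0 = z"
  proof (rule ell2_eqI)
    show "coord (u 0) k = coord z k" for k using u[of 0 k] by (cases "k = 0") auto
  qed
  ultimately show ?thesis by blast
qed

section \<open>The global semiflow of a cut-off system\<close>

definition flow :: "real \<Rightarrow> ell2 \<Rightarrow> ell2" where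
  "flow t z = (SOME u. solves lam F {0..} u \<and> u 0 = z) t"

lemma flow_solves: "solves lam F {0..} (\<lambda>t. flow t z)" and flow_0 [simp]: "flow 0 z = z"
  using someI_ex[OF solution_exists[of z]] unfolding flow_def by auto

lemma flow_unique:
  assumes "solves lam F {0..T} u" "t \<in> {0..T}" shows "u t = flow t (u 0)"
  using solutions_close[OF assms(1) solves_subset[OF flow_solves] assms(2), of "u 0"] by simp

lemma flow_close: "0 \<le> t \<Longrightarrow> norm (flow t y - flow t z) \<le> 2 * exp (rate * t) * norm (y - z)"
  using solutions_close[of t "\<lambda>t. flow t y" "\<lambda>t. flow t z" t]
  by (simp add: solves_subset[OF flow_solves])

lemma flow_add:
  assumes "0 \<le> s" "0 \<le> t" shows "flow (s + t) z = flow t (flow s z)"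
proof -
  have "solves lam F {0..t} (\<lambda>t. flow (s + t) z)"
    by (rule solves_shift, rule solves_subset[OF flow_solves]) (use assms in auto)
  from flow_unique[OF this, of t] show ?thesis using assms by simp
qed

text \<open>Joint continuity combines Lipschitz dependence on the initial point, locally uniform in
  time, with continuity in time along the single orbit of \<open>z\<close>.\<close>

lemma continuous_flow: "continuous_on ({0..} \<times> UNIV) (\<lambda>(t, z). flow t z)"
proof (clarsimp simp: continuous_on_eq_continuous_within continuous_within)
  fix t :: real and z :: ell2 assume t: "0 \<le> t"
  let ?F = "at (t, z) within {0..} \<times> UNIV"
  have fs: "((\<lambda>p. fst p) \<longlongrightarrow> t) ?F" "((\<lambda>p. snd p) \<longlongrightarrow> z) ?F"
    by (auto intro!: tendsto_eq_intros)
  have mem: "\<forall>\<^sub>F p in ?F. fst p \<in> {0..}" by (auto simp: eventually_at_filter mem_Times_iff intro: always_eventually)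
  have "((\<lambda>s. flow s z) \<longlongrightarrow> flow t z) (at t within {0..})"
    using solvesD(1)[OF flow_solves[of z]] t by (auto simp: continuous_on_def)
  then have 1: "((\<lambda>p. flow (fst p) z) \<longlongrightarrow> flow t z) ?F"
  proof -
    have "((\<lambda>p. flow (fst p) z) \<longlongrightarrow> flow t z) ?F"
      using continuous_on_tendsto_compose[OF solvesD(1)[OF flow_solves[of z]] fs(1)] t mem by simp
    then show ?thesis .
  qed
  have 2: "((\<lambda>p. flow (fst p) (snd p) - flow (fst p) z) \<longlongrightarrow> 0) ?F"
  proof (rule tendsto_0_le[where K = 1])
    show "((\<lambda>p. 2 * exp (rate * fst p) * norm (snd p - z)) \<longlongrightarrow> 0) ?F"
      by (rule tendsto_eq_intros fs refl | simp)+
    show "\<forall>\<^sub>F p in ?F. norm (flow (fst p) (snd p) - flow (fst p) z) \<le> norm (2 * exp (rate * fst p) * norm (snd p - z)) * 1"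
      using mem by eventually_elim (use flow_close in auto)
  qed
  from tendsto_add[OF 2 1] show "((\<lambda>(t, z). flow t z) \<longlongrightarrow> flow t z) ?F"
    by (simp add: case_prod_unfold)
qed

lemma continuous_on_flow: "0 \<le> t \<Longrightarrow> continuous_on S (flow t)"
proof -
  assume "0 \<le> t"
  have "continuous_on S (\<lambda>z. (\<lambda>(t, z). flow t z) (t, z))"
    by (rule continuous_on_compose2[OF continuous_flow]) (use \<open>0 \<le> t\<close> in \<open>auto intro!: continuous_intros\<close>)
  then show ?thesis by simp
qed

end

section \<open>The quadratic part of the ladder\<close>

definition lam :: "real \<Rightarrow> nat \<Rightarrow> real" where
  "lam \<mu> k = real k ^ 2 * (1 - \<mu> * real k ^ 2)"

text \<open>With the reflected and the shifted sequence, the finite convolution and the infinite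
  series of the ladder become inner products, open to Cauchy-Schwarz.\<close>

definition reflect :: "nat \<Rightarrow> ell2 \<Rightarrow> ell2" where
  "reflect k b = Abs_ell2 (\<lambda>i. if 0 < i \<and> i < k then coord b (k - i) else 0)"

definition shift :: "nat \<Rightarrow> ell2 \<Rightarrow> ell2" where
  "shift k b = Abs_ell2 (\<lambda>i. if 0 < i then coord b (k + i) else 0)"

lemma coord_reflect: "coord (reflect k b) i = (if 0 < i \<and> i < k then coord b (k - i) else 0)"
proof -
  have "summable (\<lambda>i. (if 0 < i \<and> i < k then coord b (k - i) else 0)\<^sup>2)"
    by (rule summable_finite[of "{..<k}"]) auto
  then show ?thesis unfolding reflect_def by (subst coord_Abs) auto
qed

lemma coord_shift: "coord (shift k b) i = (if 0 < i then coord b (k + i) else 0)"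
proof -
  have "summable (\<lambda>i. (coord b (i + k))\<^sup>2)"
    by (rule summable_ignore_initial_segment[OF summable_coord_square])
  then have "summable (\<lambda>i. (if 0 < i then coord b (k + i) else 0)\<^sup>2)"
    by (rule summable_comparison_test'[where N = 0]) (auto simp: add.commute)
  then show ?thesis unfolding shift_def by (subst coord_Abs) auto
qed

lemma norm_reflect_le: "norm (reflect k b) \<le> norm b"
proof (rule power2_le_imp_le)
  have "(norm (reflect k b))\<^sup>2 = (\<Sum>i\<in>{1..<k}. (coord b (k - i))\<^sup>2)"
    unfolding norm_ell2_square by (subst suminf_finite[of "{1..<k}"]) (auto simp: coord_reflect)
  also have "\<dots> = (\<Sum>i\<in>{1..<k}. (coord b i)\<^sup>2)"
    by (rule sum.reindex_bij_witness[of _ "\<lambda>i. k - i" "\<lambda>i. k - i"]) auto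
  also have "\<dots> \<le> (norm b)\<^sup>2"
    unfolding norm_ell2_square by (intro sum_le_suminf summable_coord_square) auto
  finally show "(norm (reflect k b))\<^sup>2 \<le> (norm b)\<^sup>2" .
qed simp

lemma norm_shift_le: "norm (shift k b) \<le> norm b"
proof (rule power2_le_imp_le)
  have "(norm (shift k b))\<^sup>2 \<le> (\<Sum>i. (coord b (i + k))\<^sup>2)"
    unfolding norm_ell2_square
    by (intro suminf_le summable_coord_square summable_ignore_initial_segment)
      (auto simp: coord_shift add.commute)
  also have "\<dots> \<le> (\<Sum>i. (coord b (i + k))\<^sup>2) + (\<Sum>i<k. (coord b i)\<^sup>2)"
    by (simp add: sum_nonneg)
  also have "\<dots> = (norm b)\<^sup>2"
    unfolding norm_ell2_square by (rule suminf_split_initial_segment[OF summable_coord_square, symmetric])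
  finally show "(norm (shift k b))\<^sup>2 \<le> (norm b)\<^sup>2" .
qed simp

definition bil :: "nat \<Rightarrow> ell2 \<Rightarrow> ell2 \<Rightarrow> real" where
  "bil k a b = 2 * real k * inner a (shift k b) - real k * inner a (reflect k b)"

definition nl :: "nat \<Rightarrow> ell2 \<Rightarrow> real" where
  "nl k a = bil k a a"

lemma inner_reflect: "inner a (reflect k b) = (\<Sum>i = 1..k - 1. coord a i * coord b (k - i))"
  unfolding inner_ell2_def by (subst suminf_finite[of "{1..k-1}"]) (auto simp: coord_reflect intro!: sum.cong)

lemma inner_shift: "inner a (shift k b) = (\<Sum>i. coord a (Suc i) * coord b (k + Suc i))"
  using suminf_split_head[OF summable_coord_mult[of a "shift k b"]]
  by (simp add: inner_ell2_def coord_shift)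

lemma ks_ladder_eq: "ks_ladder \<mu> a k = lam \<mu> k * coord a k + nl k a"
  by (simp add: ks_ladder_def lam_def nl_def bil_def inner_reflect inner_shift)

lemma bil_diff_right: "bil k a (b - c) = bil k a b - bil k a c"
proof -
  have *: "reflect k (b - c) = reflect k b - reflect k c" "shift k (b - c) = shift k b - shift k c"
    by (auto intro!: ell2_eqI simp: coord_reflect coord_shift)
  show ?thesis unfolding bil_def * inner_diff_right by (simp add: algebra_simps)
qed

lemma bil_diff_left: "bil k (a - b) c = bil k a c - bil k b c"
  by (simp add: bil_def inner_diff_left algebra_simps)

lemma bil_scaleR: "bil k (r *\<^sub>R a) (s *\<^sub>R b) = r * s * bil k a b"
proof -
  have *: "reflect k (s *\<^sub>R b) = s *\<^sub>R reflect k b" "shift k (s *\<^sub>R b) = s *\<^sub>R shift k b"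
    by (auto intro!: ell2_eqI simp: coord_reflect coord_shift)
  show ?thesis unfolding bil_def * by (simp add: algebra_simps)
qed

lemma abs_bil_le: "\<bar>bil k a b\<bar> \<le> 3 * real k * (norm a * norm b)"
proof -
  have "\<bar>inner a (shift k b)\<bar> \<le> norm a * norm b"
    by (rule order_trans[OF Cauchy_Schwarz_ineq2]) (simp add: mult_left_mono norm_shift_le)
  moreover have "\<bar>inner a (reflect k b)\<bar> \<le> norm a * norm b"
    by (rule order_trans[OF Cauchy_Schwarz_ineq2]) (simp add: mult_left_mono norm_reflect_le)
  ultimately have "\<bar>2 * inner a (shift k b) - inner a (reflect k b)\<bar> \<le> 3 * (norm a * norm b)"
    by linarith
  then have "real k * \<bar>2 * inner a (shift k b) - inner a (reflect k b)\<bar> \<le> real k * (3 * (norm a * norm b))"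
    by (rule mult_left_mono) simp
  moreover have "bil k a b = real k * (2 * inner a (shift k b) - inner a (reflect k b))"
    by (simp add: bil_def algebra_simps)
  then have "\<bar>bil k a b\<bar> = real k * \<bar>2 * inner a (shift k b) - inner a (reflect k b)\<bar>"
    by (simp only: abs_mult abs_of_nat)
  ultimately show ?thesis by linarith
qed

lemma nl_diff: "nl k a - nl k b = bil k (a - b) a + bil k b (a - b)"
  by (simp add: nl_def bil_diff_left bil_diff_right)

lemma nl_lipschitz: "\<bar>nl k a - nl k b\<bar> \<le> 3 * real k * (norm (a - b) * (norm a + norm b))"
proof -
  have "\<bar>nl k a - nl k b\<bar> \<le> \<bar>bil k (a - b) a\<bar> + \<bar>bil k b (a - b)\<bar>"
    unfolding nl_diff by (rule abs_triangle_ineq)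
  also have "\<dots> \<le> 3 * real k * (norm (a - b) * norm a) + 3 * real k * (norm b * norm (a - b))"
    by (intro add_mono abs_bil_le)
  finally show ?thesis by (simp add: algebra_simps)
qed

lemma nl_scaleR: "nl k (r *\<^sub>R a) = r\<^sup>2 * nl k a"
  by (simp add: nl_def bil_scaleR power2_eq_square)

lemma nl_zero [simp]: "nl k 0 = 0"
  using abs_bil_le[of k 0 0] by (simp add: nl_def)

lemma lam_le_quartic:
  assumes "(99/100) \<le> \<mu>" shows "lam \<mu> k \<le> 1 - real k ^ 4 / 2"
proof -
  define x where "x = real k ^ 2"
  \<comment> \<open>A square completed for 99/100 - 1/2 = (7/10)^2: x - 49/100 x^2 is at most 25/49,
    which is below 1.\<close>
  have "0 \<le> ((7/10) * x - 5/7)\<^sup>2" by simp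
  moreover have "0 \<le> x\<^sup>2 * (\<mu> - (99/100))" using assms by simp
  moreover have "real k ^ 4 = x\<^sup>2" by (simp add: x_def power_mult[symmetric])
  moreover have "0 \<le> (x - 1)\<^sup>2" by simp
  ultimately show ?thesis
    unfolding lam_def x_def[symmetric] by (simp add: power2_eq_square algebra_simps)
qed

section \<open>The local semiflow on the unit ball\<close>

text \<open>Composing the nonlinearity with the retraction onto the unit ball makes it globally Lipschitz without
  changing the solutions that stay in the ball.\<close>

definition retract1 :: "ell2 \<Rightarrow> ell2" where
  "retract1 a = a /\<^sub>R max 1 (norm a)"

lemma retract1_id: "norm a \<le> 1 \<Longrightarrow> retract1 a = a"
  by (simp add: retract1_def)

lemma norm_retract1: "norm (retract1 a) \<le> 1"
  by (auto simp: retract1_def max_def field_simps)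

lemma retract1_lipschitz: "norm (retract1 a - retract1 b) \<le> 2 * norm (a - b)"
proof -
  define m n where "m = max 1 (norm a)" and "n = max 1 (norm b)"
  have mn: "1 \<le> m" "1 \<le> n" "norm b \<le> n" by (auto simp: m_def n_def)
  have d: "\<bar>n - m\<bar> \<le> norm (a - b)"
    using norm_triangle_ineq3[of a b] by (auto simp: m_def n_def)
  have "retract1 a - retract1 b = (a - b) /\<^sub>R m + ((n - m) / (m * n)) *\<^sub>R b"
  proof (rule ell2_eqI)
    fix k
    show "coord (retract1 a - retract1 b) k = coord ((a - b) /\<^sub>R m + ((n - m) / (m * n)) *\<^sub>R b) k"
      using mn by (simp add: retract1_def m_def[symmetric] n_def[symmetric] field_simps)
  qed
  also have "norm \<dots> \<le> norm ((a - b) /\<^sub>R m) + norm (((n - m) / (m * n)) *\<^sub>R b)"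
    by (rule norm_triangle_ineq)
  also have "norm ((a - b) /\<^sub>R m) \<le> norm (a - b)"
  proof -
    have "inverse m * norm (a - b) \<le> 1 * norm (a - b)"
      using mn by (intro mult_right_mono) (auto simp: inverse_le_1_iff)
    then show ?thesis using mn by simp
  qed
  also have "norm (((n - m) / (m * n)) *\<^sub>R b) \<le> \<bar>n - m\<bar>"
  proof -
    have "norm (((n - m) / (m * n)) *\<^sub>R b) = \<bar>n - m\<bar> * (norm b / (m * n))"
      using mn by (simp add: abs_mult)
    also have "norm b / (m * n) \<le> 1"
      using mn mult_mono[of 1 m "norm b" n] by (simp add: field_simps)
    then have "\<bar>n - m\<bar> * (norm b / (m * n)) \<le> \<bar>n - m\<bar> * 1"
      by (intro mult_left_mono) auto
    finally show ?thesis by simp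
  qed
  finally show ?thesis using d by linarith
qed

text \<open>The constant 12 is the factor 3 of the quadratic form, times the Lipschitz constant 2 of
  the retraction, times 2 for the sum of the two norms.\<close>

lemma semilinear_cut:
  assumes "(99/100) \<le> \<mu>" shows "semilinear (lam \<mu>) (\<lambda>a k. nl k (retract1 a)) 12"
proof
  fix k a b
  have "norm (retract1 a - retract1 b) * (norm (retract1 a) + norm (retract1 b)) \<le> (2 * norm (a - b)) * (1 + 1)"
    by (intro mult_mono add_mono norm_retract1 retract1_lipschitz) auto
  then have "3 * real k * (norm (retract1 a - retract1 b) * (norm (retract1 a) + norm (retract1 b)))
      \<le> 3 * real k * ((2 * norm (a - b)) * (1 + 1))"
    by (intro mult_left_mono) auto
  with nl_lipschitz[of k "retract1 a" "retract1 b"]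
  show "\<bar>nl k (retract1 a) - nl k (retract1 b)\<bar> \<le> 12 * real k * norm (a - b)"
    by simp
qed (use lam_le_quartic[OF assms] in \<open>auto simp: retract1_def\<close>)

definition ks_flow :: "real \<Rightarrow> real \<Rightarrow> ell2 \<Rightarrow> ell2" where
  "ks_flow \<mu> = semilinear.flow (lam \<mu>) (\<lambda>a k. nl k (retract1 a))"

text \<open>Exit time from the open unit ball. Since \<open>t = 0\<close> always qualifies, a point
  outside the ball gets time 0, the convention for points where no solution starts.\<close>

definition ks_time :: "real \<Rightarrow> ell2 \<Rightarrow> ereal" where
  "ks_time \<mu> z = Sup {ereal t | t. 0 \<le> t \<and> (\<forall>s\<in>{0..<t}. norm (ks_flow \<mu> s z) < 1)}"

abbreviation ks_curve :: "real \<Rightarrow> real set \<Rightarrow> (real \<Rightarrow> ell2) \<Rightarrow> bool" where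
  "ks_curve \<mu> \<equiv> solves (lam \<mu>) (\<lambda>a k. nl k a)"

lemma ks_solution_iff: "ks_solution \<mu> T u \<longleftrightarrow> ks_curve \<mu> {t. 0 \<le> t \<and> ereal t < T} u"
  by (auto simp: ks_solution_def solves_def ks_ladder_eq)

lemma norm_lt_1_if_lt_time:
  assumes "0 \<le> t" "ereal t < ks_time \<mu> z" shows "norm (ks_flow \<mu> t z) < 1"
proof -
  obtain t' where "ereal t < ereal t'" "\<forall>s\<in>{0..<t'}. norm (ks_flow \<mu> s z) < 1"
    using assms(2) unfolding ks_time_def less_Sup_iff by auto
  with assms(1) show ?thesis by auto
qed

lemma time_geI:
  assumes "\<And>t. 0 \<le> t \<Longrightarrow> ereal t < T \<Longrightarrow> norm (ks_flow \<mu> t z) < 1"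
  shows "T \<le> ks_time \<mu> z"
proof (rule dense_le)
  fix x assume "x < T"
  show "x \<le> ks_time \<mu> z"
  proof (cases "x \<le> 0")
    case True
    have "ereal 0 \<le> ks_time \<mu> z" unfolding ks_time_def by (rule Sup_upper) auto
    with True show ?thesis by (simp add: zero_ereal_def[symmetric])
  next
    case False
    with \<open>x < T\<close> obtain t where t: "x = ereal t" by (cases x) auto
    have "norm (ks_flow \<mu> s z) < 1" if "0 \<le> s" "s < t" for s
      using assms[of s] less_trans[of "ereal s" "ereal t" T] that \<open>x < T\<close> t by simp
    then show ?thesis unfolding ks_time_def t
      by (intro Sup_upper) (use False t in auto)
  qed
qed

lemma ks_time_nonneg: "0 \<le> ks_time \<mu> z"
  by (rule time_geI) simp

context
  fixes \<mu> :: real assumes mu: "(99/100) \<le> \<mu>"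
begin

interpretation cut: semilinear "lam \<mu>" "\<lambda>a k. nl k (retract1 a)" 12
  rewrites "semilinear.flow (lam \<mu>) (\<lambda>a k. nl k (retract1 a)) = ks_flow \<mu>"
  by (rule semilinear_cut[OF mu]) (simp add: ks_flow_def)

lemma ks_flow_0: "ks_flow \<mu> 0 z = z" by (rule cut.flow_0)

lemma ks_flow_add: "0 \<le> s \<Longrightarrow> 0 \<le> t \<Longrightarrow> ks_flow \<mu> (s + t) z = ks_flow \<mu> t (ks_flow \<mu> s z)"
  by (rule cut.flow_add)

lemma continuous_on_ks_flow: "0 \<le> t \<Longrightarrow> continuous_on S (ks_flow \<mu> t)"
  by (rule cut.continuous_on_flow)

lemma ks_curve_flow:
  assumes "\<And>s. s \<in> S \<Longrightarrow> 0 \<le> s \<and> norm (ks_flow \<mu> s z) \<le> 1"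
  shows "ks_curve \<mu> S (\<lambda>s. ks_flow \<mu> s z)"
  by (rule solves_change_F[OF _ solves_subset[OF cut.flow_solves]]) (use assms in \<open>auto simp: retract1_id\<close>)

lemma ks_curve_flow_lt_time:
  assumes "ereal t < ks_time \<mu> z" shows "ks_curve \<mu> {0..t} (\<lambda>s. ks_flow \<mu> s z)"
proof (rule ks_curve_flow)
  fix s assume s: "s \<in> {0..t}"
  then have "ereal s < ks_time \<mu> z"
    using le_less_trans[of "ereal s" "ereal t", OF _ assms] by simp
  with s show "0 \<le> s \<and> norm (ks_flow \<mu> s z) \<le> 1"
    using norm_lt_1_if_lt_time[of s \<mu> z] by simp
qed

lemma ks_flow_unique:
  assumes "ks_curve \<mu> {0..T} u" "\<And>t. t \<in> {0..T} \<Longrightarrow> norm (u t) \<le> 1" "t \<in> {0..T}"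
  shows "u t = ks_flow \<mu> t (u 0)"
proof (rule cut.flow_unique[OF _ assms(3)])
  show "solves (lam \<mu>) (\<lambda>a k. nl k (retract1 a)) {0..T} u"
    by (rule solves_change_F[OF _ assms(1)]) (simp add: retract1_id assms(2))
qed

lemma ks_flow_global:
  assumes "ks_curve \<mu> {0..} u" "\<And>t. 0 \<le> t \<Longrightarrow> norm (u t) < 1"
  shows "ks_time \<mu> (u 0) = \<infinity>" "0 \<le> t \<Longrightarrow> ks_flow \<mu> t (u 0) = u t"
proof -
  show u: "ks_flow \<mu> t (u 0) = u t" if "0 \<le> t" for t
  proof -
    have "u t = ks_flow \<mu> t (u 0)"
      by (rule ks_flow_unique[where T = t])
        (use solves_subset[OF assms(1), of "{0..t}"] that assms(2) in \<open>auto intro: less_imp_le\<close>)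
    then show ?thesis ..
  qed
  have "\<infinity> \<le> ks_time \<mu> (u 0)"
    by (rule time_geI) (simp add: u assms(2))
  then show "ks_time \<mu> (u 0) = \<infinity>" by simp
qed

lemma local_semiflow_ks: "local_semiflow (ks_flow \<mu>) (ks_time \<mu>)"
  unfolding local_semiflow_def
proof (intro conjI allI impI)
  show "0 \<le> ks_time \<mu> z" for z by (rule ks_time_nonneg)
  show "continuous_on {(t, z). 0 \<le> t \<and> ereal t < ks_time \<mu> z} (\<lambda>(t, z). ks_flow \<mu> t z)"
    by (rule continuous_on_subset[OF cut.continuous_flow]) auto
  show "ks_flow \<mu> 0 z = z" for z by (rule ks_flow_0)
next
  fix z s t assume a: "0 < s \<and> 0 < t \<and> ereal (s + t) < ks_time \<mu> z"
  \<comment> \<open>A time strictly in between leaves room for the strict inequality after the shift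
    by \<open>s\<close>.\<close>
  then obtain r where r: "ereal (s + t) < ereal r" "ereal r < ks_time \<mu> z"
    using ereal_dense2 by blast
  have "ereal (r - s) \<le> ks_time \<mu> (ks_flow \<mu> s z)"
  proof (rule time_geI)
    fix q assume q: "0 \<le> q" "ereal q < ereal (r - s)"
    then have "ereal (s + q) < ks_time \<mu> z"
      using r by (auto intro: le_less_trans[of _ "ereal r"])
    then have "norm (ks_flow \<mu> (s + q) z) < 1"
      using a q by (intro norm_lt_1_if_lt_time) auto
    then show "norm (ks_flow \<mu> q (ks_flow \<mu> s z)) < 1"
      using a q by (simp add: ks_flow_add)
  qed
  then show "ereal t < ks_time \<mu> (ks_flow \<mu> s z)"
    using r by (auto intro: less_le_trans[of _ "ereal (r - s)"])
  show "ks_flow \<mu> t (ks_flow \<mu> s z) = ks_flow \<mu> (t + s) z"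
    using a by (simp add: ks_flow_add add.commute[of t])
qed

text \<open>The identity change of coordinates is used on the open unit ball. There the retraction
  is the identity, so the solutions of the ladder are exactly the pieces of cut-off orbits before
  their exit.\<close>

lemma generates_ks: "generates (ks_solution_in_coords \<mu> (\<lambda>b. b) (ball 0 1)) (ks_flow \<mu>) (ks_time \<mu>)"
  unfolding generates_def
proof (intro conjI allI impI local_semiflow_ks)
  fix z u and T :: ereal assume T: "0 < T"
  let ?S = "{t. 0 \<le> t \<and> ereal t < T}"
  show "(ks_solution_in_coords \<mu> (\<lambda>b. b) (ball 0 1) T u \<and> u 0 = z) \<longleftrightarrow>
    (T \<le> ks_time \<mu> z \<and> (\<forall>t. 0 \<le> t \<and> ereal t < T \<longrightarrow> u t = ks_flow \<mu> t z))"
  proof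
    assume "ks_solution_in_coords \<mu> (\<lambda>b. b) (ball 0 1) T u \<and> u 0 = z"
    then have u: "ks_curve \<mu> ?S u" "\<And>t. 0 \<le> t \<Longrightarrow> ereal t < T \<Longrightarrow> norm (u t) < 1" "u 0 = z"
      by (auto simp: ks_solution_in_coords_def ks_solution_iff)
    have eq: "u t = ks_flow \<mu> t z" if t: "0 \<le> t" "ereal t < T" for t
    proof -
      have "u t = ks_flow \<mu> t (u 0)"
      proof (rule ks_flow_unique)
        have sub: "{0..t} \<subseteq> ?S"
          using le_less_trans[of "ereal _" "ereal t", OF _ t(2)] by auto
        show "ks_curve \<mu> {0..t} u" by (rule solves_subset[OF u(1) sub])
        show "norm (u s) \<le> 1" if "s \<in> {0..t}" for s
          using u(2)[of s] that sub by auto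
      qed (use t in auto)
      with u(3) show ?thesis by simp
    qed
    moreover have "T \<le> ks_time \<mu> z"
      by (rule time_geI) (use eq u(2) in fastforce)
    ultimately show "T \<le> ks_time \<mu> z \<and> (\<forall>t. 0 \<le> t \<and> ereal t < T \<longrightarrow> u t = ks_flow \<mu> t z)"
      by blast
  next
    assume R: "T \<le> ks_time \<mu> z \<and> (\<forall>t. 0 \<le> t \<and> ereal t < T \<longrightarrow> u t = ks_flow \<mu> t z)"
    then have n: "norm (ks_flow \<mu> t z) < 1" if "t \<in> ?S" for t
      using that by (intro norm_lt_1_if_lt_time) auto
    have "ks_curve \<mu> ?S (\<lambda>t. ks_flow \<mu> t z)"
      by (rule ks_curve_flow) (use n in \<open>auto intro: less_imp_le\<close>)
    then have c: "ks_curve \<mu> ?S u"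
      by (rule solves_cong[rotated]) (use R in auto)
    have "u 0 = z" using R T ks_flow_0 by (auto simp: zero_ereal_def)
    moreover have "u t \<in> ball 0 1" if "0 \<le> t \<and> ereal t < T" for t
      using n[of t] R that by auto
    ultimately show "ks_solution_in_coords \<mu> (\<lambda>b. b) (ball 0 1) T u \<and> u 0 = z"
      using c solvesD(1)[OF c] by (auto simp: ks_solution_in_coords_def ks_solution_iff)
  qed
qed

end

section \<open>Regions in which the first mode slaves all others\<close>

definition slaved :: "real \<Rightarrow> real \<Rightarrow> real \<Rightarrow> real \<Rightarrow> ell2 set" where
  "slaved r l h g = {a. \<bar>coord a 1\<bar> \<le> r \<and> - l * (coord a 1)\<^sup>2 \<le> coord a 2 \<and> coord a 2 \<le> - h * (coord a 1)\<^sup>2 \<and>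
     (\<forall>k\<ge>3. \<bar>coord a k\<bar> \<le> g * (1/5)^k * (coord a 1)\<^sup>2)}"

text \<open>The bounds on \<open>a\<^sub>2\<close> enclose its quasi-stationary value \<open>2 a\<^sub>1\<^sup>2 / \<lambda>\<^sub>2\<close>, about \<open>- a\<^sub>1\<^sup>2 / 6\<close>. The second, larger region is one in which all
  differential inequalities are derived: it contains small boxes around the points \<open>a\<close> of the former with \<open>a\<^sub>1 \<noteq> 0\<close>.\<close>

definition trap :: "ell2 set" where "trap = slaved (1/5) (1/5) (1/7) 1"

definition wide :: "ell2 set" where "wide = slaved (1/4) (1/4) (1/8) 2"

lemma trap_subset_wide: "trap \<subseteq> wide"
proof
  fix a assume "a \<in> trap"
  then have a: "\<bar>coord a 1\<bar> \<le> 1/5" "- (1/5) * (coord a 1)\<^sup>2 \<le> coord a 2" "coord a 2 \<le> - (1/7) * (coord a 1)\<^sup>2"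
    "\<And>k. 3 \<le> k \<Longrightarrow> \<bar>coord a k\<bar> \<le> (1/5)^k * (coord a 1)\<^sup>2"
    by (auto simp: trap_def slaved_def)
  have "0 \<le> (coord a 1)\<^sup>2" by simp
  moreover have "\<bar>coord a k\<bar> \<le> 2 * (1/5)^k * (coord a 1)\<^sup>2" if "3 \<le> k" for k
    using a(4)[OF that] mult_nonneg_nonneg[of "(1/5)^k" "(coord a 1)\<^sup>2"] by linarith
  ultimately show "a \<in> wide"
    using a(1-3) by (auto simp: wide_def slaved_def)
qed

lemma closed_slaved: "closed (slaved r l h g)"
  unfolding slaved_def
  by (intro closed_Collect_conj closed_Collect_le closed_Collect_all closed_Collect_imp open_Collect_const
      continuous_intros continuous_coord)

lemma norm_geom_le: "norm geom \<le> 1/4"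
proof -
  have eq: "(coord geom k)\<^sup>2 = (1/25)^k - (if k = 0 then 1 else 0)" for k
    by (simp add: coord_geom power2_eq_square power_mult_distrib[symmetric])
  have "(\<lambda>k. (1/25)^k - (if k = 0 then 1 else 0 :: real)) sums (1 / (1 - 1/25) - 1)"
    by (intro sums_diff geometric_sums sums_single) simp
  then have "(norm geom)\<^sup>2 = 1/24"
    unfolding norm_ell2_square eq by (simp add: sums_iff)
  also have "\<dots> \<le> (1/4)\<^sup>2" by (simp add: power2_eq_square)
  finally show ?thesis by (rule power2_le_imp_le) simp
qed

lemma abs_suminf_geometric_le:
  fixes f :: "nat \<Rightarrow> real"
  assumes "\<And>i. \<bar>f i\<bar> \<le> C * (1/25)^i" shows "\<bar>suminf f\<bar> \<le> C * (25/24)"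
proof -
  have s: "(\<lambda>i. C * (1/25::real)^i) sums (C * (1 / (1 - 1/25)))"
    by (intro sums_mult geometric_sums) simp
  have "norm (suminf f) \<le> (\<Sum>i. C * (1/25::real)^i)"
    by (rule norm_suminf_le[OF _ sums_summable[OF s]]) (use assms in simp)
  also have "\<dots> = C * (25/24)" using s by (simp add: sums_iff)
  finally show ?thesis by simp
qed

text \<open>The product 2 a_1 a_2 carries the cubic saturation; the remaining series involves only
  modes from 2 on and is of fourth order in a_1 on \<open>wide\<close>.\<close>

lemma nl_1_split: "nl 1 b = 2 * coord b 1 * coord b 2 + 2 * (\<Sum>i. coord b (i + 2) * coord b (i + 3))"
proof -
  let ?f = "\<lambda>i. coord b (Suc i) * coord b (1 + Suc i)"
  have "summable ?f"
    using summable_ignore_initial_segment[OF summable_coord_mult[of b "shift 1 b"], of 1]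
    by (simp add: coord_shift)
  from suminf_split_head[OF this]
  have "suminf ?f = coord b 1 * coord b 2 + (\<Sum>i. coord b (i + 2) * coord b (i + 3))"
    by (simp add: numeral_2_eq_2 numeral_3_eq_3)
  moreover have "inner b (reflect 1 b) = 0" by (simp add: inner_reflect)
  ultimately show ?thesis by (simp add: nl_def bil_def inner_shift)
qed

context
  fixes a :: ell2 assumes a: "a \<in> wide"
begin

abbreviation (input) "\<alpha> \<equiv> coord a 1"

lemma wide_coords:
  shows "\<bar>\<alpha>\<bar> \<le> 1/4" "- (1/4) * \<alpha>\<^sup>2 \<le> coord a 2" "coord a 2 \<le> - (1/8) * \<alpha>\<^sup>2"
    "3 \<le> k \<Longrightarrow> \<bar>coord a k\<bar> \<le> 2 * (1/5)^k * \<alpha>\<^sup>2"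
  using a by (auto simp: wide_def slaved_def)

text \<open>One geometric bound for all slaved modes; the constant is dictated by mode 2, where 1/4
  = 25/4 * 5^-2.\<close>

lemma wide_coord_le:
  assumes "2 \<le> k" shows "\<bar>coord a k\<bar> \<le> 25/4 * (1/5)^k * \<alpha>\<^sup>2"
proof (cases "k = 2")
  case True
  then show ?thesis using wide_coords(2,3) by (simp add: power2_eq_square abs_le_iff)
next
  case False
  then have "\<bar>coord a k\<bar> \<le> 2 * ((1/5)^k * \<alpha>\<^sup>2)" using wide_coords(4)[of k] assms by simp
  also have "\<dots> \<le> 25/4 * ((1/5)^k * \<alpha>\<^sup>2)" by (rule mult_right_mono) auto
  finally show ?thesis by simp
qed

text \<open>40 rounds up (25/4)^2 = 625/16, and the weights multiply to a power that depends only on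
  \<open>i + j\<close>.\<close>

lemma wide_prod_le_4:
  assumes "2 \<le> i" "2 \<le> j" shows "\<bar>coord a i * coord a j\<bar> \<le> 40 * (1/5)^(i + j) * \<alpha>^4"
proof -
  have "\<bar>coord a i\<bar> * \<bar>coord a j\<bar> \<le> (25/4 * (1/5)^i * \<alpha>\<^sup>2) * (25/4 * (1/5)^j * \<alpha>\<^sup>2)"
    by (intro mult_mono wide_coord_le assms) auto
  also have "\<dots> = 625/16 * ((1/5)^(i + j) * \<alpha>^4)"
    by (simp add: power_add power2_eq_square power4_eq_xxxx)
  also have "\<dots> \<le> 40 * ((1/5)^(i + j) * \<alpha>^4)" by (rule mult_right_mono) auto
  finally show ?thesis by (simp add: abs_mult)
qed

lemma wide_prod_le_3:
  assumes "1 \<le> i" "1 \<le> j" "3 \<le> i + j"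
  shows "\<bar>coord a i * coord a j\<bar> \<le> 40 * (1/5)^(i + j) * \<bar>\<alpha>\<bar>^3"
proof -
  have one: "\<bar>\<alpha> * coord a n\<bar> \<le> 40 * (1/5)^(1 + n) * \<bar>\<alpha>\<bar>^3" if "2 \<le> n" for n
  proof -
    have "\<bar>\<alpha>\<bar> * \<bar>coord a n\<bar> \<le> \<bar>\<alpha>\<bar> * (25/4 * (1/5)^n * \<alpha>\<^sup>2)"
      by (intro mult_left_mono wide_coord_le that) auto
    also have "\<dots> = 125/4 * ((1/5)^(1 + n) * \<bar>\<alpha>\<bar>^3)"
      by (simp add: power3_eq_cube power2_eq_square)
    also have "\<dots> \<le> 40 * ((1/5)^(1 + n) * \<bar>\<alpha>\<bar>^3)" by (rule mult_right_mono) auto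
    finally show ?thesis by (simp add: abs_mult)
  qed
  consider "i = 1" "2 \<le> j" | "j = 1" "2 \<le> i" | "2 \<le> i" "2 \<le> j" using assms by linarith
  then show ?thesis
  proof cases
    case 1 then show ?thesis using one[of j] by simp
  next
    case 2 then show ?thesis using one[of i] by (simp add: mult.commute)
  next
    case 3
    have "\<alpha>^4 = \<bar>\<alpha>\<bar> * \<bar>\<alpha>\<bar>^3" by (simp add: power4_eq_xxxx power3_eq_cube)
    also have "\<dots> \<le> 1 * \<bar>\<alpha>\<bar>^3" using wide_coords(1) by (intro mult_right_mono) auto
    finally have "40 * (1/5)^(i + j) * \<alpha>^4 \<le> 40 * (1/5)^(i + j) * \<bar>\<alpha>\<bar>^3"
      by (intro mult_left_mono) auto
    with wide_prod_le_4[OF 3] show ?thesis by linarith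
  qed
qed

text \<open>The index sums grow by 2 from term to term, so the series is geometric of ratio 1/25
  with first term 40/25; times 25/24 this is 5/3.\<close>

lemma wide_inner_shift_le:
  assumes "1 \<le> k" shows "\<bar>inner a (shift k a)\<bar> \<le> 5/3 * (1/5)^k * \<bar>\<alpha>\<bar>^3"
proof -
  have "\<bar>inner a (shift k a)\<bar> \<le> 40 * (1/5)^k * \<bar>\<alpha>\<bar>^3 / 25 * (25/24)"
    unfolding inner_shift
  proof (rule abs_suminf_geometric_le)
    fix i
    have "\<bar>coord a (Suc i) * coord a (k + Suc i)\<bar> \<le> 40 * (1/5)^(Suc i + (k + Suc i)) * \<bar>\<alpha>\<bar>^3"
      using assms by (intro wide_prod_le_3) auto
    also have "(1/5::real)^(Suc i + (k + Suc i)) = (1/5)^k * (1/25)^i / 25"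
      by (simp add: power_add power_mult_distrib[symmetric])
    finally show "\<bar>coord a (Suc i) * coord a (k + Suc i)\<bar> \<le> 40 * (1/5)^k * \<bar>\<alpha>\<bar>^3 / 25 * (1/25)^i"
      by (simp add: ac_simps)
  qed
  then show ?thesis by simp
qed

text \<open>Each of the k - 1 convolution terms has the same bound 40 * 5^-k * |a_1|^3, which gives
  40 k (k - 1); the shift series contributes 10/3 k, rounded up to 4 k.\<close>

lemma wide_nl_ge_3:
  assumes "3 \<le> k" shows "\<bar>nl k a\<bar> \<le> (40 * (real k)\<^sup>2 - 36 * real k) * (1/5)^k * \<bar>\<alpha>\<bar>^3"
proof -
  define c where "c = (1/5)^k * \<bar>\<alpha>\<bar>^3"
  have "0 \<le> c" by (simp add: c_def)
  have "\<bar>inner a (reflect k a)\<bar> \<le> (\<Sum>i = 1..k - 1. \<bar>coord a i * coord a (k - i)\<bar>)"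
    unfolding inner_reflect by (rule sum_abs)
  also have "\<dots> \<le> of_nat (card {1..k - 1}) * (40 * c)"
  proof (rule sum_bounded_above)
    fix i assume "i \<in> {1..k - 1}"
    then show "\<bar>coord a i * coord a (k - i)\<bar> \<le> 40 * c"
      using wide_prod_le_3[of i "k - i"] assms by (auto simp: c_def ac_simps)
  qed
  also have "\<dots> = (real k - 1) * (40 * c)" using assms by (simp add: of_nat_diff)
  finally have "real k * \<bar>inner a (reflect k a)\<bar> \<le> real k * ((real k - 1) * (40 * c))"
    by (rule mult_left_mono) simp
  moreover have "2 * real k * \<bar>inner a (shift k a)\<bar> \<le> 2 * real k * (5/3 * c)"
    using wide_inner_shift_le[of k] assms by (intro mult_left_mono) (auto simp: c_def)
  moreover have "\<bar>nl k a\<bar> \<le> 2 * real k * \<bar>inner a (shift k a)\<bar> + real k * \<bar>inner a (reflect k a)\<bar>"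
    unfolding nl_def bil_def by (rule order_trans[OF abs_triangle_ineq4]) (simp add: abs_mult)
  moreover have "2 * real k * (5/3 * c) \<le> 4 * real k * c"
    using \<open>0 \<le> c\<close> by (simp add: mult_right_mono)
  ultimately have "\<bar>nl k a\<bar> \<le> 4 * real k * c + real k * ((real k - 1) * (40 * c))" by linarith
  then show ?thesis by (simp add: c_def power2_eq_square algebra_simps)
qed

text \<open>The convolution for mode 2 is the single term a_1^2, the forcing that keeps a_2 near -
  a_1^2 / 6.\<close>

lemma wide_nl_2: "\<bar>nl 2 a + 2 * \<alpha>\<^sup>2\<bar> \<le> 4/15 * \<bar>\<alpha>\<bar>^3"
proof -
  have "{1..2 - 1::nat} = {1}" by auto
  then have "inner a (reflect 2 a) = \<alpha>\<^sup>2"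
    unfolding inner_reflect by (simp add: power2_eq_square)
  then show ?thesis
    using wide_inner_shift_le[of 2] by (simp add: nl_def bil_def power2_eq_square)
qed

lemma wide_nl_1: "\<bar>nl 1 a - 2 * \<alpha> * coord a 2\<bar> \<le> 2/75 * \<alpha>^4"
proof -
  have "\<bar>\<Sum>i. coord a (i + 2) * coord a (i + 3)\<bar> \<le> 40/3125 * \<alpha>^4 * (25/24)"
  proof (rule abs_suminf_geometric_le)
    fix i
    have "\<bar>coord a (i + 2) * coord a (i + 3)\<bar> \<le> 40 * (1/5)^((i + 2) + (i + 3)) * \<alpha>^4"
      by (intro wide_prod_le_4) auto
    also have "(1/5::real)^((i + 2) + (i + 3)) = (1/5)^(2 * i + 5)" by (rule arg_cong[where f = "power _"]) simp
    also have "\<dots> = (1/25)^i / 3125" by (simp only: power_add power_mult) (simp add: power_divide)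
    finally show "\<bar>coord a (i + 2) * coord a (i + 3)\<bar> \<le> 40/3125 * \<alpha>^4 * (1/25)^i"
      by (simp add: ac_simps)
  qed
  then show ?thesis unfolding nl_1_split by simp
qed

text \<open>The cubic damping: 2 a_2 / a_1^2 lies between -1/2 and -1/4, and the remainder is at
  most 2/75 * 1/4 of a_1^4. The first estimate keeps a_2, because at |a_1| = 1/5 the coarse constant
  24/100 does not beat the largest linear growth.\<close>

lemma wide_mult_nl_1:
  shows "\<alpha> * nl 1 a \<le> 2 * \<alpha>\<^sup>2 * coord a 2 + 2/75 * (\<alpha>\<^sup>2 * \<bar>\<alpha>\<bar>^3)"
    and "- (51/100) * \<alpha>^4 \<le> \<alpha> * nl 1 a" "\<alpha> * nl 1 a \<le> - (24/100) * \<alpha>^4"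
proof -
  have e: "\<bar>\<alpha> * nl 1 a - 2 * \<alpha>\<^sup>2 * coord a 2\<bar> \<le> 2/75 * (\<alpha>\<^sup>2 * \<bar>\<alpha>\<bar>^3)"
  proof -
    have "\<bar>\<alpha>\<bar> * \<bar>nl 1 a - 2 * \<alpha> * coord a 2\<bar> \<le> \<bar>\<alpha>\<bar> * (2/75 * \<alpha>^4)"
      by (intro mult_left_mono wide_nl_1) auto
    moreover have "\<alpha> * nl 1 a - 2 * \<alpha>\<^sup>2 * coord a 2 = \<alpha> * (nl 1 a - 2 * \<alpha> * coord a 2)"
      by (simp add: algebra_simps power2_eq_square)
    moreover have "\<bar>\<alpha>\<bar> * \<alpha>^4 = \<alpha>\<^sup>2 * \<bar>\<alpha>\<bar>^3"
      by (cases "0 \<le> \<alpha>") (auto simp: power2_eq_square power3_eq_cube power4_eq_xxxx)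
    ultimately show ?thesis by (simp add: abs_mult)
  qed
  then show "\<alpha> * nl 1 a \<le> 2 * \<alpha>\<^sup>2 * coord a 2 + 2/75 * (\<alpha>\<^sup>2 * \<bar>\<alpha>\<bar>^3)" by linarith
  have "\<alpha>\<^sup>2 * \<bar>\<alpha>\<bar>^3 = \<bar>\<alpha>\<bar> * \<alpha>^4"
    by (cases "0 \<le> \<alpha>") (auto simp: power2_eq_square power3_eq_cube power4_eq_xxxx)
  also have "\<dots> \<le> 1/4 * \<alpha>^4" using wide_coords(1) by (intro mult_right_mono) auto
  finally have s: "\<alpha>\<^sup>2 * \<bar>\<alpha>\<bar>^3 \<le> 1/4 * \<alpha>^4" .
  have "\<alpha>\<^sup>2 * (- (1/4) * \<alpha>\<^sup>2) \<le> \<alpha>\<^sup>2 * coord a 2" "\<alpha>\<^sup>2 * coord a 2 \<le> \<alpha>\<^sup>2 * (- (1/8) * \<alpha>\<^sup>2)"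
    by (intro mult_left_mono wide_coords; simp)+
  then have b: "- (1/4) * \<alpha>^4 \<le> \<alpha>\<^sup>2 * coord a 2" "\<alpha>\<^sup>2 * coord a 2 \<le> - (1/8) * \<alpha>^4"
    by (simp_all add: power2_eq_square power4_eq_xxxx)
  have p: "0 \<le> \<alpha>^4" by simp
  show "- (51/100) * \<alpha>^4 \<le> \<alpha> * nl 1 a" "\<alpha> * nl 1 a \<le> - (24/100) * \<alpha>^4"
    using e s b p unfolding abs_le_iff by linarith+
qed

lemma wide_le_geom:
  assumes "1 \<le> k" shows "\<bar>coord a k\<bar> \<le> coord ((5/4) *\<^sub>R geom) k"
proof (cases "k = 1")
  case True then show ?thesis using wide_coords(1) by (simp add: coord_geom)
next
  case False
  then have "\<bar>coord a k\<bar> \<le> 25/4 * (1/5)^k * \<alpha>\<^sup>2" using assms by (intro wide_coord_le) auto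
  also have "\<alpha>\<^sup>2 \<le> (1/4)\<^sup>2" using wide_coords(1) by (simp add: abs_le_square_iff[symmetric])
  then have "25/4 * (1/5)^k * \<alpha>\<^sup>2 \<le> 25/4 * (1/5)^k * (1/4)\<^sup>2" by (intro mult_left_mono) auto
  also have "\<dots> \<le> 5/4 * (1/5)^k" by (simp add: power2_eq_square)
  finally show ?thesis using assms by (simp add: coord_geom)
qed

text \<open>Places the region inside the unit ball, where the semiflow of the ladder was
  constructed.\<close>

lemma norm_wide: "norm a < 1"
proof -
  have "norm a \<le> norm ((5/4) *\<^sub>R geom)"
    by (rule norm_coord_mono) (rule order_trans[OF wide_le_geom abs_ge_self])
  then show ?thesis using norm_geom_le by simp
qed

end

lemma compact_trap: "compact trap"
proof -
  have "trap = trap \<inter> {a. \<forall>k\<ge>1. \<bar>coord a k\<bar> \<le> coord ((5/4) *\<^sub>R geom) k}"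
    using wide_le_geom trap_subset_wide by blast
  also have "compact \<dots>"
    unfolding trap_def by (intro closed_Int_compact closed_slaved compact_ell2_box)
  finally show ?thesis .
qed

lemma zero_in_trap: "0 \<in> trap"
  by (simp add: trap_def slaved_def)

lemma wide_zero_iff:
  assumes "a \<in> wide" shows "coord a 1 = 0 \<longleftrightarrow> a = 0"
proof
  assume *: "coord a 1 = 0"
  show "a = 0"
  proof (rule ell2_eqI)
    fix k :: nat
    consider "k = 0" | "k = 1" | "2 \<le> k" by linarith
    then show "coord a k = coord 0 k"
      using wide_coord_le[OF assms, of k] * by cases auto
  qed
qed simp

section \<open>Forward invariance of the trapping region\<close>

definition clip :: "real \<Rightarrow> real \<Rightarrow> real \<Rightarrow> real" where
  "clip l u x = max l (min u x)"

lemma clip_id: "l \<le> x \<Longrightarrow> x \<le> u \<Longrightarrow> clip l u x = x"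
  by (simp add: clip_def)

lemma clip_bounds: "l \<le> u \<Longrightarrow> l \<le> clip l u x \<and> clip l u x \<le> u"
  by (simp add: clip_def)

lemma clip_diff: "\<bar>l - l'\<bar> \<le> c \<Longrightarrow> \<bar>u - u'\<bar> \<le> c \<Longrightarrow> \<bar>clip l u x - clip l' u' x'\<bar> \<le> \<bar>x - x'\<bar> + c"
  unfolding clip_def by (auto simp: max_def min_def)

definition lower :: "nat \<Rightarrow> real" where "lower k = (if k = 2 then - 1/5 else - ((1/5)^k))"
definition upper :: "nat \<Rightarrow> real" where "upper k = (if k = 2 then - 1/7 else (1/5)^k)"
definition main_mode :: "ell2 \<Rightarrow> real" where "main_mode a = clip (- 1/5) (1/5) (coord a 1)"

text \<open>A retraction used as a second cut-off. The nonlinearity is then evaluated at a point of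
  \<open>trap\<close> even if the solution were outside, so its bounds hold without a priori
  information, and the infinitely many faces can be examined one at a time.\<close>

definition to_trap :: "ell2 \<Rightarrow> ell2" where
  "to_trap a = Abs_ell2 (\<lambda>k. if k = 0 then 0 else if k = 1 then main_mode a
     else clip (lower k * (main_mode a)\<^sup>2) (upper k * (main_mode a)\<^sup>2) (coord a k))"

lemma lower_upper:
  shows "lower k \<le> upper k" "1 \<le> k \<Longrightarrow> \<bar>lower k\<bar> \<le> 5 * (1/5)^k" "1 \<le> k \<Longrightarrow> \<bar>upper k\<bar> \<le> 5 * (1/5)^k"
  by (auto simp: lower_def upper_def power2_eq_square)

lemma abs_main_mode: "\<bar>main_mode a\<bar> \<le> 1/5"
  using clip_bounds[of "- 1/5" "1/5" "coord a 1"]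
  unfolding main_mode_def abs_le_iff by linarith

lemma main_mode_square: "(main_mode a)\<^sup>2 \<le> 1/25"
  using abs_main_mode[of a] abs_le_square_iff[of "main_mode a" "1/5"] by (simp add: power2_eq_square)

lemma coord_to_trap:
  "coord (to_trap a) k = (if k = 0 then 0 else if k = 1 then main_mode a
     else clip (lower k * (main_mode a)\<^sup>2) (upper k * (main_mode a)\<^sup>2) (coord a k))"
  and norm_to_trap_le: "norm (to_trap a) \<le> 1/4"
proof -
  let ?f = "\<lambda>k. if k = 0 then 0 else if k = 1 then main_mode a
     else clip (lower k * (main_mode a)\<^sup>2) (upper k * (main_mode a)\<^sup>2) (coord a k)"
  have le: "\<bar>?f k\<bar> \<le> coord geom k" if "1 \<le> k" for k
  proof (cases "k = 1")
    case True then show ?thesis using abs_main_mode by (simp add: coord_geom)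
  next
    case False
    let ?s = "(main_mode a)\<^sup>2"
    have "lower k * ?s \<le> upper k * ?s" by (intro mult_right_mono lower_upper) simp
    then have "\<bar>?f k\<bar> \<le> max \<bar>lower k * ?s\<bar> \<bar>upper k * ?s\<bar>"
      using clip_bounds[of "lower k * ?s" "upper k * ?s" "coord a k"] that False by (auto simp: max_def)
    also have "\<dots> \<le> 5 * (1/5)^k * (1/25)"
    proof -
      have "\<bar>c * ?s\<bar> \<le> 5 * (1/5)^k * (1/25)" if "\<bar>c\<bar> \<le> 5 * (1/5)^k" for c
        using mult_mono[OF that main_mode_square[of a]] by (simp add: abs_mult)
      then show ?thesis using lower_upper(2,3)[OF that] by (simp del: times_divide_eq_right)
    qed
    also have "\<dots> \<le> (1/5)^k" by simp
    finally show ?thesis using that by (simp add: coord_geom)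
  qed
  have "coord (to_trap a) = ?f"
    unfolding to_trap_def by (rule ell2_dominated(1)[of _ geom]) (simp, rule le)
  then show "coord (to_trap a) k = ?f k" by simp
  have "norm (to_trap a) \<le> norm geom"
    unfolding to_trap_def by (rule ell2_dominated(2)) (simp, rule le)
  then show "norm (to_trap a) \<le> 1/4" using norm_geom_le by simp
qed

lemma to_trap_in_trap: "to_trap a \<in> trap"
proof -
  let ?s = "(main_mode a)\<^sup>2"
  have b: "lower k * ?s \<le> coord (to_trap a) k \<and> coord (to_trap a) k \<le> upper k * ?s" if "2 \<le> k" for k
  proof -
    have "lower k * ?s \<le> upper k * ?s" by (intro mult_right_mono lower_upper) simp
    then show ?thesis using clip_bounds[of "lower k * ?s" "upper k * ?s" "coord a k"] that
      by (simp add: coord_to_trap)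
  qed
  have "\<bar>coord (to_trap a) k\<bar> \<le> (1/5)^k * ?s" if "3 \<le> k" for k
    using b[of k] that by (auto simp: lower_def upper_def abs_le_iff)
  moreover have "coord (to_trap a) 1 = main_mode a" by (simp add: coord_to_trap)
  ultimately show ?thesis
    using b[of 2] abs_main_mode[of a] by (simp add: trap_def slaved_def lower_def upper_def)
qed

lemma to_trap_id:
  assumes "a \<in> trap" shows "to_trap a = a"
proof (rule ell2_eqI)
  fix k
  have a: "\<bar>coord a 1\<bar> \<le> 1/5" "- (1/5) * (coord a 1)\<^sup>2 \<le> coord a 2" "coord a 2 \<le> - (1/7) * (coord a 1)\<^sup>2"
    "3 \<le> k \<Longrightarrow> \<bar>coord a k\<bar> \<le> (1/5)^k * (coord a 1)\<^sup>2"
    using assms by (auto simp: trap_def slaved_def)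
  have m: "main_mode a = coord a 1"
    unfolding main_mode_def by (rule clip_id) (use a(1) in \<open>auto simp: abs_le_iff\<close>)
  consider "k = 0" | "k = 1" | "k = 2" | "3 \<le> k" by linarith
  then show "coord (to_trap a) k = coord a k"
  proof cases
    case 3 then show ?thesis using a by (simp add: coord_to_trap m lower_def upper_def clip_id)
  next
    case 4 then show ?thesis
      using a(4) by (simp add: coord_to_trap m lower_def upper_def clip_id abs_le_iff)
  qed (simp_all add: coord_to_trap m)
qed

text \<open>The faces move with the square of the first mode, whose Lipschitz constant is 2/5; the
  multiple of \<open>geom\<close> collects the induced shifts of all faces.\<close>

lemma to_trap_lipschitz: "norm (to_trap a - to_trap b) \<le> 2 * norm (a - b)"
proof -
  let ?d = "norm (a - b)"
  have m: "\<bar>main_mode a - main_mode b\<bar> \<le> \<bar>coord a 1 - coord b 1\<bar>"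
    unfolding main_mode_def using clip_diff[of "-1/5" "-1/5" 0 "1/5" "1/5"] by simp
  also have "\<dots> \<le> ?d" using abs_coord_le_norm[of "a - b" 1] by simp
  finally have md: "\<bar>main_mode a - main_mode b\<bar> \<le> ?d" .
  have "\<bar>(main_mode a)\<^sup>2 - (main_mode b)\<^sup>2\<bar> = \<bar>main_mode a + main_mode b\<bar> * \<bar>main_mode a - main_mode b\<bar>"
    by (simp add: abs_mult[symmetric] algebra_simps power2_eq_square)
  also have "\<dots> \<le> 2/5 * ?d"
  proof (rule mult_mono[OF _ md])
    show "\<bar>main_mode a + main_mode b\<bar> \<le> 2/5"
      using abs_main_mode[of a] abs_main_mode[of b] by linarith
  qed auto
  finally have sq: "\<bar>(main_mode a)\<^sup>2 - (main_mode b)\<^sup>2\<bar> \<le> 2/5 * ?d" .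
  have "norm (to_trap a - to_trap b) \<le> norm (abs_ell2 (a - b) + (2 * ?d) *\<^sub>R geom)"
  proof (rule norm_coord_mono)
    fix k :: nat assume k: "1 \<le> k"
    have "\<bar>coord (to_trap a - to_trap b) k\<bar> \<le> \<bar>coord a k - coord b k\<bar> + 2 * ?d * (1/5)^k"
    proof (cases "k = 1")
      case True
      have "0 \<le> 2 * ?d * (1/5)^k" by simp
      moreover have "coord (to_trap a - to_trap b) k = main_mode a - main_mode b"
        using True by (simp add: coord_to_trap)
      ultimately show ?thesis using m unfolding True by linarith
    next
      case False
      have c: "\<bar>c * (main_mode a)\<^sup>2 - c * (main_mode b)\<^sup>2\<bar> \<le> 2 * ?d * (1/5)^k" if "\<bar>c\<bar> \<le> 5 * (1/5)^k" for c
      proof -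
        have "\<bar>c * (main_mode a)\<^sup>2 - c * (main_mode b)\<^sup>2\<bar> = \<bar>c\<bar> * \<bar>(main_mode a)\<^sup>2 - (main_mode b)\<^sup>2\<bar>"
          by (simp add: abs_mult[symmetric] algebra_simps)
        also have "\<dots> \<le> (5 * (1/5)^k) * (2/5 * ?d)"
          using that sq by (intro mult_mono) auto
        finally show ?thesis by simp
      qed
      show ?thesis
        using clip_diff[OF c[OF lower_upper(2)[OF k]] c[OF lower_upper(3)[OF k]]] False k
        by (simp add: coord_to_trap)
    qed
    then show "\<bar>coord (to_trap a - to_trap b) k\<bar> \<le> \<bar>coord (abs_ell2 (a - b) + (2 * ?d) *\<^sub>R geom) k\<bar>"
      using k by (intro order_trans[OF _ abs_ge_self]) (simp add: coord_geom)
  qed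
  also have "\<dots> \<le> norm (abs_ell2 (a - b)) + norm ((2 * ?d) *\<^sub>R geom)"
    by (rule norm_triangle_ineq)
  also have "\<dots> \<le> ?d + 2 * ?d * (1/4)"
    using mult_left_mono[OF norm_geom_le, of "2 * ?d"] by simp
  finally show ?thesis using norm_ge_zero[of "a - b"] by linarith
qed

lemma semilinear_trap:
  assumes "(99/100) \<le> \<mu>" shows "semilinear (lam \<mu>) (\<lambda>a k. nl k (to_trap a)) 3"
proof
  fix k a b
  have "norm (to_trap a - to_trap b) * (norm (to_trap a) + norm (to_trap b)) \<le> (2 * norm (a - b)) * (1/4 + 1/4)"
    by (intro mult_mono add_mono norm_to_trap_le to_trap_lipschitz) auto
  then have "3 * real k * (norm (to_trap a - to_trap b) * (norm (to_trap a) + norm (to_trap b)))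
      \<le> 3 * real k * ((2 * norm (a - b)) * (1/4 + 1/4))"
    by (intro mult_left_mono) auto
  with nl_lipschitz[of k "to_trap a" "to_trap b"]
  show "\<bar>nl k (to_trap a) - nl k (to_trap b)\<bar> \<le> 3 * real k * norm (a - b)"
    by simp
qed (use lam_le_quartic[OF assms] in \<open>auto simp: to_trap_id zero_in_trap\<close>)

text \<open>The second rate is 4 - 16 \<mu>, about -12. For k \<ge> 3 the destabilising k^2 is at
  most k^4 / 9, and 99/100 - 1/9 exceeds 87/100.\<close>

lemma lam_bounds:
  assumes "(99/100) \<le> \<mu>" "\<mu> \<le> (101/100)"
  shows "lam \<mu> 1 = 1 - \<mu>" "- (1216/100) \<le> lam \<mu> 2" "lam \<mu> 2 \<le> - (1184/100)"
    "lam \<mu> k \<le> (real k)\<^sup>2 - (99/100) * real k ^ 4" "3 \<le> k \<Longrightarrow> lam \<mu> k \<le> - (87/100) * real k ^ 4"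
proof -
  show "lam \<mu> 1 = 1 - \<mu>" "- (1216/100) \<le> lam \<mu> 2" "lam \<mu> 2 \<le> - (1184/100)"
    using assms by (auto simp: lam_def)
  have "(99/100) * real k ^ 4 \<le> \<mu> * real k ^ 4" using assms by (intro mult_right_mono) auto
  moreover have "lam \<mu> k = (real k)\<^sup>2 - \<mu> * real k ^ 4"
    by (simp add: lam_def algebra_simps power2_eq_square power4_eq_xxxx)
  ultimately show *: "lam \<mu> k \<le> (real k)\<^sup>2 - (99/100) * real k ^ 4" by simp
  assume "3 \<le> k"
  then have "3\<^sup>2 \<le> (real k)\<^sup>2" by (intro power_mono) auto
  then have "9 * (real k)\<^sup>2 \<le> (real k)\<^sup>2 * (real k)\<^sup>2" by (intro mult_right_mono) auto
  then have "9 * (real k)\<^sup>2 \<le> real k ^ 4" by (simp add: power2_eq_square power4_eq_xxxx)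
  moreover have "0 \<le> real k ^ 4" by simp
  ultimately show "lam \<mu> k \<le> - (87/100) * real k ^ 4" using * by linarith
qed

context
  fixes \<mu> :: real assumes mu: "(99/100) \<le> \<mu>" "\<mu> \<le> (101/100)"
begin

text \<open>Every face is a barrier for the cut-off system. The faces for a_2 and the high modes
  scale with a_1^2, so the inequalities on them are strict only for a_1 \<noteq> 0; this is why the
  pinch point is excluded.\<close>

lemma trap_invariant_aux:
  assumes u: "solves (lam \<mu>) (\<lambda>a k. nl k (to_trap a)) {0..} u" and u0: "u 0 \<in> trap" "coord (u 0) 1 \<noteq> 0"
    and T: "0 \<le> T"
  shows "u T \<in> trap"
proof -
  have d: "((\<lambda>s. coord (u s) k) has_real_derivative lam \<mu> k * coord (u t) k + nl k (to_trap (u t))) (at t within {0..T})"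
    if "1 \<le> k" "t \<in> {0..T}" for k t T
    by (rule solvesD(2)[OF solves_subset[OF u] that]) auto
  have tw: "to_trap b \<in> wide" for b using to_trap_in_trap trap_subset_wide by blast
  have nl1: "- (51/100) * (main_mode b)^4 \<le> main_mode b * nl 1 (to_trap b)"
    "main_mode b * nl 1 (to_trap b) \<le> - (24/100) * (main_mode b)^4" for b
    using wide_mult_nl_1(2,3)[OF tw[of b]] by (simp_all add: coord_to_trap)
  \<comment> \<open>At |a_1| = 1/5 the bound a_2 \<le> - a_1^2 / 7 yields a damping of 2/4375, which
    even after the remainder exceeds 1/2500, the largest linear growth.\<close>
  have u1: "\<bar>coord (u t) 1\<bar> \<le> 1/5" if "0 \<le> t" for t
  proof -
    have "0 \<le> 1/25 - (coord (u t) 1)\<^sup>2"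
    proof (rule barrier[where f = "\<lambda>t. 1/25 - (coord (u t) 1)\<^sup>2" and a = 0])
      show "0 \<le> 1/25 - (coord (u 0) 1)\<^sup>2"
        using u0(1) abs_le_square_iff[of "coord (u 0) 1" "1/5"]
        by (simp add: trap_def slaved_def power2_eq_square)
      fix s assume s: "s \<in> {0..t}"
      show "((\<lambda>t. 1/25 - (coord (u t) 1)\<^sup>2) has_real_derivative
          - 2 * coord (u s) 1 * (lam \<mu> 1 * coord (u s) 1 + nl 1 (to_trap (u s)))) (at s within {0..t})"
        using d[OF _ s, of 1] by (auto intro!: derivative_eq_intros)
      assume "1/25 - (coord (u s) 1)\<^sup>2 = 0"
      then have sq: "(coord (u s) 1)\<^sup>2 = (1/5)\<^sup>2" by (simp add: power2_eq_square)
      then have ab: "\<bar>coord (u s) 1\<bar> = 1/5" by (metis abs_of_nonneg real_sqrt_abs zero_le_divide_1_iff zero_le_numeral)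
      have m: "main_mode (u s) = coord (u s) 1"
        unfolding main_mode_def using ab by (intro clip_id) (auto simp: abs_if split: if_splits)
      let ?b = "to_trap (u s)"
      have b1: "coord ?b 1 = coord (u s) 1" by (simp add: coord_to_trap m)
      have "coord ?b 2 \<le> - (1/7) * (coord ?b 1)\<^sup>2"
        using to_trap_in_trap[of "u s"] by (auto simp: trap_def slaved_def)
      then have b2: "coord ?b 2 \<le> - (1/175)" unfolding b1 sq by (simp add: power2_eq_square)
      have "coord (u s) 1 * nl 1 ?b \<le> 2 * (coord ?b 1)\<^sup>2 * coord ?b 2 + 2/75 * ((coord ?b 1)\<^sup>2 * \<bar>coord ?b 1\<bar>^3)"
        using wide_mult_nl_1(1)[OF tw[of "u s"]] b1 by simp
      also have "\<dots> \<le> 2/25 * (- (1/175)) + 2/75 * (1/25 * (1/5)^3)"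
        unfolding b1 sq ab using b2 by (simp add: power2_eq_square)
      finally have "coord (u s) 1 * nl 1 ?b < - (1/2500)" by (simp add: power3_eq_cube)
      moreover have "lam \<mu> 1 * (coord (u s) 1)\<^sup>2 \<le> 1/2500"
        unfolding lam_bounds(1)[OF mu] sq using mu by (simp add: power2_eq_square)
      ultimately show "0 < - 2 * coord (u s) 1 * (lam \<mu> 1 * coord (u s) 1 + nl 1 ?b)"
        by (simp add: algebra_simps power2_eq_square)
    qed (use that in auto)
    then have "(coord (u t) 1)\<^sup>2 \<le> (1/5)\<^sup>2" by (simp add: power2_eq_square)
    then show ?thesis by (simp add: abs_le_square_iff[symmetric])
  qed
  have m: "main_mode (u t) = coord (u t) 1" if "0 \<le> t" for t
    unfolding main_mode_def using u1[OF that] by (intro clip_id) (auto simp: abs_le_iff)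
  have sq: "(coord (u t) 1)\<^sup>2 \<le> 1/25" if "0 \<le> t" for t
    using main_mode_square[of "u t"] m[OF that] by simp
  have quart: "(coord (u t) 1)^4 \<le> 1/25 * (coord (u t) 1)\<^sup>2" if "0 \<le> t" for t
    using mult_right_mono[OF sq[OF that], of "(coord (u t) 1)\<^sup>2"]
    by (simp add: power2_eq_square power4_eq_xxxx)
  have lam1: "- (1/100) * (coord (u t) 1)\<^sup>2 \<le> lam \<mu> 1 * (coord (u t) 1)\<^sup>2" "lam \<mu> 1 * (coord (u t) 1)\<^sup>2 \<le> (1/100) * (coord (u t) 1)\<^sup>2" for t
  proof -
    have "- (1/100) \<le> lam \<mu> 1" "lam \<mu> 1 \<le> 1/100" using lam_bounds(1)[OF mu] mu by linarith+
    then show "- (1/100) * (coord (u t) 1)\<^sup>2 \<le> lam \<mu> 1 * (coord (u t) 1)\<^sup>2" "lam \<mu> 1 * (coord (u t) 1)\<^sup>2 \<le> (1/100) * (coord (u t) 1)\<^sup>2"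
      by (simp_all only: mult_right_mono zero_le_power2)
  qed
  \<comment> \<open>\<open>g\<close> is half the derivative of a_1^2. Its relative size of at most
    4/100 makes the faces move slowly compared with the damping of the other modes, whose rates
    exceed 11.\<close>
  define g where "g t = coord (u t) 1 * (lam \<mu> 1 * coord (u t) 1 + nl 1 (to_trap (u t)))" for t
  have g: "- (4/100) * (coord (u t) 1)\<^sup>2 \<le> g t" "g t \<le> (4/100) * (coord (u t) 1)\<^sup>2" if "0 \<le> t" for t
  proof -
    have "g t = lam \<mu> 1 * (coord (u t) 1)\<^sup>2 + coord (u t) 1 * nl 1 (to_trap (u t))"
      by (simp add: g_def algebra_simps power2_eq_square)
    moreover have "0 \<le> (coord (u t) 1)^4" "0 \<le> (coord (u t) 1)\<^sup>2" by simp_all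
    ultimately show "- (4/100) * (coord (u t) 1)\<^sup>2 \<le> g t" "g t \<le> (4/100) * (coord (u t) 1)\<^sup>2"
      using nl1[of "u t"] quart[OF that] lam1[of t] unfolding m[OF that] by linarith+
  qed
  have dsq: "((\<lambda>t. (coord (u t) 1)\<^sup>2) has_real_derivative 2 * g t) (at t within {0..T})" if "t \<in> {0..T}" for t T
    using d[OF _ that, of 1] by (auto intro!: derivative_eq_intros simp: g_def)
  have pos: "0 < (coord (u t) 1)\<^sup>2" if "0 \<le> t" for t
  proof -
    have "- (coord (u t) 1)\<^sup>2 \<le> exp (- 1 * (t - 0)) * - (coord (u 0) 1)\<^sup>2"
    proof (rule differential_inequality[where f = "\<lambda>t. - (coord (u t) 1)\<^sup>2"])
      fix s assume s: "s \<in> {0..t}"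
      show "((\<lambda>t. - (coord (u t) 1)\<^sup>2) has_real_derivative - (2 * g s)) (at s within {0..t})"
        by (intro DERIV_minus dsq s)
      show "- (2 * g s) \<le> - 1 * - (coord (u s) 1)\<^sup>2" using g[of s] s by auto
    qed (use that in auto)
    also have "\<dots> < 0" using u0(2) by simp
    finally show ?thesis by simp
  qed
  have cube: "\<bar>coord (u t) 1\<bar>^3 \<le> 1/5 * (coord (u t) 1)\<^sup>2" if "0 \<le> t" for t
    using mult_right_mono[OF u1[OF that], of "(coord (u t) 1)\<^sup>2"]
    by (simp add: power2_eq_square power3_eq_cube)
  have c1: "coord (to_trap (u t)) 1 = coord (u t) 1" if "0 \<le> t" for t
    using m[OF that] by (simp add: coord_to_trap)
  \<comment> \<open>At the face - a_1^2 / 5 the restoring term is at least 1184/500 a_1^2, against a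
    forcing of 2 a_1^2 and small corrections; at the face - a_1^2 / 7 the restoring term is at most
    1216/700 a_1^2, below the forcing.\<close>
  have lower2: "- (1/5) * (coord (u T) 1)\<^sup>2 \<le> coord (u T) 2"
  proof -
    have "0 \<le> coord (u T) 2 + 1/5 * (coord (u T) 1)\<^sup>2"
    proof (rule barrier[where f = "\<lambda>t. coord (u t) 2 + 1/5 * (coord (u t) 1)\<^sup>2" and a = 0])
      fix s assume s: "s \<in> {0..T}"
      then have s0: "0 \<le> s" by simp
      show "((\<lambda>t. coord (u t) 2 + 1/5 * (coord (u t) 1)\<^sup>2) has_real_derivative
          (lam \<mu> 2 * coord (u s) 2 + nl 2 (to_trap (u s))) + 1/5 * (2 * g s)) (at s within {0..T})"
        by (intro DERIV_add DERIV_cmult d dsq s) simp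
      assume "coord (u s) 2 + 1/5 * (coord (u s) 1)\<^sup>2 = 0"
      then have e: "coord (u s) 2 = - (1/5 * (coord (u s) 1)\<^sup>2)" by linarith
      have "lam \<mu> 2 * coord (u s) 2 = - lam \<mu> 2 * (1/5 * (coord (u s) 1)\<^sup>2)"
        unfolding e by (simp only: mult_minus_left mult_minus_right)
      also have "\<dots> \<ge> (1184/100) * (1/5 * (coord (u s) 1)\<^sup>2)"
        using lam_bounds(3)[OF mu] by (intro mult_right_mono) auto
      finally have "(1184/100) * (1/5 * (coord (u s) 1)\<^sup>2) \<le> lam \<mu> 2 * coord (u s) 2" .
      moreover have "- 2 * (coord (u s) 1)\<^sup>2 - 4/15 * \<bar>coord (u s) 1\<bar>^3 \<le> nl 2 (to_trap (u s))"
      proof -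
        have c: "coord (to_trap (u s)) 1 = coord (u s) 1" using c1[of s] s by simp
        from wide_nl_2[OF tw[of "u s"]] show ?thesis unfolding c abs_le_iff by linarith
      qed
      ultimately show "0 < (lam \<mu> 2 * coord (u s) 2 + nl 2 (to_trap (u s))) + 1/5 * (2 * g s)"
        using g(1)[OF s0] cube[OF s0] pos[OF s0] by linarith
    qed (use u0 T in \<open>auto simp: trap_def slaved_def\<close>)
    then show ?thesis by simp
  qed
  have upper2: "coord (u T) 2 \<le> - (1/7) * (coord (u T) 1)\<^sup>2"
  proof -
    have "0 \<le> - coord (u T) 2 + (- 1/7) * (coord (u T) 1)\<^sup>2"
    proof (rule barrier[where f = "\<lambda>t. - coord (u t) 2 + (- 1/7) * (coord (u t) 1)\<^sup>2" and a = 0])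
      fix s assume s: "s \<in> {0..T}"
      then have s0: "0 \<le> s" by simp
      show "((\<lambda>t. - coord (u t) 2 + (- 1/7) * (coord (u t) 1)\<^sup>2) has_real_derivative
          - (lam \<mu> 2 * coord (u s) 2 + nl 2 (to_trap (u s))) + (- 1/7) * (2 * g s)) (at s within {0..T})"
        by (intro DERIV_add DERIV_cmult DERIV_minus d dsq s) simp
      assume "- coord (u s) 2 + (- 1/7) * (coord (u s) 1)\<^sup>2 = 0"
      then have e: "coord (u s) 2 = - (1/7 * (coord (u s) 1)\<^sup>2)" by linarith
      have "lam \<mu> 2 * coord (u s) 2 = - lam \<mu> 2 * (1/7 * (coord (u s) 1)\<^sup>2)"
        unfolding e by (simp only: mult_minus_left mult_minus_right)
      also have "\<dots> \<le> (1216/100) * (1/7 * (coord (u s) 1)\<^sup>2)"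
        using lam_bounds(2)[OF mu] by (intro mult_right_mono) auto
      finally have "lam \<mu> 2 * coord (u s) 2 \<le> (1216/100) * (1/7 * (coord (u s) 1)\<^sup>2)" .
      moreover have "nl 2 (to_trap (u s)) \<le> - 2 * (coord (u s) 1)\<^sup>2 + 4/15 * \<bar>coord (u s) 1\<bar>^3"
      proof -
        have c: "coord (to_trap (u s)) 1 = coord (u s) 1" using c1[of s] s by simp
        from wide_nl_2[OF tw[of "u s"]] show ?thesis unfolding c abs_le_iff by linarith
      qed
      ultimately show "0 < - (lam \<mu> 2 * coord (u s) 2 + nl 2 (to_trap (u s))) + (- 1/7) * (2 * g s)"
        using g(2)[OF s0] cube[OF s0] pos[OF s0] by linarith
    qed (use u0 T in \<open>auto simp: trap_def slaved_def\<close>)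
    then show ?thesis by simp
  qed
  have high: "\<bar>coord (u T) k\<bar> \<le> (1/5)^k * (coord (u T) 1)\<^sup>2" if k: "3 \<le> k" for k
  proof -
    \<comment> \<open>The factor 1/5 is the bound on |a_1|. For k = 3 the quadratic term alone, 72,
      exceeds the available damping of about 71, and the linear term closes the gap. From k = 4 on
      the comparison k^2 \<le> k^4 / 16 is enough.\<close>
    have "40 * (real k)\<^sup>2 / 5 - 36 * real k / 5 < - lam \<mu> k - (8/100)"
    proof (cases "k = 3")
      case True then show ?thesis using lam_bounds(4)[OF mu, of 3] by (simp add: power2_eq_square)
    next
      case False
      with k have "4 \<le> real k" by auto
      then have "4\<^sup>2 \<le> (real k)\<^sup>2" by (intro power_mono) auto
      then have "16 * (real k)\<^sup>2 \<le> (real k)\<^sup>2 * (real k)\<^sup>2" by (intro mult_right_mono) auto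
      then have "16 * (real k)\<^sup>2 \<le> real k ^ 4" by (simp add: power2_eq_square power4_eq_xxxx)
      moreover have "0 \<le> (real k)\<^sup>2" by simp
      ultimately show ?thesis using lam_bounds(4)[OF mu, of k] \<open>4 \<le> real k\<close> by linarith
    qed
    then have gap: "0 < - lam \<mu> k - (8/100) - (40 * (real k)\<^sup>2 - 36 * real k) / 5" by (simp add: diff_divide_distrib)
    have kk: "0 \<le> 40 * (real k)\<^sup>2 - 36 * real k"
    proof -
      have "36 * real k \<le> (40 * real k) * real k" using k by (intro mult_right_mono) auto
      then show ?thesis by (simp add: power2_eq_square)
    qed
    have half: "s * coord (u T) k \<le> (1/5)^k * (coord (u T) 1)\<^sup>2" if s1: "\<bar>s\<bar> = 1" for s
    proof -
      have "0 \<le> (1/5)^k * (coord (u T) 1)\<^sup>2 - s * coord (u T) k"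
      proof (rule barrier[where f = "\<lambda>t. (1/5)^k * (coord (u t) 1)\<^sup>2 - s * coord (u t) k" and a = 0])
        have "s * coord (u 0) k \<le> \<bar>s * coord (u 0) k\<bar>" by simp
        also have "\<dots> \<le> (1/5)^k * (coord (u 0) 1)\<^sup>2"
          using u0(1) k s1 by (simp add: abs_mult trap_def slaved_def)
        finally show "0 \<le> (1/5)^k * (coord (u 0) 1)\<^sup>2 - s * coord (u 0) k" by simp
        fix t assume t: "t \<in> {0..T}"
        show "((\<lambda>t. (1/5)^k * (coord (u t) 1)\<^sup>2 - s * coord (u t) k) has_real_derivative
            (1/5)^k * (2 * g t) - s * (lam \<mu> k * coord (u t) k + nl k (to_trap (u t)))) (at t within {0..T})"
          using k by (intro DERIV_diff DERIV_cmult d dsq t) simp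
        assume f0: "(1/5)^k * (coord (u t) 1)\<^sup>2 - s * coord (u t) k = 0"
        define c where "c = (1/5)^k * (coord (u t) 1)\<^sup>2"
        have c: "0 < c" using pos[of t] t by (simp add: c_def)
        have "s * nl k (to_trap (u t)) \<le> \<bar>nl k (to_trap (u t))\<bar>"
          using s1 abs_ge_self[of "s * nl k (to_trap (u t))"] by (simp add: abs_mult)
        also have "\<dots> \<le> (40 * (real k)\<^sup>2 - 36 * real k) * (1/5)^k * \<bar>coord (u t) 1\<bar>^3"
          using wide_nl_ge_3[OF tw[of "u t"] k] c1[of t] t by simp
        also have "\<dots> \<le> (40 * (real k)\<^sup>2 - 36 * real k) * (1/5)^k * (1/5 * (coord (u t) 1)\<^sup>2)"
          using cube[of t] t kk by (intro mult_left_mono) auto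
        finally have n: "s * nl k (to_trap (u t)) \<le> (40 * (real k)\<^sup>2 - 36 * real k) / 5 * c"
          by (simp add: c_def)
        have "s * (lam \<mu> k * coord (u t) k) = lam \<mu> k * c" using f0 by (simp add: c_def)
        moreover have "- (8/100) * c \<le> (1/5)^k * (2 * g t)"
        proof -
          have "(1/5)^k * (- (8/100) * (coord (u t) 1)\<^sup>2) \<le> (1/5)^k * (2 * g t)"
            using g(1)[of t] t by (intro mult_left_mono) auto
          then show ?thesis by (simp add: c_def)
        qed
        moreover have "0 < (- lam \<mu> k - (8/100) - (40 * (real k)\<^sup>2 - 36 * real k) / 5) * c"
          using gap c by (rule mult_pos_pos)
        ultimately show "0 < (1/5)^k * (2 * g t) - s * (lam \<mu> k * coord (u t) k + nl k (to_trap (u t)))"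
          using n unfolding left_diff_distrib distrib_left mult_minus_left by linarith
      qed (use T in auto)
      then show ?thesis by simp
    qed
    show ?thesis using half[of 1] half[of "-1"] by (simp add: abs_le_iff)
  qed
  show ?thesis
    using u1[OF T] lower2 upper2 high by (simp add: trap_def slaved_def)
qed

text \<open>The cut-off solution never leaves \<open>trap\<close>, so it solves the ladder, and
  uniqueness in the unit ball identifies it with \<open>ks_flow\<close>. The origin is treated apart
  because the barriers need a nonzero first mode.\<close>

lemma
  assumes z: "z \<in> trap"
  shows ks_time_trap: "ks_time \<mu> z = \<infinity>" and ks_flow_trap: "0 \<le> t \<Longrightarrow> ks_flow \<mu> t z \<in> trap"
proof -
  interpret semilinear "lam \<mu>" "\<lambda>a k. nl k (to_trap a)" 3
    by (rule semilinear_trap[OF mu(1)])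
  define u where "u t = flow t z" for t
  have u: "solves (lam \<mu>) (\<lambda>a k. nl k (to_trap a)) {0..} u" and u0: "u 0 = z"
    using flow_solves[of z] by (simp_all add: u_def[abs_def])
  have trap: "u t \<in> trap" if "0 \<le> t" for t
  proof (cases "coord z 1 = 0")
    case True
    then have "z = 0" using z wide_zero_iff trap_subset_wide by blast
    have "solves (lam \<mu>) (\<lambda>a k. nl k (to_trap a)) {0..t} (\<lambda>_. 0)"
      by (simp add: solves_def to_trap_id zero_in_trap)
    from flow_unique[OF this, of t] that have "u t = 0" by (simp add: u_def \<open>z = 0\<close>)
    then show ?thesis by (simp add: zero_in_trap)
  next
    case False
    with trap_invariant_aux[OF u, of t] u0 z that show ?thesis by simp
  qed
  have "ks_curve \<mu> {0..} u"
    by (rule solves_change_F[OF _ u]) (simp add: trap to_trap_id)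
  moreover have "norm (u t) < 1" if "0 \<le> t" for t
    using norm_wide subsetD[OF trap_subset_wide trap[OF that]] .
  ultimately show "ks_time \<mu> z = \<infinity>" "0 \<le> t \<Longrightarrow> ks_flow \<mu> t z \<in> trap"
    using ks_flow_global[OF mu(1), of u] trap u0 by auto
qed

lemma ks_curve_trap:
  assumes "z \<in> trap" shows "ks_curve \<mu> {0..} (\<lambda>t. ks_flow \<mu> t z)"
proof (rule ks_curve_flow[OF mu(1)])
  fix s :: real assume "s \<in> {0..}"
  then show "0 \<le> s \<and> norm (ks_flow \<mu> s z) \<le> 1"
    using norm_wide[OF subsetD[OF trap_subset_wide ks_flow_trap[OF assms, of s]]] by simp
qed

lemma fixed_point_zero: "fixed_point (ks_flow \<mu>) (ks_time \<mu>) 0"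
proof -
  have "ks_curve \<mu> {0..} (\<lambda>_. 0)" by (simp add: solves_def)
  from ks_flow_global[OF mu(1) this] show ?thesis by (simp add: fixed_point_def)
qed

end

section \<open>Logarithmic coordinates\<close>

text \<open>In the coordinates \<open>2 ln a\<^sub>1\<close>, \<open>a\<^sub>2 / a\<^sub>1\<^sup>2\<close>, \<open>a\<^sub>k / a\<^sub>1\<close> the cubic saturation of the first mode becomes a
  contraction: \<open>(ln a\<^sub>1)' = \<lambda>\<^sub>1 + 2 a\<^sub>2 + \<dots>\<close> with \<open>a\<^sub>2 / a\<^sub>1\<^sup>2\<close> close to \<open>- 1/6\<close>.\<close>

definition chart :: "ell2 \<Rightarrow> ell2" where
  "chart a = (1 / coord a 1) *\<^sub>R a + (2 * ln (coord a 1) - 1) *\<^sub>R unit 1 +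
     (coord a 2 / (coord a 1)\<^sup>2 - coord a 2 / coord a 1) *\<^sub>R unit 2"

text \<open>Logarithmic derivative of a_1 along the ladder.\<close>

definition growth :: "real \<Rightarrow> ell2 \<Rightarrow> real" where
  "growth \<mu> a = lam \<mu> 1 + nl 1 a / coord a 1"

text \<open>The vector field in the chart; dividing by powers of a_1 shifts the linear rates by
  multiples of \<open>growth\<close>.\<close>

definition chart_rate :: "real \<Rightarrow> ell2 \<Rightarrow> nat \<Rightarrow> real" where
  "chart_rate \<mu> a k = (if k = 1 then 2 * growth \<mu> a
     else if k = 2 then (lam \<mu> 2 - 2 * growth \<mu> a) * (coord a 2 / (coord a 1)\<^sup>2) + nl 2 a / (coord a 1)\<^sup>2
     else (lam \<mu> k - growth \<mu> a) * (coord a k / coord a 1) + nl k a / coord a 1)"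

lemma coord_chart:
  assumes "coord a 1 \<noteq> 0"
  shows "coord (chart a) 1 = 2 * ln (coord a 1)" "coord (chart a) 2 = coord a 2 / (coord a 1)\<^sup>2"
    "3 \<le> k \<Longrightarrow> coord (chart a) k = coord a k / coord a 1"
  using assms by (simp_all add: chart_def coord_unit)

lemma norm_unit: "1 \<le> k \<Longrightarrow> norm (unit k) = 1"
proof -
  assume "1 \<le> k"
  then have "(norm (unit k))\<^sup>2 = 1"
    unfolding norm_ell2_square by (subst suminf_finite[of "{k}"]) (auto simp: coord_unit)
  then show ?thesis using norm_ge_zero[of "unit k"] by (simp add: power2_eq_1_iff)
qed

definition tail :: "nat \<Rightarrow> ell2 \<Rightarrow> ell2" where
  "tail n a = a - truncate n a"

lemma coord_tail: "coord (tail n a) k = (if k < n then 0 else coord a k)"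
  by (simp add: tail_def coord_truncate)

lemma norm_tail_square: "(norm (tail n a))\<^sup>2 = (\<Sum>k. (coord a (k + n))\<^sup>2)"
proof -
  have "(norm (tail n a))\<^sup>2 = (\<Sum>k. (coord (tail n a) (k + n))\<^sup>2) + (\<Sum>k<n. (coord (tail n a) k)\<^sup>2)"
    unfolding norm_ell2_square by (rule suminf_split_initial_segment[OF summable_coord_square])
  then show ?thesis by (simp add: coord_tail)
qed

lemma norm_square_split:
  "(norm a)\<^sup>2 = (coord a 1)\<^sup>2 + (coord a 2)\<^sup>2 + (norm (tail 3 a))\<^sup>2"
proof -
  have "(norm a)\<^sup>2 = (\<Sum>k. (coord a (k + 3))\<^sup>2) + (\<Sum>k<3. (coord a k)\<^sup>2)"
    unfolding norm_ell2_square by (rule suminf_split_initial_segment[OF summable_coord_square])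
  moreover have "{..<3::nat} = {0, 1, 2}" by auto
  ultimately show ?thesis by (simp add: norm_tail_square)
qed

lemma norm_tail_geom:
  assumes "1 \<le> n" shows "norm (tail n geom) \<le> 103/100 * (1/5)^n"
proof -
  have sq: "((1/5::real)^m)\<^sup>2 = (1/25)^m" for m
    by (simp add: power2_eq_square power_mult_distrib[symmetric])
  have eq: "(coord geom (k + n))\<^sup>2 = (1/25)^n * (1/25)^k" for k
    using assms by (simp add: coord_geom sq power_add power_mult_distrib mult.commute)
  have "(\<lambda>k. (1/25)^n * (1/25)^k) sums ((1/25)^n * (1 / (1 - 1/25 :: real)))"
    by (intro sums_mult geometric_sums) simp
  then have "(norm (tail n geom))\<^sup>2 = (1/25)^n * (25/24)"
    unfolding norm_tail_square eq by (simp add: sums_iff)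
  also have "\<dots> \<le> (1/25)^n * (103/100)\<^sup>2" by (intro mult_left_mono) (auto simp: power2_eq_square)
  also have "\<dots> = (103/100 * (1/5)^n)\<^sup>2"
    unfolding power_mult_distrib sq by simp
  finally show ?thesis by (rule power2_le_imp_le) simp
qed

lemma inner_shift_cong:
  assumes "\<And>i. 1 \<le> i \<Longrightarrow> coord a i \<noteq> 0 \<Longrightarrow> coord b (k + i) = coord c (k + i)"
  shows "inner a (shift k b) = inner a (shift k c)"
proof -
  have "coord a (Suc i) * coord b (k + Suc i) = coord a (Suc i) * coord c (k + Suc i)" for i
    using assms[of "Suc i"] by (cases "coord a (Suc i) = 0") auto
  then show ?thesis unfolding inner_shift by presburger
qed

lemma abs_inner_shift_le: "\<bar>inner a (shift k b)\<bar> \<le> norm a * norm b"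
  by (rule order_trans[OF Cauchy_Schwarz_ineq2]) (simp add: mult_left_mono norm_shift_le)

lemma shift_diff: "shift k (a - b) = shift k a - shift k b"
  by (auto intro!: ell2_eqI simp: coord_shift)

text \<open>Consecutive terms have the ratio (1 + 1/k) / 5 < 1, so the first admissible index is the
  worst.\<close>

lemma power_one_fifth_le: "3 \<le> k \<Longrightarrow> real k * (1/5)^k \<le> 3/125"
proof (induction k rule: nat_induct_at_least)
  case base then show ?case by (simp add: power3_eq_cube)
next
  case (Suc k)
  have "real (Suc k) * (1/5)^Suc k \<le> real k * (1/5)^k"
  proof -
    have "(1 + real k) * (1/5)^k \<le> 5 * real k * (1/5)^k" using Suc(1) by (intro mult_right_mono) auto
    then show ?thesis by simp
  qed
  then show ?case using Suc(2) by (rule order.trans)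
qed

lemma abs_le_sum_terms: "\<bar>(x::real)\<bar> \<le> a \<Longrightarrow> \<bar>y\<bar> \<le> b \<Longrightarrow> \<bar>x + y\<bar> \<le> a + b"
  by linarith

lemma wide_chart_bounds:
  assumes a: "a \<in> wide" and pos: "0 < coord a 1"
  shows "- (1/4) \<le> coord (chart a) 2" "coord (chart a) 2 \<le> - (1/8)"
    "3 \<le> k \<Longrightarrow> \<bar>coord (chart a) k\<bar> \<le> 2 * (1/5)^k * coord a 1"
proof -
  have p2: "0 < (coord a 1)\<^sup>2" using pos by simp
  show "- (1/4) \<le> coord (chart a) 2" "coord (chart a) 2 \<le> - (1/8)"
    using wide_coords(2,3)[OF a] p2 pos by (simp_all add: coord_chart field_simps)
  assume k: "3 \<le> k"
  have "\<bar>coord (chart a) k\<bar> = \<bar>coord a k\<bar> / coord a 1" using pos k by (simp add: coord_chart)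
  also have "\<dots> \<le> (2 * (1/5)^k * (coord a 1)\<^sup>2) / coord a 1"
    using wide_coords(4)[OF a k] pos by (intro divide_right_mono) auto
  also have "\<dots> = 2 * (1/5)^k * coord a 1" using pos by (simp add: power2_eq_square)
  finally show "\<bar>coord (chart a) k\<bar> \<le> 2 * (1/5)^k * coord a 1" .
qed

lemma wide_growth:
  assumes a: "a \<in> wide" and pos: "0 < coord a 1"
  shows "lam \<mu> 1 - 51/100 * (coord a 1)\<^sup>2 \<le> growth \<mu> a" "growth \<mu> a \<le> lam \<mu> 1 - 24/100 * (coord a 1)\<^sup>2"
proof -
  let ?n = "nl 1 a / coord a 1"
  have p2: "0 < (coord a 1)\<^sup>2" using pos by simp
  have "coord a 1 * nl 1 a = (coord a 1)\<^sup>2 * ?n" using pos by (simp add: power2_eq_square)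
  then have "- (51/100) * (coord a 1)^4 \<le> (coord a 1)\<^sup>2 * ?n" "(coord a 1)\<^sup>2 * ?n \<le> - (24/100) * (coord a 1)^4"
    using wide_mult_nl_1(2,3)[OF a] by simp_all
  then have "(coord a 1)\<^sup>2 * (- (51/100) * (coord a 1)\<^sup>2) \<le> (coord a 1)\<^sup>2 * ?n"
    "(coord a 1)\<^sup>2 * ?n \<le> (coord a 1)\<^sup>2 * (- (24/100) * (coord a 1)\<^sup>2)"
    by (simp_all add: power2_eq_square power4_eq_xxxx)
  then have "- (51/100) * (coord a 1)\<^sup>2 \<le> ?n" "?n \<le> - (24/100) * (coord a 1)\<^sup>2"
    using mult_le_cancel_left_pos[OF p2] by blast+
  then show "lam \<mu> 1 - 51/100 * (coord a 1)\<^sup>2 \<le> growth \<mu> a" "growth \<mu> a \<le> lam \<mu> 1 - 24/100 * (coord a 1)\<^sup>2"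
    by (simp_all add: growth_def)
qed

section \<open>Comparison of two points\<close>

text \<open>The quantities compared are symmetric in the pair, so the order of the first modes is a
  normalisation; it makes \<open>p\<close> and \<open>D\<close> nonnegative. The damping of the
  first mode acts as a multiple of - p * D. When both amplitudes are small, D is much smaller than
  p, so the errors must be measured by D, q and R rather than by p.\<close>

locale ordered_pair =
  fixes \<mu> :: real and x y :: ell2
  assumes mu: "99/100 \<le> \<mu>" "\<mu> \<le> 101/100" and xw: "x \<in> wide" and yw: "y \<in> wide"
    and y1: "0 < coord y 1" and yx: "coord y 1 \<le> coord x 1"
begin

abbreviation "\<xi> \<equiv> coord x 1"
abbreviation "\<eta> \<equiv> coord y 1"
abbreviation "cx \<equiv> coord (chart x) 2"
abbreviation "cy \<equiv> coord (chart y) 2"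

definition "p = ln \<xi> - ln \<eta>"
definition "D = \<xi>\<^sup>2 - \<eta>\<^sup>2"
definition "d = chart x - chart y"
definition "q = \<bar>coord d 2\<bar>"
definition "R = norm (tail 3 d)"
text \<open>Rescaling makes both first coordinates equal to 1. The first mode then drops out of the
  difference \<Delta>, and the amplitudes come out of the quadratic terms as scalar factors.\<close>

definition "bx = (1 / \<xi>) *\<^sub>R x"
definition "by' = (1 / \<eta>) *\<^sub>R y"
definition "\<Delta> = bx - by'"
definition "h = growth \<mu> x - growth \<mu> y"
definition "E k = chart_rate \<mu> x k - chart_rate \<mu> y k"

lemma x1: "0 < \<xi>" using y1 yx by simp

lemma small: "\<xi> \<le> 1/4" "\<eta> \<le> 1/4"
  using wide_coords(1)[OF xw] wide_coords(1)[OF yw] by auto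

lemma nonneg: "0 \<le> p" "0 \<le> D" "0 \<le> q" "0 \<le> R"
proof -
  show "0 \<le> p" using yx y1 by (simp add: p_def)
  have "\<eta>\<^sup>2 \<le> \<xi>\<^sup>2" using yx y1 by (intro power_mono) auto
  then show "0 \<le> D" by (simp add: D_def)
qed (simp_all add: q_def R_def)

lemma d1: "coord d 1 = 2 * p"
  using coord_chart(1)[of x] coord_chart(1)[of y] x1 y1 by (simp add: d_def p_def)

lemma norm_d: "(norm d)\<^sup>2 = 4 * p\<^sup>2 + q\<^sup>2 + R\<^sup>2"
  unfolding norm_square_split[of d] d1 by (simp add: q_def R_def power_mult_distrib)

text \<open>Everything follows from D = (\<xi> + \<eta>) * (\<xi> - \<eta>) and from ln x \<le> x -
  1, used for both quotients of the amplitudes; the factor 8 comes from amplitudes of at most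
  1/4.\<close>

lemma D_bounds:
  shows "\<xi> * (\<xi> - \<eta>) \<le> D" "2 * (\<eta> * (\<xi> - \<eta>)) \<le> D" "\<eta> * p \<le> \<xi> - \<eta>" "\<xi> - \<eta> \<le> \<xi> * p"
    "\<xi> * \<eta> * p \<le> D" "2 * (\<eta>\<^sup>2 * p) \<le> D" "8 * D \<le> p" "\<xi> - \<eta> \<le> p / 4"
proof -
  have s: "D = (\<xi> + \<eta>) * (\<xi> - \<eta>)" by (simp add: D_def algebra_simps power2_eq_square)
  show 1: "\<xi> * (\<xi> - \<eta>) \<le> D" unfolding s using yx y1 by (intro mult_right_mono) auto
  have "(2 * \<eta>) * (\<xi> - \<eta>) \<le> D" unfolding s using yx y1 by (intro mult_right_mono) auto
  then show 2: "2 * (\<eta> * (\<xi> - \<eta>)) \<le> D" by simp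
  have "p = ln (\<xi> / \<eta>)" using x1 y1 by (simp add: p_def ln_div)
  also have "\<dots> \<le> \<xi> / \<eta> - 1" using x1 y1 by (intro ln_le_minus_one) auto
  finally have "\<eta> * p \<le> \<eta> * (\<xi> / \<eta> - 1)" using y1 by (intro mult_left_mono) auto
  then show 3: "\<eta> * p \<le> \<xi> - \<eta>" using y1 by (simp add: right_diff_distrib)
  have "- p = ln (\<eta> / \<xi>)" using x1 y1 by (simp add: p_def ln_div)
  also have "\<dots> \<le> \<eta> / \<xi> - 1" using x1 y1 by (intro ln_le_minus_one) auto
  finally have "\<xi> * (1 - \<eta> / \<xi>) \<le> \<xi> * p" using x1 by (intro mult_left_mono) auto
  then show 4: "\<xi> - \<eta> \<le> \<xi> * p" using x1 by (simp add: right_diff_distrib)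
  have "\<xi> * (\<eta> * p) \<le> \<xi> * (\<xi> - \<eta>)" using 3 x1 by (intro mult_left_mono) auto
  with 1 show "\<xi> * \<eta> * p \<le> D" by (simp add: mult.assoc)
  have "\<eta> * (\<eta> * p) \<le> \<eta> * (\<xi> - \<eta>)" using 3 y1 by (intro mult_left_mono) auto
  with 2 show "2 * (\<eta>\<^sup>2 * p) \<le> D" by (simp add: power2_eq_square mult.assoc)
  have ap: "\<xi> * p \<le> 1/4 * p" using small nonneg by (intro mult_right_mono) auto
  with 4 show "\<xi> - \<eta> \<le> p / 4" by simp
  have "D \<le> 1/2 * (\<xi> - \<eta>)" unfolding s using small yx by (intro mult_right_mono) auto
  with 4 ap show "8 * D \<le> p" by simp
qed

lemma coord_b: "coord bx 1 = 1" "coord by' 1 = 1" "coord bx 2 = \<xi> * cx" "coord by' 2 = \<eta> * cy"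
  "3 \<le> k \<Longrightarrow> coord bx k = coord (chart x) k" "3 \<le> k \<Longrightarrow> coord by' k = coord (chart y) k"
  using x1 y1 by (simp_all add: bx_def by'_def coord_chart power2_eq_square)

lemma coord_\<Delta>: "coord \<Delta> 1 = 0" "\<bar>coord \<Delta> 2\<bar> \<le> (\<xi> - \<eta>) / 4 + \<eta> * q" "3 \<le> k \<Longrightarrow> coord \<Delta> k = coord d k"
proof -
  show "coord \<Delta> 1 = 0" "3 \<le> k \<Longrightarrow> coord \<Delta> k = coord d k"
    by (simp_all add: \<Delta>_def coord_b[simplified] d_def)
  have "coord \<Delta> 2 = (\<xi> - \<eta>) * cx + \<eta> * coord d 2"
    by (simp add: \<Delta>_def coord_b d_def algebra_simps)
  also have "\<bar>\<dots>\<bar> \<le> \<bar>(\<xi> - \<eta>) * cx\<bar> + \<bar>\<eta> * coord d 2\<bar>" by (rule abs_triangle_ineq)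
  also have "\<bar>(\<xi> - \<eta>) * cx\<bar> \<le> (\<xi> - \<eta>) * (1/4)"
    unfolding abs_mult using wide_chart_bounds(1,2)[OF xw x1] yx by (intro mult_mono) (auto simp: abs_le_iff)
  finally show "\<bar>coord \<Delta> 2\<bar> \<le> (\<xi> - \<eta>) / 4 + \<eta> * q" using y1 by (simp add: abs_mult q_def)
qed

lemma norm_\<Delta>: "norm \<Delta> \<le> (\<xi> - \<eta>) / 4 + \<eta> * q + R"
proof -
  have "\<Delta> = coord \<Delta> 2 *\<^sub>R unit 2 + tail 3 d"
  proof (rule ell2_eqI)
    fix k :: nat
    consider "k = 0" | "k = 1" | "k = 2" | "3 \<le> k" by linarith
    then show "coord \<Delta> k = coord (coord \<Delta> 2 *\<^sub>R unit 2 + tail 3 d) k"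
      using coord_\<Delta>(1) coord_\<Delta>(3)[of k] by cases (simp_all add: coord_unit coord_tail)
  qed
  then have "norm \<Delta> \<le> norm (coord \<Delta> 2 *\<^sub>R unit 2) + norm (tail 3 d)" by (metis norm_triangle_ineq)
  also have "norm (coord \<Delta> 2 *\<^sub>R unit 2) = \<bar>coord \<Delta> 2\<bar>" by (simp add: norm_unit)
  finally show ?thesis using coord_\<Delta>(2) by (simp add: R_def)
qed

lemma mult_norm_\<Delta>:
  shows "\<eta> * norm \<Delta> \<le> D / 8 + q / 16 + R / 4" "\<xi> * norm \<Delta> \<le> D / 4 + q / 16 + R / 4"
proof -
  have "\<eta> * \<eta> \<le> 1/4 * (1/4)" "\<xi> * \<eta> \<le> 1/4 * (1/4)" using small x1 y1 by (intro mult_mono; simp)+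
  then have 1: "\<eta> * (\<eta> * q) \<le> q / 16" "\<xi> * (\<eta> * q) \<le> q / 16"
    using mult_right_mono[OF _ nonneg(3), of _ "1/4 * (1/4)"] by (simp_all add: mult.assoc[symmetric])
  have 2: "\<eta> * R \<le> R / 4" "\<xi> * R \<le> R / 4"
    using mult_right_mono[OF _ nonneg(4), of _ "1/4"] small by simp_all
  have "\<eta> * norm \<Delta> \<le> \<eta> * ((\<xi> - \<eta>) / 4 + \<eta> * q + R)" "\<xi> * norm \<Delta> \<le> \<xi> * ((\<xi> - \<eta>) / 4 + \<eta> * q + R)"
    using x1 y1 by (intro mult_left_mono norm_\<Delta>; simp)+
  then show "\<eta> * norm \<Delta> \<le> D / 8 + q / 16 + R / 4" "\<xi> * norm \<Delta> \<le> D / 4 + q / 16 + R / 4"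
    using 1 2 D_bounds(1,2) by (simp_all add: distrib_left)
qed

text \<open>The first bound uses the weight 2 of the modes k \<ge> 3 in \<open>wide\<close>, the
  second the common weight 25/4, since mode 2 is included.\<close>

lemma norm_tail_le:
  assumes "a \<in> wide" "0 < coord a 1" "3 \<le> n"
  shows "norm (tail n ((1 / coord a 1) *\<^sub>R a)) \<le> 206/100 * (1/5)^n * coord a 1"
    "norm (tail 2 ((1 / coord a 1) *\<^sub>R a)) \<le> 26/100 * coord a 1"
proof -
  have *: "norm (tail m ((1 / coord a 1) *\<^sub>R a)) \<le> c * coord a 1 * norm (tail m geom)"
    if c: "0 \<le> c" "1 \<le> m" "\<And>k. m \<le> k \<Longrightarrow> \<bar>coord a k\<bar> \<le> c * (1/5)^k * (coord a 1)\<^sup>2" for c m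
  proof -
    have "norm (tail m ((1 / coord a 1) *\<^sub>R a)) \<le> norm ((c * coord a 1) *\<^sub>R tail m geom)"
    proof (rule norm_coord_mono)
      fix k :: nat
      show "\<bar>coord (tail m ((1 / coord a 1) *\<^sub>R a)) k\<bar> \<le> \<bar>coord ((c * coord a 1) *\<^sub>R tail m geom) k\<bar>"
      proof (cases "k < m")
        case False
        then have "\<bar>coord a k\<bar> / coord a 1 \<le> (c * (1/5)^k * (coord a 1)\<^sup>2) / coord a 1"
          using c(3)[of k] assms(2) by (intro divide_right_mono) auto
        then show ?thesis using False assms(2) c(1,2)
          by (simp add: coord_tail coord_geom abs_mult power2_eq_square mult_ac)
      qed (simp add: coord_tail)
    qed
    then show ?thesis using assms(2) c(1) by simp
  qed
  have "norm (tail n ((1 / coord a 1) *\<^sub>R a)) \<le> 2 * coord a 1 * norm (tail n geom)"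
    by (rule *) (use assms wide_coords(4)[OF assms(1)] in auto)
  also have "\<dots> \<le> 2 * coord a 1 * (103/100 * (1/5)^n)"
    using assms by (intro mult_left_mono norm_tail_geom) auto
  finally show "norm (tail n ((1 / coord a 1) *\<^sub>R a)) \<le> 206/100 * (1/5)^n * coord a 1" by (simp add: mult_ac)
  have "norm (tail 2 ((1 / coord a 1) *\<^sub>R a)) \<le> 25/4 * coord a 1 * norm (tail 2 geom)"
    by (rule *) (use assms wide_coord_le[OF assms(1)] in auto)
  also have "\<dots> \<le> 25/4 * coord a 1 * (103/100 * (1/5)^2)"
    using assms by (intro mult_left_mono norm_tail_geom) auto
  also have "\<dots> \<le> 26/100 * coord a 1" using assms by (simp add: power2_eq_square)
  finally show "norm (tail 2 ((1 / coord a 1) *\<^sub>R a)) \<le> 26/100 * coord a 1" .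
qed

lemma norm_b: "norm bx \<le> 107/100" "norm by' \<le> 107/100"
proof -
  have *: "norm ((1 / coord a 1) *\<^sub>R a) \<le> 107/100" if "a \<in> wide" "0 < coord a 1" for a
  proof -
    let ?b = "(1 / coord a 1) *\<^sub>R a"
    have "?b = unit 1 + tail 2 ?b"
    proof (rule ell2_eqI)
      fix k :: nat
      consider "k = 0" | "k = 1" | "2 \<le> k" by linarith
      then show "coord ?b k = coord (unit 1 + tail 2 ?b) k"
        using that by cases (simp_all add: coord_unit coord_tail)
    qed
    then have "norm ?b \<le> norm (unit 1) + norm (tail 2 ?b)" by (metis norm_triangle_ineq)
    also have "norm (tail 2 ?b) \<le> 26/100 * coord a 1" using that by (intro norm_tail_le) auto
    also have "coord a 1 \<le> 1/4" using wide_coords(1)[OF that(1)] by simp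
    finally show ?thesis using norm_unit[of 1] by linarith
  qed
  show "norm bx \<le> 107/100" "norm by' \<le> 107/100"
    unfolding bx_def by'_def by (rule *[OF xw x1], rule *[OF yw y1])
qed

section \<open>Difference of the growth rates\<close>

lemma nl_b: "nl k x = \<xi>\<^sup>2 * nl k bx" "nl k y = \<eta>\<^sup>2 * nl k by'"
proof -
  have "x = \<xi> *\<^sub>R bx" "y = \<eta> *\<^sub>R by'" using x1 y1 by (simp_all add: bx_def by'_def)
  then show "nl k x = \<xi>\<^sup>2 * nl k bx" "nl k y = \<eta>\<^sup>2 * nl k by'" by (metis nl_scaleR)+
qed

text \<open>The part of \<open>nl 1\<close> without the first coordinate, written with tails so that
  both factors are small.\<close>

definition s :: "ell2 \<Rightarrow> real" where "s a = inner (tail 2 a) (shift 1 (tail 3 a))"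

lemma nl_1_b: "nl 1 a = 2 * coord a 1 * coord a 2 + 2 * s a"
proof -
  have "s a = (\<Sum>i. coord (tail 2 a) (Suc i) * coord (tail 3 a) (1 + Suc i))"
    unfolding s_def inner_shift ..
  also have "\<dots> = (\<Sum>i. coord (tail 2 a) (Suc (i + 1)) * coord (tail 3 a) (1 + Suc (i + 1)))"
  proof -
    have "summable (\<lambda>i. coord (tail 2 a) (Suc i) * coord (shift 1 (tail 3 a)) (Suc i))"
      using summable_ignore_initial_segment[OF summable_coord_mult[of "tail 2 a" "shift 1 (tail 3 a)"], of 1] by simp
    then have "summable (\<lambda>i. coord (tail 2 a) (Suc i) * coord (tail 3 a) (1 + Suc i))"
      by (simp add: coord_shift)
    from suminf_split_initial_segment[OF this, of 1] show ?thesis by (simp add: coord_tail)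
  qed
  also have "\<dots> = (\<Sum>i. coord a (i + 2) * coord a (i + 3))"
    by (intro arg_cong[where f = suminf] ext) (simp add: coord_tail numeral_3_eq_3)
  finally show ?thesis unfolding nl_1_split[of a] by (simp only:)
qed

lemma growth_eq: "growth \<mu> x = lam \<mu> 1 + 2 * \<xi>\<^sup>2 * cx + 2 * \<xi> * s bx"
  "growth \<mu> y = lam \<mu> 1 + 2 * \<eta>\<^sup>2 * cy + 2 * \<eta> * s by'"
proof -
  have *: "\<xi>\<^sup>2 * z / \<xi> = \<xi> * z" "\<eta>\<^sup>2 * z / \<eta> = \<eta> * z" for z
    using x1 y1 by (simp_all add: power2_eq_square)
  show "growth \<mu> x = lam \<mu> 1 + 2 * \<xi>\<^sup>2 * cx + 2 * \<xi> * s bx"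
    "growth \<mu> y = lam \<mu> 1 + 2 * \<eta>\<^sup>2 * cy + 2 * \<eta> * s by'"
    unfolding growth_def nl_b nl_1_b coord_b * by (simp_all add: power2_eq_square algebra_simps)
qed

text \<open>Splitting off \<open>2 * D * cx\<close> isolates the damping: \<open>cx\<close> is
  negative, so to leading order the point with the larger first mode grows more slowly.\<close>

lemma h_eq: "h = 2 * D * cx + 2 * \<eta>\<^sup>2 * coord d 2 + (2 * (\<xi> - \<eta>) * s bx + 2 * \<eta> * (s bx - s by'))"
  by (simp add: h_def growth_eq D_def d_def algebra_simps)

lemma abs_s: "\<bar>s bx\<bar> \<le> 5/1000 * \<xi>\<^sup>2"
proof -
  have "\<bar>s bx\<bar> \<le> norm (tail 2 bx) * norm (tail 3 bx)"
    unfolding s_def by (rule abs_inner_shift_le)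
  also have "\<dots> \<le> (26/100 * \<xi>) * (206/100 * (1/5)^3 * \<xi>)"
    unfolding bx_def using norm_tail_le[OF xw x1, of 3] x1 by (intro mult_mono) auto
  also have "\<dots> \<le> 5/1000 * \<xi>\<^sup>2" using x1 by (simp add: power2_eq_square power3_eq_cube)
  finally show ?thesis .
qed

lemma abs_s_diff: "\<bar>s bx - s by'\<bar> \<le> 17/1000 * \<xi> * norm \<Delta> + 26/100 * \<eta> * R"
proof -
  have t: "tail 2 bx - tail 2 by' = \<Delta>"
    by (rule ell2_eqI) (use coord_\<Delta>(1) in \<open>auto simp: coord_tail \<Delta>_def less_2_cases_iff\<close>)
  have t3: "tail 3 bx - tail 3 by' = tail 3 d"
    by (rule ell2_eqI) (use coord_\<Delta>(3) in \<open>auto simp: coord_tail \<Delta>_def\<close>)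
  have "s bx - s by' = inner (tail 2 bx - tail 2 by') (shift 1 (tail 3 bx)) + inner (tail 2 by') (shift 1 (tail 3 bx - tail 3 by'))"
    by (simp add: s_def inner_diff_left inner_diff_right shift_diff)
  also have "\<bar>\<dots>\<bar> \<le> norm \<Delta> * norm (tail 3 bx) + norm (tail 2 by') * R"
    unfolding t t3 R_def by (intro abs_le_sum_terms abs_inner_shift_le)
  also have "\<dots> \<le> norm \<Delta> * (17/1000 * \<xi>) + (26/100 * \<eta>) * R"
  proof (intro add_mono mult_left_mono mult_right_mono)
    have "norm (tail 3 bx) \<le> 206/100 * (1/5)^3 * \<xi>"
      unfolding bx_def by (rule norm_tail_le[OF xw x1]) simp
    also have "\<dots> \<le> 17/1000 * \<xi>" using x1 by (simp add: power3_eq_cube)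
    finally show "norm (tail 3 bx) \<le> 17/1000 * \<xi>" .
    show "norm (tail 2 by') \<le> 26/100 * \<eta>" unfolding by'_def by (rule norm_tail_le[OF yw y1]) (rule order_refl)
  qed (use nonneg in auto)
  finally show ?thesis by (simp add: mult_ac)
qed

lemma h_remainder:
  "\<bar>2 * (\<xi> - \<eta>) * s bx + 2 * \<eta> * (s bx - s by')\<bar> \<le> 3/1000 * D + 34/1000 * (\<xi> * \<eta> * norm \<Delta>) + 52/100 * (\<eta>\<^sup>2 * R)"
proof -
  have "\<bar>2 * (\<xi> - \<eta>) * s bx\<bar> \<le> 2 * (\<xi> - \<eta>) * (5/1000 * \<xi>\<^sup>2)"
    unfolding abs_mult[of "2 * (\<xi> - \<eta>)"] using abs_s yx by (intro mult_mono) auto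
  also have "\<dots> = 1/100 * \<xi> * (\<xi> * (\<xi> - \<eta>))" by (simp add: power2_eq_square)
  also have "\<dots> \<le> 1/100 * (1/4) * D"
    using D_bounds(1) small x1 yx by (intro mult_mono) auto
  finally have 1: "\<bar>2 * (\<xi> - \<eta>) * s bx\<bar> \<le> 3/1000 * D" using nonneg by simp
  have "\<bar>2 * \<eta> * (s bx - s by')\<bar> \<le> 2 * \<eta> * (17/1000 * \<xi> * norm \<Delta> + 26/100 * \<eta> * R)"
    using abs_s_diff y1 by (simp add: abs_mult mult_left_mono)
  also have "\<dots> = 34/1000 * (\<xi> * \<eta> * norm \<Delta>) + 52/100 * (\<eta>\<^sup>2 * R)"
    by (simp add: algebra_simps power2_eq_square)
  finally show ?thesis using 1 by linarith
qed

text \<open>The dissipation in the chart: cx \<le> -1/8 bounds the leading term by - p * D / 4. In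
  the errors p either multiplies D or comes with \<eta>^2 or \<xi> * \<eta>, and such a product is
  traded for D.\<close>

lemma p_h: "p * h \<le> - (244/1000) * (p * D) + 101/100 * (D * q) + 30/100 * (D * R)"
proof -
  have "p * h = p * (2 * D * cx) + p * (2 * \<eta>\<^sup>2 * coord d 2) + p * (2 * (\<xi> - \<eta>) * s bx + 2 * \<eta> * (s bx - s by'))"
    unfolding h_eq by (simp add: distrib_left)
  moreover have "p * (2 * D * cx) \<le> - (1/4) * (p * D)"
  proof -
    have "(2 * p * D) * cx \<le> (2 * p * D) * (- (1/8))"
      using nonneg wide_chart_bounds(2)[OF xw x1] by (intro mult_left_mono) auto
    then show ?thesis by (simp add: mult_ac)
  qed
  moreover have "p * (2 * \<eta>\<^sup>2 * coord d 2) \<le> D * q"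
  proof -
    have "p * (2 * \<eta>\<^sup>2 * coord d 2) \<le> p * (2 * \<eta>\<^sup>2 * q)"
      using nonneg by (intro mult_left_mono) (auto simp: q_def)
    also have "\<dots> = 2 * (\<eta>\<^sup>2 * p) * q" by simp
    also have "\<dots> \<le> D * q" using D_bounds(6) nonneg by (intro mult_right_mono) auto
    finally show ?thesis .
  qed
  moreover have "p * (2 * (\<xi> - \<eta>) * s bx + 2 * \<eta> * (s bx - s by'))
    \<le> 3/1000 * (p * D) + 34/1000 * (D * norm \<Delta>) + 26/100 * (D * R)"
  proof -
    have "p * (2 * (\<xi> - \<eta>) * s bx + 2 * \<eta> * (s bx - s by')) \<le> p * (3/1000 * D + 34/1000 * (\<xi> * \<eta> * norm \<Delta>) + 52/100 * (\<eta>\<^sup>2 * R))"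
      using h_remainder nonneg(1) by (intro mult_left_mono) auto
    also have "\<dots> = 3/1000 * (p * D) + 34/1000 * ((\<xi> * \<eta> * p) * norm \<Delta>) + 26/100 * ((2 * (\<eta>\<^sup>2 * p)) * R)"
      by (simp add: algebra_simps)
    also have "\<dots> \<le> 3/1000 * (p * D) + 34/1000 * (D * norm \<Delta>) + 26/100 * (D * R)"
      using D_bounds(5,6) nonneg by (intro add_mono mult_left_mono mult_right_mono) auto
    finally show ?thesis .
  qed
  moreover have "D * norm \<Delta> \<le> p * D / 16 + D * q / 4 + D * R"
  proof -
    have "\<eta> * q \<le> q / 4" using small nonneg mult_right_mono[of \<eta> "1/4" q] by simp
    moreover have "(\<xi> - \<eta>) / 4 \<le> p / 16" using D_bounds(8) by simp
    ultimately have "norm \<Delta> \<le> p / 16 + q / 4 + R" using norm_\<Delta> by linarith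
    then have "D * norm \<Delta> \<le> D * (p / 16 + q / 4 + R)" using nonneg by (intro mult_left_mono) auto
    then show ?thesis by (simp add: algebra_simps)
  qed
  moreover have "0 \<le> p * D" "0 \<le> D * q" "0 \<le> D * R" using nonneg by simp_all
  ultimately show ?thesis by linarith
qed

lemma abs_h: "\<bar>h\<bar> \<le> 51/100 * D + 13/100 * q + 4/100 * R"
proof -
  have "\<bar>2 * D * cx\<bar> \<le> 2 * D * (1/4)"
    unfolding abs_mult[of "2 * D"] using wide_chart_bounds(1,2)[OF xw x1] nonneg
    by (intro mult_mono) (auto simp: abs_le_iff)
  moreover have "\<eta> * \<eta> \<le> 1/4 * (1/4)" using small y1 by (intro mult_mono) auto
  then have b2: "\<eta>\<^sup>2 \<le> 1/16" by (simp add: power2_eq_square)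
  then have "\<bar>2 * \<eta>\<^sup>2 * coord d 2\<bar> \<le> 1/8 * q"
    using nonneg mult_right_mono[of "2 * \<eta>\<^sup>2" "1/8" q] by (simp add: abs_mult q_def)
  moreover have "\<eta>\<^sup>2 * R \<le> 1/16 * R" using b2 nonneg by (intro mult_right_mono) auto
  moreover have "\<xi> * \<eta> * norm \<Delta> \<le> D / 32 + q / 64 + R / 16"
  proof -
    have "\<xi> * (\<eta> * norm \<Delta>) \<le> 1/4 * (D / 8 + q / 16 + R / 4)"
      using mult_norm_\<Delta>(1) small x1 y1 by (intro mult_mono) auto
    then show ?thesis by (simp add: mult.assoc)
  qed
  ultimately show ?thesis
    unfolding h_eq using h_remainder nonneg by linarith
qed

section \<open>Damping of the second and of the high modes\<close>

lemma abs_nl_2_diff: "\<bar>nl 2 bx - nl 2 by'\<bar> \<le> 4/1000 * D + 1/1000 * q + 43/10 * R"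
proof -
  have nl2: "nl 2 b = 4 * inner b (shift 2 b) - 2 * (coord b 1)\<^sup>2" for b
  proof -
    have "{1..2 - 1::nat} = {1}" by auto
    then have "inner b (reflect 2 b) = (coord b 1)\<^sup>2"
      unfolding inner_reflect by (simp add: power2_eq_square)
    then show ?thesis by (simp add: nl_def bil_def)
  qed
  \<comment> \<open>The convolution part equals -2 at both points, the first coordinates being 1,
    and cancels.\<close>
  have "nl 2 bx - nl 2 by' = 4 * (inner bx (shift 2 bx) - inner by' (shift 2 by'))"
    unfolding nl2 coord_b by simp
  also have "inner bx (shift 2 bx) - inner by' (shift 2 by') = inner \<Delta> (shift 2 bx) + inner by' (shift 2 \<Delta>)"
    by (simp add: \<Delta>_def inner_diff_left inner_diff_right shift_diff)
  \<comment> \<open>\<Delta> has no first coordinate, so the shift by 2 meets only the modes of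
    \<open>bx\<close> from 4 on, of size 5^-4.\<close>
  also have "inner \<Delta> (shift 2 bx) = inner \<Delta> (shift 2 (tail 4 bx))"
  proof (rule inner_shift_cong)
    fix i :: nat assume "1 \<le> i" "coord \<Delta> i \<noteq> 0"
    then have "i \<noteq> 1" using coord_\<Delta>(1) by auto
    with \<open>1 \<le> i\<close> show "coord bx (2 + i) = coord (tail 4 bx) (2 + i)" by (simp add: coord_tail)
  qed
  also have "inner by' (shift 2 \<Delta>) = inner by' (shift 2 (tail 3 d))"
    by (rule inner_shift_cong) (simp add: coord_tail coord_\<Delta>)
  finally have eq: "nl 2 bx - nl 2 by' = 4 * (inner \<Delta> (shift 2 (tail 4 bx)) + inner by' (shift 2 (tail 3 d)))" .
  have "\<bar>nl 2 bx - nl 2 by'\<bar> = 4 * \<bar>inner \<Delta> (shift 2 (tail 4 bx)) + inner by' (shift 2 (tail 3 d))\<bar>"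
    unfolding eq abs_mult by simp
  also have "\<bar>inner \<Delta> (shift 2 (tail 4 bx)) + inner by' (shift 2 (tail 3 d))\<bar> \<le> norm \<Delta> * norm (tail 4 bx) + norm by' * R"
    unfolding R_def by (intro abs_le_sum_terms abs_inner_shift_le)
  also have "norm by' * R \<le> 107/100 * R" using norm_b nonneg by (intro mult_right_mono) auto
  also have "norm \<Delta> * norm (tail 4 bx) \<le> norm \<Delta> * (34/10000 * \<xi>)"
  proof (rule mult_left_mono)
    have "norm (tail 4 bx) \<le> 206/100 * (1/5)^4 * \<xi>"
      unfolding bx_def by (rule norm_tail_le[OF xw x1]) simp
    also have "\<dots> \<le> 34/10000 * \<xi>" using x1 by (simp add: power4_eq_xxxx)
    finally show "norm (tail 4 bx) \<le> 34/10000 * \<xi>" .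
  qed simp
  finally show ?thesis using mult_norm_\<Delta>(2) nonneg by (simp add: mult.commute[of "norm \<Delta>"])
qed

lemma growth_small: "\<bar>growth \<mu> x\<bar> \<le> 5/100"
proof -
  have "\<xi>\<^sup>2 \<le> (1/4)\<^sup>2" using small x1 by (intro power_mono) auto
  then have "\<xi>\<^sup>2 \<le> 1/16" "0 \<le> \<xi>\<^sup>2" by (simp_all add: power2_eq_square)
  moreover have "- (1/100) \<le> lam \<mu> 1" "lam \<mu> 1 \<le> 1/100" using lam_bounds(1)[OF mu] mu by linarith+
  ultimately show ?thesis using wide_growth[OF xw x1, of \<mu>] by linarith
qed

lemma mode_2: "coord d 2 * E 2 \<le> - (115/10) * q\<^sup>2 + 27/100 * (D * q) + 435/100 * (R * q)"
proof -
  have E2: "E 2 = (lam \<mu> 2 - 2 * growth \<mu> x) * coord d 2 + (- 2 * h * cy + (nl 2 bx - nl 2 by'))"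
  proof -
    have c: "coord x 2 / \<xi>\<^sup>2 = cx" "coord y 2 / \<eta>\<^sup>2 = cy" using x1 y1 by (simp_all add: coord_chart)
    have n: "nl 2 x / \<xi>\<^sup>2 = nl 2 bx" "nl 2 y / \<eta>\<^sup>2 = nl 2 by'" using x1 y1 by (simp_all add: nl_b)
    have "E 2 = (lam \<mu> 2 - 2 * growth \<mu> x) * cx + nl 2 bx - ((lam \<mu> 2 - 2 * growth \<mu> y) * cy + nl 2 by')"
      unfolding E_def chart_rate_def c n by simp
    then show ?thesis by (simp add: d_def h_def algebra_simps)
  qed
  have "coord d 2 * E 2 = (lam \<mu> 2 - 2 * growth \<mu> x) * q\<^sup>2 + coord d 2 * (- 2 * h * cy + (nl 2 bx - nl 2 by'))"
    unfolding E2 by (simp add: q_def power2_eq_square algebra_simps)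
  also have "(lam \<mu> 2 - 2 * growth \<mu> x) * q\<^sup>2 \<le> - (1174/100) * q\<^sup>2"
    using lam_bounds(3)[OF mu] growth_small by (intro mult_right_mono) (auto simp: abs_le_iff)
  also have "coord d 2 * (- 2 * h * cy + (nl 2 bx - nl 2 by')) \<le> q * (26/100 * D + 7/100 * q + 432/100 * R)"
  proof -
    have "\<bar>2 * h * cy\<bar> \<le> 2 * \<bar>h\<bar> * (1/4)"
      unfolding abs_mult using wide_chart_bounds(1,2)[OF yw y1] by (intro mult_mono) (auto simp: abs_le_iff)
    then have "\<bar>- 2 * h * cy + (nl 2 bx - nl 2 by')\<bar> \<le> 26/100 * D + 7/100 * q + 432/100 * R"
      using abs_h abs_nl_2_diff nonneg by linarith
    then have "q * \<bar>- 2 * h * cy + (nl 2 bx - nl 2 by')\<bar> \<le> q * (26/100 * D + 7/100 * q + 432/100 * R)"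
      using nonneg by (intro mult_left_mono) auto
    then show ?thesis
      using abs_ge_self[of "coord d 2 * (- 2 * h * cy + (nl 2 bx - nl 2 by'))"] by (simp add: abs_mult q_def)
  qed
  finally have "coord d 2 * E 2 \<le> - (1174/100) * q\<^sup>2 + q * (26/100 * D + 7/100 * q + 432/100 * R)" by simp
  moreover have "0 \<le> D * q" "0 \<le> R * q" "0 \<le> q\<^sup>2" using nonneg by simp_all
  moreover have "q * (26/100 * D + 7/100 * q + 432/100 * R) = 26/100 * (D * q) + 7/100 * q\<^sup>2 + 432/100 * (R * q)"
    by (simp add: algebra_simps power2_eq_square)
  ultimately show ?thesis by linarith
qed

text \<open>Measures the forcing of the high modes: mode k receives at most k * K. The coefficients
  are rounded up from the three estimates in \<open>E_high\<close>.\<close>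

definition "K = 18/10 * D + 42/100 * q + 162/100 * R"

lemma E_high:
  assumes k: "3 \<le> k"
  shows "\<bar>E k - (lam \<mu> k - growth \<mu> x) * coord d k\<bar> \<le> real k * K"
proof -
  have "E k - (lam \<mu> k - growth \<mu> x) * coord d k
      = - h * coord (chart y) k + ((\<xi> - \<eta>) * nl k bx + \<eta> * (nl k bx - nl k by'))"
  proof -
    have c: "coord x k / \<xi> = coord (chart x) k" "coord y k / \<eta> = coord (chart y) k"
      using x1 y1 k by (simp_all add: coord_chart)
    have n: "nl k x / \<xi> = \<xi> * nl k bx" "nl k y / \<eta> = \<eta> * nl k by'"
      using x1 y1 by (simp_all add: nl_b power2_eq_square)
    have "E k = (lam \<mu> k - growth \<mu> x) * coord (chart x) k + \<xi> * nl k bx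
        - ((lam \<mu> k - growth \<mu> y) * coord (chart y) k + \<eta> * nl k by')"
      using k unfolding E_def chart_rate_def c n by simp
    then show ?thesis by (simp add: d_def h_def algebra_simps)
  qed
  also have "\<bar>\<dots>\<bar> \<le> \<bar>h * coord (chart y) k\<bar> + \<bar>(\<xi> - \<eta>) * nl k bx\<bar> + \<bar>\<eta> * (nl k bx - nl k by')\<bar>"
    by linarith
  also have "\<bar>(\<xi> - \<eta>) * nl k bx\<bar> \<le> real k * (96/100 * D)"
  proof -
    have kk: "(40 * (real k)\<^sup>2 - 36 * real k) * (1/5)^k \<le> real k * (96/100)"
    proof -
      have "(40 * (real k)\<^sup>2 - 36 * real k) * (1/5)^k \<le> (40 * (real k)\<^sup>2) * (1/5)^k"
        by (intro mult_right_mono) auto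
      also have "\<dots> = 40 * real k * (real k * (1/5)^k)" by (simp add: power2_eq_square)
      also have "\<dots> \<le> 40 * real k * (3/125)" using power_one_fifth_le[OF k] by (intro mult_left_mono) auto
      finally show ?thesis by simp
    qed
    have "\<xi>\<^sup>2 * \<bar>nl k bx\<bar> = \<bar>nl k x\<bar>" by (simp add: nl_b abs_mult)
    also have "\<dots> \<le> (40 * (real k)\<^sup>2 - 36 * real k) * (1/5)^k * \<bar>\<xi>\<bar>^3"
      by (rule wide_nl_ge_3[OF xw k])
    also have "\<dots> \<le> real k * (96/100) * \<bar>\<xi>\<bar>^3" using kk by (intro mult_right_mono) auto
    also have "\<dots> = \<xi>\<^sup>2 * (real k * (96/100) * \<xi>)" using x1 by (simp add: power2_eq_square power3_eq_cube)
    finally have "\<bar>nl k bx\<bar> \<le> real k * (96/100) * \<xi>" using x1 by (simp add: mult_le_cancel_left_pos)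
    then have "(\<xi> - \<eta>) * \<bar>nl k bx\<bar> \<le> (\<xi> - \<eta>) * (real k * (96/100) * \<xi>)"
      using yx by (intro mult_left_mono) auto
    also have "\<dots> = real k * (96/100) * (\<xi> * (\<xi> - \<eta>))" by simp
    also have "\<dots> \<le> real k * (96/100) * D" using D_bounds(1) by (intro mult_left_mono) auto
    finally show ?thesis using yx by (simp add: abs_mult)
  qed
  also have "\<bar>\<eta> * (nl k bx - nl k by')\<bar> \<le> real k * (642/100 * (D / 8 + q / 16 + R / 4))"
  proof -
    have "\<bar>nl k bx - nl k by'\<bar> \<le> 3 * real k * (norm \<Delta> * (norm bx + norm by'))"
      unfolding \<Delta>_def by (rule nl_lipschitz)
    also have "\<dots> \<le> 3 * real k * (norm \<Delta> * (107/100 + 107/100))"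
      using norm_b by (intro mult_left_mono add_mono) auto
    finally have "\<eta> * \<bar>nl k bx - nl k by'\<bar> \<le> \<eta> * (3 * real k * (norm \<Delta> * (107/100 + 107/100)))"
      using y1 by (intro mult_left_mono) auto
    also have "\<dots> = real k * (642/100 * (\<eta> * norm \<Delta>))" by simp
    also have "\<dots> \<le> real k * (642/100 * (D / 8 + q / 16 + R / 4))"
      using mult_norm_\<Delta>(1) by (intro mult_left_mono) auto
    finally show ?thesis using y1 by (simp add: abs_mult)
  qed
  also have "\<bar>h * coord (chart y) k\<bar> \<le> real k * (4/1000 * \<bar>h\<bar>)"
  proof -
    have "\<bar>coord (chart y) k\<bar> \<le> 2 * (1/5)^k * \<eta>" by (rule wide_chart_bounds(3)[OF yw y1 k])
    also have "\<dots> \<le> 2 * (1/5)^k * (1/4)" using small by (intro mult_left_mono) auto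
    also have "\<dots> \<le> real k * (1/5)^k * (1/6)" using k by simp
    also have "\<dots> \<le> 3/125 * (1/6)" using power_one_fifth_le[OF k] by simp
    also have "\<dots> \<le> 4/1000 * real k" using k by simp
    finally have "\<bar>h\<bar> * \<bar>coord (chart y) k\<bar> \<le> \<bar>h\<bar> * (4/1000 * real k)" by (intro mult_left_mono) auto
    then show ?thesis by (simp add: abs_mult mult_ac)
  qed
  finally have "\<bar>E k - (lam \<mu> k - growth \<mu> x) * coord d k\<bar>
      \<le> real k * (4/1000 * \<bar>h\<bar> + 96/100 * D + 642/100 * (D / 8 + q / 16 + R / 4))"
    by (simp add: distrib_left)
  also have "\<dots> \<le> real k * K"
  proof (rule mult_left_mono)
    have "642/100 * (D / 8 + q / 16 + R / 4) = 8025/10000 * D + 40125/100000 * q + 1605/1000 * R" by simp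
    then show "4/1000 * \<bar>h\<bar> + 96/100 * D + 642/100 * (D / 8 + q / 16 + R / 4) \<le> K"
      unfolding K_def using abs_h nonneg by linarith
  qed simp
  finally show ?thesis .
qed

text \<open>With X = k^2 * |d_k| the forcing term is X * K / k, and Young's inequality splits it
  into 4/10 X^2 and a summable 5/8 K^2 / k^2. The damping 87/100 X^2 absorbs the former; since X^2
  \<ge> 81 d_k^2, more than 36 d_k^2 remains.\<close>

lemma mode_high:
  assumes k: "3 \<le> k"
  shows "coord d k * E k \<le> - 36 * (coord d k)\<^sup>2 + 5/8 * K\<^sup>2 * (1 / (real k)\<^sup>2)"
proof -
  define X where "X = (real k)\<^sup>2 * \<bar>coord d k\<bar>"
  have kpos: "0 < real k" using k by simp
  have X2: "X\<^sup>2 = real k ^ 4 * (coord d k)\<^sup>2"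
    by (simp add: X_def power_mult_distrib power_mult[symmetric])
  have "\<bar>coord d k * (E k - (lam \<mu> k - growth \<mu> x) * coord d k)\<bar> \<le> \<bar>coord d k\<bar> * (real k * K)"
    unfolding abs_mult by (intro mult_left_mono E_high k) simp
  also have "\<bar>coord d k\<bar> * (real k * K) = X * (K / real k)"
    using kpos by (simp add: X_def power2_eq_square)
  also have "X * (K / real k) \<le> 4/10 * X\<^sup>2 + 5/8 * (K / real k)\<^sup>2"
  proof -
    have "0 \<le> (4/10 * X - 1/2 * (K / real k))\<^sup>2" by simp
    then show ?thesis by (simp add: power2_eq_square algebra_simps)
  qed
  finally have "coord d k * (E k - (lam \<mu> k - growth \<mu> x) * coord d k) \<le> 4/10 * X\<^sup>2 + 5/8 * (K / real k)\<^sup>2"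
    by linarith
  moreover have "coord d k * ((lam \<mu> k - growth \<mu> x) * coord d k) \<le> - (87/100) * X\<^sup>2 + 5/100 * (coord d k)\<^sup>2"
  proof -
    have "(lam \<mu> k - growth \<mu> x) * (coord d k)\<^sup>2 \<le> (- (87/100) * real k ^ 4 + 5/100) * (coord d k)\<^sup>2"
      using lam_bounds(5)[OF mu k] growth_small by (intro mult_right_mono) (auto simp: abs_le_iff)
    moreover have "coord d k * ((lam \<mu> k - growth \<mu> x) * coord d k) = (lam \<mu> k - growth \<mu> x) * (coord d k)\<^sup>2"
      by (simp add: power2_eq_square)
    moreover have "(- (87/100) * real k ^ 4 + 5/100) * (coord d k)\<^sup>2 = - (87/100) * X\<^sup>2 + 5/100 * (coord d k)\<^sup>2"
      unfolding X2 by (simp add: algebra_simps)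
    ultimately show ?thesis by linarith
  qed
  moreover have "81 * (coord d k)\<^sup>2 \<le> X\<^sup>2"
  proof -
    have "3^4 \<le> real k ^ 4" using k by (intro power_mono) auto
    then show ?thesis unfolding X2 by (intro mult_right_mono) auto
  qed
  moreover have "coord d k * E k = coord d k * (E k - (lam \<mu> k - growth \<mu> x) * coord d k) + coord d k * ((lam \<mu> k - growth \<mu> x) * coord d k)"
    by (simp add: algebra_simps)
  moreover have "0 \<le> (coord d k)\<^sup>2" by simp
  ultimately have "coord d k * E k \<le> - 36 * (coord d k)\<^sup>2 + 5/8 * (K / real k)\<^sup>2" by linarith
  then show ?thesis by (simp add: power_divide)
qed

text \<open>The sum of 1/k^2 over k \<ge> 3 is at most the telescoping sum of 1/(k - 1) - 1/k, which
  is 1/2.\<close>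

lemma sum_high:
  assumes "summable (\<lambda>i. coord d (i + 3) * E (i + 3))"
  shows "(\<Sum>i. coord d (i + 3) * E (i + 3)) \<le> - 36 * R\<^sup>2 + 5/16 * K\<^sup>2"
proof -
  let ?t = "\<lambda>i. 1 / real (i + 2) - 1 / real (Suc i + 2)"
  have "(\<lambda>i. 1 / real (i + 2)) \<longlonglongrightarrow> 0"
    using LIMSEQ_ignore_initial_segment[OF lim_1_over_n, of 2] by simp
  from telescope_sums'[OF this] have t: "?t sums (1/2)" by simp
  have tt: "1 / (real (i + 3))\<^sup>2 \<le> ?t i" for i
  proof -
    have "1 / (real (i + 3))\<^sup>2 \<le> 1 / (real (i + 2) * real (i + 3))"
      by (intro divide_left_mono) (auto simp: power2_eq_square intro!: mult_right_mono)
    also have "\<dots> = ?t i" by (simp add: divide_simps)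
    finally show ?thesis .
  qed
  have s: "summable (\<lambda>i. (coord d (i + 3))\<^sup>2)"
    by (rule summable_ignore_initial_segment[OF summable_coord_square])
  have st: "(\<lambda>i. - 36 * (coord d (i + 3))\<^sup>2 + 5/8 * K\<^sup>2 * ?t i) sums (- 36 * R\<^sup>2 + 5/8 * K\<^sup>2 * (1/2))"
    unfolding R_def norm_tail_square by (intro sums_add sums_mult summable_sums s t)
  have "(\<Sum>i. coord d (i + 3) * E (i + 3)) \<le> (\<Sum>i. - 36 * (coord d (i + 3))\<^sup>2 + 5/8 * K\<^sup>2 * ?t i)"
  proof (rule suminf_le[OF _ assms sums_summable[OF st]])
    fix i
    have "5/8 * K\<^sup>2 * (1 / (real (i + 3))\<^sup>2) \<le> 5/8 * K\<^sup>2 * ?t i"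
      using tt by (intro mult_left_mono) auto
    with mode_high[OF le_add2, of i]
    show "coord d (i + 3) * E (i + 3) \<le> - 36 * (coord d (i + 3))\<^sup>2 + 5/8 * K\<^sup>2 * ?t i" by linarith
  qed
  also have "\<dots> = - 36 * R\<^sup>2 + 5/16 * K\<^sup>2" using st by (simp add: sums_iff)
  finally show ?thesis .
qed

text \<open>\<open>S\<close> is half the derivative of the squared distance of the two points in the chart.\<close>

context
  fixes S assumes s: "summable (\<lambda>i. coord d (i + 3) * E (i + 3))"
    and S: "S = coord d 1 * E 1 + coord d 2 * E 2 + (\<Sum>i. coord d (i + 3) * E (i + 3))"
begin

lemma E_1: "E 1 = 2 * h"
  by (simp add: E_def chart_rate_def h_def algebra_simps)

lemma K_square: "5/16 * K\<^sup>2 \<le> 102/100 * D\<^sup>2 + 6/100 * q\<^sup>2 + 83/100 * R\<^sup>2 + 48/100 * (D * q) + 183/100 * (D * R) + 43/100 * (R * q)"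
proof -
  have "5/16 * K\<^sup>2 = 5/16 * 324/100 * D\<^sup>2 + 5/16 * 1764/10000 * q\<^sup>2 + 5/16 * 26244/10000 * R\<^sup>2
      + 5/16 * 1512/1000 * (D * q) + 5/16 * 5832/1000 * (D * R) + 5/16 * 13608/10000 * (R * q)"
    unfolding K_def by (simp add: power2_eq_square algebra_simps)
  moreover have "0 \<le> D * q" "0 \<le> D * R" "0 \<le> R * q" "0 \<le> D\<^sup>2" "0 \<le> q\<^sup>2" "0 \<le> R\<^sup>2" using nonneg by simp_all
  ultimately show ?thesis by linarith
qed

lemma products:
  "2 * (D * q) \<le> D\<^sup>2 + q\<^sup>2" "2 * (D * R) \<le> D\<^sup>2 + R\<^sup>2" "2 * (R * q) \<le> R\<^sup>2 + q\<^sup>2" "8 * D\<^sup>2 \<le> p * D"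
  using sum_squares_bound[of D q] sum_squares_bound[of D R] sum_squares_bound[of R q]
    mult_right_mono[OF D_bounds(7) nonneg(2)]
  by (simp_all add: power2_eq_square mult.assoc)

text \<open>Mixed products are split into squares, and D^2 is absorbed by p * D. The rate is limited
  by the first coordinate, where p * D \<ge> 2 * \<eta>^2 * p^2 is what remains; hence the factor
  \<eta>^2.\<close>

lemma contraction_aux: "S \<le> - (1/20) * \<eta>\<^sup>2 * (norm d)\<^sup>2"
proof -
  have "S \<le> 4 * (p * h) + coord d 2 * E 2 + (- 36 * R\<^sup>2 + 5/16 * K\<^sup>2)"
    using sum_high[OF s] unfolding S d1 E_1 by simp
  then have "S \<le> - (15/100) * (p * D) - 6 * q\<^sup>2 - 30 * R\<^sup>2"
    using p_h mode_2 K_square products zero_le_power2[of q] zero_le_power2[of R] zero_le_power2[of D] by linarith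
  moreover have "2 * (\<eta>\<^sup>2 * p\<^sup>2) \<le> p * D"
    using mult_right_mono[OF D_bounds(6) nonneg(1)] by (simp add: power2_eq_square mult_ac)
  moreover have "\<eta>\<^sup>2 * q\<^sup>2 \<le> 1 * q\<^sup>2" "\<eta>\<^sup>2 * R\<^sup>2 \<le> 1 * R\<^sup>2"
    using small y1 by (intro mult_right_mono power_le_one; simp)+
  moreover have "(1/20) * \<eta>\<^sup>2 * (norm d)\<^sup>2 = (1/5) * (\<eta>\<^sup>2 * p\<^sup>2) + (1/20) * (\<eta>\<^sup>2 * q\<^sup>2) + (1/20) * (\<eta>\<^sup>2 * R\<^sup>2)"
    unfolding norm_d by (simp add: algebra_simps)
  moreover have "0 \<le> \<eta>\<^sup>2 * p\<^sup>2" "0 \<le> q\<^sup>2" "0 \<le> R\<^sup>2" by simp_all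
  ultimately show ?thesis by linarith
qed

text \<open>The assumption says that the squared differences of the other coordinates together
  exceed that of the first. Their damping then dominates the slow first coordinate, at a rate that
  does not depend on the amplitudes. The left side is half the derivative of the cone form.\<close>

lemma cone_aux:
  assumes G: "2 * (coord d 1)\<^sup>2 < (norm d)\<^sup>2"
  shows "S - 2 * (coord d 1 * E 1) < - ((norm d)\<^sup>2 - 2 * (coord d 1)\<^sup>2)"
proof -
  define Q where "Q = q\<^sup>2 + R\<^sup>2"
  have Q: "4 * p\<^sup>2 < Q" using G unfolding norm_d d1 Q_def by (simp add: power_mult_distrib)
  have "64 * D\<^sup>2 \<le> p\<^sup>2"
    using mult_mono[OF D_bounds(7) D_bounds(7)] nonneg by (simp add: power2_eq_square)
  then have D2: "256 * D\<^sup>2 \<le> Q" using Q by linarith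
  have "\<bar>coord d 1 * E 1\<bar> = 4 * (p * \<bar>h\<bar>)" unfolding d1 E_1 using nonneg by (simp add: abs_mult)
  also have "\<dots> \<le> 4 * (p * (51/100 * D + 13/100 * q + 4/100 * R))"
    using abs_h nonneg by (intro mult_left_mono) auto
  also have "\<dots> = 2 * (51/100 * (p * (2 * D)) + 13/100 * (2 * p * q) + 4/100 * (2 * p * R))"
    by (simp add: algebra_simps)
  also have "p * (2 * D) \<le> p\<^sup>2 + D\<^sup>2" using sum_squares_bound[of p D] by simp
  also have "2 * p * q \<le> p\<^sup>2 + q\<^sup>2" by (rule sum_squares_bound)
  also have "2 * p * R \<le> p\<^sup>2 + R\<^sup>2" by (rule sum_squares_bound)
  finally have "\<bar>coord d 1 * E 1\<bar> \<le> 2 * (51/100 * (p\<^sup>2 + D\<^sup>2) + 13/100 * (p\<^sup>2 + q\<^sup>2) + 4/100 * (p\<^sup>2 + R\<^sup>2))"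
    by simp
  then have "\<bar>coord d 1 * E 1\<bar> \<le> 136/100 * p\<^sup>2 + 102/100 * D\<^sup>2 + 26/100 * q\<^sup>2 + 8/100 * R\<^sup>2"
    by (simp add: algebra_simps add_divide_distrib)
  moreover have "S - coord d 1 * E 1 \<le> coord d 2 * E 2 + (- 36 * R\<^sup>2 + 5/16 * K\<^sup>2)"
    using sum_high[OF s] unfolding S by simp
  moreover have "- ((norm d)\<^sup>2 - 2 * (coord d 1)\<^sup>2) = 4 * p\<^sup>2 - q\<^sup>2 - R\<^sup>2"
    unfolding norm_d d1 by (simp add: power_mult_distrib)
  moreover have "0 \<le> D\<^sup>2" "0 \<le> q\<^sup>2" "0 \<le> R\<^sup>2" "0 \<le> p\<^sup>2" by simp_all
  ultimately show ?thesis
    using mode_2 K_square products Q D2 unfolding Q_def by linarith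
qed

end

text \<open>Where the first coordinate dominates, its difference changes at a relative rate of at
  most 1, uniformly down to the origin.\<close>

lemma E_1_le:
  assumes "(norm d)\<^sup>2 \<le> 2 * (coord d 1)\<^sup>2" shows "\<bar>E 1\<bar> \<le> \<bar>coord d 1\<bar>"
proof -
  have "q\<^sup>2 + R\<^sup>2 \<le> (2 * p)\<^sup>2" using assms unfolding norm_d d1 by (simp add: power_mult_distrib)
  then have "q\<^sup>2 \<le> (2 * p)\<^sup>2" "R\<^sup>2 \<le> (2 * p)\<^sup>2" using zero_le_power2[of q] zero_le_power2[of R] by linarith+
  then have "q \<le> 2 * p" "R \<le> 2 * p" using nonneg by (auto intro: power2_le_imp_le)
  moreover have "E 1 = 2 * h" by (simp add: E_def chart_rate_def h_def algebra_simps)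
  ultimately show ?thesis unfolding d1 using abs_h D_bounds(7) nonneg by (simp add: abs_mult)
qed

end

section \<open>Distances in the chart and in the sequence space\<close>

context ordered_pair
begin

text \<open>No amplitude enters the constant, because inverting the chart multiplies by powers of
  the small first modes; 8 rounds up 1 + 25/4.\<close>

lemma norm_diff_le_chart: "norm (x - y) \<le> 8 * norm d"
proof -
  have d1n: "\<bar>coord d 1\<bar> \<le> norm d" by (rule abs_coord_le_norm)
  have xy: "\<xi> - \<eta> \<le> \<bar>coord d 1\<bar> / 8" using D_bounds(8) nonneg d1 by simp
  have "norm (x - y) \<le> norm (abs_ell2 d + (25 * \<bar>coord d 1\<bar>) *\<^sub>R geom)"
  proof (rule norm_coord_mono)
    fix k :: nat assume "1 \<le> k"
    then consider "k = 1" | "k = 2" | "3 \<le> k" by linarith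
    then have "\<bar>coord x k - coord y k\<bar> \<le> \<bar>coord d k\<bar> + 25 * \<bar>coord d 1\<bar> * (1/5)^k"
    proof cases
      case 1
      have "\<bar>\<xi> - \<eta>\<bar> \<le> \<bar>coord d 1\<bar> / 8" using xy yx by simp
      then show ?thesis unfolding 1 power_one_right using abs_ge_zero[of "coord d 1"] by linarith
    next
      case 2
      have "coord x 2 = \<xi>\<^sup>2 * cx" "coord y 2 = \<eta>\<^sup>2 * cy" using x1 y1 by (simp_all add: coord_chart)
      then have "coord x 2 - coord y 2 = \<xi>\<^sup>2 * coord d 2 + D * cy"
        by (simp add: d_def D_def algebra_simps)
      also have "\<bar>\<dots>\<bar> \<le> \<bar>\<xi>\<^sup>2 * coord d 2\<bar> + \<bar>D * cy\<bar>" by (rule abs_triangle_ineq)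
      also have "\<bar>\<xi>\<^sup>2 * coord d 2\<bar> \<le> 1 * \<bar>coord d 2\<bar>"
        unfolding abs_mult using small x1 by (intro mult_right_mono) (auto intro: power_le_one)
      also have "\<bar>D * cy\<bar> \<le> D * 1"
        unfolding abs_mult using nonneg wide_chart_bounds(1,2)[OF yw y1] by (intro mult_mono) (auto simp: abs_le_iff)
      finally show ?thesis using D_bounds(7) nonneg d1 unfolding 2 by (simp add: power2_eq_square)
    next
      case 3
      have "coord x k = \<xi> * coord (chart x) k" "coord y k = \<eta> * coord (chart y) k"
        using x1 y1 3 by (simp_all add: coord_chart)
      then have "coord x k - coord y k = \<xi> * coord d k + (\<xi> - \<eta>) * coord (chart y) k"
        by (simp add: d_def algebra_simps)
      also have "\<bar>\<dots>\<bar> \<le> \<bar>\<xi> * coord d k\<bar> + \<bar>(\<xi> - \<eta>) * coord (chart y) k\<bar>" by (rule abs_triangle_ineq)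
      also have "\<bar>\<xi> * coord d k\<bar> \<le> 1 * \<bar>coord d k\<bar>"
        unfolding abs_mult using small x1 by (intro mult_right_mono) auto
      also have "\<bar>(\<xi> - \<eta>) * coord (chart y) k\<bar> \<le> (\<bar>coord d 1\<bar> / 8) * (2 * (1/5)^k * \<eta>)"
        unfolding abs_mult using xy yx wide_chart_bounds(3)[OF yw y1 3] by (intro mult_mono) auto
      also have "\<dots> \<le> (\<bar>coord d 1\<bar> / 8) * (2 * (1/5)^k * 1)"
        using small by (intro mult_left_mono) auto
      also have "\<dots> \<le> 25 * \<bar>coord d 1\<bar> * (1/5)^k" by simp
      finally show ?thesis by simp
    qed
    then show "\<bar>coord (x - y) k\<bar> \<le> \<bar>coord (abs_ell2 d + (25 * \<bar>coord d 1\<bar>) *\<^sub>R geom) k\<bar>"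
      using \<open>1 \<le> k\<close> by (intro order_trans[OF _ abs_ge_self]) (simp add: coord_geom)
  qed
  also have "\<dots> \<le> norm (abs_ell2 d) + norm ((25 * \<bar>coord d 1\<bar>) *\<^sub>R geom)" by (rule norm_triangle_ineq)
  also have "\<dots> \<le> norm d + 25 * \<bar>coord d 1\<bar> * (1/4)"
    using mult_left_mono[OF norm_geom_le, of "25 * \<bar>coord d 1\<bar>"] by simp
  finally show ?thesis using d1n by linarith
qed

text \<open>This comparison degenerates with the smaller first mode, since the chart divides by up
  to its square; 9 rounds up 2 + 25/4.\<close>

lemma chart_le_norm_diff: "norm d \<le> 9 / \<eta>\<^sup>2 * norm (x - y)"
proof -
  define m where "m = 1 / \<eta>\<^sup>2"
  have e2: "\<eta>\<^sup>2 \<le> \<eta>" using small y1 by (simp add: power2_eq_square mult_left_le)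
  have m: "1 / \<eta> \<le> m" "0 < m" "1 / \<xi>\<^sup>2 \<le> m" "1 / \<xi> \<le> m"
  proof -
    show 1: "1 / \<eta> \<le> m" unfolding m_def using e2 y1 by (intro divide_left_mono) auto
    show "0 < m" using y1 by (simp add: m_def)
    have "\<eta>\<^sup>2 \<le> \<xi>\<^sup>2" using yx y1 by (intro power_mono) auto
    then show "1 / \<xi>\<^sup>2 \<le> m" unfolding m_def using y1 x1 by (intro divide_left_mono) auto
    have "1 / \<xi> \<le> 1 / \<eta>" using y1 x1 yx by (intro divide_left_mono) auto
    with 1 show "1 / \<xi> \<le> m" by simp
  qed
  let ?e = "\<bar>coord (x - y) 1\<bar>"
  have e: "\<xi> - \<eta> = ?e" using yx by simp
  have "norm d \<le> norm ((2 * m) *\<^sub>R abs_ell2 (x - y) + (25 * m * ?e) *\<^sub>R geom)"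
  proof (rule norm_coord_mono)
    fix k :: nat assume "1 \<le> k"
    then consider "k = 1" | "k = 2" | "3 \<le> k" by linarith
    then have "\<bar>coord d k\<bar> \<le> 2 * m * \<bar>coord x k - coord y k\<bar> + 25 * m * ?e * (1/5)^k"
    proof cases
      case 1
      have "p \<le> (\<xi> - \<eta>) * (1 / \<eta>)" using D_bounds(3) y1 by (simp add: field_simps)
      also have "\<dots> \<le> (\<xi> - \<eta>) * m" using m yx by (intro mult_left_mono) auto
      finally have "2 * p \<le> 2 * ((\<xi> - \<eta>) * m)" by linarith
      then have "2 * p \<le> 2 * m * (\<xi> - \<eta>)" by (simp only: mult_ac)
      then have "\<bar>coord d 1\<bar> \<le> 2 * m * \<bar>\<xi> - \<eta>\<bar>" unfolding d1 using nonneg yx by simp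
      moreover have "0 \<le> 25 * m * ?e * (1/5)^1" using m by simp
      ultimately show ?thesis unfolding 1 by linarith
    next
      case 2
      have y2: "coord y 2 = \<eta>\<^sup>2 * cy" using y1 by (simp add: coord_chart)
      have "coord d 2 = (1 / \<xi>\<^sup>2) * (coord x 2 - coord y 2) - (1 / \<xi>\<^sup>2) * (D * cy)"
        using x1 y1 y2 by (simp add: d_def coord_chart D_def field_simps)
      also have "\<bar>\<dots>\<bar> \<le> \<bar>(1 / \<xi>\<^sup>2) * (coord x 2 - coord y 2)\<bar> + \<bar>(1 / \<xi>\<^sup>2) * (D * cy)\<bar>" by (rule abs_triangle_ineq4)
      also have "\<bar>(1 / \<xi>\<^sup>2) * (coord x 2 - coord y 2)\<bar> \<le> m * \<bar>coord x 2 - coord y 2\<bar>"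
        unfolding abs_mult using m by (intro mult_right_mono) auto
      also have "\<bar>(1 / \<xi>\<^sup>2) * (D * cy)\<bar> \<le> m * (?e * 1)"
      proof -
        have "D = (\<xi> + \<eta>) * ?e" unfolding e[symmetric] by (simp add: D_def power2_eq_square algebra_simps)
        also have "\<dots> \<le> 1 * ?e" using small by (intro mult_right_mono) auto
        finally have "\<bar>D\<bar> \<le> ?e" using nonneg by simp
        moreover have "\<bar>cy\<bar> \<le> 1" using wide_chart_bounds(1,2)[OF yw y1] by linarith
        ultimately show ?thesis unfolding abs_mult using m by (intro mult_mono) auto
      qed
      finally have "\<bar>coord d 2\<bar> \<le> m * \<bar>coord x 2 - coord y 2\<bar> + m * (?e * 1)" by simp
      moreover have "0 \<le> m * \<bar>coord x 2 - coord y 2\<bar>" using m by simp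
      ultimately show ?thesis unfolding 2 by (simp add: power2_eq_square)
    next
      case 3
      have yk: "coord y k = \<eta> * coord (chart y) k" using y1 3 by (simp add: coord_chart)
      have "coord d k = (1 / \<xi>) * (coord x k - coord y k) - (1 / \<xi>) * (?e * coord (chart y) k)"
        unfolding e[symmetric] using x1 y1 yk 3 by (simp add: d_def coord_chart field_simps)
      also have "\<bar>\<dots>\<bar> \<le> \<bar>(1 / \<xi>) * (coord x k - coord y k)\<bar> + \<bar>(1 / \<xi>) * (?e * coord (chart y) k)\<bar>" by (rule abs_triangle_ineq4)
      also have "\<bar>(1 / \<xi>) * (coord x k - coord y k)\<bar> \<le> m * \<bar>coord x k - coord y k\<bar>"
        unfolding abs_mult using m x1 by (intro mult_right_mono) auto
      also have "\<bar>(1 / \<xi>) * (?e * coord (chart y) k)\<bar> \<le> m * (?e * (1/5)^k)"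
      proof -
        have "\<bar>coord (chart y) k\<bar> \<le> 2 * (1/5)^k * \<eta>" by (rule wide_chart_bounds(3)[OF yw y1 3])
        also have "\<dots> \<le> 2 * (1/5)^k * (1/4)" using small by (intro mult_left_mono) auto
        also have "\<dots> \<le> (1/5)^k" by simp
        finally show ?thesis unfolding abs_mult using m x1 by (intro mult_mono) auto
      qed
      finally have "\<bar>coord d k\<bar> \<le> m * \<bar>coord x k - coord y k\<bar> + m * (?e * (1/5)^k)" by simp
      moreover have "0 \<le> m * \<bar>coord x k - coord y k\<bar>" "0 \<le> m * (?e * (1/5)^k)" using m by simp_all
      ultimately show ?thesis by linarith
    qed
    then show "\<bar>coord d k\<bar> \<le> \<bar>coord ((2 * m) *\<^sub>R abs_ell2 (x - y) + (25 * m * ?e) *\<^sub>R geom) k\<bar>"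
      using \<open>1 \<le> k\<close> by (intro order_trans[OF _ abs_ge_self]) (simp add: coord_geom)
  qed
  also have "\<dots> \<le> norm ((2 * m) *\<^sub>R abs_ell2 (x - y)) + norm ((25 * m * ?e) *\<^sub>R geom)" by (rule norm_triangle_ineq)
  also have "norm ((2 * m) *\<^sub>R abs_ell2 (x - y)) = 2 * m * norm (x - y)" using m by simp
  also have "norm ((25 * m * ?e) *\<^sub>R geom) \<le> 25 * m * norm (x - y) * (1/4)"
  proof -
    have "norm ((25 * m * ?e) *\<^sub>R geom) = 25 * m * ?e * norm geom" using m by simp
    also have "\<dots> \<le> 25 * m * norm (x - y) * (1/4)"
      using m abs_coord_le_norm[of "x - y" 1] norm_geom_le by (intro mult_mono) auto
    finally show ?thesis .
  qed
  finally have "norm d \<le> m * norm (x - y) * 2 + m * norm (x - y) * (25/4)" by (simp add: mult_ac)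
  also have "\<dots> \<le> m * norm (x - y) * 9"
    using m by (simp add: distrib_left[symmetric] del: distrib_left_numeral)
  finally show ?thesis by (simp add: m_def mult_ac)
qed

end

section \<open>Two solutions in the chart\<close>

definition dE :: "real \<Rightarrow> ell2 \<Rightarrow> ell2 \<Rightarrow> nat \<Rightarrow> real" where
  "dE \<mu> x y k = coord (chart x - chart y) k * (chart_rate \<mu> x k - chart_rate \<mu> y k)"

text \<open>Half the time derivative of the squared chart distance of two solutions; the first two
  coordinates stand apart because the chart treats them differently.\<close>

definition pair_rate :: "real \<Rightarrow> ell2 \<Rightarrow> ell2 \<Rightarrow> real" where
  "pair_rate \<mu> x y = dE \<mu> x y 1 + dE \<mu> x y 2 + (\<Sum>i. dE \<mu> x y (i + 3))"

text \<open>The squared differences of all other coordinates minus that of the first. It is bounded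
  above on the part of \<open>wide\<close> with positive first mode, which the squared chart
  distance is not.\<close>

definition cone_form :: "ell2 \<Rightarrow> ell2 \<Rightarrow> real" where
  "cone_form x y = (norm (chart x - chart y))\<^sup>2 - 2 * (coord (chart x - chart y) 1)\<^sup>2"

lemma cone_form_commute: "cone_form x y = cone_form y x"
  unfolding cone_form_def norm_minus_commute[of "chart x"] by (simp add: power2_commute)

lemma dE_commute: "dE \<mu> x y k = dE \<mu> y x k"
  by (simp add: dE_def algebra_simps)

lemma pair_rate_commute: "pair_rate \<mu> x y = pair_rate \<mu> y x"
  by (simp add: pair_rate_def dE_commute[of \<mu> x y])

lemma summable_quartic: "summable (\<lambda>k. real k ^ 4 * (1/5)^k)"
proof (rule summable_ratio_test[where c = "1/2" and N = 4])
  fix n :: nat assume n: "4 \<le> n"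
  have "real (Suc n) ^ 4 \<le> (5/4 * real n) ^ 4" using n by (intro power_mono) auto
  also have "\<dots> \<le> 5/2 * real n ^ 4" by (simp add: power_mult_distrib power_divide)
  finally have "real (Suc n) ^ 4 * ((1/5)^n / 5) \<le> 5/2 * real n ^ 4 * ((1/5)^n / 5)"
    by (intro mult_right_mono) auto
  then show "norm (real (Suc n) ^ 4 * (1/5)^Suc n) \<le> 1/2 * norm (real n ^ 4 * (1/5)^n)" by simp
qed simp

text \<open>Termwise differentiation under a summable majorant of the derivatives.\<close>

lemma suminf_has_real_derivative:
  fixes f f' :: "nat \<Rightarrow> real \<Rightarrow> real"
  assumes S: "convex S" "t \<in> S"
    and d: "\<And>n t. t \<in> S \<Longrightarrow> (f n has_real_derivative f' n t) (at t within S)"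
    and M: "\<And>n t. t \<in> S \<Longrightarrow> \<bar>f' n t\<bar> \<le> M n" "summable M"
    and s: "\<And>t. t \<in> S \<Longrightarrow> summable (\<lambda>n. f n t)"
  shows "((\<lambda>t. \<Sum>n. f n t) has_real_derivative (\<Sum>n. f' n t)) (at t within S)"
proof -
  have "uniform_limit S (\<lambda>n t. \<Sum>i<n. f' i t) (\<lambda>t. \<Sum>n. f' n t) sequentially"
    by (rule Weierstrass_m_test) (use M in auto)
  from has_field_derivative_series[OF S(1) d this S(2) s[OF S(2)]]
  obtain g where g: "\<And>t. t \<in> S \<Longrightarrow> (\<lambda>n. f n t) sums g t"
    "\<And>t. t \<in> S \<Longrightarrow> (g has_real_derivative (\<Sum>n. f' n t)) (at t within S)" by blast
  have "g r = (\<Sum>n. f n r)" if "r \<in> S" for r using g(1)[OF that] by (simp add: sums_iff)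
  then show ?thesis
    using has_field_derivative_transform_within[OF g(2)[OF S(2)] zero_less_one S(2)] by simp
qed

context
  fixes \<mu> :: real assumes mu: "99/100 \<le> \<mu>" "\<mu> \<le> 101/100"
begin

lemma ordered_pairI:
  "x \<in> wide \<Longrightarrow> y \<in> wide \<Longrightarrow> 0 < coord y 1 \<Longrightarrow> coord y 1 \<le> coord x 1 \<Longrightarrow> ordered_pair \<mu> x y"
  using mu by unfold_locales auto

lemma abs_growth_le: "a \<in> wide \<Longrightarrow> 0 < coord a 1 \<Longrightarrow> \<bar>growth \<mu> a\<bar> \<le> 5/100"
  using ordered_pair.growth_small[OF ordered_pairI[of a a]] by simp

text \<open>The factor 5^-k outweighs the growth k^4 of the linear rates; this majorant permits
  differentiating the squared chart distance term by term.\<close>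

lemma abs_chart_rate_le:
  assumes a: "a \<in> wide" "0 < coord a 1" and k: "3 \<le> k"
  shows "\<bar>chart_rate \<mu> a k\<bar> \<le> 7 * real k ^ 4 * (1/5)^k"
proof -
  have kk: "1 \<le> (real k)\<^sup>2" "(real k)\<^sup>2 \<le> real k ^ 4" using k by (auto intro: power_increasing)
  have a1: "coord a 1 \<le> 1/4" using wide_coords(1)[OF a(1)] by simp
  have "\<bar>lam \<mu> k\<bar> \<le> 2 * real k ^ 4"
  proof -
    have "lam \<mu> k = (real k)\<^sup>2 - \<mu> * real k ^ 4"
      by (simp add: lam_def algebra_simps power2_eq_square power4_eq_xxxx)
    moreover have "\<mu> * real k ^ 4 \<le> 101/100 * real k ^ 4" "0 * real k ^ 4 \<le> \<mu> * real k ^ 4"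
      using mu by (intro mult_right_mono; simp)+
    ultimately show ?thesis using kk by linarith
  qed
  then have l: "\<bar>lam \<mu> k - growth \<mu> a\<bar> \<le> 3 * real k ^ 4" using abs_growth_le[OF a] kk by linarith
  have c: "\<bar>coord (chart a) k\<bar> \<le> (1/5)^k"
  proof -
    have "\<bar>coord (chart a) k\<bar> \<le> 2 * (1/5)^k * coord a 1" by (rule wide_chart_bounds(3)[OF a k])
    also have "\<dots> \<le> 2 * (1/5)^k * (1/4)" using a1 by (intro mult_left_mono) auto
    finally show ?thesis by simp
  qed
  have n: "\<bar>nl k a / coord a 1\<bar> \<le> 4 * real k ^ 4 * (1/5)^k"
  proof -
    have "\<bar>nl k a\<bar> \<le> (40 * (real k)\<^sup>2 - 36 * real k) * (1/5)^k * \<bar>coord a 1\<bar>^3" by (rule wide_nl_ge_3[OF a(1) k])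
    also have "\<dots> \<le> 40 * real k ^ 4 * (1/5)^k * \<bar>coord a 1\<bar>^3"
      using kk by (intro mult_right_mono) auto
    finally have "\<bar>nl k a\<bar> / coord a 1 \<le> 40 * real k ^ 4 * (1/5)^k * \<bar>coord a 1\<bar>^3 / coord a 1"
      using a by (intro divide_right_mono) auto
    also have "\<dots> = 40 * real k ^ 4 * (1/5)^k * (coord a 1)\<^sup>2" using a by (simp add: power3_eq_cube power2_eq_square)
    also have "\<dots> \<le> 40 * real k ^ 4 * (1/5)^k * (1/4)\<^sup>2"
      using a1 a by (intro mult_left_mono power_mono) auto
    also have "\<dots> \<le> 4 * real k ^ 4 * (1/5)^k" by (simp add: power2_eq_square)
    finally show ?thesis using a by simp
  qed
  have "chart_rate \<mu> a k = (lam \<mu> k - growth \<mu> a) * coord (chart a) k + nl k a / coord a 1"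
    using k a by (simp add: chart_rate_def coord_chart)
  also have "\<bar>\<dots>\<bar> \<le> \<bar>lam \<mu> k - growth \<mu> a\<bar> * \<bar>coord (chart a) k\<bar> + \<bar>nl k a / coord a 1\<bar>"
    by (rule order_trans[OF abs_triangle_ineq]) (simp add: abs_mult)
  also have "\<bar>lam \<mu> k - growth \<mu> a\<bar> * \<bar>coord (chart a) k\<bar> \<le> 3 * real k ^ 4 * (1/5)^k"
    using l c by (intro mult_mono) auto
  finally show ?thesis using n by linarith
qed

lemma abs_dE_le:
  assumes "x \<in> wide" "y \<in> wide" "0 < coord x 1" "0 < coord y 1" and k: "3 \<le> k"
  shows "\<bar>dE \<mu> x y k\<bar> \<le> 14 * (real k ^ 4 * (1/5)^k)"
proof -
  have c: "\<bar>coord (chart a) k\<bar> \<le> 1/2" if "a \<in> wide" "0 < coord a 1" for a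
  proof -
    have "\<bar>coord (chart a) k\<bar> \<le> 2 * (1/5)^k * coord a 1" by (rule wide_chart_bounds(3)[OF that k])
    also have "\<dots> \<le> 2 * 1 * (1/4)"
      using wide_coords(1)[OF that(1)] that(2) by (intro mult_mono power_le_one) auto
    finally show ?thesis by simp
  qed
  have "\<bar>coord (chart x - chart y) k\<bar> \<le> 1" using c[OF assms(1,3)] c[OF assms(2,4)] unfolding coord_minus by linarith
  moreover have "\<bar>chart_rate \<mu> x k - chart_rate \<mu> y k\<bar> \<le> 14 * (real k ^ 4 * (1/5)^k)"
    using abs_chart_rate_le[of x k] abs_chart_rate_le[of y k] assms by linarith
  ultimately have "\<bar>coord (chart x - chart y) k\<bar> * \<bar>chart_rate \<mu> x k - chart_rate \<mu> y k\<bar> \<le> 1 * (14 * (real k ^ 4 * (1/5)^k))"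
    by (intro mult_mono) auto
  then show ?thesis by (simp add: dE_def abs_mult)
qed

lemma summable_dE:
  assumes "x \<in> wide" "y \<in> wide" "0 < coord x 1" "0 < coord y 1"
  shows "summable (\<lambda>i. dE \<mu> x y (i + 3))"
proof (rule summable_comparison_test'[where N = 0])
  show "summable (\<lambda>i. 14 * (real (i + 3) ^ 4 * (1/5)^(i + 3)))"
    by (intro summable_mult summable_ignore_initial_segment[OF summable_quartic])
  show "norm (dE \<mu> x y (n + 3)) \<le> 14 * (real (n + 3) ^ 4 * (1/5)^(n + 3))" for n
    using abs_dE_le[OF assms, of "n + 3"] by simp
qed

text \<open>The ordered case is transferred by the symmetry of \<open>pair_rate\<close>, and the
  smaller first mode is replaced by its lower bound \<open>m\<close>.\<close>

lemma pair_contraction_rate: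
  assumes "x \<in> wide" "y \<in> wide" "0 < m" "m \<le> coord x 1" "m \<le> coord y 1"
  shows "pair_rate \<mu> x y \<le> - (1/20) * m\<^sup>2 * (norm (chart x - chart y))\<^sup>2"
proof -
  have *: "pair_rate \<mu> x y \<le> - (1/20) * m\<^sup>2 * (norm (chart x - chart y))\<^sup>2"
    if a: "x \<in> wide" "y \<in> wide" "m \<le> coord y 1" "coord y 1 \<le> coord x 1" for x y
  proof -
    interpret ordered_pair \<mu> x y using a assms by (intro ordered_pairI) auto
    have "pair_rate \<mu> x y \<le> - (1/20) * (coord y 1)\<^sup>2 * (norm d)\<^sup>2"
      using summable_dE[OF a(1,2) x1 y1]
      by (intro contraction_aux) (simp_all add: pair_rate_def dE_def[abs_def] d_def E_def)
    also have "\<dots> \<le> - (1/20) * m\<^sup>2 * (norm d)\<^sup>2"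
      using a assms by (intro mult_right_mono) (auto intro: power_mono)
    finally show ?thesis by (simp add: d_def)
  qed
  show ?thesis
  proof (cases "coord y 1 \<le> coord x 1")
    case True then show ?thesis using * assms by blast
  next
    case False
    then have "pair_rate \<mu> y x \<le> - (1/20) * m\<^sup>2 * (norm (chart y - chart x))\<^sup>2" using assms by (intro *) auto
    then show ?thesis by (simp only: pair_rate_commute[of \<mu> y x] norm_minus_commute[of "chart y"])
  qed
qed

lemma pair_cone_rate:
  assumes "x \<in> wide" "y \<in> wide" "0 < coord x 1" "0 < coord y 1" "0 < cone_form x y"
  shows "pair_rate \<mu> x y - 2 * dE \<mu> x y 1 < - cone_form x y"
proof -
  have *: "pair_rate \<mu> x y - 2 * dE \<mu> x y 1 < - cone_form x y"
    if a: "x \<in> wide" "y \<in> wide" "0 < coord y 1" "coord y 1 \<le> coord x 1" "0 < cone_form x y" for x y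
  proof -
    interpret ordered_pair \<mu> x y using a by (intro ordered_pairI) auto
    have dE: "dE \<mu> x y k = coord d k * E k" for k by (simp add: dE_def d_def E_def)
    show ?thesis
      using summable_dE[OF a(1,2) x1 y1] cone_aux[of "pair_rate \<mu> x y"] a(5)
      unfolding pair_rate_def dE cone_form_def d_def[symmetric] by simp
  qed
  show ?thesis
  proof (cases "coord y 1 \<le> coord x 1")
    case True then show ?thesis using * assms by blast
  next
    case False
    then have "pair_rate \<mu> y x - 2 * dE \<mu> y x 1 < - cone_form y x"
      using assms by (intro *) (auto simp: cone_form_commute[of y])
    then show ?thesis by (simp only: pair_rate_commute[of \<mu> y x] dE_commute[of \<mu> y x] cone_form_commute[of y])
  qed
qed

lemma pair_slow_rate:
  assumes "x \<in> wide" "y \<in> wide" "0 < coord x 1" "0 < coord y 1" "cone_form x y \<le> 0"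
  shows "\<bar>chart_rate \<mu> x 1 - chart_rate \<mu> y 1\<bar> \<le> \<bar>coord (chart x - chart y) 1\<bar>"
proof -
  have *: "\<bar>chart_rate \<mu> x 1 - chart_rate \<mu> y 1\<bar> \<le> \<bar>coord (chart x - chart y) 1\<bar>"
    if a: "x \<in> wide" "y \<in> wide" "0 < coord y 1" "coord y 1 \<le> coord x 1" "cone_form x y \<le> 0" for x y
  proof -
    interpret ordered_pair \<mu> x y using a by (intro ordered_pairI) auto
    show ?thesis using E_1_le a(5) unfolding cone_form_def d_def E_def by simp
  qed
  show ?thesis
  proof (cases "coord y 1 \<le> coord x 1")
    case True then show ?thesis using * assms by blast
  next
    case False
    then have "\<bar>chart_rate \<mu> y 1 - chart_rate \<mu> x 1\<bar> \<le> \<bar>coord (chart y - chart x) 1\<bar>"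
      using assms by (intro *) (auto simp: cone_form_commute[of y])
    then show ?thesis by (simp add: abs_minus_commute)
  qed
qed

lemma norm_diff_le_chart:
  assumes "x \<in> wide" "y \<in> wide" "0 < coord x 1" "0 < coord y 1"
  shows "norm (x - y) \<le> 8 * norm (chart x - chart y)"
proof (cases "coord y 1 \<le> coord x 1")
  case True
  then interpret ordered_pair \<mu> x y using assms by (intro ordered_pairI) auto
  show ?thesis using norm_diff_le_chart unfolding d_def .
next
  case False
  then interpret ordered_pair \<mu> y x using assms by (intro ordered_pairI) auto
  show ?thesis using norm_diff_le_chart unfolding d_def norm_minus_commute[of x] norm_minus_commute[of "chart x"] .
qed

lemma chart_le_norm_diff:
  assumes "x \<in> wide" "y \<in> wide" "0 < m" "m \<le> coord x 1" "m \<le> coord y 1"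
  shows "norm (chart x - chart y) \<le> 9 / m\<^sup>2 * norm (x - y)"
proof -
  have mono: "9 / c\<^sup>2 * norm (x - y) \<le> 9 / m\<^sup>2 * norm (x - y)" if "m \<le> c" for c
    using that assms(3) by (intro mult_right_mono divide_left_mono power_mono) auto
  show ?thesis
  proof (cases "coord y 1 \<le> coord x 1")
    case True
    then interpret ordered_pair \<mu> x y using assms by (intro ordered_pairI) auto
    show ?thesis using chart_le_norm_diff mono[of "coord y 1"] assms unfolding d_def by simp
  next
    case False
    then interpret ordered_pair \<mu> y x using assms by (intro ordered_pairI) auto
    show ?thesis using chart_le_norm_diff mono[of "coord x 1"] assms
      unfolding d_def norm_minus_commute[of y] norm_minus_commute[of "chart y"] by simp
  qed
qed

lemma chart_deriv:
  assumes u: "ks_curve \<mu> S u" and pos: "\<And>t. t \<in> S \<Longrightarrow> 0 < coord (u t) 1" and t: "t \<in> S" and k: "1 \<le> k"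
  shows "((\<lambda>s. coord (chart (u s)) k) has_real_derivative chart_rate \<mu> (u t) k) (at t within S)"
proof -
  let ?a = "\<lambda>s. coord (u s)"
  have p: "0 < ?a t 1" by (rule pos[OF t])
  have d: "((\<lambda>s. ?a s i) has_real_derivative lam \<mu> i * ?a t i + nl i (u t)) (at t within S)" if "1 \<le> i" for i
    by (rule solvesD(2)[OF u that t])
  have tr: ?thesis if "(f has_real_derivative chart_rate \<mu> (u t) k) (at t within S)"
    "\<And>s. s \<in> S \<Longrightarrow> f s = coord (chart (u s)) k" for f
    using has_field_derivative_transform_within[OF that(1) zero_less_one t] that(2) by simp
  have d1: "((\<lambda>s. ?a s 1) has_real_derivative growth \<mu> (u t) * ?a t 1) (at t within S)"
  proof -
    have "growth \<mu> (u t) * ?a t 1 = lam \<mu> 1 * ?a t 1 + nl 1 (u t)"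
      using p by (simp add: growth_def distrib_right)
    with d[of 1] show ?thesis by simp
  qed
  consider "k = 1" | "k = 2" | "3 \<le> k" using k by linarith
  then show ?thesis
  proof cases
    case 1
    show ?thesis
    proof (rule tr)
      show "((\<lambda>s. 2 * ln (?a s 1)) has_real_derivative chart_rate \<mu> (u t) k) (at t within S)"
        using d1 p by (auto intro!: derivative_eq_intros simp: 1 chart_rate_def)
      show "2 * ln (?a s 1) = coord (chart (u s)) k" if "s \<in> S" for s
        using coord_chart(1)[of "u s"] pos[OF that] by (simp add: 1)
    qed
  next
    case 2
    show ?thesis
    proof (rule tr)
      have "((\<lambda>s. ?a s 2 / (?a s 1)\<^sup>2) has_real_derivative
          ((lam \<mu> 2 * ?a t 2 + nl 2 (u t)) * (?a t 1)\<^sup>2 - ?a t 2 * (2 * ?a t 1 * (growth \<mu> (u t) * ?a t 1))) / ((?a t 1)\<^sup>2 * (?a t 1)\<^sup>2)) (at t within S)"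
        using d1 d[of 2] p by (auto intro!: derivative_eq_intros)
      moreover have "((lam \<mu> 2 * ?a t 2 + nl 2 (u t)) * (?a t 1)\<^sup>2 - ?a t 2 * (2 * ?a t 1 * (growth \<mu> (u t) * ?a t 1))) / ((?a t 1)\<^sup>2 * (?a t 1)\<^sup>2)
          = chart_rate \<mu> (u t) k"
        using p by (simp add: 2 chart_rate_def field_simps power2_eq_square)
      ultimately show "((\<lambda>s. ?a s 2 / (?a s 1)\<^sup>2) has_real_derivative chart_rate \<mu> (u t) k) (at t within S)" by simp
      show "?a s 2 / (?a s 1)\<^sup>2 = coord (chart (u s)) k" if "s \<in> S" for s
        using pos[OF that] by (simp add: 2 coord_chart)
    qed
  next
    case 3
    show ?thesis
    proof (rule tr)
      have "((\<lambda>s. ?a s k / ?a s 1) has_real_derivative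
          ((lam \<mu> k * ?a t k + nl k (u t)) * ?a t 1 - ?a t k * (growth \<mu> (u t) * ?a t 1)) / (?a t 1 * ?a t 1)) (at t within S)"
        using d1 d[of k] p k by (auto intro!: derivative_eq_intros)
      moreover have "((lam \<mu> k * ?a t k + nl k (u t)) * ?a t 1 - ?a t k * (growth \<mu> (u t) * ?a t 1)) / (?a t 1 * ?a t 1)
          = chart_rate \<mu> (u t) k"
        using p 3 by (simp add: chart_rate_def field_simps)
      ultimately show "((\<lambda>s. ?a s k / ?a s 1) has_real_derivative chart_rate \<mu> (u t) k) (at t within S)" by simp
      show "?a s k / ?a s 1 = coord (chart (u s)) k" if "s \<in> S" for s
        using pos[OF that] 3 by (simp add: coord_chart)
    qed
  qed
qed

context
  fixes x y :: "real \<Rightarrow> ell2" and a b :: real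
  assumes x: "ks_curve \<mu> {a..b} x" and y: "ks_curve \<mu> {a..b} y"
    and xw: "\<And>t. t \<in> {a..b} \<Longrightarrow> x t \<in> wide" and yw: "\<And>t. t \<in> {a..b} \<Longrightarrow> y t \<in> wide"
    and xp: "\<And>t. t \<in> {a..b} \<Longrightarrow> 0 < coord (x t) 1" and yp: "\<And>t. t \<in> {a..b} \<Longrightarrow> 0 < coord (y t) 1"
begin

lemma chart_diff_deriv:
  assumes "t \<in> {a..b}" "1 \<le> k"
  shows "((\<lambda>t. coord (chart (x t) - chart (y t)) k) has_real_derivative
    chart_rate \<mu> (x t) k - chart_rate \<mu> (y t) k) (at t within {a..b})"
  using DERIV_diff[OF chart_deriv[OF x xp assms] chart_deriv[OF y yp assms]] by simp

lemma chart_diff_square_deriv: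
  assumes "t \<in> {a..b}" "1 \<le> k"
  shows "((\<lambda>t. (coord (chart (x t) - chart (y t)) k)\<^sup>2) has_real_derivative 2 * dE \<mu> (x t) (y t) k) (at t within {a..b})"
  using DERIV_power[OF chart_diff_deriv[OF assms], of 2] by (simp add: dE_def mult_ac)

lemma norm_chart_diff_deriv:
  assumes t: "t \<in> {a..b}"
  shows "((\<lambda>t. (norm (chart (x t) - chart (y t)))\<^sup>2) has_real_derivative 2 * pair_rate \<mu> (x t) (y t)) (at t within {a..b})"
proof -
  let ?d = "\<lambda>t. chart (x t) - chart (y t)"
  have "((\<lambda>t. \<Sum>i. (coord (?d t) (i + 3))\<^sup>2) has_real_derivative (\<Sum>i. 2 * dE \<mu> (x t) (y t) (i + 3))) (at t within {a..b})"
  proof (rule suminf_has_real_derivative[where M = "\<lambda>i. 2 * (14 * (real (i + 3) ^ 4 * (1/5)^(i + 3)))"])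
    show "summable (\<lambda>i. 2 * (14 * (real (i + 3) ^ 4 * (1/5::real)^(i + 3))))"
      by (intro summable_mult summable_ignore_initial_segment[OF summable_quartic])
    show "((\<lambda>t. (coord (?d t) (n + 3))\<^sup>2) has_real_derivative 2 * dE \<mu> (x s) (y s) (n + 3)) (at s within {a..b})"
      if "s \<in> {a..b}" for n s
      by (rule chart_diff_square_deriv[OF that]) simp
    show "\<bar>2 * dE \<mu> (x s) (y s) (n + 3)\<bar> \<le> 2 * (14 * (real (n + 3) ^ 4 * (1/5)^(n + 3)))" if "s \<in> {a..b}" for n s
      using abs_dE_le[OF xw yw xp yp, OF that that that that, of "n + 3"] by simp
    show "summable (\<lambda>n. (coord (?d s) (n + 3))\<^sup>2)" for s
      by (rule summable_ignore_initial_segment[OF summable_coord_square])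
  qed (use t in auto)
  also have "(\<Sum>i. 2 * dE \<mu> (x t) (y t) (i + 3)) = 2 * (\<Sum>i. dE \<mu> (x t) (y t) (i + 3))"
    by (intro suminf_mult summable_dE xw yw xp yp t)
  finally have "((\<lambda>t. (coord (?d t) 1)\<^sup>2 + (coord (?d t) 2)\<^sup>2 + (\<Sum>i. (coord (?d t) (i + 3))\<^sup>2)) has_real_derivative
      2 * dE \<mu> (x t) (y t) 1 + 2 * dE \<mu> (x t) (y t) 2 + 2 * (\<Sum>i. dE \<mu> (x t) (y t) (i + 3))) (at t within {a..b})"
    by (intro DERIV_add chart_diff_square_deriv t) simp_all
  then show ?thesis
    unfolding norm_square_split[of "chart _ - chart _"] norm_tail_square pair_rate_def by (simp add: distrib_left)
qed

lemma chart_contraction: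
  assumes "a \<le> b" "0 < m" "\<And>t. t \<in> {a..b} \<Longrightarrow> m \<le> coord (x t) 1" "\<And>t. t \<in> {a..b} \<Longrightarrow> m \<le> coord (y t) 1"
  shows "(norm (chart (x b) - chart (y b)))\<^sup>2 \<le> exp (- (m\<^sup>2 / 10) * (b - a)) * (norm (chart (x a) - chart (y a)))\<^sup>2"
proof (rule differential_inequality[OF \<open>a \<le> b\<close> norm_chart_diff_deriv])
  fix t assume t: "t \<in> {a..b}"
  show "2 * pair_rate \<mu> (x t) (y t) \<le> - (m\<^sup>2 / 10) * (norm (chart (x t) - chart (y t)))\<^sup>2"
    using pair_contraction_rate[OF xw[OF t] yw[OF t] assms(2) assms(3,4)[OF t]] by simp
qed

text \<open>Wherever the cone form is positive, \<open>pair_cone_rate\<close> makes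
  \<open>exp (2 * t)\<close> times the form decrease forward in time; read backward, the form grows
  exponentially.\<close>

lemma cone_form_backward:
  assumes "a \<le> b" "0 < cone_form (x b) (y b)"
  shows "exp (2 * (b - a)) * cone_form (x b) (y b) \<le> 2 * cone_form (x a) (y a)"
proof -
  define c where "c = exp (2 * b) * cone_form (x b) (y b) / 2"
  have c: "0 < c" using assms by (simp add: c_def)
  have "0 \<le> exp (2 * a) * cone_form (x a) (y a) - c"
  proof (rule barrier_backward[where f = "\<lambda>t. exp (2 * t) * cone_form (x t) (y t) - c", OF \<open>a \<le> b\<close>])
    show "0 \<le> exp (2 * b) * cone_form (x b) (y b) - c" using c unfolding c_def by linarith
    fix t assume t: "t \<in> {a..b}"
    have "((\<lambda>t. cone_form (x t) (y t)) has_real_derivative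
        2 * pair_rate \<mu> (x t) (y t) - 2 * (2 * dE \<mu> (x t) (y t) 1)) (at t within {a..b})"
      unfolding cone_form_def by (intro DERIV_diff DERIV_cmult norm_chart_diff_deriv chart_diff_square_deriv t) simp
    then show "((\<lambda>t. exp (2 * t) * cone_form (x t) (y t) - c) has_real_derivative
        exp (2 * t) * (2 * cone_form (x t) (y t) + (2 * pair_rate \<mu> (x t) (y t) - 2 * (2 * dE \<mu> (x t) (y t) 1)))) (at t within {a..b})"
      by (auto intro!: derivative_eq_intros simp: algebra_simps)
    \<comment> \<open>At a zero of the barrier function the cone form equals
      \<open>exp (- 2 * t) * c\<close>, which is positive, as \<open>pair_cone_rate\<close>
      requires.\<close>
    assume "exp (2 * t) * cone_form (x t) (y t) - c = 0"
    then have "0 < exp (2 * t) * cone_form (x t) (y t)" using c by simp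
    then have "0 < cone_form (x t) (y t)" by (simp add: zero_less_mult_iff)
    from pair_cone_rate[OF xw[OF t] yw[OF t] xp[OF t] yp[OF t] this]
    show "exp (2 * t) * (2 * cone_form (x t) (y t) + (2 * pair_rate \<mu> (x t) (y t) - 2 * (2 * dE \<mu> (x t) (y t) 1))) < 0"
      by (simp add: mult_less_0_iff)
  qed
  then have "exp (- 2 * a) * c \<le> exp (- 2 * a) * (exp (2 * a) * cone_form (x a) (y a))"
    by (intro mult_left_mono) auto
  then show ?thesis by (simp add: c_def mult.assoc[symmetric] mult_exp_exp right_diff_distrib)
qed

end

end

section \<open>Invariant sets and cuboids\<close>

lemma full_trajectory_in_shift:
  assumes "full_trajectory_in \<phi> \<tau> S z" shows "full_trajectory_in \<phi> \<tau> S (\<lambda>t. z (t + c))"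
proof -
  have "ereal s < \<tau> (z (t + c)) \<and> \<phi> s (z (t + c)) = z (t + s + c)" if "0 \<le> s" for t s
    using assms that by (auto simp: trajectory_in_def add.commute add.left_commute)
  then show ?thesis using assms by (auto simp: trajectory_in_def)
qed

text \<open>A time shift puts all points of a full trajectory in \<open>S\<close> into this set,
  which settles the clause on ranges. Finding the maximal invariant set thus means classifying full
  trajectories.\<close>

lemma maximal_invariant_set_full_trajectories:
  "maximal_invariant_set \<phi> \<tau> S {p. \<exists>z. full_trajectory_in \<phi> \<tau> S z \<and> z 0 = p}" (is "maximal_invariant_set _ _ _ ?J")
proof -
  have range: "range z \<subseteq> ?J" if "full_trajectory_in \<phi> \<tau> S z" for z
  proof
    fix p assume "p \<in> range z"
    then obtain c where "p = z c" by blast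
    then show "p \<in> ?J" using full_trajectory_in_shift[OF that, of c] by force
  qed
  have "invariant_part \<phi> \<tau> S ?J"
    unfolding invariant_part_def
  proof (intro conjI ballI iffI allI impI)
    show "?J \<subseteq> S" unfolding trajectory_in_def by blast
    show "range z \<subseteq> ?J" if "full_trajectory_in \<phi> \<tau> S z \<and> z 0 = p" for p z using that by (intro range) blast
  qed blast+
  moreover have "J' \<subseteq> ?J" if "invariant_part \<phi> \<tau> S J'" for J'
    using that unfolding invariant_part_def by blast
  ultimately show ?thesis by (simp add: maximal_invariant_set_def)
qed

lemma orthogonal_comp_zero: "{0 :: ell2}\<^sup>\<bottom> = UNIV"
  by (auto simp: orthogonal_comp_def orthogonal_def)

lemma cuboid_zero: "0 \<le> r \<Longrightarrow> cuboid 0 {0} (\<lambda>_ _. 0) T r = T"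
  by (simp add: cuboid_def)

text \<open>For n = 0 the cuboid and its enlargement are both \<open>T\<close>: there is no exit
  direction, (I1) is forward invariance and (I2) concerns an empty difference.\<close>

lemma isolating_cuboid_forward_invariant:
  assumes T: "compact T" "T \<noteq> {}" and inv: "\<And>z t. z \<in> T \<Longrightarrow> 0 \<le> t \<Longrightarrow> \<phi> t z \<in> T"
    and tau: "\<And>z. z \<in> T \<Longrightarrow> \<tau> z = \<infinity>"
  shows "isolating_cuboid \<phi> \<tau> 1 0 {0} (\<lambda>_ _. 0) T"
proof -
  have "subspace_of_dim 0 {0}"
    unfolding subspace_of_dim_def by (rule exI[of _ "{}"]) (auto simp: independent_empty)
  moreover have "homeomorphic_map (top_of_set {0 :: ell2}) (Euclidean_space 0) (\<lambda>_ _. 0)"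
  proof -
    have "homeomorphic_maps (top_of_set {0 :: ell2}) (Euclidean_space 0) (\<lambda>_ _. 0) (\<lambda>_. 0)"
      by (auto simp: homeomorphic_maps_def topspace_Euclidean_space)
    then show ?thesis unfolding homeomorphic_map_maps by blast
  qed
  ultimately have "cuboid_data 0 {0} (\<lambda>_ _. 0) T"
    unfolding cuboid_data_def using T by (simp add: orthogonal_comp_zero)
  then show ?thesis
    unfolding isolating_cuboid_def Let_def
    using inv tau by (auto simp: cuboid_zero flow_image_def intro!: exI[of _ 1])
qed

section \<open>Hyperbolicity\<close>

lemma proj_zero [simp]: "proj {0} z = 0"
  by (simp add: proj_def orthogonal_comp_zero)

lemma inner_unit: "1 \<le> k \<Longrightarrow> inner (unit k) a = coord a k"
  unfolding inner_ell2_def by (subst suminf_finite[of "{k}"]) (auto simp: coord_unit)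

lemma proj_span_unit:
  assumes "1 \<le> k" shows "proj (span {unit k}) z = coord z k *\<^sub>R unit k"
  unfolding proj_def
proof (rule the_equality)
  have u: "inner (unit k) (unit k) = 1" using assms by (simp add: inner_unit coord_unit)
  show "coord z k *\<^sub>R unit k \<in> span {unit k} \<and> z - coord z k *\<^sub>R unit k \<in> (span {unit k})\<^sup>\<bottom>"
    using assms u by (auto simp: span_singleton orthogonal_comp_def orthogonal_def inner_diff_right inner_unit)
  fix x assume "x \<in> span {unit k} \<and> z - x \<in> (span {unit k})\<^sup>\<bottom>"
  then obtain c where c: "x = c *\<^sub>R unit k" "z - x \<in> (span {unit k})\<^sup>\<bottom>" by (auto simp: span_singleton)
  then have "inner (1 *\<^sub>R unit k) (z - x) = 0"
    unfolding orthogonal_comp_def orthogonal_def span_singleton by blast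
  then show "x = coord z k *\<^sub>R unit k"
    using assms u c(1) by (simp add: inner_diff_right inner_unit)
qed

text \<open>With n = 0 the positive cone is empty and the negative cone is all of \<open>N\<close>,
  so the decay estimate is the only analytic content.\<close>

lemma hyperbolic_wrt_stable:
  assumes "z\<^sub>0 \<in> N" "0 < B" "0 < \<omega>"
    and "\<And>z t. 0 \<le> t \<Longrightarrow> ereal t < \<tau> z \<Longrightarrow> \<forall>s\<in>{0..t}. \<phi> s z \<in> N \<Longrightarrow>
      norm (\<phi> t z - z\<^sub>0) \<le> B * exp (- \<omega> * t) * norm (z - z\<^sub>0)"
  shows "hyperbolic_wrt \<phi> \<tau> 0 {0} N z\<^sub>0"
proof -
  have pos: "pos_cone {0} N z\<^sub>0 = {}" and neg: "neg_cone {0} N z\<^sub>0 = N"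
    by (auto simp: pos_cone_def neg_cone_def quad_form_def not_less)
  show ?thesis
    unfolding hyperbolic_wrt_def pos neg
  proof (intro conjI)
    show "backward_invariant \<phi> \<tau> N N"
      unfolding backward_invariant_def trajectory_in_def by blast
    show "\<exists>A B \<omega>. 0 < A \<and> 0 < B \<and> 0 < \<omega> \<and> (\<forall>z\<in>{}. \<forall>t\<ge>0. ereal t < \<tau> z \<and> (\<forall>s\<in>{0..t}. \<phi> s z \<in> N) \<longrightarrow>
        A * exp (\<omega> * t) * norm (proj {0} (z - z\<^sub>0)) \<le> norm (proj {0} (\<phi> t z - z\<^sub>0))) \<and>
        (\<forall>z. \<forall>t\<ge>0. ereal t < \<tau> z \<and> (\<forall>s\<in>{0..t}. \<phi> s z \<in> N) \<longrightarrow>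
        norm (\<phi> t z - z\<^sub>0 - proj {0} (\<phi> t z - z\<^sub>0)) \<le> B * exp (- \<omega> * t) * norm (z - z\<^sub>0 - proj {0} (z - z\<^sub>0)))"
      using assms by (intro exI[of _ 1] exI[of _ B] exI[of _ \<omega>]) auto
  qed (use assms in \<open>auto simp: forward_invariant_def\<close>)
qed

text \<open>The box has half-widths \<open>w\<close> around the fixed point, and the empty set of
  directions encodes n = 0.\<close>

lemma hyperbolic_fixed_pointI_stable:
  assumes "fixed_point \<phi> \<tau> z\<^sub>0" "0 < B" "0 < \<omega>"
    and "\<And>k. 1 \<le> k \<Longrightarrow> 0 < coord w k"
    and "\<And>z t. 0 \<le> t \<Longrightarrow> ereal t < \<tau> z \<Longrightarrow> \<forall>s\<in>{0..t}. \<forall>k\<ge>1. \<bar>coord (\<phi> s z) k - coord z\<^sub>0 k\<bar> \<le> coord w k \<Longrightarrow>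
      norm (\<phi> t z - z\<^sub>0) \<le> B * exp (- \<omega> * t) * norm (z - z\<^sub>0)"
  shows "hyperbolic_fixed_point \<phi> \<tau> z\<^sub>0"
  unfolding hyperbolic_fixed_point_def
proof (intro conjI exI)
  let ?N = "{z. \<forall>k\<ge>1. coord (z\<^sub>0 - w) k \<le> coord z k \<and> coord z k \<le> coord (z\<^sub>0 + w) k}"
  show "\<forall>k\<ge>1. coord (z\<^sub>0 - w) k < coord z\<^sub>0 k \<and> coord z\<^sub>0 k < coord (z\<^sub>0 + w) k"
    using assms(4) by auto
  have "hyperbolic_wrt \<phi> \<tau> 0 {0} ?N z\<^sub>0"
  proof (rule hyperbolic_wrt_stable[OF _ assms(2,3)])
    show "z\<^sub>0 \<in> ?N" using assms(4) by (auto intro: less_imp_le)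
    fix z t assume t: "0 \<le> t" "ereal t < \<tau> z" and s: "\<forall>s\<in>{0..t}. \<phi> s z \<in> ?N"
    show "norm (\<phi> t z - z\<^sub>0) \<le> B * exp (- \<omega> * t) * norm (z - z\<^sub>0)"
      by (rule assms(5)[OF t]) (use s in \<open>auto simp: abs_le_iff algebra_simps\<close>)
  qed
  then show "hyperbolic_wrt \<phi> \<tau> (card {}) (span (unit ` {})) ?N z\<^sub>0" by simp
qed (use assms in auto)

section \<open>The trivial solution\<close>

context
  fixes \<mu> :: real assumes mu: "99/100 \<le> \<mu>" "\<mu> \<le> 101/100"
begin

lemma abs_lam_le: "1 \<le> k \<Longrightarrow> \<bar>lam \<mu> k\<bar> \<le> 2 * real k ^ 4"
proof -
  assume k: "1 \<le> k"
  have "(real k)\<^sup>2 \<le> real k ^ 4" "0 \<le> (real k)\<^sup>2" using k by (auto intro: power_increasing)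
  moreover have "lam \<mu> k = (real k)\<^sup>2 - \<mu> * real k ^ 4"
    by (simp add: lam_def algebra_simps power2_eq_square power4_eq_xxxx)
  moreover have "\<mu> * real k ^ 4 \<le> 101/100 * real k ^ 4" "0 * real k ^ 4 \<le> \<mu> * real k ^ 4"
    using mu by (intro mult_right_mono; simp)+
  ultimately show ?thesis by linarith
qed

lemma lam_ge_2_le: "2 \<le> k \<Longrightarrow> lam \<mu> k \<le> - 11"
proof -
  assume "2 \<le> k"
  show ?thesis
  proof (cases "k = 2")
    case True then show ?thesis using lam_bounds(3)[OF mu] by simp
  next
    case False
    with \<open>2 \<le> k\<close> have "3 \<le> k" by simp
    have "3^4 \<le> real k ^ 4" using \<open>3 \<le> k\<close> by (intro power_mono) auto
    then show ?thesis using lam_bounds(5)[OF mu \<open>3 \<le> k\<close>] by simp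
  qed
qed

text \<open>Half the time derivative of a_k^2.\<close>

definition mode_energy :: "ell2 \<Rightarrow> nat \<Rightarrow> real" where
  "mode_energy a k = coord a k * (lam \<mu> k * coord a k + nl k a)"

context
  fixes \<delta> a assumes \<delta>: "0 \<le> \<delta>" "\<delta> \<le> 1" and a: "\<And>k. 1 \<le> k \<Longrightarrow> \<bar>coord a k\<bar> \<le> \<delta> * (1/5)^k"
begin

text \<open>In a box with half-widths \<delta> * 5^-k the cubic terms are small against the squared
  norm: k * 5^-k is at most (2/5)^k, and 3 times the geometric sum 5/3 is the 5 in
  \<open>suminf_mode_energy_le\<close>.\<close>

lemma abs_coord_nl_le: "\<bar>coord a k * nl k a\<bar> \<le> 3 * \<delta> * (norm a)\<^sup>2 * (2/5)^k"
proof (cases "k = 0")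
  case False
  have "\<bar>nl k a\<bar> \<le> 3 * real k * (norm a)\<^sup>2"
    using abs_bil_le[of k a a] by (simp add: nl_def power2_eq_square)
  then have "\<bar>coord a k\<bar> * \<bar>nl k a\<bar> \<le> (\<delta> * (1/5)^k) * (3 * real k * (norm a)\<^sup>2)"
    using a[of k] False \<delta> by (intro mult_mono) auto
  also have "\<dots> \<le> (\<delta> * (1/5)^k) * (3 * 2^k * (norm a)\<^sup>2)"
    using \<delta> of_nat_less_two_power[of k, where ?'a = real]
    by (intro mult_left_mono mult_right_mono) auto
  also have "\<dots> = 3 * \<delta> * (norm a)\<^sup>2 * ((1/5)^k * 2^k)" by simp
  also have "(1/5)^k * 2^k = (2/5::real)^k" by (simp add: power_mult_distrib[symmetric])
  finally show ?thesis by (simp add: abs_mult)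
qed (use \<delta> in auto)

lemma abs_mode_energy_le: "\<bar>mode_energy a k\<bar> \<le> 5 * (real k ^ 4 * (1/5)^k)"
proof (cases "k = 0")
  case False
  then have k: "1 \<le> k" by simp
  have c: "\<bar>coord a k\<bar> \<le> (1/5)^k"
    using order_trans[OF a[OF k] mult_right_mono[OF \<delta>(2), of "(1/5)^k"]] by simp
  have "norm a \<le> norm (\<delta> *\<^sub>R geom)"
    by (rule norm_coord_mono) (use a \<delta> in \<open>auto simp: coord_geom abs_mult\<close>)
  also have "\<dots> \<le> 1 * 1"
    unfolding norm_scaleR using \<delta> norm_geom_le by (intro mult_mono) auto
  finally have n: "norm a \<le> 1" by simp
  have "\<bar>lam \<mu> k * coord a k + nl k a\<bar> \<le> \<bar>lam \<mu> k\<bar> * \<bar>coord a k\<bar> + \<bar>nl k a\<bar>"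
    by (rule order_trans[OF abs_triangle_ineq]) (simp add: abs_mult)
  also have "\<bar>lam \<mu> k\<bar> * \<bar>coord a k\<bar> \<le> 2 * real k ^ 4 * 1"
    using abs_lam_le[OF k] c power_le_one[of "1/5::real" k] by (intro mult_mono) auto
  also have "\<bar>nl k a\<bar> \<le> 3 * real k * (1 * 1)"
    by (rule order_trans[OF abs_bil_le[of k a a, folded nl_def]]) (use n in \<open>intro mult_left_mono mult_mono; simp\<close>)
  also have "3 * real k * (1 * 1) \<le> 3 * real k ^ 4"
    using k power_increasing[of 1 4 "real k"] by simp
  finally have "\<bar>lam \<mu> k * coord a k + nl k a\<bar> \<le> 5 * real k ^ 4" by simp
  then have "\<bar>coord a k\<bar> * \<bar>lam \<mu> k * coord a k + nl k a\<bar> \<le> (1/5)^k * (5 * real k ^ 4)"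
    using c by (intro mult_mono) auto
  then show ?thesis by (simp add: mode_energy_def abs_mult mult_ac)
qed (simp add: mode_energy_def)

lemma summable_mode_energy: "summable (mode_energy a)"
  by (rule summable_comparison_test'[where N = 0, OF summable_mult[OF summable_quartic]])
    (use abs_mode_energy_le in auto)

lemma suminf_mode_energy_le:
  assumes "\<And>k. 1 \<le> k \<Longrightarrow> lam \<mu> k \<le> c k"
    and s: "(\<lambda>k. c k * (coord a k)\<^sup>2) sums C"
  shows "suminf (mode_energy a) \<le> C + 5 * \<delta> * (norm a)\<^sup>2"
proof -
  have "(\<lambda>k. c k * (coord a k)\<^sup>2 + 3 * \<delta> * (norm a)\<^sup>2 * (2/5)^k) sums (C + 3 * \<delta> * (norm a)\<^sup>2 * (1 / (1 - 2/5)))"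
    by (intro sums_add s sums_mult geometric_sums) simp
  moreover have "mode_energy a k \<le> c k * (coord a k)\<^sup>2 + 3 * \<delta> * (norm a)\<^sup>2 * (2/5)^k" for k
  proof -
    have "lam \<mu> k * (coord a k)\<^sup>2 \<le> c k * (coord a k)\<^sup>2"
      using assms(1)[of k] by (cases "k = 0") (auto intro: mult_right_mono)
    then show ?thesis
      using abs_coord_nl_le[of k] by (simp add: mode_energy_def power2_eq_square algebra_simps abs_le_iff)
  qed
  ultimately have "suminf (mode_energy a) \<le> C + 3 * \<delta> * (norm a)\<^sup>2 * (1 / (1 - 2/5))"
    by (intro sums_le[OF _ summable_sums[OF summable_mode_energy]])
  then show ?thesis by simp
qed

lemma mode_energy_1_ge: "lam \<mu> 1 * (coord a 1)\<^sup>2 - 12/10 * \<delta> * (norm a)\<^sup>2 \<le> mode_energy a 1"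
  using abs_coord_nl_le[of 1] by (simp add: mode_energy_def power2_eq_square algebra_simps abs_le_iff)

end

lemma norm_square_deriv:
  assumes u: "ks_curve \<mu> {0..T} u" and \<delta>: "0 \<le> \<delta>" "\<delta> \<le> 1"
    and b: "\<And>t k. t \<in> {0..T} \<Longrightarrow> 1 \<le> k \<Longrightarrow> \<bar>coord (u t) k\<bar> \<le> \<delta> * (1/5)^k" and t: "t \<in> {0..T}"
  shows "((\<lambda>t. (coord (u t) k)\<^sup>2) has_real_derivative 2 * mode_energy (u t) k) (at t within {0..T})"
    "((\<lambda>t. (norm (u t))\<^sup>2) has_real_derivative 2 * suminf (mode_energy (u t))) (at t within {0..T})"
proof -
  have *: "((\<lambda>t. (coord (u t) k)\<^sup>2) has_real_derivative 2 * mode_energy (u t) k) (at t within {0..T})"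
    if "t \<in> {0..T}" for t k
  proof (cases "k = 0")
    case False
    then show ?thesis
      using DERIV_power[OF solvesD(2)[OF u _ that, of k], of 2] by (simp add: mode_energy_def mult_ac)
  qed (simp add: mode_energy_def)
  from *[OF t] show "((\<lambda>t. (coord (u t) k)\<^sup>2) has_real_derivative 2 * mode_energy (u t) k) (at t within {0..T})" .
  have "((\<lambda>t. \<Sum>k. (coord (u t) k)\<^sup>2) has_real_derivative (\<Sum>k. 2 * mode_energy (u t) k)) (at t within {0..T})"
  proof (rule suminf_has_real_derivative[where M = "\<lambda>k. 2 * (5 * (real k ^ 4 * (1/5)^k))"])
    show "summable (\<lambda>k. 2 * (5 * (real k ^ 4 * (1/5::real)^k)))" by (intro summable_mult summable_quartic)
    show "\<bar>2 * mode_energy (u s) k\<bar> \<le> 2 * (5 * (real k ^ 4 * (1/5)^k))" if "s \<in> {0..T}" for k s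
      using abs_mode_energy_le[OF \<delta> b[OF that], of k] by simp
  qed (use t * summable_coord_square in auto)
  then show "((\<lambda>t. (norm (u t))\<^sup>2) has_real_derivative 2 * suminf (mode_energy (u t))) (at t within {0..T})"
    unfolding norm_ell2_square using suminf_mult[OF summable_mode_energy[OF \<delta> b[OF t]], of 2] by simp
qed

lemma hyperbolic_zero_stable:
  assumes "1 < \<mu>" shows "hyperbolic_fixed_point (ks_flow \<mu>) (ks_time \<mu>) 0"
proof -
  define \<nu> where "\<nu> = \<mu> - 1"
  \<comment> \<open>The cubic terms cost 5 * \<delta> = \<nu> / 2, half of the linear decay.\<close>
  define \<delta> where "\<delta> = \<nu> / 10"
  have \<nu>: "0 < \<nu>" "\<nu> \<le> 1/100" using assms mu by (auto simp: \<nu>_def)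
  have \<delta>: "0 \<le> \<delta>" "\<delta> \<le> 1" using \<nu> by (auto simp: \<delta>_def)
  show ?thesis
  proof (rule hyperbolic_fixed_pointI_stable[where w = "\<delta> *\<^sub>R geom" and B = 1 and \<omega> = "\<nu> / 2"])
    show "fixed_point (ks_flow \<mu>) (ks_time \<mu>) 0" by (rule fixed_point_zero[OF mu])
    show "0 < coord (\<delta> *\<^sub>R geom) k" if "1 \<le> k" for k using that \<nu> by (simp add: coord_geom \<delta>_def)
    fix z t assume t: "0 \<le> t" "ereal t < ks_time \<mu> z"
      and N: "\<forall>s\<in>{0..t}. \<forall>k\<ge>1. \<bar>coord (ks_flow \<mu> s z) k - coord 0 k\<bar> \<le> coord (\<delta> *\<^sub>R geom) k"
    let ?u = "\<lambda>s. ks_flow \<mu> s z"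
    have u: "ks_curve \<mu> {0..t} ?u" by (rule ks_curve_flow_lt_time[OF mu(1) t(2)])
    have b: "\<bar>coord (?u s) k\<bar> \<le> \<delta> * (1/5)^k" if "s \<in> {0..t}" "1 \<le> k" for s k
      using N that by (auto simp: coord_geom)
    have "(norm (?u t))\<^sup>2 \<le> exp (- \<nu> * (t - 0)) * (norm (?u 0))\<^sup>2"
    proof (rule differential_inequality[OF t(1) norm_square_deriv(2)[OF u \<delta> b]])
      fix s assume s: "s \<in> {0..t}"
      have "suminf (mode_energy (?u s)) \<le> - \<nu> * (norm (?u s))\<^sup>2 + 5 * \<delta> * (norm (?u s))\<^sup>2"
      proof (rule suminf_mode_energy_le[OF \<delta> b[OF s], where c = "\<lambda>_. - \<nu>"])
        show "(\<lambda>k. - \<nu> * (coord (?u s) k)\<^sup>2) sums (- \<nu> * (norm (?u s))\<^sup>2)"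
          unfolding norm_ell2_square by (intro sums_mult summable_sums summable_coord_square)
        show "lam \<mu> k \<le> - \<nu>" if "1 \<le> k" for k
          using lam_bounds(1)[OF mu] lam_ge_2_le[of k] that \<nu> by (cases "k = 1") (auto simp: \<nu>_def)
      qed
      then show "2 * suminf (mode_energy (?u s)) \<le> - \<nu> * (norm (?u s))\<^sup>2" by (simp add: \<delta>_def)
    qed
    also have "exp (- \<nu> * (t - 0)) = (exp (- (\<nu> / 2) * t))\<^sup>2" by (simp add: exp_double[symmetric])
    finally have "(norm (?u t))\<^sup>2 \<le> (exp (- (\<nu> / 2) * t) * norm z)\<^sup>2"
      by (simp add: power_mult_distrib ks_flow_0[OF mu(1)])
    then have "norm (?u t) \<le> exp (- (\<nu> / 2) * t) * norm z" by (rule power2_le_imp_le) simp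
    then show "norm (?u t - 0) \<le> 1 * exp (- (\<nu> / 2) * t) * norm (z - 0)" by simp
  qed (use \<nu> in auto)
qed

text \<open>The quadratic form does not decrease along solutions in the box. This one monotonicity
  gives forward invariance of the positive cone and backward invariance of the negative
  cone.\<close>

lemma hyperbolic_zero_saddle:
  assumes "\<mu> < 1" shows "hyperbolic_fixed_point (ks_flow \<mu>) (ks_time \<mu>) 0"
proof -
  define \<nu> where "\<nu> = 1 - \<mu>"
  \<comment> \<open>The cubic terms, 5 * \<delta> = \<nu> / 5 in the total energy and 6/5 * \<delta>
    in the first mode, stay below \<nu> / 4 together.\<close>
  define \<delta> where "\<delta> = \<nu> / 25"
  have \<nu>: "0 < \<nu>" "\<nu> \<le> 1/100" using assms mu by (auto simp: \<nu>_def)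
  have \<delta>: "0 \<le> \<delta>" "\<delta> \<le> 1" using \<nu> by (auto simp: \<delta>_def)
  define N where "N = {z. \<forall>k\<ge>1. coord (- (\<delta> *\<^sub>R geom)) k \<le> coord z k \<and> coord z k \<le> coord (\<delta> *\<^sub>R geom) k}"
  define X where "X = span {unit 1}"
  have N: "z \<in> N \<longleftrightarrow> (\<forall>k\<ge>1. \<bar>coord z k\<bar> \<le> \<delta> * (1/5)^k)" for z
    by (auto simp: N_def coord_geom abs_le_iff minus_le_iff)
  have proj: "proj X z = coord z 1 *\<^sub>R unit 1" for z unfolding X_def by (rule proj_span_unit) simp
  have nproj: "norm (proj X z) = \<bar>coord z 1\<bar>" for z by (simp add: proj norm_unit)
  have ncomp: "(norm (z - proj X z))\<^sup>2 = (norm z)\<^sup>2 - (coord z 1)\<^sup>2" for z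
  proof -
    have "inner z (unit 1) = coord z 1" using inner_unit[of 1 z] by (subst inner_commute) simp
    then show ?thesis unfolding proj power2_norm_eq_inner using inner_unit[of 1]
      by (simp add: inner_diff_left inner_diff_right coord_unit power2_eq_square)
  qed
  have Q: "quad_form X z = 2 * (coord z 1)\<^sup>2 - (norm z)\<^sup>2" for z
    by (simp add: quad_form_def nproj ncomp)
  have high: "suminf (mode_energy z) \<le> mode_energy z 1 - 11 * (norm z)\<^sup>2 + 11 * (coord z 1)\<^sup>2 + 1/4 * (\<nu> * (norm z)\<^sup>2)"
    and one: "\<nu> * (coord z 1)\<^sup>2 - 6/125 * (\<nu> * (norm z)\<^sup>2) \<le> mode_energy z 1" if "z \<in> N" for z
  proof -
    have b: "\<bar>coord z k\<bar> \<le> \<delta> * (1/5)^k" if "1 \<le> k" for k using \<open>z \<in> N\<close> that by (simp add: N)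
    have l1: "lam \<mu> 1 = \<nu>" using lam_bounds(1)[OF mu] by (simp add: \<nu>_def)
    show 1: "\<nu> * (coord z 1)\<^sup>2 - 6/125 * (\<nu> * (norm z)\<^sup>2) \<le> mode_energy z 1"
      using mode_energy_1_ge[OF \<delta> b] unfolding l1 by (simp add: \<delta>_def)
    define c where "c k = (if k = 1 then lam \<mu> 1 else - 11)" for k :: nat
    have "(\<lambda>k. - 11 * (coord z k)\<^sup>2 + (if k = 1 then (lam \<mu> 1 + 11) * (coord z 1)\<^sup>2 else 0))
        sums (- 11 * (norm z)\<^sup>2 + (lam \<mu> 1 + 11) * (coord z 1)\<^sup>2)"
      unfolding norm_ell2_square by (intro sums_add sums_mult summable_sums summable_coord_square sums_single)
    moreover have "- 11 * (coord z k)\<^sup>2 + (if k = 1 then (lam \<mu> 1 + 11) * (coord z 1)\<^sup>2 else 0) = c k * (coord z k)\<^sup>2" for k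
      by (simp add: c_def algebra_simps)
    ultimately have "(\<lambda>k. c k * (coord z k)\<^sup>2) sums (- 11 * (norm z)\<^sup>2 + (lam \<mu> 1 + 11) * (coord z 1)\<^sup>2)"
      by simp
    from suminf_mode_energy_le[OF \<delta> b _ this]
    have "suminf (mode_energy z) \<le> - 11 * (norm z)\<^sup>2 + (lam \<mu> 1 + 11) * (coord z 1)\<^sup>2 + 5 * \<delta> * (norm z)\<^sup>2"
      using lam_ge_2_le by (simp add: c_def)
    moreover have "5 * \<delta> * (norm z)\<^sup>2 = 1/5 * (\<nu> * (norm z)\<^sup>2)" by (simp add: \<delta>_def)
    moreover have "0 \<le> \<nu> * (norm z)\<^sup>2" using \<nu> by simp
    moreover have "\<bar>coord z 1 * nl 1 z\<bar> \<le> 3 * \<delta> * (norm z)\<^sup>2 * (2/5)^1" by (rule abs_coord_nl_le[OF \<delta> b])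
    moreover have "3 * \<delta> * (norm z)\<^sup>2 * (2/5)^1 = 6/125 * (\<nu> * (norm z)\<^sup>2)" by (simp add: \<delta>_def)
    moreover have "mode_energy z 1 = lam \<mu> 1 * (coord z 1)\<^sup>2 + coord z 1 * nl 1 z"
      by (simp add: mode_energy_def power2_eq_square algebra_simps)
    ultimately show "suminf (mode_energy z) \<le> mode_energy z 1 - 11 * (norm z)\<^sup>2 + 11 * (coord z 1)\<^sup>2 + 1/4 * (\<nu> * (norm z)\<^sup>2)"
      using distrib_right[of "lam \<mu> 1" 11 "(coord z 1)\<^sup>2"] by linarith
  qed
  have E_ge: "(coord z 1)\<^sup>2 \<le> (norm z)\<^sup>2" for z
    using abs_coord_le_norm[of z 1] by (simp add: abs_le_square_iff[symmetric])
  have G_le: "\<nu> * (norm z)\<^sup>2 - \<nu> * (coord z 1)\<^sup>2 \<le> 1/100 * (norm z)\<^sup>2 - 1/100 * (coord z 1)\<^sup>2" for z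
    using mult_right_mono[OF \<nu>(2), of "(norm z)\<^sup>2 - (coord z 1)\<^sup>2"] E_ge[of z]
    by (simp only: right_diff_distrib diff_ge_0_iff_ge)
  have mono: "quad_form X (u 0) \<le> quad_form X (u t)"
    if u: "ks_curve \<mu> {0..t} u" "\<And>s. s \<in> {0..t} \<Longrightarrow> u s \<in> N" "0 \<le> t" for u t
  proof (rule has_real_derivative_nonneg_imp_le[where f = "\<lambda>t. quad_form X (u t)", OF \<open>0 \<le> t\<close>])
    fix s assume s: "s \<in> {0..t}"
    have b: "\<bar>coord (u r) k\<bar> \<le> \<delta> * (1/5)^k" if "r \<in> {0..t}" "1 \<le> k" for r k
      using u(2)[OF that(1)] that(2) by (simp add: N)
    show "((\<lambda>t. quad_form X (u t)) has_real_derivative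
        2 * (2 * mode_energy (u s) 1) - 2 * suminf (mode_energy (u s))) (at s within {0..t})"
      unfolding Q by (intro DERIV_diff DERIV_cmult norm_square_deriv[OF u(1) \<delta> b] s)
    have "0 \<le> \<nu> * (coord (u s) 1)\<^sup>2" using \<nu> by simp
    with G_le[of "u s"] show "0 \<le> 2 * (2 * mode_energy (u s) 1) - 2 * suminf (mode_energy (u s))"
      using high[OF u(2)[OF s]] one[OF u(2)[OF s]] E_ge[of "u s"] by linarith
  qed
  have traj_mono: "quad_form X (w r) \<le> quad_form X (w s)"
    if w: "trajectory_in (ks_flow \<mu>) (ks_time \<mu>) N I w" "r \<in> I" "s \<in> I" "r \<le> s" for w I r s
  proof -
    have ij: "is_interval I" and tr: "\<And>t s. 0 \<le> s \<Longrightarrow> t \<in> I \<Longrightarrow> t + s \<in> I \<Longrightarrow> ereal s < ks_time \<mu> (w t) \<and> ks_flow \<mu> s (w t) = w (t + s)"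
      and wN: "\<And>t. t \<in> I \<Longrightarrow> w t \<in> N"
      using w(1) unfolding trajectory_in_def by blast+
    have eq: "ks_flow \<mu> q (w r) = w (r + q)" "r + q \<in> I" if "0 \<le> q" "q \<le> s - r" for q
    proof -
      show "r + q \<in> I" using mem_is_interval_1_I[OF ij w(2,3), of "r + q"] that by simp
      then show "ks_flow \<mu> q (w r) = w (r + q)" using tr[of q r] that w(2) by simp
    qed
    have "ereal (s - r) < ks_time \<mu> (w r)" using tr[of "s - r" r] w by simp
    from ks_curve_flow_lt_time[OF mu(1) this]
    have "quad_form X (ks_flow \<mu> 0 (w r)) \<le> quad_form X (ks_flow \<mu> (s - r) (w r))"
      by (rule mono) (use w eq wN in auto)
    then show ?thesis using eq[of "s - r"] w by (simp add: ks_flow_0[OF mu(1)])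
  qed
  have zero: "pos_cone X N 0 \<noteq> {}" "neg_cone X N 0 \<noteq> {}"
  proof -
    have "(\<delta> / 5) *\<^sub>R unit 1 \<in> pos_cone X N 0"
      using \<nu> by (simp add: pos_cone_def N Q coord_unit norm_unit \<delta>_def power2_eq_square)
    then show "pos_cone X N 0 \<noteq> {}" by blast
    have "0 \<in> neg_cone X N 0" using \<delta> by (simp add: neg_cone_def N Q)
    then show "neg_cone X N 0 \<noteq> {}" by blast
  qed
  have "hyperbolic_wrt (ks_flow \<mu>) (ks_time \<mu>) (card {1::nat}) X N 0"
    unfolding hyperbolic_wrt_def
  proof (intro conjI impI zero exI)
    show "forward_invariant (ks_flow \<mu>) (ks_time \<mu>) N (pos_cone X N 0)"
      unfolding forward_invariant_def pos_cone_def
    proof (clarsimp)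
      fix I w t s assume w: "trajectory_in (ks_flow \<mu>) (ks_time \<mu>) N I w" "{0..t} \<subseteq> I" "0 \<le> s" "s \<le> t" "0 < quad_form X (w 0)"
      then have "0 \<in> I" "s \<in> I" by auto
      with traj_mono[OF w(1) this w(3)] w(5) w(1) show "w s \<in> N \<and> 0 < quad_form X (w s)"
        unfolding trajectory_in_def by auto
    qed
    show "backward_invariant (ks_flow \<mu>) (ks_time \<mu>) N (neg_cone X N 0)"
      unfolding backward_invariant_def neg_cone_def
    proof (clarsimp)
      fix I w t s assume w: "trajectory_in (ks_flow \<mu>) (ks_time \<mu>) N I w" "{t..0} \<subseteq> I" "t \<le> s" "s \<le> 0" "quad_form X (w 0) \<le> 0"
      then have "0 \<in> I" "s \<in> I" by auto
      with traj_mono[OF w(1) this(2,1) w(4)] w(5) w(1) show "w s \<in> N \<and> quad_form X (w s) \<le> 0"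
        unfolding trajectory_in_def by auto
    qed
    show "0 < (1::real)" "0 < (1::real)" "0 < \<nu> / 2" using \<nu> by auto
    show "\<forall>z\<in>pos_cone X N 0. \<forall>t\<ge>0. ereal t < ks_time \<mu> z \<and> (\<forall>s\<in>{0..t}. ks_flow \<mu> s z \<in> N) \<longrightarrow>
        1 * exp (\<nu> / 2 * t) * norm (proj X (z - 0)) \<le> norm (proj X (ks_flow \<mu> t z - 0))"
    proof (intro ballI allI impI)
      fix z t assume z: "z \<in> pos_cone X N 0" and t: "0 \<le> t"
        and tN: "ereal t < ks_time \<mu> z \<and> (\<forall>s\<in>{0..t}. ks_flow \<mu> s z \<in> N)"
      let ?u = "\<lambda>s. ks_flow \<mu> s z"
      have u: "ks_curve \<mu> {0..t} ?u" using tN by (intro ks_curve_flow_lt_time[OF mu(1)]) simp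
      have b: "\<bar>coord (?u s) k\<bar> \<le> \<delta> * (1/5)^k" if "s \<in> {0..t}" "1 \<le> k" for s k
        using tN that by (auto simp: N)
      have "- (coord (?u t) 1)\<^sup>2 \<le> exp (\<nu> * (t - 0)) * - (coord (?u 0) 1)\<^sup>2"
      proof (rule differential_inequality[where f = "\<lambda>s. - (coord (?u s) 1)\<^sup>2", OF t])
        fix s assume s: "s \<in> {0..t}"
        show "((\<lambda>s. - (coord (?u s) 1)\<^sup>2) has_real_derivative - (2 * mode_energy (?u s) 1)) (at s within {0..t})"
          by (intro DERIV_minus norm_square_deriv(1)[OF u \<delta> b s])
        \<comment> \<open>The orbit stays in the positive cone, where the squared norm is at most
          twice a_1^2; the cubic terms then cost less than half of the linear growth.\<close>
        have "quad_form X (?u 0) \<le> quad_form X (?u s)"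
          by (rule mono[OF solves_subset[OF u]]) (use s tN in auto)
        moreover have "0 < quad_form X (?u 0)" using z by (simp add: pos_cone_def ks_flow_0[OF mu(1)])
        ultimately have "(norm (?u s))\<^sup>2 \<le> 2 * (coord (?u s) 1)\<^sup>2" unfolding Q by simp
        then have "\<nu> * (norm (?u s))\<^sup>2 \<le> \<nu> * (2 * (coord (?u s) 1)\<^sup>2)" using \<nu> by (intro mult_left_mono) auto
        moreover have "0 \<le> \<nu> * (coord (?u s) 1)\<^sup>2" using \<nu> by simp
        ultimately show "- (2 * mode_energy (?u s) 1) \<le> \<nu> * - (coord (?u s) 1)\<^sup>2"
          using one[of "?u s"] tN s by simp
      qed
      moreover have "exp (\<nu> * (t - 0)) = (exp (\<nu> / 2 * t))\<^sup>2" by (simp add: exp_double[symmetric])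
      ultimately have "(exp (\<nu> / 2 * t) * \<bar>coord z 1\<bar>)\<^sup>2 \<le> \<bar>coord (?u t) 1\<bar>\<^sup>2"
        by (simp add: power_mult_distrib ks_flow_0[OF mu(1)])
      then have "exp (\<nu> / 2 * t) * \<bar>coord z 1\<bar> \<le> \<bar>coord (?u t) 1\<bar>" by (rule power2_le_imp_le) simp
      then show "1 * exp (\<nu> / 2 * t) * norm (proj X (z - 0)) \<le> norm (proj X (?u t - 0))" by (simp add: nproj)
    qed
    show "\<forall>z. \<forall>t\<ge>0. ereal t < ks_time \<mu> z \<and> (\<forall>s\<in>{0..t}. ks_flow \<mu> s z \<in> neg_cone X N 0) \<longrightarrow>
        norm (ks_flow \<mu> t z - 0 - proj X (ks_flow \<mu> t z - 0)) \<le> 1 * exp (- (\<nu> / 2) * t) * norm (z - 0 - proj X (z - 0))"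
    proof (intro allI impI)
      fix z t assume t: "0 \<le> t"
        and tN: "ereal t < ks_time \<mu> z \<and> (\<forall>s\<in>{0..t}. ks_flow \<mu> s z \<in> neg_cone X N 0)"
      let ?u = "\<lambda>s. ks_flow \<mu> s z"
      have u: "ks_curve \<mu> {0..t} ?u" using tN by (intro ks_curve_flow_lt_time[OF mu(1)]) simp
      have b: "\<bar>coord (?u s) k\<bar> \<le> \<delta> * (1/5)^k" if "s \<in> {0..t}" "1 \<le> k" for s k
        using tN that by (auto simp: N neg_cone_def)
      have "(norm (?u t - proj X (?u t)))\<^sup>2 \<le> exp (- \<nu> * (t - 0)) * (norm (?u 0 - proj X (?u 0)))\<^sup>2"
        unfolding ncomp
      proof (rule differential_inequality[where f = "\<lambda>s. (norm (?u s))\<^sup>2 - (coord (?u s) 1)\<^sup>2", OF t])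
        fix s assume s: "s \<in> {0..t}"
        show "((\<lambda>s. (norm (?u s))\<^sup>2 - (coord (?u s) 1)\<^sup>2) has_real_derivative
            2 * suminf (mode_energy (?u s)) - 2 * mode_energy (?u s) 1) (at s within {0..t})"
          by (intro DERIV_diff norm_square_deriv[OF u \<delta> b s])
        have "quad_form X (?u s) \<le> 0" using tN s by (auto simp: neg_cone_def)
        \<comment> \<open>In the negative cone the full norm is controlled by the part orthogonal to
          the first mode, so the cubic terms can be absorbed there.\<close>
        then have E: "(norm (?u s))\<^sup>2 \<le> 2 * ((norm (?u s))\<^sup>2 - (coord (?u s) 1)\<^sup>2)" unfolding Q by simp
        have "\<nu> * (norm (?u s))\<^sup>2 \<le> 1/100 * (norm (?u s))\<^sup>2" using \<nu> by (intro mult_right_mono) auto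
        moreover note G_le[of "?u s"]
        moreover have "?u s \<in> N" using tN s by (auto simp: neg_cone_def)
        ultimately show "2 * suminf (mode_energy (?u s)) - 2 * mode_energy (?u s) 1
            \<le> - \<nu> * ((norm (?u s))\<^sup>2 - (coord (?u s) 1)\<^sup>2)"
          using high[of "?u s"] E E_ge[of "?u s"] by (simp add: right_diff_distrib)
      qed
      also have "exp (- \<nu> * (t - 0)) = (exp (- (\<nu> / 2) * t))\<^sup>2" by (simp add: exp_double[symmetric])
      finally have "(norm (?u t - proj X (?u t)))\<^sup>2 \<le> (exp (- (\<nu> / 2) * t) * norm (z - proj X z))\<^sup>2"
        by (simp add: power_mult_distrib ks_flow_0[OF mu(1)])
      then have "norm (?u t - proj X (?u t)) \<le> exp (- (\<nu> / 2) * t) * norm (z - proj X z)"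
        by (rule power2_le_imp_le) simp
      then show "norm (?u t - 0 - proj X (?u t - 0)) \<le> 1 * exp (- (\<nu> / 2) * t) * norm (z - 0 - proj X (z - 0))" by simp
    qed
  qed
  then have "hyperbolic_wrt (ks_flow \<mu>) (ks_time \<mu>) (card {1::nat}) (span (unit ` {1}))
      {z. \<forall>k\<ge>1. coord (- (\<delta> *\<^sub>R geom)) k \<le> coord z k \<and> coord z k \<le> coord (\<delta> *\<^sub>R geom) k} 0"
    by (simp add: X_def N_def)
  moreover have "\<forall>k\<ge>1. coord (- (\<delta> *\<^sub>R geom)) k < coord 0 k \<and> coord 0 k < coord (\<delta> *\<^sub>R geom) k"
    using \<nu> by (simp add: coord_geom \<delta>_def)
  ultimately show ?thesis
    unfolding hyperbolic_fixed_point_def using fixed_point_zero[OF mu]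
    by (intro conjI exI[of _ "- (\<delta> *\<^sub>R geom)"] exI[of _ "\<delta> *\<^sub>R geom"] exI[of _ "{1}"]) auto
qed

end

section \<open>Dynamics in the trapping region\<close>

lemma trap_wide: "a \<in> trap \<Longrightarrow> a \<in> wide"
  using trap_subset_wide by blast

text \<open>All slaved modes are of order a_1^2, so convergence to the origin can be read off from
  the first mode.\<close>

lemma norm_wide_le:
  assumes "a \<in> wide" shows "norm a \<le> 2 * \<bar>coord a 1\<bar>"
proof -
  have "norm a \<le> norm ((5 * \<bar>coord a 1\<bar>) *\<^sub>R geom)"
  proof (rule norm_coord_mono)
    fix k :: nat assume "1 \<le> k"
    have "\<bar>coord a k\<bar> \<le> 5 * \<bar>coord a 1\<bar> * (1/5)^k"
    proof (cases "k = 1")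
      case False
      then have "\<bar>coord a k\<bar> \<le> 25/4 * (1/5)^k * (coord a 1)\<^sup>2"
        using \<open>1 \<le> k\<close> by (intro wide_coord_le[OF assms]) auto
      also have "\<dots> = 25/4 * (1/5)^k * (\<bar>coord a 1\<bar> * \<bar>coord a 1\<bar>)" by (simp add: power2_eq_square)
      also have "\<dots> \<le> 25/4 * (1/5)^k * (\<bar>coord a 1\<bar> * (1/4))"
        using wide_coords(1)[OF assms] by (intro mult_left_mono) auto
      also have "\<dots> \<le> 5 * \<bar>coord a 1\<bar> * (1/5)^k" by simp
      finally show ?thesis .
    qed simp
    then show "\<bar>coord a k\<bar> \<le> \<bar>coord ((5 * \<bar>coord a 1\<bar>) *\<^sub>R geom) k\<bar>"
      using \<open>1 \<le> k\<close> by (intro order_trans[OF _ abs_ge_self]) (simp add: coord_geom)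
  qed
  also have "\<dots> \<le> 5 * \<bar>coord a 1\<bar> * (1/4)"
    using mult_left_mono[OF norm_geom_le, of "5 * \<bar>coord a 1\<bar>"] by simp
  finally show ?thesis by simp
qed

text \<open>The first chart coordinate, 2 ln a_1, is unbounded near the origin, but it enters the
  cone form with a negative sign; the others contribute at most 1/64 + 1/16.\<close>

lemma cone_form_le_1:
  assumes "x \<in> wide" "y \<in> wide" "0 < coord x 1" "0 < coord y 1"
  shows "cone_form x y \<le> 1"
proof -
  let ?d = "chart x - chart y"
  have "norm (tail 3 ?d) \<le> norm geom"
  proof (rule norm_coord_mono)
    fix k :: nat
    have c: "\<bar>coord (chart a) k\<bar> \<le> 1/2 * (1/5)^k" if "a \<in> wide" "0 < coord a 1" "3 \<le> k" for a
    proof -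
      have "\<bar>coord (chart a) k\<bar> \<le> 2 * (1/5)^k * coord a 1" by (rule wide_chart_bounds(3)[OF that])
      also have "\<dots> \<le> 2 * (1/5)^k * (1/4)" using wide_coords(1)[OF that(1)] by (intro mult_left_mono) auto
      finally show ?thesis by simp
    qed
    show "\<bar>coord (tail 3 ?d) k\<bar> \<le> \<bar>coord geom k\<bar>"
    proof (cases "k < 3")
      case False
      then have "\<bar>coord ?d k\<bar> \<le> (1/5)^k"
        using c[OF assms(1,3)] c[OF assms(2,4)] unfolding coord_minus by linarith
      then show ?thesis using False by (simp add: coord_tail coord_geom)
    qed (simp add: coord_tail)
  qed
  then have R: "(norm (tail 3 ?d))\<^sup>2 \<le> (1/4)\<^sup>2" using norm_geom_le by (intro power_mono) auto
  have "\<bar>coord ?d 2\<bar> \<le> 1/8"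
    using wide_chart_bounds(1,2)[OF assms(1,3)] wide_chart_bounds(1,2)[OF assms(2,4)] unfolding coord_minus by linarith
  then have "(coord ?d 2)\<^sup>2 \<le> (1/8)\<^sup>2" by (simp add: abs_le_square_iff[symmetric])
  moreover have "cone_form x y = (coord ?d 2)\<^sup>2 + (norm (tail 3 ?d))\<^sup>2 - (coord ?d 1)\<^sup>2"
    unfolding cone_form_def norm_square_split[of ?d] by simp
  moreover have "(1/8)\<^sup>2 + (1/4)\<^sup>2 \<le> (1::real)" by (simp add: power2_eq_square)
  ultimately show ?thesis using R zero_le_power2[of "coord ?d 1"] by linarith
qed

lemma exp_rate_tendsto_0:
  fixes c C :: real
  assumes "0 < c" shows "((\<lambda>t. C * exp (- c * t)) \<longlongrightarrow> 0) at_top"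
proof -
  have "filterlim (\<lambda>t. c * t) at_top at_top"
    by (rule filterlim_tendsto_pos_mult_at_top[OF tendsto_const assms filterlim_ident])
  then have "filterlim (\<lambda>t. - c * t) at_bot at_top"
    unfolding filterlim_uminus_at_bot by simp
  from tendsto_mult_right_zero[OF filterlim_compose[OF exp_at_bot this], of C] show ?thesis .
qed

context
  fixes \<mu> :: real assumes mu: "99/100 \<le> \<mu>" "\<mu> \<le> 101/100"
begin

abbreviation trap_orbit :: "(real \<Rightarrow> ell2) \<Rightarrow> bool" where
  "trap_orbit z \<equiv> full_trajectory_in (ks_flow \<mu>) (ks_time \<mu>) trap z"

lemma trap_orbit_iff:
  "trap_orbit z \<longleftrightarrow> (\<forall>t. z t \<in> trap) \<and> (\<forall>s t. 0 \<le> s \<longrightarrow> ks_flow \<mu> s (z t) = z (t + s))"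
  unfolding trajectory_in_def by (auto simp: ks_time_trap[OF mu])

lemma trap_orbit_const:
  assumes "p \<in> trap" "\<And>t. 0 \<le> t \<Longrightarrow> ks_flow \<mu> t p = p" shows "trap_orbit (\<lambda>_. p)"
  using assms by (simp add: trap_orbit_iff)

lemma trap_orbit_curve:
  assumes "trap_orbit z" shows "ks_curve \<mu> {a..} z"
proof (rule solves_cong)
  have z: "z a \<in> trap" using assms by (simp add: trap_orbit_iff)
  show "ks_curve \<mu> {a..} (\<lambda>t. ks_flow \<mu> (- a + t) (z a))"
    by (rule solves_shift, rule solves_subset[OF ks_curve_trap[OF mu z]]) auto
  fix t assume "t \<in> {a..}"
  then show "ks_flow \<mu> (- a + t) (z a) = z t" using assms by (simp add: trap_orbit_iff)
qed

lemma main_square_deriv: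
  assumes "ks_curve \<mu> S u" "t \<in> S"
  shows "((\<lambda>t. (coord (u t) 1)\<^sup>2) has_real_derivative
    2 * (lam \<mu> 1 * (coord (u t) 1)\<^sup>2 + coord (u t) 1 * nl 1 (u t))) (at t within S)"
  using DERIV_power[OF solvesD(2)[OF assms(1) _ assms(2), of 1], of 2]
  by (simp add: power2_eq_square algebra_simps)

text \<open>Logistic inequalities for a_1^2, from above and below. Working with the square avoids a
  distinction by the sign of a_1.\<close>

lemma main_square_bounds:
  assumes "a \<in> trap"
  shows "2 * (lam \<mu> 1 * (coord a 1)\<^sup>2 + coord a 1 * nl 1 a) \<le> 2 * (1 - \<mu>) * (coord a 1)\<^sup>2 - 48/100 * ((coord a 1)\<^sup>2 * (coord a 1)\<^sup>2)"
    "2 * (1 - \<mu>) * (coord a 1)\<^sup>2 - 102/100 * ((coord a 1)\<^sup>2 * (coord a 1)\<^sup>2) \<le> 2 * (lam \<mu> 1 * (coord a 1)\<^sup>2 + coord a 1 * nl 1 a)"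
    "(coord a 1)\<^sup>2 \<le> 1/25"
proof -
  have e: "(coord a 1)^4 = (coord a 1)\<^sup>2 * (coord a 1)\<^sup>2" by (simp add: power2_eq_square power4_eq_xxxx)
  show "2 * (lam \<mu> 1 * (coord a 1)\<^sup>2 + coord a 1 * nl 1 a) \<le> 2 * (1 - \<mu>) * (coord a 1)\<^sup>2 - 48/100 * ((coord a 1)\<^sup>2 * (coord a 1)\<^sup>2)"
    "2 * (1 - \<mu>) * (coord a 1)\<^sup>2 - 102/100 * ((coord a 1)\<^sup>2 * (coord a 1)\<^sup>2) \<le> 2 * (lam \<mu> 1 * (coord a 1)\<^sup>2 + coord a 1 * nl 1 a)"
    using wide_mult_nl_1(2,3)[OF trap_wide[OF assms]] unfolding lam_bounds(1)[OF mu] e distrib_left mult.assoc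
    by linarith+
  have "\<bar>coord a 1\<bar> \<le> 1/5" using assms by (auto simp: trap_def slaved_def)
  then show "(coord a 1)\<^sup>2 \<le> 1/25" using abs_le_square_iff[of "coord a 1" "1/5"] by (simp add: power2_eq_square)
qed

text \<open>For \<mu> \<ge> 1 the square f of the first mode satisfies f' \<le> - 48/100 f^2;
  followed backward, a positive value would outgrow the bound 1/25.\<close>

lemma trap_orbit_zero:
  assumes z: "trap_orbit z" and "1 \<le> \<mu>" shows "z t = 0"
proof -
  define f where "f s = (coord (z s) 1)\<^sup>2" for s
  have zt: "z s \<in> trap" for s using z by (simp add: trap_orbit_iff)
  define f' where "f' s = 2 * (lam \<mu> 1 * (coord (z s) 1)\<^sup>2 + coord (z s) 1 * nl 1 (z s))" for s
  have f'_deriv: "(f has_real_derivative f' s) (at s within {a..b})" if "s \<in> {a..b}" for a b s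
    unfolding f_def f'_def by (rule main_square_deriv[OF solves_subset[OF trap_orbit_curve[OF z, of a]] that]) auto
  have f'_le: "f' s \<le> - (48/100) * (f s * f s)" for s
  proof -
    have "(1 - \<mu>) * f s \<le> 0" using \<open>1 \<le> \<mu>\<close> by (intro mult_nonpos_nonneg) (auto simp: f_def)
    then have "2 * (1 - \<mu>) * f s \<le> 0" by (simp only: mult.assoc)
    then show ?thesis using main_square_bounds(1)[OF zt[of s]] unfolding f_def f'_def by linarith
  qed
  have mono: "f b \<le> f a" if "a \<le> b" for a b
  proof -
    have "f b \<le> exp (0 * (b - a)) * f a"
    proof (rule differential_inequality[OF that f'_deriv])
      fix s
      have "0 \<le> f s * f s" by simp
      then show "f' s \<le> 0 * f s" using f'_le[of s] by linarith
    qed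
    then show ?thesis by simp
  qed
  have "f t \<le> 0"
  proof (rule ccontr)
    assume "\<not> f t \<le> 0"
    then have c: "0 < f t" by simp
    \<comment> \<open>On the interval of length T before t the function is at least
      \<open>f t\<close>, so it decays there at rate \<open>48/100 * f t\<close>. This T makes the
      exponent \<open>1 / (25 * f t)\<close>, and exp x \<ge> 1 + x leads to f t + 1/25 \<le>
      1/25.\<close>
    define T where "T = 1 / (12 * (f t)\<^sup>2)"
    have T: "0 < T" using c by (simp add: T_def)
    have "f t \<le> exp (- (48/100 * f t) * (t - (t - T))) * f (t - T)"
    proof (rule differential_inequality[OF _ f'_deriv])
      fix s assume s: "s \<in> {t - T..t}"
      then have "f t * f s \<le> f s * f s" using mono[of s t] by (intro mult_right_mono) (auto simp: f_def)
      then show "f' s \<le> - (48/100 * f t) * f s" using f'_le[of s] by simp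
    qed (use T in auto)
    also have "\<dots> \<le> exp (- (48/100 * f t * T)) * (1/25)"
      using main_square_bounds(3)[OF zt[of "t - T"]] by (auto simp: f_def)
    also have "48/100 * f t * T = 1 / (25 * f t)" using c by (simp add: T_def power2_eq_square)
    finally have *: "f t \<le> exp (- (1 / (25 * f t))) * (1/25)" .
    have "1 + 1 / (25 * f t) \<le> exp (1 / (25 * f t))" by (rule exp_ge_add_one_self)
    moreover have "f t * exp (1 / (25 * f t)) \<le> 1/25"
      using mult_right_mono[OF *, of "exp (1 / (25 * f t))"] by (simp add: exp_minus)
    ultimately have "f t * (1 + 1 / (25 * f t)) \<le> 1/25"
      using c by (meson mult_left_mono less_imp_le order_trans)
    moreover have "f t * (1 + 1 / (25 * f t)) = f t + 1/25" using c by (simp add: distrib_left)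
    ultimately show False using c by simp
  qed
  then have "coord (z t) 1 = 0" by (simp add: f_def)
  then show ?thesis using wide_zero_iff[OF trap_wide[OF zt]] by simp
qed

lemma main_square_growth:
  assumes u: "ks_curve \<mu> {a..b} u" "\<And>t. t \<in> {a..b} \<Longrightarrow> u t \<in> trap" and ab: "a \<le> b"
  shows "(coord (u b) 1)\<^sup>2 \<le> exp (2 * (1 - \<mu>) * (b - a)) * (coord (u a) 1)\<^sup>2"
    "exp (- (b - a)) * (coord (u a) 1)\<^sup>2 \<le> (coord (u b) 1)\<^sup>2"
proof -
  show "(coord (u b) 1)\<^sup>2 \<le> exp (2 * (1 - \<mu>) * (b - a)) * (coord (u a) 1)\<^sup>2"
  proof (rule differential_inequality[OF ab main_square_deriv[OF u(1)]])
    fix t assume "t \<in> {a..b}"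
    from main_square_bounds(1)[OF u(2)[OF this]] mult_nonneg_nonneg[OF zero_le_power2 zero_le_power2, of "coord (u t) 1" "coord (u t) 1"]
    show "2 * (lam \<mu> 1 * (coord (u t) 1)\<^sup>2 + coord (u t) 1 * nl 1 (u t)) \<le> 2 * (1 - \<mu>) * (coord (u t) 1)\<^sup>2" by linarith
  qed
  have "- (coord (u b) 1)\<^sup>2 \<le> exp (- 1 * (b - a)) * - (coord (u a) 1)\<^sup>2"
  proof (rule differential_inequality[where f = "\<lambda>t. - (coord (u t) 1)\<^sup>2", OF ab DERIV_minus[OF main_square_deriv[OF u(1)]]])
    fix t assume t: "t \<in> {a..b}"
    let ?f = "(coord (u t) 1)\<^sup>2"
    have "?f * ?f \<le> 1/25 * ?f" using main_square_bounds(3)[OF u(2)[OF t]] by (intro mult_right_mono) auto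
    moreover have "- (1/100) * ?f \<le> (1 - \<mu>) * ?f" using mu by (intro mult_right_mono) auto
    ultimately show "- (2 * (lam \<mu> 1 * ?f + coord (u t) 1 * nl 1 (u t))) \<le> - 1 * - ?f"
      using main_square_bounds(2)[OF u(2)[OF t]] zero_le_power2[of "coord (u t) 1"] by linarith
  qed
  then show "exp (- (b - a)) * (coord (u a) 1)\<^sup>2 \<le> (coord (u b) 1)\<^sup>2" by simp
qed

text \<open>The square of the first mode decays at most exponentially, so a nonzero first mode never
  reaches zero and cannot change sign.\<close>

lemma main_mode_sgn:
  assumes u: "ks_curve \<mu> {a..b} u" "\<And>t. t \<in> {a..b} \<Longrightarrow> u t \<in> trap" and ab: "a \<le> b"
  shows "sgn (coord (u b) 1) = sgn (coord (u a) 1)"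
proof (cases "coord (u a) 1 = 0")
  case True
  then show ?thesis using main_square_growth(1)[OF assms] by simp
next
  case False
  have nz: "coord (u t) 1 \<noteq> 0" if t: "t \<in> {a..b}" for t
  proof -
    have "exp (- (t - a)) * (coord (u a) 1)\<^sup>2 \<le> (coord (u t) 1)\<^sup>2"
      by (rule main_square_growth(2)[OF solves_subset[OF u(1)]]) (use t u(2) in auto)
    moreover have "0 < exp (- (t - a)) * (coord (u a) 1)\<^sup>2" using False by simp
    ultimately show ?thesis by auto
  qed
  have c: "continuous_on {a..b} (\<lambda>t. coord (u t) 1)"
    by (intro continuous_coord solvesD(1)[OF u(1)])
  show ?thesis
  proof (rule ccontr)
    assume "sgn (coord (u b) 1) \<noteq> sgn (coord (u a) 1)"
    with nz[of a] nz[of b] ab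
    consider "coord (u a) 1 \<le> 0" "0 \<le> coord (u b) 1" | "0 \<le> coord (u a) 1" "coord (u b) 1 \<le> 0"
      by (auto simp: sgn_if split: if_splits)
    then have "\<exists>t\<ge>a. t \<le> b \<and> coord (u t) 1 = 0"
    proof cases
      case 1 then show ?thesis using IVT'[OF _ _ ab c] by blast
    next
      case 2 then show ?thesis using IVT2'[OF _ _ ab c] by blast
    qed
    with nz show False by auto
  qed
qed

lemma trap_orbit_sgn:
  assumes "trap_orbit z" shows "sgn (coord (z t) 1) = sgn (coord (z s) 1)"
proof -
  have *: "sgn (coord (z b) 1) = sgn (coord (z a) 1)" if "a \<le> b" for a b
    by (rule main_mode_sgn[OF solves_subset[OF trap_orbit_curve[OF assms, of a]] _ that])
      (use assms in \<open>auto simp: trap_orbit_iff\<close>)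
  show ?thesis using *[of s t] *[of t s] by (cases "s \<le> t") auto
qed

end

section \<open>Parameters below 1: growth up to a fixed amplitude\<close>

locale supercritical =
  fixes \<mu> :: real assumes mu: "99/100 \<le> \<mu>" "\<mu> < 1"
begin

lemma mu': "99/100 \<le> \<mu>" "\<mu> \<le> 101/100" using mu by auto

definition "\<nu> = 1 - \<mu>"

text \<open>Below the amplitude \<open>level\<close> the first mode grows at least at rate \<open>\<nu>/2\<close>.\<close>

definition "level = sqrt (\<nu> / 2)"

lemma nu: "0 < \<nu>" "\<nu> \<le> 1/100" using mu by (auto simp: \<nu>_def)

lemma level: "0 < level" "level\<^sup>2 = \<nu> / 2" "level \<le> 1/5"
proof -
  show 1: "0 < level" "level\<^sup>2 = \<nu> / 2" using nu by (auto simp: level_def)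
  have "level\<^sup>2 \<le> (1/5)\<^sup>2" unfolding 1 using nu by (simp add: power2_eq_square)
  then show "level \<le> 1/5" by (rule power2_le_imp_le) simp
qed

text \<open>At a_1^2 = L \<le> \<nu> the lower logistic bound 2 \<nu> L - 102/100 L^2 is positive,
  so such a value is crossed upward only.\<close>

lemma square_ge_forward:
  assumes u: "ks_curve \<mu> {a..b} u" "\<And>t. t \<in> {a..b} \<Longrightarrow> u t \<in> trap" and ab: "a \<le> b"
    and L: "0 < L" "L \<le> \<nu>" "L \<le> (coord (u a) 1)\<^sup>2"
  shows "L \<le> (coord (u b) 1)\<^sup>2"
proof -
  have "0 \<le> (coord (u b) 1)\<^sup>2 - L"
  proof (rule barrier[where f = "\<lambda>t. (coord (u t) 1)\<^sup>2 - L", OF ab])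
    fix t assume t: "t \<in> {a..b}"
    show "((\<lambda>t. (coord (u t) 1)\<^sup>2 - L) has_real_derivative
      2 * (lam \<mu> 1 * (coord (u t) 1)\<^sup>2 + coord (u t) 1 * nl 1 (u t))) (at t within {a..b})"
      using DERIV_diff[OF main_square_deriv[OF mu' u(1) t] DERIV_const] by simp
    assume "(coord (u t) 1)\<^sup>2 - L = 0"
    then have f: "(coord (u t) 1)\<^sup>2 = L" by simp
    have "L * L \<le> \<nu> * L" "0 < \<nu> * L" using L nu by (auto intro: mult_right_mono)
    then show "0 < 2 * (lam \<mu> 1 * (coord (u t) 1)\<^sup>2 + coord (u t) 1 * nl 1 (u t))"
      using main_square_bounds(2)[OF mu' u(2)[OF t]] unfolding f \<nu>_def[symmetric] by linarith
  qed (use L in auto)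
  then show ?thesis by simp
qed

lemma square_growth_below_level:
  assumes u: "ks_curve \<mu> {a..b} u" "\<And>t. t \<in> {a..b} \<Longrightarrow> u t \<in> trap" and ab: "a \<le> b"
    and le: "\<And>t. t \<in> {a..b} \<Longrightarrow> (coord (u t) 1)\<^sup>2 \<le> level\<^sup>2"
  shows "exp (\<nu> * (b - a)) * (coord (u a) 1)\<^sup>2 \<le> (coord (u b) 1)\<^sup>2"
proof -
  have "- (coord (u b) 1)\<^sup>2 \<le> exp (\<nu> * (b - a)) * - (coord (u a) 1)\<^sup>2"
  proof (rule differential_inequality[where f = "\<lambda>t. - (coord (u t) 1)\<^sup>2", OF ab DERIV_minus[OF main_square_deriv[OF mu' u(1)]]])
    fix t assume t: "t \<in> {a..b}"
    let ?f = "(coord (u t) 1)\<^sup>2"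
    have "?f * ?f \<le> (\<nu> / 2) * ?f" using le[OF t] unfolding level by (intro mult_right_mono) auto
    moreover have "0 \<le> \<nu> * ?f" using nu by simp
    ultimately show "- (2 * (lam \<mu> 1 * ?f + coord (u t) 1 * nl 1 (u t))) \<le> \<nu> * - ?f"
      using main_square_bounds(2)[OF mu' u(2)[OF t]] unfolding \<nu>_def[symmetric] by simp
  qed
  then show ?thesis by simp
qed

text \<open>An earlier value above the level would persist. Hence the orbit was below the level on
  the whole interval, where a_1^2 grows at rate at least \<nu>.\<close>

lemma square_le_level_backward:
  assumes u: "ks_curve \<mu> {a..b} u" "\<And>t. t \<in> {a..b} \<Longrightarrow> u t \<in> trap" and ab: "a \<le> b"
    and b: "(coord (u b) 1)\<^sup>2 \<le> level\<^sup>2"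
  shows "exp (\<nu> * (b - a)) * (coord (u a) 1)\<^sup>2 \<le> level\<^sup>2"
proof -
  have "(coord (u t) 1)\<^sup>2 \<le> level\<^sup>2" if t: "t \<in> {a..b}" for t
  proof (rule ccontr)
    assume n: "\<not> (coord (u t) 1)\<^sup>2 \<le> level\<^sup>2"
    \<comment> \<open>The minimum respects the restriction L \<le> \<nu> of
      \<open>square_ge_forward\<close> and is still strictly above the squared level.\<close>
    define L where "L = min \<nu> ((coord (u t) 1)\<^sup>2)"
    have L: "level\<^sup>2 < L" "L \<le> \<nu>" "L \<le> (coord (u t) 1)\<^sup>2" using n nu unfolding L_def level by auto
    then have "0 < L" using zero_le_power2[of level] by linarith
    have "L \<le> (coord (u b) 1)\<^sup>2"
      by (rule square_ge_forward[OF solves_subset[OF u(1)] _ _ \<open>0 < L\<close> L(2,3)]) (use t u(2) in auto)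
    with b L show False by simp
  qed
  from square_growth_below_level[OF u ab this] b show ?thesis by auto
qed

lemma reaches_level:
  assumes u: "ks_curve \<mu> {a..} u" "\<And>t. a \<le> t \<Longrightarrow> u t \<in> trap" and a: "0 < coord (u a) 1" "coord (u a) 1 \<le> level"
  obtains t where "a \<le> t" "coord (u t) 1 = level"
proof -
  have uab: "ks_curve \<mu> {a..b} u" for b by (rule solves_subset[OF u(1)]) auto
  have pos: "0 < coord (u t) 1" if "a \<le> t" for t
    using main_mode_sgn[OF mu' uab[of t] _ that] u(2) a(1) by (auto simp: sgn_if split: if_splits)
  have "\<exists>b\<ge>a. level\<^sup>2 \<le> (coord (u b) 1)\<^sup>2"
  proof (rule ccontr)
    assume n: "\<not> (\<exists>b\<ge>a. level\<^sup>2 \<le> (coord (u b) 1)\<^sup>2)"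
    define c where "c = (coord (u a) 1)\<^sup>2"
    have c: "0 < c" using a by (simp add: c_def)
    \<comment> \<open>Long enough that already the linear part of the exponential adds the squared
      level to \<open>c\<close>.\<close>
    define s where "s = level\<^sup>2 / (\<nu> * c)"
    have s: "0 < s" using c nu level by (simp add: s_def)
    have "exp (\<nu> * (a + s - a)) * (coord (u a) 1)\<^sup>2 \<le> (coord (u (a + s)) 1)\<^sup>2"
    proof (rule square_growth_below_level[OF uab])
      fix t assume "t \<in> {a..a + s}"
      then have "a \<le> t" by simp
      with n show "(coord (u t) 1)\<^sup>2 \<le> level\<^sup>2" using linear by blast
    qed (use s u(2) in auto)
    moreover have "a \<le> a + s" using s by simp
    with n have "(coord (u (a + s)) 1)\<^sup>2 < level\<^sup>2" using not_le by blast
    ultimately have "exp (\<nu> * s) * c < level\<^sup>2" by (simp add: c_def)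
    moreover have "(1 + \<nu> * s) * c \<le> exp (\<nu> * s) * c"
      using c by (intro mult_right_mono exp_ge_add_one_self) auto
    moreover have "\<nu> * s * c = level\<^sup>2" using c nu by (simp add: s_def)
    ultimately show False using c by (simp add: distrib_right)
  qed
  then obtain b where b: "a \<le> b" "level\<^sup>2 \<le> (coord (u b) 1)\<^sup>2" by blast
  then have "level \<le> coord (u b) 1" using power2_le_imp_le[of level "coord (u b) 1"] pos[of b] by simp
  moreover have "continuous_on {a..b} (\<lambda>t. coord (u t) 1)"
    by (intro continuous_coord solvesD(1)[OF uab])
  ultimately have "\<exists>t\<ge>a. t \<le> b \<and> coord (u t) 1 = level" using IVT'[of "\<lambda>t. coord (u t) 1" a level b] a b by blast
  with that show ?thesis by blast
qed

text \<open>A point on the parabola a_2 = - a_1^2 / 6, between the two faces of the region for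
  a_2.\<close>

definition starter :: "real \<Rightarrow> ell2" where
  "starter e = e *\<^sub>R unit 1 + (- (e\<^sup>2 / 6)) *\<^sub>R unit 2"

lemma starter: "coord (starter e) 1 = e" "0 < e \<Longrightarrow> e \<le> 1/5 \<Longrightarrow> starter e \<in> trap"
  by (auto simp: starter_def coord_unit trap_def slaved_def field_simps)

lemma above_level:
  assumes u: "ks_curve \<mu> {a..b} u" "\<And>t. t \<in> {a..b} \<Longrightarrow> u t \<in> trap" and ab: "a \<le> b" and l: "level \<le> coord (u a) 1"
  shows "level \<le> coord (u b) 1"
proof -
  have "level\<^sup>2 \<le> (coord (u b) 1)\<^sup>2"
  proof (rule square_ge_forward[OF u ab])
    show "level\<^sup>2 \<le> (coord (u a) 1)\<^sup>2" using l level(1) by (intro power_mono) auto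
  qed (use level nu in auto)
  moreover have "sgn (coord (u b) 1) = sgn (coord (u a) 1)" by (rule main_mode_sgn[OF mu' u ab])
  then have "0 < coord (u b) 1" using l level(1) by (auto simp: sgn_if split: if_splits)
  ultimately show ?thesis using power2_le_imp_le[of level "coord (u b) 1"] by simp
qed

definition "decay = level\<^sup>2 / 20"

lemma decay: "0 < decay" using level(1) by (simp add: decay_def)

text \<open>144 = 8 * 9 * 2: the two comparisons of chart distance and norm, and 2 as a bound for
  the initial distance of points in the unit ball.\<close>

lemma contraction_above_level:
  assumes x: "ks_curve \<mu> {a..b} x" "\<And>t. t \<in> {a..b} \<Longrightarrow> x t \<in> trap" "level \<le> coord (x a) 1"
    and y: "ks_curve \<mu> {a..b} y" "\<And>t. t \<in> {a..b} \<Longrightarrow> y t \<in> trap" "level \<le> coord (y a) 1" and ab: "a \<le> b"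
  shows "norm (x b - y b) \<le> 144 / level\<^sup>2 * exp (- decay * (b - a))"
proof -
  have xl: "level \<le> coord (x t) 1" if "t \<in> {a..b}" for t
    by (rule above_level[OF solves_subset[OF x(1)] _ _ x(3)]) (use that x in auto)
  have yl: "level \<le> coord (y t) 1" if "t \<in> {a..b}" for t
    by (rule above_level[OF solves_subset[OF y(1)] _ _ y(3)]) (use that y in auto)
  have pos: "0 < coord (x t) 1" "0 < coord (y t) 1" if "t \<in> {a..b}" for t
    using xl[OF that] yl[OF that] level(1) by linarith+
  have w: "x t \<in> wide" "y t \<in> wide" if "t \<in> {a..b}" for t
    using x(2)[OF that] y(2)[OF that] trap_wide by auto
  let ?d = "\<lambda>t. norm (chart (x t) - chart (y t))"
  have "(?d b)\<^sup>2 \<le> exp (- (level\<^sup>2 / 10) * (b - a)) * (?d a)\<^sup>2"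
    by (rule chart_contraction[OF mu' x(1) y(1) w pos ab level(1) xl yl])
  also have "exp (- (level\<^sup>2 / 10) * (b - a)) = (exp (- decay * (b - a)))\<^sup>2"
    by (simp add: exp_double[symmetric] decay_def)
  finally have "(?d b)\<^sup>2 \<le> (exp (- decay * (b - a)) * ?d a)\<^sup>2" by (simp add: power_mult_distrib)
  then have 1: "?d b \<le> exp (- decay * (b - a)) * ?d a" by (rule power2_le_imp_le) simp
  have A: "a \<in> {a..b}" "b \<in> {a..b}" using ab by auto
  have "?d a \<le> 9 / level\<^sup>2 * norm (x a - y a)"
    using A by (intro chart_le_norm_diff[OF mu'] w level(1) xl yl)
  also have "\<dots> \<le> 9 / level\<^sup>2 * 2"
  proof (rule mult_left_mono)
    show "norm (x a - y a) \<le> 2"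
      using norm_triangle_ineq4[of "x a" "y a"] norm_wide[OF w(1)[OF A(1)]] norm_wide[OF w(2)[OF A(1)]] by linarith
  qed (use level in simp)
  finally have 2: "exp (- decay * (b - a)) * ?d a \<le> exp (- decay * (b - a)) * (9 / level\<^sup>2 * 2)"
    by (intro mult_left_mono) auto
  have "norm (x b - y b) \<le> 8 * ?d b" using A by (intro norm_diff_le_chart[OF mu'] w pos)
  also have "\<dots> \<le> 8 * (exp (- decay * (b - a)) * (9 / level\<^sup>2 * 2))" using 1 2 by simp
  finally show ?thesis by simp
qed

text \<open>An orbit that starts at the level and its own time shifts stay above the level, so they
  approach each other exponentially. The orbit, sampled at integer times, is Cauchy, and continuity
  of the flow makes its limit stationary.\<close>

lemma ex_fixed_point: "\<exists>p\<in>trap. level \<le> coord p 1 \<and> (\<forall>t\<ge>0. ks_flow \<mu> t p = p)"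
proof -
  define z where "z = starter level"
  have z: "z \<in> trap" "coord z 1 = level" using starter level by (auto simp: z_def)
  define u where "u t = ks_flow \<mu> t z" for t
  have ut: "u t \<in> trap" if "0 \<le> t" for t using ks_flow_trap[OF mu' z(1) that] by (simp add: u_def)
  have u: "ks_curve \<mu> {0..} u" using ks_curve_trap[OF mu' z(1)] by (simp add: u_def[abs_def])
  have u0: "u 0 = z" by (simp add: u_def ks_flow_0[OF mu'(1)])
  have lev: "level \<le> coord (u t) 1" if "0 \<le> t" for t
    by (rule above_level[OF solves_subset[OF u], of 0 t]) (use that ut u0 z in auto)
  have close: "norm (u (s + t) - u t) \<le> 144 / level\<^sup>2 * exp (- decay * t)" if "0 \<le> s" "0 \<le> t" for s t
  proof -
    have "norm (u (s + t) - u t) \<le> 144 / level\<^sup>2 * exp (- decay * (t - 0))"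
    proof (rule contraction_above_level[where x = "\<lambda>t. u (s + t)" and y = u])
      show "ks_curve \<mu> {0..t} (\<lambda>t. u (s + t))" by (rule solves_shift[OF solves_subset[OF u]]) (use that in auto)
      show "ks_curve \<mu> {0..t} u" by (rule solves_subset[OF u]) auto
    qed (use that ut lev in auto)
    then show ?thesis by simp
  qed
  have e0: "((\<lambda>t. 144 / level\<^sup>2 * exp (- decay * t)) \<longlongrightarrow> 0) at_top"
    by (rule exp_rate_tendsto_0[OF decay])
  have e0n: "(\<lambda>n. 144 / level\<^sup>2 * exp (- decay * real n)) \<longlonglongrightarrow> 0"
    by (rule filterlim_compose[OF e0 filterlim_real_sequentially])
  have "Cauchy (\<lambda>n. u (real n))"
  proof (rule metric_CauchyI)
    fix e :: real assume "0 < e"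
    with e0n obtain M where M: "\<And>n. M \<le> n \<Longrightarrow> 144 / level\<^sup>2 * exp (- decay * real n) < e / 2"
      using order_tendstoD(2)[OF e0n, of "e / 2"] by (auto simp: eventually_sequentially)
    have "dist (u (real m)) (u (real M)) < e / 2" if "M \<le> m" for m
      using close[of "real m - real M" "real M"] M[of M] that by (simp add: dist_norm)
    then show "\<exists>M. \<forall>m\<ge>M. \<forall>n\<ge>M. dist (u (real m)) (u (real n)) < e"
      by (meson dist_triangle_half_l dist_commute_lessI)
  qed
  then obtain p where p: "(\<lambda>n. u (real n)) \<longlonglongrightarrow> p" by (auto simp: Cauchy_convergent_iff convergent_def)
  have "p \<in> trap"
    by (rule closed_sequentially[OF compact_imp_closed[OF compact_trap] _ p]) (simp add: ut)
  moreover have "level \<le> coord p 1"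
    by (rule LIMSEQ_le_const[OF tendsto_coord[OF p]]) (use lev in auto)
  moreover have "ks_flow \<mu> t p = p" if t: "0 \<le> t" for t
  proof (rule LIMSEQ_unique)
    have "isCont (ks_flow \<mu> t) p"
      using continuous_on_ks_flow[OF mu'(1) t, of UNIV] by (simp add: continuous_on_eq_continuous_at)
    from isCont_tendsto_compose[OF this p]
    have "(\<lambda>n. ks_flow \<mu> t (u (real n))) \<longlonglongrightarrow> ks_flow \<mu> t p" .
    moreover have "ks_flow \<mu> t (u (real n)) = u (t + real n)" for n
      using ks_flow_add[OF mu'(1), of "real n" t] t by (simp add: u_def add.commute)
    ultimately show "(\<lambda>n. u (t + real n)) \<longlonglongrightarrow> ks_flow \<mu> t p" by simp
    have "(\<lambda>n. u (t + real n) - u (real n)) \<longlonglongrightarrow> 0"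
      by (rule tendsto_0_le[OF e0n, where K = 1]) (use close[OF t] in \<open>auto intro!: always_eventually\<close>)
    from tendsto_add[OF this p] show "(\<lambda>n. u (t + real n)) \<longlonglongrightarrow> p" by simp
  qed
  ultimately show ?thesis by blast
qed

definition eq_pt :: ell2 where
  "eq_pt = (SOME p. p \<in> trap \<and> level \<le> coord p 1 \<and> (\<forall>t\<ge>0. ks_flow \<mu> t p = p))"

lemma eq_pt: "eq_pt \<in> trap" "level \<le> coord eq_pt 1" "0 \<le> t \<Longrightarrow> ks_flow \<mu> t eq_pt = eq_pt"
  using someI_ex[of "\<lambda>p. p \<in> trap \<and> level \<le> coord p 1 \<and> (\<forall>t\<ge>0. ks_flow \<mu> t p = p)"] ex_fixed_point
  unfolding eq_pt_def[symmetric] by blast+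

lemma eq_pt_orbit: "trap_orbit \<mu> (\<lambda>_. eq_pt)"
  using eq_pt by (intro trap_orbit_const[OF mu']) auto

lemma eq_pt_curve: "ks_curve \<mu> {a..b} (\<lambda>_. eq_pt)"
  by (rule solves_subset[OF trap_orbit_curve[OF mu' eq_pt_orbit, of a]]) auto

subsection \<open>The unstable manifold of the origin\<close>

text \<open>a_1^2 grows at rate at most 2 \<nu>, so starting at exp (- \<nu> n) times the level
  delays the arrival to time n or later.\<close>

lemma ex_late_arrival:
  "\<exists>z\<in>trap. \<exists>T\<ge>real n. coord (ks_flow \<mu> T z) 1 = level"
proof -
  define e where "e = level * exp (- \<nu> * real n)"
  have "exp (- \<nu> * real n) \<le> 1" using nu by simp
  then have e: "0 < e" "e \<le> level" using level(1) by (auto simp: e_def mult_left_le)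
  define z where "z = starter e"
  have "z \<in> trap" unfolding z_def by (rule starter(2)) (use e level in auto)
  moreover have "coord z 1 = e" unfolding z_def by (rule starter(1))
  ultimately have z: "z \<in> trap" "coord z 1 = e" .
  define u where "u t = ks_flow \<mu> t z" for t
  have ut: "u t \<in> trap" if "0 \<le> t" for t using ks_flow_trap[OF mu' z(1) that] by (simp add: u_def)
  have u: "ks_curve \<mu> {0..} u" using ks_curve_trap[OF mu' z(1)] by (simp add: u_def[abs_def])
  have u0: "coord (u 0) 1 = e" using z(2) by (simp add: u_def ks_flow_0[OF mu'(1)])
  obtain T where T: "0 \<le> T" "coord (u T) 1 = level"
    by (rule reaches_level[OF u]) (use ut u0 e in auto)
  have "(coord (u T) 1)\<^sup>2 \<le> exp (2 * (1 - \<mu>) * (T - 0)) * (coord (u 0) 1)\<^sup>2"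
    by (rule main_square_growth(1)[OF mu' solves_subset[OF u]]) (use ut T in auto)
  then have "level\<^sup>2 \<le> exp (2 * \<nu> * T) * (level * exp (- \<nu> * real n))\<^sup>2"
    using T u0 by (simp add: \<nu>_def[symmetric] e_def)
  also have "\<dots> = level\<^sup>2 * exp (2 * \<nu> * T - 2 * \<nu> * real n)"
    by (simp add: power_mult_distrib exp_double[symmetric] mult_exp_exp)
  finally have "1 \<le> exp (2 * \<nu> * T - 2 * \<nu> * real n)" using level(1) by simp
  then have "real n \<le> T" using nu by simp
  with z(1) T(2) show ?thesis by (auto simp: u_def)
qed

text \<open>Orbits that arrive later and later, sampled at integer times before their arrival, have
  a convergent subsequence in the countable power of the compact region; the limit is a backward
  orbit that still ends at the level.\<close>

lemma ex_backward_sequence: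
  "\<exists>P :: nat \<Rightarrow> ell2. coord (P 0) 1 = level \<and> (\<forall>j. P j \<in> trap \<and> ks_flow \<mu> 1 (P (Suc j)) = P j)"
proof -
  obtain Z T where Z: "\<And>n. Z n \<in> trap" "\<And>n. real n \<le> T n" "\<And>n. coord (ks_flow \<mu> (T n) (Z n)) 1 = level"
    using ex_late_arrival by metis
  \<comment> \<open>\<open>Q n j\<close> is the state j time units before arrival. The default 0
    keeps the sequence in the compact product; each fixed j leaves the default range once n is
    large.\<close>
  define Q where "Q n j = (if j \<le> n then ks_flow \<mu> (T n - real j) (Z n) else 0)" for n j :: nat
  have Tj: "0 \<le> T n - real j" if "j \<le> n" for n j
    using Z(2)[of n] that by (meson diff_ge_0_iff_ge of_nat_mono order_trans)
  have Qt: "Q n j \<in> trap" for n j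
    using Tj[of j n] Z(1)[of n] by (auto simp: Q_def zero_in_trap intro: ks_flow_trap[OF mu'])
  have Qs: "ks_flow \<mu> 1 (Q n (Suc j)) = Q n j" if "Suc j \<le> n" for n j
  proof -
    have "ks_flow \<mu> ((T n - real (Suc j)) + 1) (Z n) = ks_flow \<mu> 1 (ks_flow \<mu> (T n - real (Suc j)) (Z n))"
      by (rule ks_flow_add[OF mu'(1) Tj[OF that]]) simp
    then show ?thesis using that by (simp add: Q_def)
  qed
  have "compactin (product_topology (\<lambda>_. euclidean) UNIV) (\<Pi>\<^sub>E j\<in>(UNIV :: nat set). trap)"
    unfolding compactin_PiE using compact_trap by simp
  then have "compact (\<Pi>\<^sub>E j\<in>(UNIV :: nat set). trap)" by (simp add: euclidean_product_topology)
  then have "seq_compact (\<Pi>\<^sub>E j\<in>(UNIV :: nat set). trap)" by (rule compact_imp_seq_compact)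
  moreover have "\<forall>n. Q n \<in> (\<Pi>\<^sub>E j\<in>(UNIV :: nat set). trap)" using Qt by auto
  ultimately obtain P r where P: "P \<in> (\<Pi>\<^sub>E j\<in>(UNIV :: nat set). trap)" "strict_mono r" "(Q \<circ> r) \<longlonglongrightarrow> P"
    unfolding seq_compact_def by metis
  have lim: "(\<lambda>i. Q (r i) j) \<longlonglongrightarrow> P j" for j
  proof -
    from continuous_on_tendsto_compose[OF continuous_on_product_coordinates[of j] P(3)]
    show ?thesis by (simp add: o_def)
  qed
  have "ks_flow \<mu> 1 (P (Suc j)) = P j" for j
  proof (rule LIMSEQ_unique[OF _ lim])
    have "isCont (ks_flow \<mu> 1) (P (Suc j))"
      using continuous_on_ks_flow[OF mu'(1), of 1 UNIV] by (simp add: continuous_on_eq_continuous_at)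
    from isCont_tendsto_compose[OF this lim]
    have 1: "(\<lambda>i. ks_flow \<mu> 1 (Q (r i) (Suc j))) \<longlonglongrightarrow> ks_flow \<mu> 1 (P (Suc j))" .
    have "\<forall>\<^sub>F i in sequentially. ks_flow \<mu> 1 (Q (r i) (Suc j)) = Q (r i) j"
      unfolding eventually_sequentially
    proof (intro exI allI impI Qs)
      fix i assume "Suc j \<le> i"
      then show "Suc j \<le> r i" using seq_suble[OF P(2), of i] by simp
    qed
    with 1 show "(\<lambda>i. Q (r i) j) \<longlonglongrightarrow> ks_flow \<mu> 1 (P (Suc j))" by (simp cong: tendsto_cong)
  qed
  moreover have "coord (P 0) 1 = level"
    using LIMSEQ_unique[OF tendsto_coord[OF lim[of 0], of 1]] Z(3) by (simp add: Q_def)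
  ultimately show ?thesis using P(1) by blast
qed

lemma ex_orbit_at_level: "\<exists>w. trap_orbit \<mu> w \<and> coord (w 0) 1 = level"
proof -
  obtain P :: "nat \<Rightarrow> ell2" where P: "coord (P 0) 1 = level" "\<And>j. P j \<in> trap" "\<And>j. ks_flow \<mu> 1 (P (Suc j)) = P j"
    using ex_backward_sequence by blast
  \<comment> \<open>The flow is started from the nearest sample not later than \<open>t\<close>; any
    earlier sample leads to the same value.\<close>
  define w where "w t = ks_flow \<mu> (t + real (nat \<lceil>- t\<rceil>)) (P (nat \<lceil>- t\<rceil>))" for t
  have step: "ks_flow \<mu> (t + real (n + i)) (P (n + i)) = ks_flow \<mu> (t + real n) (P n)" if "0 \<le> t + real n" for t n i
  proof (induction i)
    case (Suc i)
    have "ks_flow \<mu> (1 + (t + real (n + i))) (P (Suc (n + i))) = ks_flow \<mu> (t + real (n + i)) (ks_flow \<mu> 1 (P (Suc (n + i))))"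
      using that by (intro ks_flow_add[OF mu'(1)]) auto
    then show ?case using Suc P(3) by (simp add: algebra_simps)
  qed simp
  have w: "w t = ks_flow \<mu> (t + real n) (P n)" if "0 \<le> t + real n" for t n
  proof -
    have "- t \<le> real n" using that by linarith
    then have le: "nat \<lceil>- t\<rceil> \<le> n" by simp
    have "0 \<le> t + real (nat \<lceil>- t\<rceil>)" by linarith
    from step[OF this, of "n - nat \<lceil>- t\<rceil>"] le show ?thesis by (simp add: w_def)
  qed
  have "trap_orbit \<mu> w"
    unfolding trap_orbit_iff[OF mu']
  proof (intro conjI allI impI)
    fix s t :: real
    obtain n :: nat where n: "- t \<le> real n" using real_arch_simple by blast
    then have n0: "0 \<le> t + real n" by simp
    show "w t \<in> trap" using w[OF n0] ks_flow_trap[OF mu' P(2) n0] by simp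
    assume s: "0 \<le> s"
    have "ks_flow \<mu> s (w t) = ks_flow \<mu> ((t + real n) + s) (P n)"
      using ks_flow_add[OF mu'(1) n0 s] w[OF n0] by simp
    also have "\<dots> = w (t + s)" using w[of "t + s" n] n0 s by (simp add: algebra_simps)
    finally show "ks_flow \<mu> s (w t) = w (t + s)" .
  qed
  moreover have "w 0 = P 0" using w[of 0 0] by (simp add: ks_flow_0[OF mu'(1)])
  ultimately show ?thesis using P(1) by auto
qed

definition connection :: "real \<Rightarrow> ell2" where
  "connection = (SOME w. trap_orbit \<mu> w \<and> coord (w 0) 1 = level)"

lemma connection: "trap_orbit \<mu> connection" "coord (connection 0) 1 = level"
  using someI_ex[OF ex_orbit_at_level] unfolding connection_def[symmetric] by blast+

lemma orbit_curve: "trap_orbit \<mu> z \<Longrightarrow> ks_curve \<mu> {a..b} z"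
  by (rule solves_subset[OF trap_orbit_curve[OF mu', of z a]]) auto

lemma orbit_trap: "trap_orbit \<mu> z \<Longrightarrow> z t \<in> trap"
  by (simp add: trap_orbit_iff[OF mu'])

lemma orbit_pos:
  assumes "trap_orbit \<mu> z" "0 < coord (z s) 1" shows "0 < coord (z t) 1"
  using trap_orbit_sgn[OF mu' assms(1), of t s] assms(2) by (auto simp: sgn_if split: if_splits)

text \<open>Backward from the level a_1^2 decays like exp (\<nu> t), and the norm is at most twice
  |a_1|.\<close>

lemma connection_tendsto_zero: "(connection \<longlongrightarrow> 0) at_bot"
proof -
  have lim: "((\<lambda>t. 2 * level * exp (- (\<nu> / 2) * (- t))) \<longlongrightarrow> 0) at_bot"
    by (rule filterlim_compose[OF exp_rate_tendsto_0 filterlim_uminus_at_top_at_bot]) (use nu in simp)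
  show ?thesis
  proof (rule tendsto_0_le[OF lim, where K = 1])
    show "\<forall>\<^sub>F t in at_bot. norm (connection t) \<le> norm (2 * level * exp (- (\<nu> / 2) * (- t))) * 1"
      unfolding eventually_at_bot_linorder
    proof (intro exI allI impI)
      fix t :: real assume t: "t \<le> 0"
      have "exp (\<nu> * (0 - t)) * (coord (connection t) 1)\<^sup>2 \<le> level\<^sup>2"
        by (rule square_le_level_backward[OF orbit_curve[OF connection(1)]])
          (use t connection orbit_trap[OF connection(1)] in auto)
      then have "exp (\<nu> * t) * (exp (- \<nu> * t) * (coord (connection t) 1)\<^sup>2) \<le> exp (\<nu> * t) * level\<^sup>2"
        by (intro mult_left_mono) auto
      then have "(coord (connection t) 1)\<^sup>2 \<le> exp (\<nu> * t) * level\<^sup>2"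
        by (simp add: mult.assoc[symmetric] mult_exp_exp)
      also have "\<dots> = (level * exp (\<nu> / 2 * t))\<^sup>2"
        by (simp add: power_mult_distrib exp_double[symmetric] mult.commute)
      finally have "\<bar>coord (connection t) 1\<bar>\<^sup>2 \<le> (level * exp (\<nu> / 2 * t))\<^sup>2" by simp
      then have "\<bar>coord (connection t) 1\<bar> \<le> level * exp (\<nu> / 2 * t)"
        by (rule power2_le_imp_le) (use level in simp)
      moreover have "norm (connection t) \<le> 2 * \<bar>coord (connection t) 1\<bar>"
        by (rule norm_wide_le[OF trap_wide[OF orbit_trap[OF connection(1)]]])
      ultimately show "norm (connection t) \<le> norm (2 * level * exp (- (\<nu> / 2) * (- t))) * 1"
        using level(1) by (simp add: abs_mult)
    qed
  qed
qed

lemma connection_tendsto_eq_pt: "(connection \<longlongrightarrow> eq_pt) at_top"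
proof -
  have "((\<lambda>t. connection t - eq_pt) \<longlongrightarrow> 0) at_top"
  proof (rule tendsto_0_le[OF exp_rate_tendsto_0[OF decay, of "144 / level\<^sup>2"], where K = 1])
    show "\<forall>\<^sub>F t in at_top. norm (connection t - eq_pt) \<le> norm (144 / level\<^sup>2 * exp (- decay * t)) * 1"
      unfolding eventually_at_top_linorder
    proof (intro exI allI impI)
      fix t :: real assume t: "0 \<le> t"
      have "norm (connection t - eq_pt) \<le> 144 / level\<^sup>2 * exp (- decay * (t - 0))"
        by (rule contraction_above_level[OF orbit_curve[OF connection(1)] orbit_trap[OF connection(1)] _ eq_pt_curve])
          (use t connection eq_pt in auto)
      then show "norm (connection t - eq_pt) \<le> norm (144 / level\<^sup>2 * exp (- decay * t)) * 1" by simp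
    qed
  qed
  from tendsto_add[OF this tendsto_const[of eq_pt]] show ?thesis by simp
qed

subsection \<open>Classification of the bounded orbits\<close>

text \<open>The cone form of the pair is never positive, since it would grow backward beyond its
  bound 1. Therefore the squared difference f of the first chart coordinates satisfies |f'| \<le> 2
  f; it vanishes at time 0, hence always, and a nonpositive cone form leaves no other
  difference.\<close>

lemma orbits_eq_if_same_main_mode:
  assumes x: "trap_orbit \<mu> x" and y: "trap_orbit \<mu> y" and eq: "coord (x 0) 1 = coord (y 0) 1" and pos: "0 < coord (x 0) 1"
  shows "x t = y t"
proof -
  have xp: "0 < coord (x t) 1" and yp: "0 < coord (y t) 1" for t
    using orbit_pos[OF x pos] orbit_pos[OF y pos[unfolded eq]] .
  have xw: "x t \<in> wide" and yw: "y t \<in> wide" for t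
    using orbit_trap x y trap_wide by blast+
  have cone: "cone_form (x t) (y t) \<le> 0" for t
  proof (rule ccontr)
    assume "\<not> cone_form (x t) (y t) \<le> 0"
    then have c: "0 < cone_form (x t) (y t)" by simp
    \<comment> \<open>With this T, (1 + 2 T) times the cone form is 2 plus the form itself, which
      contradicts the bound 2.\<close>
    define T where "T = 1 / cone_form (x t) (y t)"
    have T: "0 < T" using c by (simp add: T_def)
    have "exp (2 * (t - (t - T))) * cone_form (x t) (y t) \<le> 2 * cone_form (x (t - T)) (y (t - T))"
      by (rule cone_form_backward[OF mu' orbit_curve[OF x] orbit_curve[OF y] xw yw xp yp]) (use T c in auto)
    also have "\<dots> \<le> 2 * 1" by (intro mult_left_mono cone_form_le_1 xw yw xp yp) simp
    finally have "exp (2 * T) * cone_form (x t) (y t) \<le> 2" by simp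
    moreover have "(1 + 2 * T) * cone_form (x t) (y t) \<le> exp (2 * T) * cone_form (x t) (y t)"
      using c by (intro mult_right_mono exp_ge_add_one_self) auto
    moreover have "T * cone_form (x t) (y t) = 1" using c by (simp add: T_def)
    ultimately show False using c by (simp add: distrib_right mult.assoc)
  qed
  define f where "f t = (coord (chart (x t) - chart (y t)) 1)\<^sup>2" for t
  have f': "(f has_real_derivative 2 * dE \<mu> (x t) (y t) 1) (at t within {a..b})" if "t \<in> {a..b}" for a b t
    unfolding f_def by (rule chart_diff_square_deriv[OF mu' orbit_curve[OF x] orbit_curve[OF y] xw yw xp yp that]) simp
  have dE: "\<bar>2 * dE \<mu> (x t) (y t) 1\<bar> \<le> 2 * f t" for t
  proof -
    have "\<bar>coord (chart (x t) - chart (y t)) 1\<bar> * \<bar>chart_rate \<mu> (x t) 1 - chart_rate \<mu> (y t) 1\<bar>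
        \<le> \<bar>coord (chart (x t) - chart (y t)) 1\<bar> * \<bar>coord (chart (x t) - chart (y t)) 1\<bar>"
      by (intro mult_left_mono pair_slow_rate[OF mu'] xw yw xp yp cone) simp
    then show ?thesis by (simp add: f_def dE_def abs_mult power2_eq_square)
  qed
  have f0: "f 0 = 0" using eq coord_chart(1)[of "x 0"] coord_chart(1)[of "y 0"] xp[of 0] yp[of 0] by (simp add: f_def)
  have "f t \<le> 0"
  proof (cases "0 \<le> t")
    case True
    have "f t \<le> exp (2 * (t - 0)) * f 0"
      by (rule differential_inequality[OF True f']) (use dE in \<open>auto simp: abs_le_iff\<close>)
    then show ?thesis by (simp add: f0)
  next
    case False
    then have "t \<le> 0" by simp
    have "- f 0 \<le> exp (- 2 * (0 - t)) * - f t"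
    proof (rule differential_inequality[OF \<open>t \<le> 0\<close> DERIV_minus[OF f']])
      show "- (2 * dE \<mu> (x s) (y s) 1) \<le> - 2 * - f s" for s using dE[of s] by (simp add: abs_le_iff)
    qed
    then show ?thesis by (simp add: f0 mult_le_0_iff)
  qed
  then have "coord (chart (x t) - chart (y t)) 1 = 0" by (simp add: f_def)
  then have "norm (chart (x t) - chart (y t)) = 0" using cone[of t] by (simp add: cone_form_def)
  then have "norm (x t - y t) \<le> 0" using norm_diff_le_chart[OF mu' xw yw xp yp, of t t] by simp
  then show ?thesis by simp
qed

text \<open>An orbit above the level at all times is compared with the equilibrium from time - n on,
  for n tending to infinity. Any other orbit passes the level, and a time shift gives it the first
  mode of \<open>connection 0\<close>.\<close>

lemma positive_orbit_cases:
  assumes z: "trap_orbit \<mu> z" and pos: "0 < coord (z 0) 1"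
  shows "z 0 = eq_pt \<or> z 0 \<in> range connection"
proof (cases "\<forall>t. level \<le> coord (z t) 1")
  case True
  have "norm (z 0 - eq_pt) \<le> 0"
  proof (rule LIMSEQ_le_const[OF filterlim_compose[OF exp_rate_tendsto_0[OF decay, of "144 / level\<^sup>2"] filterlim_real_sequentially]])
    have "norm (z 0 - eq_pt) \<le> 144 / level\<^sup>2 * exp (- decay * (0 - (- real n)))" for n
      by (rule contraction_above_level[OF orbit_curve[OF z] orbit_trap[OF z] _ eq_pt_curve])
        (use True eq_pt in auto)
    then show "\<exists>N. \<forall>n\<ge>N. norm (z 0 - eq_pt) \<le> 144 / level\<^sup>2 * exp (- decay * real n)" by simp
  qed
  then show ?thesis by simp
next
  case False
  then obtain s where s: "coord (z s) 1 \<le> level" by (auto simp: not_le intro: less_imp_le)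
  obtain t where t: "coord (z t) 1 = level"
    by (rule reaches_level[OF trap_orbit_curve[OF mu' z, of s]])
      (use orbit_trap[OF z] orbit_pos[OF z pos] s in auto)
  have "trap_orbit \<mu> (\<lambda>r. z (r + t))" by (rule full_trajectory_in_shift[OF z])
  from orbits_eq_if_same_main_mode[OF this connection(1), of "- t"] t connection(2) level(1)
  have "z 0 = connection (- t)" by simp
  then show ?thesis by blast
qed

end

section \<open>Translation by half a period\<close>

definition flip :: "ell2 \<Rightarrow> ell2" where
  "flip a = Abs_ell2 (\<lambda>k. (- 1) ^ k * coord a k)"

lemma coord_flip [simp]: "coord (flip a) k = (- 1) ^ k * coord a k"
proof -
  have "((- 1) ^ k * coord a k)\<^sup>2 = (coord a k)\<^sup>2" for k
    by (simp add: power_mult_distrib power_mult[symmetric] mult.commute[of k])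
  then have "summable (\<lambda>k. ((- 1) ^ k * coord a k)\<^sup>2)" by (simp add: summable_coord_square)
  then show ?thesis unfolding flip_def by (subst coord_Abs) auto
qed

lemma minus_one_power_mult_self: "(- 1) ^ k * ((- 1) ^ k * x) = (x :: real)"
  by (simp add: mult.assoc[symmetric] power_mult_distrib[symmetric])

lemma flip_flip [simp]: "flip (flip a) = a"
  by (rule ell2_eqI) (simp add: minus_one_power_mult_self)

lemma flip_zero [simp]: "flip 0 = 0"
  by (rule ell2_eqI) simp

lemma flip_diff: "flip a - flip b = flip (a - b)"
  by (rule ell2_eqI) (simp add: algebra_simps)

lemma norm_flip [simp]: "norm (flip a) = norm a"
  by (intro antisym norm_coord_mono) (simp_all add: abs_mult power_abs)

lemma inner_flip: "inner (flip a) (flip b) = inner a b"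
  unfolding inner_ell2_def
  by (intro arg_cong[where f = suminf] ext) (simp add: mult_ac minus_one_power_mult_self)

text \<open>The signs multiply to (-1)^k in both sums, since i + (k - i) and i + (k + i) are
  congruent to k modulo 2.\<close>

lemma nl_flip: "nl k (flip a) = (- 1) ^ k * nl k a"
proof -
  have s: "shift k (flip a) = (- 1) ^ k *\<^sub>R flip (shift k a)"
    by (rule ell2_eqI) (simp add: coord_shift power_add)
  have "(- 1 :: real) ^ (k - i) = (- 1) ^ k * (- 1) ^ i" if "i < k" for i
    using that by (simp add: power_add[symmetric] uminus_power_if)
  then have r: "reflect k (flip a) = (- 1) ^ k *\<^sub>R flip (reflect k a)"
    by (intro ell2_eqI) (simp add: coord_reflect)
  show ?thesis unfolding nl_def bil_def s r by (simp add: inner_flip algebra_simps)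
qed

lemma continuous_on_flip: "continuous_on S u \<Longrightarrow> continuous_on S (\<lambda>t. flip (u t))"
proof -
  assume u: "continuous_on S u"
  have "1-lipschitz_on UNIV flip" by (rule lipschitz_onI) (simp_all add: dist_norm flip_diff)
  from continuous_on_compose2[OF lipschitz_on_continuous_on[OF this] u] show ?thesis by simp
qed

lemma ks_curve_flip:
  assumes "ks_curve \<mu> S u" shows "ks_curve \<mu> S (\<lambda>t. flip (u t))"
  unfolding solves_def
proof (intro conjI allI impI ballI)
  show "continuous_on S (\<lambda>t. flip (u t))" by (rule continuous_on_flip[OF solvesD(1)[OF assms]])
  fix k :: nat and t assume "1 \<le> k" "t \<in> S"
  from DERIV_cmult[OF solvesD(2)[OF assms this], of "(- 1) ^ k"]
  show "((\<lambda>s. coord (flip (u s)) k) has_real_derivative lam \<mu> k * coord (flip (u t)) k + nl k (flip (u t))) (at t within S)"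
    by (simp add: nl_flip algebra_simps)
qed

lemma flip_trap: "a \<in> trap \<Longrightarrow> flip a \<in> trap"
  by (simp add: trap_def slaved_def abs_mult power_abs)

context supercritical
begin

lemma trap_orbit_flip:
  assumes z: "trap_orbit \<mu> z" shows "trap_orbit \<mu> (\<lambda>t. flip (z t))"
  unfolding trap_orbit_iff[OF mu']
proof (intro conjI allI impI)
  show "flip (z t) \<in> trap" for t by (intro flip_trap orbit_trap z)
  fix s t :: real assume s: "0 \<le> s"
  have "ks_curve \<mu> {0..} (\<lambda>s. flip (z (t + s)))"
    by (rule ks_curve_flip, rule solves_shift, rule solves_subset[OF trap_orbit_curve[OF mu' z, of t]]) auto
  from ks_flow_global(2)[OF mu'(1) this _ s]
  show "ks_flow \<mu> s (flip (z t)) = flip (z (t + s))"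
    using norm_wide[OF trap_wide[OF orbit_trap[OF z]]] by simp
qed

text \<open>The bounds of \<open>wide\<close> scale with a_1^2, and so must the box around the
  equilibrium; the factor 1/100 fits it into the gap between \<open>trap\<close> and
  \<open>wide\<close>.\<close>

definition "radius = (coord eq_pt 1)\<^sup>2 / 100"

lemma box_subset_wide:
  assumes z: "\<And>k. 1 \<le> k \<Longrightarrow> \<bar>coord z k - coord eq_pt k\<bar> \<le> radius * (1/5)^k"
  shows "z \<in> wide" "coord eq_pt 1 / 2 \<le> coord z 1"
proof -
  define e where "e = coord eq_pt 1"
  have e: "0 < e" using eq_pt(2) level(1) by (simp add: e_def)
  have p: "e \<le> 1/5" "- (1/5) * e\<^sup>2 \<le> coord eq_pt 2" "coord eq_pt 2 \<le> - (1/7) * e\<^sup>2"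
    "3 \<le> k \<Longrightarrow> \<bar>coord eq_pt k\<bar> \<le> (1/5)^k * e\<^sup>2" for k
    using eq_pt(1) by (auto simp: trap_def slaved_def e_def)
  have r: "radius = e\<^sup>2 / 100" by (simp add: radius_def e_def)
  have e2: "e\<^sup>2 \<le> e / 5" using e p(1) mult_left_mono[OF p(1), of e] by (simp add: power2_eq_square)
  have d1: "\<bar>coord z 1 - e\<bar> \<le> e / 2500" using z[of 1] e2 unfolding r e_def[symmetric] by simp
  then have z1: "2499/2500 * e \<le> coord z 1" "coord z 1 \<le> 2501/2500 * e" unfolding abs_le_iff by linarith+
  then show "coord eq_pt 1 / 2 \<le> coord z 1" using e unfolding e_def[symmetric] by linarith
  have "(2499/2500 * e)\<^sup>2 \<le> (coord z 1)\<^sup>2" "(coord z 1)\<^sup>2 \<le> (2501/2500 * e)\<^sup>2"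
    using z1 e by (intro power_mono; simp)+
  then have z1s: "99/100 * e\<^sup>2 \<le> (coord z 1)\<^sup>2" "(coord z 1)\<^sup>2 \<le> 101/100 * e\<^sup>2"
    using zero_le_power2[of e] by (simp_all add: power_mult_distrib power_divide)
  have z2: "\<bar>coord z 2 - coord eq_pt 2\<bar> \<le> e\<^sup>2 / 2500" using z[of 2] by (simp add: r power2_eq_square)
  have "\<bar>coord z 1\<bar> \<le> 1/4" using z1 e p(1) by (simp add: abs_le_iff)
  moreover have "- (1/4) * (coord z 1)\<^sup>2 \<le> coord z 2" "coord z 2 \<le> - (1/8) * (coord z 1)\<^sup>2"
    using z2 p(2,3) z1s zero_le_power2[of e] unfolding abs_le_iff by linarith+
  moreover have "\<bar>coord z k\<bar> \<le> 2 * (1/5)^k * (coord z 1)\<^sup>2" if k: "3 \<le> k" for k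
  proof -
    have "\<bar>coord z k\<bar> \<le> \<bar>coord eq_pt k\<bar> + \<bar>coord z k - coord eq_pt k\<bar>" by linarith
    also have "\<dots> \<le> (1/5)^k * e\<^sup>2 + e\<^sup>2 / 100 * (1/5)^k"
      using p(4)[OF k] z[of k] k by (intro add_mono) (auto simp: r)
    also have "\<dots> = (1/5)^k * (101/100 * e\<^sup>2)" by (simp add: algebra_simps)
    also have "\<dots> \<le> (1/5)^k * (2 * (coord z 1)\<^sup>2)"
      using z1s(1) zero_le_power2[of e] by (intro mult_left_mono) (linarith, simp)
    finally show ?thesis by simp
  qed
  ultimately show "z \<in> wide" by (simp add: wide_def slaved_def)
qed

definition "local_rate = (coord eq_pt 1 / 2)\<^sup>2 / 20"

text \<open>The box lies in \<open>wide\<close>, with a_1 at least half its equilibrium value, so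
  the chart contracts at a fixed rate. The constant 72 = 8 * 9 combines the two comparisons of chart
  distance and norm.\<close>

lemma local_stability:
  assumes u: "ks_curve \<mu> {0..t} u" and t: "0 \<le> t"
    and box: "\<And>s k. s \<in> {0..t} \<Longrightarrow> 1 \<le> k \<Longrightarrow> \<bar>coord (u s) k - coord eq_pt k\<bar> \<le> radius * (1/5)^k"
  shows "norm (u t - eq_pt) \<le> 72 / (coord eq_pt 1 / 2)\<^sup>2 * exp (- local_rate * t) * norm (u 0 - eq_pt)"
proof -
  let ?m = "coord eq_pt 1 / 2"
  let ?d = "\<lambda>s. norm (chart (u s) - chart eq_pt)"
  have m: "0 < ?m" using eq_pt(2) level(1) by simp
  have uw: "u s \<in> wide" and um: "?m \<le> coord (u s) 1" if "s \<in> {0..t}" for s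
    using box_subset_wide[OF box[OF that]] by auto
  have pw: "eq_pt \<in> wide" and pm: "?m \<le> coord eq_pt 1" and pp: "0 < coord eq_pt 1"
    using trap_wide[OF eq_pt(1)] m by auto
  have up: "0 < coord (u s) 1" if "s \<in> {0..t}" for s using um[OF that] m by linarith
  have "(?d t)\<^sup>2 \<le> exp (- (?m\<^sup>2 / 10) * (t - 0)) * (?d 0)\<^sup>2"
    by (rule chart_contraction[OF mu' u eq_pt_curve uw pw up pp t m um pm])
  also have "exp (- (?m\<^sup>2 / 10) * (t - 0)) = (exp (- local_rate * t))\<^sup>2"
    by (simp add: exp_double[symmetric] local_rate_def)
  finally have "(?d t)\<^sup>2 \<le> (exp (- local_rate * t) * ?d 0)\<^sup>2" by (simp add: power_mult_distrib)
  then have 1: "?d t \<le> exp (- local_rate * t) * ?d 0" by (rule power2_le_imp_le) simp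
  have "?d 0 \<le> 9 / ?m\<^sup>2 * norm (u 0 - eq_pt)"
    using t by (intro chart_le_norm_diff[OF mu'] uw pw m um pm) auto
  then have 2: "exp (- local_rate * t) * ?d 0 \<le> exp (- local_rate * t) * (9 / ?m\<^sup>2 * norm (u 0 - eq_pt))"
    by (intro mult_left_mono) auto
  have "norm (u t - eq_pt) \<le> 8 * ?d t" using t by (intro norm_diff_le_chart[OF mu'] uw pw up pp) auto
  also have "\<dots> \<le> 8 * (exp (- local_rate * t) * (9 / ?m\<^sup>2 * norm (u 0 - eq_pt)))" using 1 2 by simp
  finally show ?thesis by (simp add: mult_ac)
qed

lemma trap_orbit_fixed_point: "trap_orbit \<mu> (\<lambda>_. p) \<Longrightarrow> fixed_point (ks_flow \<mu>) (ks_time \<mu>) p"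
  by (simp add: trap_orbit_iff[OF mu'] fixed_point_def ks_time_trap[OF mu'])

lemma hyperbolic_eq_pt:
  shows "hyperbolic_fixed_point (ks_flow \<mu>) (ks_time \<mu>) eq_pt"
    and "hyperbolic_fixed_point (ks_flow \<mu>) (ks_time \<mu>) (flip eq_pt)"
proof -
  have p: "0 < coord eq_pt 1" using eq_pt(2) level(1) by simp
  have pos: "0 < 72 / (coord eq_pt 1 / 2)\<^sup>2" "0 < local_rate" "0 < coord (radius *\<^sub>R geom) k" if "1 \<le> k" for k
    using p that by (simp_all add: local_rate_def radius_def coord_geom)
  show "hyperbolic_fixed_point (ks_flow \<mu>) (ks_time \<mu>) eq_pt"
  proof (rule hyperbolic_fixed_pointI_stable[where w = "radius *\<^sub>R geom"])
    show "fixed_point (ks_flow \<mu>) (ks_time \<mu>) eq_pt" by (rule trap_orbit_fixed_point[OF eq_pt_orbit])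
    fix z t assume t: "0 \<le> t" "ereal t < ks_time \<mu> z"
      and N: "\<forall>s\<in>{0..t}. \<forall>k\<ge>1. \<bar>coord (ks_flow \<mu> s z) k - coord eq_pt k\<bar> \<le> coord (radius *\<^sub>R geom) k"
    have "norm (ks_flow \<mu> t z - eq_pt) \<le> 72 / (coord eq_pt 1 / 2)\<^sup>2 * exp (- local_rate * t) * norm (ks_flow \<mu> 0 z - eq_pt)"
      by (rule local_stability[OF ks_curve_flow_lt_time[OF mu'(1) t(2)] t(1)]) (use N in \<open>auto simp: coord_geom\<close>)
    then show "norm (ks_flow \<mu> t z - eq_pt) \<le> 72 / (coord eq_pt 1 / 2)\<^sup>2 * exp (- local_rate * t) * norm (z - eq_pt)"
      by (simp add: ks_flow_0[OF mu'(1)])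
  qed (use pos in auto)
  show "hyperbolic_fixed_point (ks_flow \<mu>) (ks_time \<mu>) (flip eq_pt)"
  proof (rule hyperbolic_fixed_pointI_stable[where w = "radius *\<^sub>R geom"])
    show "fixed_point (ks_flow \<mu>) (ks_time \<mu>) (flip eq_pt)"
      by (rule trap_orbit_fixed_point[OF trap_orbit_flip[OF eq_pt_orbit]])
    fix z t assume t: "0 \<le> t" "ereal t < ks_time \<mu> z"
      and N: "\<forall>s\<in>{0..t}. \<forall>k\<ge>1. \<bar>coord (ks_flow \<mu> s z) k - coord (flip eq_pt) k\<bar> \<le> coord (radius *\<^sub>R geom) k"
    \<comment> \<open>The box is symmetric in each coordinate, so the reflected orbit lies in the
      box around \<open>eq_pt\<close> and the estimate there applies.\<close>
    have "norm (flip (ks_flow \<mu> t z) - eq_pt) \<le> 72 / (coord eq_pt 1 / 2)\<^sup>2 * exp (- local_rate * t) * norm (flip (ks_flow \<mu> 0 z) - eq_pt)"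
    proof (rule local_stability[OF ks_curve_flip[OF ks_curve_flow_lt_time[OF mu'(1) t(2)]] t(1)])
      fix s and k :: nat assume sk: "s \<in> {0..t}" "1 \<le> k"
      have "coord (flip (ks_flow \<mu> s z)) k - coord eq_pt k = (- 1) ^ k * (coord (ks_flow \<mu> s z) k - coord (flip eq_pt) k)"
        by (simp add: right_diff_distrib minus_one_power_mult_self)
      then have "\<bar>coord (flip (ks_flow \<mu> s z)) k - coord eq_pt k\<bar> = \<bar>coord (ks_flow \<mu> s z) k - coord (flip eq_pt) k\<bar>"
        by (simp only: abs_mult power_abs) simp
      then show "\<bar>coord (flip (ks_flow \<mu> s z)) k - coord eq_pt k\<bar> \<le> radius * (1/5)^k"
        using N sk by (simp add: coord_geom)
    qed
    moreover have "norm (flip a - eq_pt) = norm (a - flip eq_pt)" for a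
      using norm_flip[of "a - flip eq_pt"] by (simp only: flip_diff[symmetric] flip_flip)
    ultimately show "norm (ks_flow \<mu> t z - flip eq_pt) \<le> 72 / (coord eq_pt 1 / 2)\<^sup>2 * exp (- local_rate * t) * norm (z - flip eq_pt)"
      by (simp add: ks_flow_0[OF mu'(1)])
  qed (use pos in auto)
qed

section \<open>Connections and the maximal invariant set\<close>

lemma heteroclinic_connection:
  shows "heteroclinic (ks_flow \<mu>) (ks_time \<mu>) 0 eq_pt connection"
    and "heteroclinic (ks_flow \<mu>) (ks_time \<mu>) 0 (flip eq_pt) (\<lambda>t. flip (connection t))"
proof -
  have sub: "full_trajectory_in (ks_flow \<mu>) (ks_time \<mu>) UNIV z" if "trap_orbit \<mu> z" for z
    using that by (simp add: trajectory_in_def)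
  show "heteroclinic (ks_flow \<mu>) (ks_time \<mu>) 0 eq_pt connection"
    unfolding heteroclinic_def
    using sub[OF connection(1)] connection_tendsto_zero connection_tendsto_eq_pt by blast
  have "isCont flip a" for a
    using continuous_on_flip[OF continuous_on_id, of UNIV] by (simp add: continuous_on_eq_continuous_at)
  from isCont_tendsto_compose[OF this connection_tendsto_zero] isCont_tendsto_compose[OF this connection_tendsto_eq_pt]
  show "heteroclinic (ks_flow \<mu>) (ks_time \<mu>) 0 (flip eq_pt) (\<lambda>t. flip (connection t))"
    unfolding heteroclinic_def using sub[OF trap_orbit_flip[OF connection(1)]] by simp
qed

text \<open>The sign of the first mode decides: positive orbits are already classified, negative
  ones are their reflections, and in the region a vanishing first mode means the origin.\<close>

lemma trap_orbit_points:
  "{p. \<exists>z. trap_orbit \<mu> z \<and> z 0 = p}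
    = {0, eq_pt, flip eq_pt} \<union> range connection \<union> range (\<lambda>t. flip (connection t))" (is "?L = ?R")
proof (intro equalityI subsetI)
  fix p assume "p \<in> ?L"
  then obtain z where z: "trap_orbit \<mu> z" "z 0 = p" by blast
  consider "0 < coord p 1" | "coord p 1 = 0" | "coord p 1 < 0" by linarith
  then show "p \<in> ?R"
  proof cases
    case 1 then show ?thesis using positive_orbit_cases[OF z(1)] z(2) by auto
  next
    case 2
    then have "p = 0" using wide_zero_iff[OF trap_wide[OF orbit_trap[OF z(1), of 0]]] z(2) by simp
    then show ?thesis by simp
  next
    case 3
    then have "flip p = eq_pt \<or> flip p \<in> range connection"
      using positive_orbit_cases[OF trap_orbit_flip[OF z(1)]] z(2) by simp
    then show ?thesis
    proof
      assume "flip p = eq_pt"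
      then have "flip (flip p) = flip eq_pt" by (simp only:)
      then show ?thesis by simp
    next
      assume "flip p \<in> range connection"
      then obtain t where "flip p = connection t" by blast
      then have "flip (flip p) = flip (connection t)" by (simp only:)
      then show ?thesis by auto
    qed
  qed
next
  have orbit: "w c \<in> ?L" if "trap_orbit \<mu> w" for w c
    using full_trajectory_in_shift[OF that, of c] by force
  have "trap_orbit \<mu> (\<lambda>_. 0)"
    using fixed_point_zero[OF mu'] by (intro trap_orbit_const[OF mu' zero_in_trap]) (simp add: fixed_point_def)
  note orbits = orbit[OF this] orbit[OF eq_pt_orbit] orbit[OF trap_orbit_flip[OF eq_pt_orbit]]
    orbit[OF connection(1)] orbit[OF trap_orbit_flip[OF connection(1)]]
  fix p assume "p \<in> ?R"
  with orbits show "p \<in> ?L" by blast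
qed

end

section \<open>The pitchfork bifurcation\<close>

text \<open>The power series at x has the constant term x and the linear term h; all higher
  multilinear maps are zero.\<close>

lemma real_analytic_on_local_id:
  assumes "\<And>x. x \<in> S \<Longrightarrow> \<exists>r>0. \<forall>h. norm h < r \<longrightarrow> f (x + h) = x + h"
  shows "real_analytic_on f S"
  unfolding real_analytic_on_def
proof
  fix x assume "x \<in> S"
  then obtain r where r: "r > 0" "\<And>h. norm h < r \<Longrightarrow> f (x + h) = x + h" using assms by blast
  define A :: "nat \<Rightarrow> (nat \<Rightarrow> ell2) \<Rightarrow> ell2" where
    "A n v = (if n = 0 then x else if n = 1 then v 0 else 0)" for n v
  have "bounded_multilinear n (A n)" for n
  proof -
    have "linear (\<lambda>h. A n (v(i := h)))" if "i < n" for i v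
      using that by (auto simp: A_def linear_iff)
    moreover have "norm (A n v) \<le> (norm x + 1) * (\<Prod>i<n. norm (v i))" for v
      by (auto simp: A_def algebra_simps intro!: add_nonneg_nonneg mult_nonneg_nonneg prod_nonneg)
    moreover have "\<forall>v w. (\<forall>i<n. v i = w i) \<longrightarrow> A n v = A n w" by (auto simp: A_def)
    ultimately show ?thesis unfolding bounded_multilinear_def by blast
  qed
  moreover have "(\<lambda>n. A n (\<lambda>_. h)) sums f (x + h)" if "norm h < r" for h
    using sums_finite[of "{0, 1}" "\<lambda>n. A n (\<lambda>_. h)"] r(2)[OF that] by (simp add: A_def)
  ultimately show "\<exists>r>0. \<exists>A. (\<forall>n. bounded_multilinear n (A n)) \<and> (\<forall>h. norm h < r \<longrightarrow> (\<lambda>n. A n (\<lambda>_. h)) sums f (x + h))"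
    using r(1) by blast
qed

lemma analytic_change_on_id:
  assumes "open U" "0 \<in> U" shows "analytic_change_on (\<lambda>b. b) U"
proof -
  \<comment> \<open>The inverse is specified only on \<open>U\<close>, so openness has to provide
    the radius of convergence.\<close>
  have inv: "\<exists>r>0. \<forall>h. norm h < r \<longrightarrow> inv_into U (\<lambda>b. b) (x + h) = x + h" if x: "x \<in> U" for x
  proof -
    obtain r where r: "r > 0" "ball x r \<subseteq> U" by (rule openE[OF assms(1) x])
    have "inv_into U (\<lambda>b. b) (x + h) = x + h" if "norm h < r" for h
    proof (rule inv_into_f_f[of "\<lambda>b. b"])
      have "x + h \<in> ball x r" using that by (simp add: dist_norm)
      with r show "x + h \<in> U" by blast
    qed simp
    with r(1) show ?thesis by blast
  qed
  show ?thesis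
    unfolding analytic_change_on_def image_ident
  proof (intro conjI assms)
    show "real_analytic_on (\<lambda>b. b) U"
      by (rule real_analytic_on_local_id) (rule exI[of _ 1], simp)
    show "real_analytic_on (inv_into U (\<lambda>b. b)) U"
      by (rule real_analytic_on_local_id) (rule inv)
  qed simp
qed

lemma inv_lambda1: "inv lambda1 \<nu> = 1 - \<nu>"
  by (rule inv_f_eq) (auto simp: lambda1_def inj_def)

text \<open>Turns the nested existentials into separate obligations for named witnesses.\<close>

lemma pitchfork_bifurcationI:
  assumes "\<nu>\<^sub>m < 0" "0 < \<nu>\<^sub>p"
    and "\<And>\<nu>. \<nu> \<in> {\<nu>\<^sub>m..\<nu>\<^sub>p} \<Longrightarrow> generates (Sol \<nu>) (\<phi> \<nu>) (\<tau> \<nu>)"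
    and "R = cuboid n X c T 1"
    and "\<And>\<nu>. \<nu> \<in> {\<nu>\<^sub>m..\<nu>\<^sub>p} \<Longrightarrow> isolating_cuboid (\<phi> \<nu>) (\<tau> \<nu>) \<epsilon> n X c T"
    and "u\<^sub>0 \<in> R"
    and "\<And>\<nu>. \<nu> \<in> {\<nu>\<^sub>m..\<nu>\<^sub>p} \<Longrightarrow> fixed_point (\<phi> \<nu>) (\<tau> \<nu>) u\<^sub>0"
    and "\<And>\<nu>. \<nu> \<in> {\<nu>\<^sub>m..\<nu>\<^sub>p} \<Longrightarrow> \<nu> \<noteq> 0 \<Longrightarrow> hyperbolic_fixed_point (\<phi> \<nu>) (\<tau> \<nu>) u\<^sub>0"
    and "\<And>\<nu>. \<nu> \<in> {\<nu>\<^sub>m..0} \<Longrightarrow> maximal_invariant_set (\<phi> \<nu>) (\<tau> \<nu>) R {u\<^sub>0}"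
    and "\<And>\<nu>. \<nu> \<in> {0<..\<nu>\<^sub>p} \<Longrightarrow> \<exists>u\<^sub>1 u\<^sub>2 w\<^sub>1 w\<^sub>2.
      u\<^sub>1 \<in> R \<and> u\<^sub>2 \<in> R \<and> u\<^sub>1 \<noteq> u\<^sub>0 \<and> u\<^sub>2 \<noteq> u\<^sub>0 \<and> u\<^sub>1 \<noteq> u\<^sub>2 \<and>
      hyperbolic_fixed_point (\<phi> \<nu>) (\<tau> \<nu>) u\<^sub>1 \<and>
      hyperbolic_fixed_point (\<phi> \<nu>) (\<tau> \<nu>) u\<^sub>2 \<and>
      heteroclinic (\<phi> \<nu>) (\<tau> \<nu>) u\<^sub>0 u\<^sub>1 w\<^sub>1 \<and>
      heteroclinic (\<phi> \<nu>) (\<tau> \<nu>) u\<^sub>0 u\<^sub>2 w\<^sub>2 \<and>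
      maximal_invariant_set (\<phi> \<nu>) (\<tau> \<nu>) R ({u\<^sub>0, u\<^sub>1, u\<^sub>2} \<union> range w\<^sub>1 \<union> range w\<^sub>2)"
  shows "pitchfork_bifurcation Sol \<nu>\<^sub>m \<nu>\<^sub>p"
  unfolding pitchfork_bifurcation_def
  by (rule conjI[OF assms(1)], rule conjI[OF assms(2)], rule exI[of _ \<phi>], rule exI[of _ \<tau>],
      rule conjI, rule ballI, erule assms(3),
      rule exI[of _ \<epsilon>], rule exI[of _ n], rule exI[of _ X], rule exI[of _ c], rule exI[of _ T], rule exI[of _ R], rule exI[of _ u\<^sub>0])
    (intro conjI ballI impI assms(4-))

theorem theoremD1:
  shows "\<exists>\<Phi> U.
    normal_form_change \<Phi> \<and>
    (\<forall>\<mu>\<in>{0.99..1.01}. analytic_change_on (\<Phi> \<mu>) U) \<and>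
    pitchfork_bifurcation
      (\<lambda>\<nu>. let \<mu> = inv lambda1 \<nu> in ks_solution_in_coords \<mu> (\<Phi> \<mu>) U)
      (lambda1 1.01) (lambda1 0.99)"
proof (intro exI conjI ballI)
  let ?U = "ball 0 1 :: ell2 set"
  let ?I = "{lambda1 1.01..lambda1 0.99}"
  show "normal_form_change (\<lambda>\<mu> b. b)" by (rule normal_form_change.identity)
  show "analytic_change_on (\<lambda>b. b) ?U" by (rule analytic_change_on_id) auto
  have mu: "99/100 \<le> 1 - \<nu>" "1 - \<nu> \<le> 101/100" if "\<nu> \<in> ?I" for \<nu>
    using that by (auto simp: lambda1_def)
  have max: "maximal_invariant_set (ks_flow \<mu>) (ks_time \<mu>) trap J" if "{p. \<exists>z. trap_orbit \<mu> z \<and> z 0 = p} = J" for \<mu> J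
    using maximal_invariant_set_full_trajectories[of "ks_flow \<mu>" "ks_time \<mu>" trap] unfolding that .
  show "pitchfork_bifurcation (\<lambda>\<nu>. let \<mu> = inv lambda1 \<nu> in ks_solution_in_coords \<mu> (\<lambda>b. b) ?U) (lambda1 1.01) (lambda1 0.99)"
    unfolding Let_def inv_lambda1
  \<comment> \<open>One region serves all parameters, since no constant of \<open>trap\<close>
    depends on \<nu>. With n = 0 every positive \<epsilon> gives the same enlargement, and 1 is a
    convenient choice.\<close>
  proof (rule pitchfork_bifurcationI[where \<phi> = "\<lambda>\<nu>. ks_flow (1 - \<nu>)" and \<tau> = "\<lambda>\<nu>. ks_time (1 - \<nu>)"
        and \<epsilon> = 1 and n = 0 and X = "{0}" and c = "\<lambda>_ _. 0" and T = trap and R = trap and u\<^sub>0 = 0])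
    show "lambda1 1.01 < 0" "0 < lambda1 0.99" by (simp_all add: lambda1_def)
    show "trap = cuboid 0 {0} (\<lambda>_ _. 0) trap 1" by (simp add: cuboid_zero)
    show "0 \<in> trap" by (rule zero_in_trap)
  next
    fix \<nu> assume nu: "\<nu> \<in> ?I"
    show "generates (ks_solution_in_coords (1 - \<nu>) (\<lambda>b. b) ?U) (ks_flow (1 - \<nu>)) (ks_time (1 - \<nu>))"
      by (rule generates_ks[OF mu(1)[OF nu]])
    show "isolating_cuboid (ks_flow (1 - \<nu>)) (ks_time (1 - \<nu>)) 1 0 {0} (\<lambda>_ _. 0) trap"
      by (rule isolating_cuboid_forward_invariant[OF compact_trap])
        (use zero_in_trap ks_flow_trap[OF mu[OF nu]] ks_time_trap[OF mu[OF nu]] in auto)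
    show "fixed_point (ks_flow (1 - \<nu>)) (ks_time (1 - \<nu>)) 0" by (rule fixed_point_zero[OF mu[OF nu]])
    assume "\<nu> \<noteq> 0"
    \<comment> \<open>\<nu> < 0 means \<mu> > 1, where the origin is attracting; for \<nu> > 0 it is
      a saddle with one unstable direction.\<close>
    then show "hyperbolic_fixed_point (ks_flow (1 - \<nu>)) (ks_time (1 - \<nu>)) 0"
      using hyperbolic_zero_stable[OF mu[OF nu]] hyperbolic_zero_saddle[OF mu[OF nu]] by (cases "\<nu> < 0") auto
  next
    fix \<nu> assume nu: "\<nu> \<in> {lambda1 1.01..0}"
    then have nuI: "\<nu> \<in> ?I" by (auto simp: lambda1_def)
    have "trap_orbit (1 - \<nu>) (\<lambda>_. 0)"
      using fixed_point_zero[OF mu[OF nuI]]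
      by (intro trap_orbit_const[OF mu[OF nuI] zero_in_trap]) (simp add: fixed_point_def)
    moreover have "z 0 = 0" if "trap_orbit (1 - \<nu>) z" for z
      using trap_orbit_zero[OF mu[OF nuI] that] nu by simp
    ultimately show "maximal_invariant_set (ks_flow (1 - \<nu>)) (ks_time (1 - \<nu>)) trap {0}"
      by (intro max) auto
  next
    fix \<nu> assume nu: "\<nu> \<in> {0<..lambda1 0.99}"
    then have "\<nu> \<in> ?I" by (auto simp: lambda1_def)
    then interpret supercritical "1 - \<nu>" using mu[of \<nu>] nu by unfold_locales auto
    have p: "0 < coord eq_pt 1" using eq_pt(2) level(1) by simp
    then have "eq_pt \<noteq> 0" "flip eq_pt \<noteq> 0" "eq_pt \<noteq> flip eq_pt"
      by (auto dest: arg_cong[where f = "\<lambda>a. coord a 1"])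
    moreover have "maximal_invariant_set (ks_flow (1 - \<nu>)) (ks_time (1 - \<nu>)) trap
        ({0, eq_pt, flip eq_pt} \<union> range connection \<union> range (\<lambda>t. flip (connection t)))"
      by (rule max[OF trap_orbit_points])
    ultimately show "\<exists>u\<^sub>1 u\<^sub>2 w\<^sub>1 w\<^sub>2. u\<^sub>1 \<in> trap \<and> u\<^sub>2 \<in> trap \<and> u\<^sub>1 \<noteq> 0 \<and> u\<^sub>2 \<noteq> 0 \<and> u\<^sub>1 \<noteq> u\<^sub>2 \<and>
        hyperbolic_fixed_point (ks_flow (1 - \<nu>)) (ks_time (1 - \<nu>)) u\<^sub>1 \<and>
        hyperbolic_fixed_point (ks_flow (1 - \<nu>)) (ks_time (1 - \<nu>)) u\<^sub>2 \<and>
        heteroclinic (ks_flow (1 - \<nu>)) (ks_time (1 - \<nu>)) 0 u\<^sub>1 w\<^sub>1 \<and>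
        heteroclinic (ks_flow (1 - \<nu>)) (ks_time (1 - \<nu>)) 0 u\<^sub>2 w\<^sub>2 \<and>
        maximal_invariant_set (ks_flow (1 - \<nu>)) (ks_time (1 - \<nu>)) trap ({0, u\<^sub>1, u\<^sub>2} \<union> range w\<^sub>1 \<union> range w\<^sub>2)"
      using eq_pt(1) flip_trap[OF eq_pt(1)] hyperbolic_eq_pt heteroclinic_connection by blast
  qed
qed

end
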